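(* Let $f:\mathbb{N}\to\mathbb{C}$ be a multiplicative function whose Dirichlet series $F(s)=\sum_{n\ge1}f(n)n^{-s}$ converges absolutely for $\mathrm{Re}(s)>1$. Write $$-\frac{F'}{F}(s)=\sum_{n\ge1}\frac{\lambda_f(n)\Lambda(n)}{n^s},$$ where $\lambda_f(n)=0$ unless $n$ is a prime power. Suppose there are constants $A,A_0\ge1$ such that for all $x\ge1$ $$\sum_{x<n\le ex}\frac{|\lambda_f(n)|^2\Lambda(n)}{n}\le A^2+\frac{A_0}{\log(ex)}.$$ Let $X\ge10$ and $0<\epsilon\le1$ be given. Put $R=[10A^2/\epsilon^2]+1$, $L=[10AR]$ and $\underline{L}=(L,\dots,L)\in\mathbb{Z}^R$. Let $w$ be a real number with $0\le\log w\le(\log X)^{1/(3R)}$. Then there exist real numbers $\tau_1,\dots,\tau_R$ with $|\tau_j|\le\exp((\log\log X)^2)$ such that for all $2\le x\le X$, $$|\mathcal{O}_{\underline{L}}(x,w;\tau_1,\dots,\tau_R)|\ll\frac{x}{\log x}(\log X)^{\epsilon},$$ where the implied constant depends only on $A$, $A_0$ and $\epsilon$.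
   Context: $\Lambda$ is the von Mangoldt function and $[\cdot]$ is the integer part. Set $S(x)=\sum_{n\le x}f(n)$. For vectors $\underline{\ell}=(\ell_1,\dots,\ell_R)$ and $\underline{j}=(j_1,\dots,j_R)$ of non-negative integers: - $\underline{j}\le\underline{\ell}$ means $0\le j_k\le\ell_k$ for all $k$; - $\binom{\underline{\ell}}{\underline{j}}=\prod_{k=1}^R\binom{\ell_k}{j_k}$. The oscillation is $$\mathcal{O}_{\underline{\ell}}(x,w;\tau_1,\dots,\tau_R)=\sum_{\underline{j}\le\underline{\ell}}(-1)^{j_1+\dots+j_R}\binom{\underline{\ell}}{\underline{j}}w^{j_1(1+i\tau_1)+\dots+j_R(1+i\tau_R)}S\Big(\frac{x}{w^{j_1+\dots+j_R}}\Big).$$ *)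

theory Defs
  imports "HOL-Analysis.Analysis" "HOL-Number_Theory.Number_Theory"
begin

(* Arithmetic functions are of type "nat \<Rightarrow> complex"; their value at 0 is never used. *)

definition multiplicative :: "(nat \<Rightarrow> complex) \<Rightarrow> bool" where
  "multiplicative f \<longleftrightarrow>
     f 1 = 1 \<and> (\<forall>m\<ge>1. \<forall>n\<ge>1. coprime m n \<longrightarrow> f (m * n) = f m * f n)"

definition dirichlet_series :: "(nat \<Rightarrow> complex) \<Rightarrow> complex \<Rightarrow> complex" where
  "dirichlet_series f s = (\<Sum>\<^sub>\<infinity>n\<in>{1..}. f n / of_nat n powr s)"

(* The coefficients of -F'/F.  Only a half-plane Re s > \<sigma>, in which F has no zeros, is required;
   there the expansion always exists, and it determines the values at prime powers uniquely.  The
   case \<sigma> = 1 is included. *)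

definition log_deriv_coeffs :: "(nat \<Rightarrow> complex) \<Rightarrow> (nat \<Rightarrow> complex) \<Rightarrow> bool" where
  "log_deriv_coeffs f lam \<longleftrightarrow>
     (\<forall>n. \<not> primepow n \<longrightarrow> lam n = 0) \<and>
     (\<exists>\<sigma>\<ge>1. \<forall>s. Re s > \<sigma> \<longrightarrow>
        dirichlet_series f s \<noteq> 0 \<and>
        ((\<lambda>n. lam n * mangoldt n / of_nat n powr s) has_sum
           - (deriv (dirichlet_series f) s / dirichlet_series f s)) {1..})"

definition summatory :: "(nat \<Rightarrow> complex) \<Rightarrow> real \<Rightarrow> complex" where
  "summatory f x = (\<Sum>n | 1 \<le> n \<and> real n \<le> x. f n)"

(* Vectors of length R are functions on {1..R}; the vectors j \<le> l are the extensional functions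
   in the finite set PiE {1..R} (\<lambda>k. {0..l k}). *)

definition vec_binomial :: "nat \<Rightarrow> (nat \<Rightarrow> nat) \<Rightarrow> (nat \<Rightarrow> nat) \<Rightarrow> nat" where
  "vec_binomial R l j = (\<Prod>k=1..R. l k choose j k)"

definition oscillation ::
  "(nat \<Rightarrow> complex) \<Rightarrow> nat \<Rightarrow> (nat \<Rightarrow> nat) \<Rightarrow> real \<Rightarrow> real \<Rightarrow> (nat \<Rightarrow> real) \<Rightarrow> complex" where
  "oscillation f R l x w \<tau> =
     (\<Sum>j \<in> Pi\<^sub>E {1..R} (\<lambda>k. {0..l k}).
        (-1) ^ (\<Sum>k=1..R. j k) * of_nat (vec_binomial R l j) *
        of_real w powr (\<Sum>k=1..R. of_nat (j k) * (1 + \<i> * of_real (\<tau> k))) *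
        summatory f (x / w ^ (\<Sum>k=1..R. j k)))"

end

theory Submission
  imports Defs "HOL-Probability.Probability" "HOL-Real_Asymp.Real_Asymp"
begin

text \<open>
  Write \<open>\<L> = ln X\<close> and \<open>T = exp ((ln \<L>)\<^sup>2)\<close>. The points \<open>s\<^sub>1, \<dots>, s\<^sub>R\<close> are chosen successively so that each
  maximizes \<open>|F|\<close> on the box \<open>Re s \<ge> 1 + 1 / \<L>\<close>, \<open>|Im s| \<le> T\<close> away from the earlier ones, and \<open>\<tau>\<^sub>k = Im s\<^sub>k\<close>.
  The function cannot be large at many separated points: by Cauchy--Schwarz over the prime powers the sum of
  \<open>ln |F(s\<^sub>k)|\<close> is about \<open>A * sqrt (2 * R) * ln \<L>\<close>, so \<open>|F|\<close> is below \<open>\<L> powr (\<epsilon> / 2)\<close> far from all \<open>\<tau>\<^sub>k\<close>.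
  The oscillation has generating function \<open>F(s)\<close> times the product of the powers \<open>(1 - w powr (1 + \<i>\<tau>\<^sub>k - s)) ^ L\<close>,
  and these factors compensate the size of \<open>F\<close> close to \<open>\<tau>\<^sub>k\<close>.

  A direct Perron integral then bounds the oscillation by \<open>x\<close> times a power of \<open>\<L>\<close>. To gain the factor \<open>1 / ln x\<close>,
  multiply by \<open>ln x\<close> and use \<open>f * ln = Lam * f\<close> (Dirichlet convolution). The small divisors are handled by the
  pointwise bound. For the others the series of \<open>f * ln\<close> is written as the integral over \<open>\<alpha>\<close> of a shifted series,
  which makes the term bilinear in two series with coefficients \<open>Lam\<close>, and their mean squares on vertical lines are
  bounded through the count of prime powers in short intervals. Sharp and Gaussian-smoothed sums differ by sums of
  \<open>f\<close> over short intervals; these are small because the relation \<open>f * ln = Lam * f\<close> can be iterated.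
\<close>

section \<open>Prime powers in short intervals\<close>

text \<open>The trivial bound for sums of \<open>f\<close> loses a factor
  \<open>\<L> powr A\<close>, so every error term must beat a fixed power of \<L>, while a loss of
  powers of ln \<L> is harmless. This dictates T: ln T is the square of ln \<L>, yet every negative
  power of T beats every power of \<L>. With smoothing width h = T^(-1/2) and excluded
  neighbourhoods of logarithmic radius \<delta> = T^(-1/4), truncating the Perron integral costs exp
  (- T / 4), the leakage of the smoothing exp (- T^(1/4) / 2), and short intervals gain T^(-1/8).
  Multiplying by ln x needs ln x = ln (x exp (- \<mu>) / n) + \<mu> + ln n for the term shifted by
  \<mu>. The middle part is a second oscillation, weighted by \<mu>; its generating polynomial is
  minus the derivative of the first, and both are bounded together. The exponent \<epsilon> is spent
  as follows: at most 46/100 \<epsilon> on F after mollification and \<epsilon> / 30 on the size of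
  ln w, hence at most \<epsilon> / 2; the rest absorbs powers of ln \<L>. When ln x is at most \<L>
  to the power \<eta> = \<epsilon> / (4 A), trivial bounds suffice; above that the relation for f ln
  can be iterated a fixed number of times.\<close>

lemma ln_fact_mangoldt:
  "ln (fact N :: real) = (\<Sum>d=1..N. mangoldt d * real (N div d))"
proof (induction N)
  case (Suc N)
  have "(\<Sum>d=1..Suc N. mangoldt d * real (Suc N div d)) =
        (\<Sum>d=1..Suc N. mangoldt d * real (N div d) + (if d dvd Suc N then mangoldt d else 0))"
    by (intro sum.cong refl) (auto simp: div_Suc dvd_eq_mod_eq_0 algebra_simps)
  also have "\<dots> = (\<Sum>d=1..Suc N. mangoldt d * real (N div d)) +
      (\<Sum>d=1..Suc N. if d dvd Suc N then mangoldt d else 0)"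
    by (rule sum.distrib)
  also have "(\<Sum>d=1..Suc N. mangoldt d * real (N div d)) = ln (fact N)"
    using Suc.IH by simp
  also have "(\<Sum>d=1..Suc N. if d dvd Suc N then mangoldt d else 0) =
      (\<Sum>d | d dvd Suc N. mangoldt d :: real)"
    by (subst sum.inter_filter [symmetric])
       (auto intro!: sum.cong dest: dvd_imp_le simp: Suc_le_eq intro: dvd_pos_nat)
  also have "\<dots> = ln (real (Suc N))"
    using mangoldt_sum[of "Suc N", where ?'a = real] by simp
  finally show ?case
    by (simp add: ln_mult add.commute del: of_nat_Suc)
qed simp

text \<open>Chebyshev's argument. In Legendre's formula for the three factorials every coefficient
  is nonnegative by superadditivity of \<open>div\<close>; for M < d the assumption
  \<open>h <= M\<close> makes the two smaller quotients vanish, which leaves at least 1.\<close>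

lemma sum_mangoldt_le_ln_binomial:
  assumes "h \<le> M"
  shows "(\<Sum>d\<in>{M<..M+h}. mangoldt d :: real) \<le> ln (real ((M + h) choose h))"
proof -
  have ext: "ln (fact k :: real) = (\<Sum>d=1..M+h. mangoldt d * real (k div d))" if "k \<le> M + h" for k
    unfolding ln_fact_mangoldt using that by (intro sum.mono_neutral_left) auto
  have le: "k div d + l div d \<le> (k + l) div d" for k l d :: nat
    by (cases "d = 0") (auto simp: less_eq_div_iff_mult_less_eq add_mult_distrib intro!: add_mono)
  have "ln (real ((M + h) choose h)) = ln (fact (M + h) :: real) - ln (fact h) - ln (fact M)"
    by (subst binomial_fact) (simp_all add: ln_div ln_mult)
  also have "\<dots> = (\<Sum>d=1..M+h. mangoldt d *
      (real ((M + h) div d) - real (h div d) - real (M div d)))"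
    by (simp add: ext sum_subtractf sum.distrib algebra_simps)
  also have "\<dots> \<ge> (\<Sum>d=1..M+h. if M < d then mangoldt d else 0)"
  proof (intro sum_mono)
    fix d assume d: "d \<in> {1..M+h}"
    show "(if M < d then mangoldt d else 0)
      \<le> mangoldt d * (real ((M + h) div d) - real (h div d) - real (M div d))"
    proof (cases "M < d")
      case True
      hence "h div d = 0" "M div d = 0" using assms by auto
      moreover have "(M + h) div d \<ge> 1" using d
        by (metis atLeastAtMost_iff div_greater_zero_iff le_eq_less_or_eq less_one linorder_not_less
            zero_less_iff_neq_zero)
      ultimately have "mangoldt d * 1 \<le> mangoldt d *
          (real ((M + h) div d) - real (h div d) - real (M div d))"
        by (intro mult_left_mono) (auto simp: mangoldt_nonneg)
      thus ?thesis using True by simp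
    next
      case False
      have "real (h div d) + real (M div d) \<le> real ((M + h) div d)"
        using le[of h d M] by (simp add: add.commute flip: of_nat_add)
      thus ?thesis using False by (auto intro!: mult_nonneg_nonneg mangoldt_nonneg)
    qed
  qed
  also have "(\<Sum>d=1..M+h. if M < d then mangoldt d else 0) = (\<Sum>d\<in>{M<..M+h}. mangoldt d :: real)"
    by (subst sum.inter_filter [symmetric]) (auto intro!: sum.cong)
  finally show ?thesis .
qed

text \<open>A single term of the expansion of (1 + y)^N. The free parameter y is later 1 / T, for
  intervals of length about N / T, where the bound 2^N would be far too weak.\<close>

lemma ln_binomial_le:
  assumes "y > 0" "h \<le> N"
  shows "ln (real (N choose h)) \<le> real N * y + real h * ln (1 / y)"
proof -
  have "real (N choose h) * y ^ h \<le> (\<Sum>k\<le>N. real (N choose k) * y ^ k * 1 ^ (N - k))"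
    using assms by (intro order_trans[OF _ member_le_sum[of h]]) auto
  also have "\<dots> = (y + 1) ^ N"
    by (rule binomial_ring [symmetric])
  also have "\<dots> \<le> exp y ^ N"
    using assms by (intro power_mono) (auto simp: exp_ge_add_one_self add.commute)
  finally have "real (N choose h) * y ^ h \<le> exp (real N * y)"
    by (simp add: exp_of_nat_mult)
  hence "ln (real (N choose h) * y ^ h) \<le> ln (exp (real N * y))"
    using assms by (subst ln_le_cancel_iff) auto
  thus ?thesis using assms
    by (simp add: ln_mult ln_realpow ln_div)
qed

lemma sum_mangoldt_dyadic: "(\<Sum>d\<in>{M<..2*M}. mangoldt d :: real) \<le> 2 * real M * ln 2"
proof -
  have "(\<Sum>d\<in>{M<..M+M}. mangoldt d :: real) \<le> ln (real ((M + M) choose M))"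
    by (rule sum_mangoldt_le_ln_binomial) simp
  also have "\<dots> \<le> ln (2 ^ (M + M))"
  proof (subst ln_le_cancel_iff)
    have "(M + M) choose M \<le> 2 ^ (M + M)" by (rule binomial_le_pow2)
    thus "real ((M + M) choose M) \<le> 2 ^ (M + M)"
      by (metis of_nat_le_iff of_nat_numeral of_nat_power)
  qed auto
  finally show ?thesis by (simp add: ln_realpow flip: mult_2)
qed

lemma sum_mangoldt_block:
  assumes "x \<ge> (1::real)"
  shows "(\<Sum>n | x < real n \<and> real n \<le> exp 1 * x. mangoldt n / real n) \<le> (10::real)"
proof -
  define M where "M = nat \<lfloor>x\<rfloor>"
  have M: "real M \<le> x" "x < real M + 1" "M \<ge> 1"
    using assms by (auto simp: M_def le_nat_floor)
  have Mx: "exp 1 * x \<le> 8 * real M"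
  proof -
    have "exp 1 * x \<le> 3 * (real M + 1)"
      using M exp_le assms by (intro mult_mono) auto
    also have "\<dots> \<le> 8 * real M" using M by simp
    finally show ?thesis .
  qed
  have sub: "{n. x < real n \<and> real n \<le> exp 1 * x} \<subseteq> {M<..8*M}"
  proof
    fix n assume "n \<in> {n. x < real n \<and> real n \<le> exp 1 * x}"
    hence "real M < real n" "real n \<le> real (8 * M)" using M Mx by auto
    thus "n \<in> {M<..8*M}" by (simp only: of_nat_le_iff of_nat_less_iff greaterThanAtMost_iff)
  qed
  have "(\<Sum>n | x < real n \<and> real n \<le> exp 1 * x. mangoldt n / real n :: real)
      \<le> (\<Sum>n | x < real n \<and> real n \<le> exp 1 * x. mangoldt n / x)"
    using assms by (intro sum_mono divide_left_mono) (auto simp: mangoldt_nonneg)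
  also have "\<dots> \<le> (\<Sum>n\<in>{M<..8*M}. mangoldt n / x)"
    using assms sub by (intro sum_mono2) (auto intro!: divide_nonneg_nonneg mangoldt_nonneg)
  \<comment> \<open>Three dyadic ranges suffice because e x <= 3 (M + 1) <= 8 M. Their lengths M, 2
    M, 4 M lead to the constant 14 ln 2 < 10.\<close>
  also have "{M<..8*M} = {M<..2*M} \<union> ({2*M<..2*(2*M)} \<union> {4*M<..2*(4*M)})" by auto
  also have "(\<Sum>n\<in>\<dots>. mangoldt n / x) =
     (\<Sum>n\<in>{M<..2*M}. mangoldt n / x) + ((\<Sum>n\<in>{2*M<..2*(2*M)}. mangoldt n / x) +
      (\<Sum>n\<in>{4*M<..2*(4*M)}. mangoldt n / x))"
    by (subst sum.union_disjoint; (subst sum.union_disjoint)?) auto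
  also have "\<dots> = ((\<Sum>n\<in>{M<..2*M}. mangoldt n) + ((\<Sum>n\<in>{2*M<..2*(2*M)}. mangoldt n) +
      (\<Sum>n\<in>{4*M<..2*(4*M)}. mangoldt n))) / x"
    by (simp add: sum_divide_distrib add_divide_distrib)
  also have "\<dots> \<le> (2 * real M * ln 2 + (2 * real (2 * M) * ln 2 + 2 * real (4 * M) * ln 2)) / x"
    using assms by (intro divide_right_mono add_mono sum_mangoldt_dyadic) auto
  also have "\<dots> = (14 * ln 2) * (real M / x)" by (simp add: field_simps)
  also have "\<dots> \<le> (14 * ln 2) * 1"
    using M assms by (intro mult_left_mono) auto
  also have "\<dots> \<le> 10"
    using ln2_le_25_over_36 by simp
  finally show ?thesis .
qed

text \<open>Only the factor $\log T$ is lost against the Brun--Titchmarsh inequality, and no sieve is needed.\<close>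

lemma sum_mangoldt_short_interval:
  assumes T: "T \<ge> 10" and z: "z \<ge> T"
  shows "(\<Sum>n | z \<le> real n \<and> real n \<le> exp (1 / T) * z. mangoldt n / real n) \<le> 10 * ln T / (T :: real)"
proof -
  \<comment> \<open>The offset turns the closed condition z <= n into M < n, also when z is an
    integer.\<close>
  define M where "M = nat (\<lceil>z\<rceil> - 1)"
  define h where "h = nat \<lfloor>exp (1 / T) * z\<rfloor> - M"
  have z1: "\<lceil>z\<rceil> \<ge> 1" using T z by linarith
  have M: "real M < z" "z \<le> real M + 1"
    using z1 unfolding M_def by (simp_all add: ceiling_le_iff) linarith+
  have lnT: "ln T \<ge> 2"
  proof -
    have "exp 1 * exp 1 \<le> 3 * (3::real)" by (intro mult_mono exp_le) auto
    hence "exp 2 \<le> T" using T by (simp flip: exp_add)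
    thus ?thesis using T by (simp add: ln_ge_iff)
  qed
  have e: "exp (1 / T) \<le> 1 + 2 / T"
    using exp_bound_half[of "1 / T"] exp_bound_lemma[of "1/T"] T by simp
  have e1: "exp (1/T) \<ge> 1" using T by simp
  have eT: "exp (1 / T) * z \<le> z + 2 * z / T"
    using mult_right_mono[OF e, of z] T z by (simp add: algebra_simps)
  have "real M \<le> exp (1 / T) * z"
    using M mult_right_mono[OF e1, of z] T z by linarith
  hence fl: "M \<le> nat \<lfloor>exp (1 / T) * z\<rfloor>" by (simp add: le_nat_floor)
  hence Mh: "M + h = nat \<lfloor>exp (1 / T) * z\<rfloor>" by (simp add: h_def)
  have Mhr: "real (M + h) \<le> exp (1 / T) * z" unfolding Mh
    using T z by (intro of_nat_floor) auto
  hence hr: "real h \<le> 3 * z / T"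
  proof -
    have "real h \<le> 2 * z / T + 1" using Mhr eT M by simp
    also have "1 \<le> z / T" using T z by (simp add: field_simps)
    finally show ?thesis by (simp add: field_simps)
  qed
  have hM: "h \<le> M"
  proof -
    have "3 * z / T \<le> 3 * z / 10" using T z by (intro divide_left_mono) auto
    hence "real h \<le> real M" using hr M T z by linarith
    thus ?thesis by simp
  qed
  have sub: "{n. z \<le> real n \<and> real n \<le> exp (1 / T) * z} \<subseteq> {M<..M+h}"
  proof
    fix n assume n: "n \<in> {n. z \<le> real n \<and> real n \<le> exp (1 / T) * z}"
    hence "real M < real n" using M by auto
    moreover have "n \<le> M + h" unfolding Mh using n by (simp add: le_nat_floor)
    ultimately show "n \<in> {M<..M+h}" by simp
  qed
  have "(\<Sum>n | z \<le> real n \<and> real n \<le> exp (1 / T) * z. mangoldt n / real n :: real)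
      \<le> (\<Sum>n | z \<le> real n \<and> real n \<le> exp (1 / T) * z. mangoldt n / z)"
    using T z by (intro sum_mono divide_left_mono) (auto simp: mangoldt_nonneg)
  also have "\<dots> \<le> (\<Sum>n\<in>{M<..M+h}. mangoldt n / z)"
    using T z sub by (intro sum_mono2) (auto intro!: divide_nonneg_nonneg mangoldt_nonneg)
  also have "\<dots> = (\<Sum>n\<in>{M<..M+h}. mangoldt n) / z" by (simp add: sum_divide_distrib)
  \<comment> \<open>The choice y = 1 / T makes both terms of order z / T, the second up to the
    factor ln T.\<close>
  also have "\<dots> \<le> (real (M + h) * (1/T) + real h * ln (1 / (1/T))) / z"
    using T z hM by (intro divide_right_mono order.trans[OF sum_mangoldt_le_ln_binomial ln_binomial_le]) auto
  also have "\<dots> \<le> (2 * z * (1/T) + 3 * z / T * ln T) / z"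
  proof -
    have "2 * z / T \<le> 2 * z / 10" using T z by (intro divide_left_mono) auto
    hence "real (M + h) \<le> 2 * z" using Mhr eT T z by linarith
    moreover have "real h * ln (1 / (1/T)) \<le> 3 * z / T * ln T"
      using mult_right_mono[OF hr, of "ln T"] lnT by simp
    ultimately show ?thesis using T z
      by (intro divide_right_mono add_mono mult_right_mono) auto
  qed
  also have "\<dots> = (2 + 3 * ln T) / T" using T z by (simp add: field_simps)
  also have "\<dots> \<le> 10 * ln T / T" using T lnT by (intro divide_right_mono) auto
  finally show ?thesis .
qed

section \<open>Gaussian smoothing\<close>

text \<open>The characteristic function of the standard normal law after the substitution y = a t;
  the factor \<open>sqrt (2 * pi)\<close> undoes the normalization of the density.\<close>

lemma has_bochner_integral_gauss_fourier:
  fixes a x :: real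
  assumes a: "a > 0"
  shows "has_bochner_integral lborel (\<lambda>t. iexp (x * t) * complex_of_real (exp (- (a * t)\<^sup>2 / 2)))
           (complex_of_real (sqrt (2 * pi) / a * exp (- (x / a)\<^sup>2 / 2)))"
proof -
  have int1: "integrable lborel (\<lambda>y. std_normal_density y *\<^sub>R iexp (t * y))" for t
    by (rule Bochner_Integration.integrable_bound[of _ "std_normal_density"])
       (auto simp: integrable_normal_density)
  have eq1: "(LINT y|lborel. std_normal_density y *\<^sub>R iexp (t * y)) = complex_of_real (exp (- (t\<^sup>2) / 2))" for t
  proof -
    have "char std_normal_distribution t = (LINT y|lborel. std_normal_density y *\<^sub>R iexp (t * y))"
      unfolding char_def by (subst integral_density) auto
    thus ?thesis by (simp add: char_std_normal_distribution)
  qed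
  have "has_bochner_integral lborel (\<lambda>y. std_normal_density y *\<^sub>R iexp ((x / a) * y))
          (complex_of_real (exp (- ((x / a)\<^sup>2) / 2)))"
    using int1[of "x / a"] eq1[of "x / a"] by (simp add: has_bochner_integral_iff)
  hence "has_bochner_integral lborel (\<lambda>t. std_normal_density (0 + a * t) *\<^sub>R iexp ((x / a) * (0 + a * t)))
          (complex_of_real (exp (- ((x / a)\<^sup>2) / 2)) /\<^sub>R \<bar>a\<bar>)"
    by (subst (asm) lborel_has_bochner_integral_real_affine_iff[of a _ _ 0]) (use a in auto)
  hence "has_bochner_integral lborel (\<lambda>t. complex_of_real (sqrt (2 * pi)) *
            (std_normal_density (0 + a * t) *\<^sub>R iexp ((x / a) * (0 + a * t))))
          (complex_of_real (sqrt (2 * pi)) * (complex_of_real (exp (- ((x / a)\<^sup>2) / 2)) /\<^sub>R \<bar>a\<bar>))"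
    by (rule has_bochner_integral_mult_right)
  thus ?thesis
    using a by (simp add: normal_density_def scaleR_conv_of_real field_simps)
qed

lemma gauss_fourier:
  fixes a x :: real
  assumes "a > 0"
  shows "integrable lborel (\<lambda>t. iexp (x * t) * complex_of_real (exp (- (a * t)\<^sup>2 / 2)))"
    and "(LINT t|lborel. iexp (x * t) * complex_of_real (exp (- (a * t)\<^sup>2 / 2))) =
           complex_of_real (sqrt (2 * pi) / a * exp (- (x / a)\<^sup>2 / 2))"
  using has_bochner_integral_gauss_fourier[OF assms, of x] by (simp_all add: has_bochner_integral_iff)

lemma integrable_gauss:
  fixes a :: real
  assumes "a > 0"
  shows "integrable lborel (\<lambda>t. exp (- (a * t)\<^sup>2 / 2))"
  using integrable_norm[OF gauss_fourier(1)[OF assms, of 0]] by simp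

lemma integral_gauss:
  fixes a :: real
  assumes "a > 0"
  shows "(LINT t|lborel. exp (- (a * t)\<^sup>2 / 2)) = sqrt (2 * pi) / a"
proof -
  have "complex_of_real (LINT t|lborel. exp (- (a * t)\<^sup>2 / 2)) = of_real (sqrt (2 * pi) / a)"
    using gauss_fourier(2)[OF assms, of 0] by (simp flip: integral_complex_of_real)
  thus ?thesis by (simp only: of_real_eq_iff)
qed

text \<open>The indicator of v >= 0 convolved with a Gaussian of standard deviation h. At v = ln (u
  / n) it smooths the cutoff n <= u on the logarithmic scale.\<close>

definition smooth_step :: "real \<Rightarrow> real \<Rightarrow> real" where
  "smooth_step h v = (LINT y|lborel. indicator {..v} y * normal_density 0 h y)"

text \<open>The two-sided Laplace transform of \<open>smooth_step h\<close>.\<close>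

definition mellin_kernel :: "real \<Rightarrow> complex \<Rightarrow> complex" where
  "mellin_kernel h s = exp (of_real (h\<^sup>2 / 2) * s\<^sup>2) / s"

context
  fixes h :: real
  assumes h: "h > 0"
begin

text \<open>Completing the square: an exponential tilt moves the mean to r h^2 at the cost of a
  constant factor.\<close>

lemma exp_mult_normal_density:
  "exp (r * y) * normal_density 0 h y = exp (r\<^sup>2 * h\<^sup>2 / 2) * normal_density (r * h\<^sup>2) h y"
proof -
  have "r * y + - (y\<^sup>2 / (2 * h\<^sup>2)) = r\<^sup>2 * h\<^sup>2 / 2 + - ((y - r * h\<^sup>2)\<^sup>2 / (2 * h\<^sup>2))"
    using h by (simp add: field_simps power2_eq_square)
  thus ?thesis
    by (simp add: normal_density_def flip: exp_add) 
qed

lemma integrable_indicator_normal: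
  "A \<in> sets borel \<Longrightarrow> integrable lborel (\<lambda>y. indicator A y * normal_density 0 h y)"
  using integrable_mult_indicator[of A lborel "normal_density 0 h"] h
  by (simp add: integrable_normal_density)

lemma smooth_step_nonneg: "smooth_step h v \<ge> 0"
  unfolding smooth_step_def by (intro integral_nonneg_AE) (auto simp: normal_density_nonneg)

text \<open>Chernoff's bound: on y <= v the indicator is at most exp (r (v - y)), and the tilted
  density integrates exactly.\<close>

lemma smooth_step_le_exp:
  assumes "r \<ge> 0"
  shows "smooth_step h v \<le> exp (r * v + r\<^sup>2 * h\<^sup>2 / 2)"
proof -
  have "smooth_step h v \<le> (LINT y|lborel. exp (r * v) * (exp (- r * y) * normal_density 0 h y))"
    unfolding smooth_step_def
  proof (rule integral_mono)
    show "integrable lborel (\<lambda>y. exp (r * v) * (exp (- r * y) * normal_density 0 h y))"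
      using h by (subst exp_mult_normal_density) (auto simp: integrable_normal_density)
    fix y :: real
    show "indicator {..v} y * normal_density 0 h y \<le> exp (r * v) * (exp (- r * y) * normal_density 0 h y)"
    proof (cases "y \<le> v")
      case True
      have "1 \<le> exp (r * (v - y))" using True assms by simp
      also have "\<dots> = exp (r * v) * exp (- r * y)" by (simp add: algebra_simps flip: exp_add)
      finally have "1 * normal_density 0 h y \<le> (exp (r * v) * exp (- r * y)) * normal_density 0 h y"
        by (intro mult_right_mono) (auto simp: normal_density_nonneg)
      thus ?thesis using True by (simp add: mult.assoc)
    qed (auto simp: normal_density_nonneg)
  qed (auto intro: integrable_indicator_normal)
  also have "\<dots> = exp (r * v) * exp (r\<^sup>2 * h\<^sup>2 / 2)"
    using h by (subst exp_mult_normal_density) (simp add: integral_normal_density)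
  finally show ?thesis by (simp add: exp_add)
qed

lemma one_minus_smooth_step:
  "1 - smooth_step h v = (LINT y|lborel. indicator {v<..} y * normal_density 0 h y)"
proof -
  have "(LINT y|lborel. indicator {..v} y * normal_density 0 h y) +
        (LINT y|lborel. indicator {v<..} y * normal_density 0 h y) =
        (LINT y|lborel. indicator {..v} y * normal_density 0 h y + indicator {v<..} y * normal_density 0 h y)"
    by (rule Bochner_Integration.integral_add [symmetric]) (auto intro: integrable_indicator_normal)
  also have "\<dots> = (LINT y|lborel. normal_density 0 h y)"
    by (intro Bochner_Integration.integral_cong) (auto simp: indicator_def)
  finally show ?thesis using h by (simp add: integral_normal_density smooth_step_def)
qed

lemma smooth_step_le_1: "smooth_step h v \<le> 1"
proof -
  have "1 - smooth_step h v \<ge> 0" unfolding one_minus_smooth_step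
    by (intro integral_nonneg_AE) (auto simp: normal_density_nonneg)
  thus ?thesis by simp
qed

lemma one_minus_smooth_step_le_exp:
  assumes "r \<ge> 0"
  shows "1 - smooth_step h v \<le> exp (- r * v + r\<^sup>2 * h\<^sup>2 / 2)"
proof -
  have "1 - smooth_step h v \<le> (LINT y|lborel. exp (- r * v) * (exp (r * y) * normal_density 0 h y))"
    unfolding one_minus_smooth_step
  proof (rule integral_mono)
    show "integrable lborel (\<lambda>y. exp (- r * v) * (exp (r * y) * normal_density 0 h y))"
      using h by (subst exp_mult_normal_density) (auto simp: integrable_normal_density)
    fix y :: real
    show "indicator {v<..} y * normal_density 0 h y \<le> exp (- r * v) * (exp (r * y) * normal_density 0 h y)"
    proof (cases "y > v")
      case True
      have "1 \<le> exp (r * (y - v))" using True assms by simp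
      also have "\<dots> = exp (- r * v) * exp (r * y)" by (simp add: algebra_simps flip: exp_add)
      finally have "1 * normal_density 0 h y \<le> (exp (- r * v) * exp (r * y)) * normal_density 0 h y"
        by (intro mult_right_mono) (auto simp: normal_density_nonneg)
      thus ?thesis using True by (simp add: mult.assoc)
    qed (auto simp: normal_density_nonneg)
  qed (auto intro: integrable_indicator_normal)
  also have "\<dots> = exp (- r * v) * exp (r\<^sup>2 * h\<^sup>2 / 2)"
    using h by (subst exp_mult_normal_density) (simp add: integral_normal_density)
  finally show ?thesis by (simp only: exp_add)
qed

text \<open>The real part of s^2 is c^2 - t^2; this is the source of the Gaussian decay on vertical
  lines.\<close>

lemma norm_mellin_kernel:
  "norm (mellin_kernel h (Complex c t)) = exp (h\<^sup>2 * c\<^sup>2 / 2) * exp (- (h * t)\<^sup>2 / 2) / norm (Complex c t)"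
  unfolding mellin_kernel_def norm_divide norm_exp_eq_Re
  by (simp add: complex_eq_iff power2_eq_square algebra_simps diff_divide_distrib flip: exp_add)

end

lemma has_bochner_integral_exp_atMost:
  fixes s :: complex
  assumes s: "Re s > 0"
  shows "has_bochner_integral lborel (\<lambda>y. indicator {..v} y *\<^sub>R exp (s * of_real y)) (exp (s * of_real v) / s)"
proof -
  have s0: "s \<noteq> 0" using s by auto
  \<comment> \<open>The fundamental theorem of calculus is applied on the open half-line; the
    endpoint v is a null set.\<close>
  have AE: "AE y in lborel. indicator {..<v} y *\<^sub>R exp (s * of_real y) = indicator {..v} y *\<^sub>R exp (s * of_real y)"
    using AE_lborel_singleton[of v] by eventually_elim (auto simp: indicator_def)
  have "set_integrable lborel (einterval (-\<infinity>) (ereal v)) (\<lambda>y. exp (Re s * y))"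
  proof (rule interval_integral_FTC_nonneg)
    show "((\<lambda>y. exp (Re s * y) / Re s) has_real_derivative exp (Re s * x)) (at x)" for x
      using s by (auto intro!: derivative_eq_intros)
    show "(((\<lambda>y. exp (Re s * y) / Re s) \<circ> real_of_ereal) \<longlongrightarrow> exp (Re s * v) / Re s) (at_left (ereal v))"
      unfolding ereal_tendsto_simps by (intro tendsto_intros) (use s in auto)
    show "(((\<lambda>y. exp (Re s * y) / Re s) \<circ> real_of_ereal) \<longlongrightarrow> 0) (at_right (-\<infinity>))"
      unfolding ereal_tendsto_simps using s by real_asymp
  qed auto
  hence int: "set_integrable lborel (einterval (-\<infinity>) (ereal v)) (\<lambda>y. exp (s * of_real y))"
    unfolding set_integrable_def
    by (rule Bochner_Integration.integrable_bound) (auto simp: indicator_def)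
  have "(LBINT y=-\<infinity>..ereal v. exp (s * of_real y)) = exp (s * of_real v) / s - 0"
  proof (rule interval_integral_FTC_integrable)
    show "((\<lambda>y. exp (s * of_real y) / s) has_vector_derivative exp (s * of_real x)) (at x)" for x
      using s0 by (auto intro!: derivative_eq_intros has_vector_derivative_real_field)
    show "(((\<lambda>y. exp (s * of_real y) / s) \<circ> real_of_ereal) \<longlongrightarrow> exp (s * of_real v) / s) (at_left (ereal v))"
      unfolding ereal_tendsto_simps by (intro tendsto_intros) (use s0 in auto)
    show "(((\<lambda>y. exp (s * of_real y) / s) \<circ> real_of_ereal) \<longlongrightarrow> 0) (at_right (-\<infinity>))"
      unfolding ereal_tendsto_simps
    proof (rule Lim_null_comparison)
      show "((\<lambda>y. exp (Re s * y) / norm s) \<longlongrightarrow> 0) at_bot"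
        using s s0 by real_asymp
    qed (auto simp: norm_divide)
  qed (use int in auto)
  hence "(LINT y|lborel. indicator {..<v} y *\<^sub>R exp (s * of_real y)) = exp (s * of_real v) / s"
    by (simp add: interval_lebesgue_integral_def set_lebesgue_integral_def einterval_def lessThan_def)
  moreover have "integrable lborel (\<lambda>y. indicator {..<v} y *\<^sub>R exp (s * of_real y))"
    using int by (simp add: set_integrable_def einterval_def lessThan_def)
  ultimately have "has_bochner_integral lborel (\<lambda>y. indicator {..<v} y *\<^sub>R exp (s * of_real y)) (exp (s * of_real v) / s)"
    by (simp add: has_bochner_integral_iff)
  thus ?thesis
    by (rule has_bochner_integralI_AE [OF _ _ AE]) measurable
qed

lemma integrable_mellin_kernel:
  assumes h: "h > 0" and c: "c > 0"
  shows "integrable lborel (\<lambda>t. mellin_kernel h (Complex c t))"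
proof (rule Bochner_Integration.integrable_bound)
  show "integrable lborel (\<lambda>t. exp (h\<^sup>2 * c\<^sup>2 / 2) / c * exp (- (h * t)\<^sup>2 / 2))"
    using integrable_gauss[OF h] by simp
  show "(\<lambda>t. mellin_kernel h (Complex c t)) \<in> borel_measurable lborel"
    unfolding mellin_kernel_def Complex_eq by measurable
  show "AE t in lborel. norm (mellin_kernel h (Complex c t)) \<le>
      norm (exp (h\<^sup>2 * c\<^sup>2 / 2) / c * exp (- (h * t)\<^sup>2 / 2))"
  proof (rule AE_I2)
    fix t
    have "c \<le> norm (Complex c t)" using complex_Re_le_cmod[of "Complex c t"] by simp
    hence "exp (h\<^sup>2 * c\<^sup>2 / 2) * exp (- (h * t)\<^sup>2 / 2) / norm (Complex c t)
        \<le> exp (h\<^sup>2 * c\<^sup>2 / 2) * exp (- (h * t)\<^sup>2 / 2) / c"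
      using c by (intro divide_left_mono mult_pos_pos) auto
    thus "norm (mellin_kernel h (Complex c t)) \<le>
      norm (exp (h\<^sup>2 * c\<^sup>2 / 2) / c * exp (- (h * t)\<^sup>2 / 2))"
      using c by (simp add: norm_mellin_kernel[OF h])
  qed
qed

text \<open>Fubini, without any contour shift. The double integral of exp (s y + h^2 s^2 / 2) over y
  <= v and the line Re s = c gives the kernel when y is integrated first, and 2 pi times the normal
  density when t is integrated first.\<close>

lemma smooth_step_perron:
  assumes h: "h > 0" and c: "c > 0"
  shows "complex_of_real (smooth_step h v) =
    (LINT t|lborel. exp (Complex c t * of_real v) * mellin_kernel h (Complex c t)) / of_real (2 * pi)"
proof -
  define E where "E = (\<lambda>t. exp (of_real (h\<^sup>2 / 2) * (Complex c t)\<^sup>2))"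
  define K where "K = (\<lambda>y t. indicator {..v} y *\<^sub>R (exp (Complex c t * of_real y) * E t))"
  have nE: "norm (E t) = exp (h\<^sup>2 * c\<^sup>2 / 2) * exp (- (h * t)\<^sup>2 / 2)" for t
    unfolding E_def norm_exp_eq_Re
    by (simp add: power2_eq_square algebra_simps diff_divide_distrib flip: exp_add)
  have [measurable]: "E \<in> borel_measurable borel"
    unfolding E_def Complex_eq by measurable
  have KM [measurable]: "(\<lambda>(y, t). K y t) \<in> borel_measurable (lborel \<Otimes>\<^sub>M lborel)"
    unfolding K_def Complex_eq by measurable
  have nK: "norm (K y t) = (indicator {..v} y * exp (c * y)) * (exp (h\<^sup>2 * c\<^sup>2 / 2) * exp (- (h * t)\<^sup>2 / 2))" for y t
    by (simp add: K_def norm_mult nE indicator_def)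
  have intE: "integrable lborel E"
    by (rule Bochner_Integration.integrable_bound[of _ "\<lambda>t. exp (h\<^sup>2 * c\<^sup>2 / 2) * exp (- (h * t)\<^sup>2 / 2)"])
       (use integrable_gauss[OF h] in \<open>auto simp: nE\<close>)
  have intc: "integrable lborel (\<lambda>y. indicator {..v} y * exp (c * y))"
  proof -
    have "integrable lborel (\<lambda>y. indicator {..v} y *\<^sub>R exp (of_real c * complex_of_real y))"
      using has_bochner_integral_exp_atMost[of "of_real c" v] c by (simp add: has_bochner_integral_iff)
    from integrable_norm[OF this] show ?thesis by simp
  qed
  \<comment> \<open>The inner integral is the Fourier transform of a Gaussian. Its exponent combines
    with the prefactor so that the dependence on c cancels, as recorded in
    \<open>ex\<close>.\<close>
  have A: "(LINT t|lborel. K y t) = of_real (2 * pi) * of_real (indicator {..v} y * normal_density 0 h y)" for y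
  proof -
    have *: "K y t = of_real (indicator {..v} y * exp (c * y + h\<^sup>2 * c\<^sup>2 / 2)) *
         (iexp ((y + h\<^sup>2 * c) * t) * complex_of_real (exp (- (h * t)\<^sup>2 / 2)))" for t
    proof -
      have "Complex c t * of_real y + of_real (h\<^sup>2 / 2) * (Complex c t)\<^sup>2 =
        of_real (c * y + h\<^sup>2 * c\<^sup>2 / 2) + \<i> * of_real ((y + h\<^sup>2 * c) * t) + of_real (- (h * t)\<^sup>2 / 2)"
        by (simp add: complex_eq_iff power2_eq_square field_simps)
      hence "exp (Complex c t * of_real y) * E t =
        exp (of_real (c * y + h\<^sup>2 * c\<^sup>2 / 2)) * (iexp ((y + h\<^sup>2 * c) * t) * exp (of_real (- (h * t)\<^sup>2 / 2)))"
        unfolding E_def by (simp only: exp_add [symmetric] add.assoc)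
      thus ?thesis unfolding K_def by (simp only: exp_of_real) (simp add: scaleR_conv_of_real)
    qed
    have ex: "c * y + h\<^sup>2 * c\<^sup>2 / 2 + - ((y + h\<^sup>2 * c) / h)\<^sup>2 / 2 = - (y\<^sup>2 / (2 * h\<^sup>2))"
      using h by (simp add: field_simps power2_eq_square)
    have "(LINT t|lborel. K y t) = of_real (indicator {..v} y * exp (c * y + h\<^sup>2 * c\<^sup>2 / 2)) *
       of_real (sqrt (2 * pi) / h * exp (- ((y + h\<^sup>2 * c) / h)\<^sup>2 / 2))"
      unfolding * by (simp only: integral_mult_right_zero gauss_fourier(2)[OF h])
    also have "\<dots> = of_real (indicator {..v} y * (sqrt (2 * pi) / h) *
        exp (c * y + h\<^sup>2 * c\<^sup>2 / 2 + - ((y + h\<^sup>2 * c) / h)\<^sup>2 / 2))"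
      by (simp only: exp_add of_real_mult mult_ac)
    also have "\<dots> = of_real (indicator {..v} y * (sqrt (2 * pi) / h) * exp (- (y\<^sup>2 / (2 * h\<^sup>2))))"
      by (simp only: ex)
    also have "(sqrt (2 * pi) / h) = 2 * pi / sqrt (2 * pi * h\<^sup>2)"
      using h by (simp add: real_sqrt_mult field_simps)
    finally show ?thesis by (simp add: normal_density_def)
  qed
  have int: "integrable (lborel \<Otimes>\<^sub>M lborel) (\<lambda>(y, t). K y t)"
  proof (rule lborel_pair.Fubini_integrable)
    show "integrable lborel (\<lambda>y. LINT t|lborel. norm (case (y, t) of (y, t) \<Rightarrow> K y t))"
      using intc by (simp add: nK)
    show "AE y in lborel. integrable lborel (\<lambda>t. case (y, t) of (y, t) \<Rightarrow> K y t)"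
    proof (rule AE_I2)
      fix y
      show "integrable lborel (\<lambda>t. case (y, t) of (y, t) \<Rightarrow> K y t)"
        by (rule Bochner_Integration.integrable_bound[of _
             "\<lambda>t. (indicator {..v} y * exp (c * y)) * (exp (h\<^sup>2 * c\<^sup>2 / 2) * exp (- (h * t)\<^sup>2 / 2))"])
           (use integrable_gauss[OF h] in \<open>auto simp: nK\<close>, (simp add: K_def Complex_eq)?)
    qed
  qed (rule KM)
  have "of_real (2 * pi) * complex_of_real (smooth_step h v) =
      (LINT y|lborel. of_real (2 * pi) * of_real (indicator {..v} y * normal_density 0 h y))"
    unfolding smooth_step_def by (simp flip: integral_complex_of_real)
  also have "\<dots> = (LINT y|lborel. LINT t|lborel. K y t)"
    by (simp only: A)
  also have "\<dots> = (LINT t|lborel. LINT y|lborel. K y t)"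
    by (rule lborel_pair.Fubini_integral [OF int, symmetric])
  also have "(\<lambda>t. LINT y|lborel. K y t) = (\<lambda>t. exp (Complex c t * of_real v) * mellin_kernel h (Complex c t))"
  proof
    fix t
    have "(LINT y|lborel. K y t) = (LINT y|lborel. (indicator {..v} y *\<^sub>R exp (Complex c t * of_real y)) * E t)"
      by (simp add: K_def)
    also have "\<dots> = exp (Complex c t * of_real v) / Complex c t * E t"
      using has_bochner_integral_exp_atMost[of "Complex c t" v] c
      by (simp only: integral_mult_left_zero) (simp add: has_bochner_integral_iff)
    finally show "(LINT y|lborel. K y t) = exp (Complex c t * of_real v) * mellin_kernel h (Complex c t)"
      by (simp add: mellin_kernel_def E_def)
  qed
  finally show ?thesis by (simp add: field_simps)
qed

section \<open>Dirichlet series\<close>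

text \<open>The index 0 contributes nothing because \<open>0 powr z = 0\<close>, so the value of
  \<open>a\<close> at 0 is irrelevant to the series.\<close>

definition ds :: "(nat \<Rightarrow> complex) \<Rightarrow> complex \<Rightarrow> complex" where
  "ds a s = (\<Sum>n. a n * of_nat n powr (- s))"

definition rds :: "(nat \<Rightarrow> real) \<Rightarrow> real \<Rightarrow> real" where
  "rds a \<sigma> = (\<Sum>n. a n * real n powr (- \<sigma>))"

definition abs_conv :: "(nat \<Rightarrow> 'a :: real_normed_vector) \<Rightarrow> real \<Rightarrow> bool" where
  "abs_conv a \<sigma> \<longleftrightarrow> summable (\<lambda>n. norm (a n) * real n powr (- \<sigma>))"

text \<open>At n = 0 every number is a divisor, the index set is infinite, and the value is 0 by
  convention.\<close>

definition dconv :: "(nat \<Rightarrow> 'a) \<Rightarrow> (nat \<Rightarrow> 'a) \<Rightarrow> nat \<Rightarrow> 'a :: comm_semiring_1" where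
  "dconv a b n = (\<Sum>d | d dvd n. a d * b (n div d))"

lemma norm_ds_term: "norm (a n * of_nat n powr (- s)) = norm (a n) * real n powr (- Re s)"
  by (simp add: norm_mult norm_powr_real_powr)

lemma powr_minus_antimono_nat: "\<sigma> \<le> \<sigma>' \<Longrightarrow> real n powr (- \<sigma>') \<le> real n powr (- \<sigma>)"
  by (cases "n = 0") (auto intro!: powr_mono)

lemma abs_conv_mono: "abs_conv a \<sigma> \<Longrightarrow> \<sigma> \<le> \<sigma>' \<Longrightarrow> abs_conv a \<sigma>'"
  unfolding abs_conv_def
  by (rule summable_comparison_test[OF exI[of _ 0]])
     (auto intro!: mult_left_mono powr_minus_antimono_nat)

lemma abs_conv_comparison:
  assumes "abs_conv b \<sigma>" and "\<And>n. n \<ge> 1 \<Longrightarrow> norm (a n) \<le> C * norm (b n)"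
  shows "abs_conv a \<sigma>"
  unfolding abs_conv_def
proof (rule summable_comparison_test[OF exI[of _ 0]])
  show "summable (\<lambda>n. C * (norm (b n) * real n powr (- \<sigma>)))"
    using assms by (auto simp: abs_conv_def intro!: summable_mult)
  show "\<forall>n\<ge>0. norm (norm (a n) * real n powr - \<sigma>) \<le> C * (norm (b n) * real n powr - \<sigma>)"
  proof safe
    fix n :: nat
    show "norm (norm (a n) * real n powr - \<sigma>) \<le> C * (norm (b n) * real n powr - \<sigma>)"
      using assms(2)[of n] by (cases "n = 0") (auto simp: mult.assoc [symmetric] intro!: mult_right_mono)
  qed
qed

lemma abs_conv_norm_iff [simp]: "abs_conv (\<lambda>n. norm (a n)) \<sigma> \<longleftrightarrow> abs_conv a \<sigma>"
  by (simp add: abs_conv_def)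

lemma abs_conv_of_real_iff [simp]: "abs_conv (\<lambda>n. complex_of_real (a n)) \<sigma> \<longleftrightarrow> abs_conv a \<sigma>"
  by (simp add: abs_conv_def)

lemma summable_norm_ds:
  assumes "abs_conv a \<sigma>" "\<sigma> \<le> Re s"
  shows "summable (\<lambda>n. norm (a n * of_nat n powr (- s)))"
  using abs_conv_mono[OF assms] by (simp add: norm_ds_term abs_conv_def)

lemma summable_ds:
  assumes "abs_conv a \<sigma>" "\<sigma> \<le> Re s"
  shows "summable (\<lambda>n. a n * of_nat n powr (- s))"
  using summable_norm_ds[OF assms] by (rule summable_norm_cancel)

lemma summable_rds:
  assumes "abs_conv a \<sigma>" "\<sigma> \<le> \<sigma>'"
  shows "summable (\<lambda>n. a n * real n powr (- \<sigma>'))"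
proof (rule summable_norm_cancel)
  show "summable (\<lambda>n. norm (a n * real n powr (- \<sigma>')))"
    using abs_conv_mono[OF assms] by (simp add: abs_mult abs_conv_def)
qed

lemma ds_of_real:
  assumes "abs_conv a \<sigma>"
  shows "ds (\<lambda>n. of_real (a n)) (of_real \<sigma>) = of_real (rds a \<sigma>)"
proof -
  have "of_real (rds a \<sigma>) = (\<Sum>n. complex_of_real (a n * real n powr (- \<sigma>)))"
    unfolding rds_def by (rule suminf_of_real) (rule summable_rds[OF assms order.refl])
  also have "\<dots> = ds (\<lambda>n. of_real (a n)) (of_real \<sigma>)"
    unfolding ds_def using powr_of_real[of "real n" "- \<sigma>" for n] by simp
  finally show ?thesis ..
qed

lemma norm_ds_le:
  assumes "abs_conv a (Re s)"
  shows "norm (ds a s) \<le> rds (\<lambda>n. norm (a n)) (Re s)"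
  unfolding ds_def rds_def
  using summable_norm[OF summable_norm_ds[OF assms order.refl]] by (simp add: norm_ds_term)

lemma rds_mono:
  assumes "abs_conv a \<sigma>" "abs_conv b \<sigma>" "\<And>n. n \<ge> 1 \<Longrightarrow> a n \<le> b n"
  shows "rds a \<sigma> \<le> rds b \<sigma>"
  unfolding rds_def
proof (rule suminf_le)
  show "a n * real n powr - \<sigma> \<le> b n * real n powr - \<sigma>" for n
    using assms(3)[of n] by (cases "n = 0") (auto intro!: mult_right_mono)
qed (use assms in \<open>auto intro!: summable_rds\<close>)

lemma rds_nonneg:
  assumes "abs_conv a \<sigma>" "\<And>n. n \<ge> 1 \<Longrightarrow> a n \<ge> 0"
  shows "rds a \<sigma> \<ge> 0"
  using rds_mono[of "\<lambda>_. 0" \<sigma> a] assms by (simp add: rds_def abs_conv_def)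

lemma rds_antimono:
  assumes "abs_conv a \<sigma>" "\<sigma> \<le> \<sigma>'" "\<And>n. n \<ge> 1 \<Longrightarrow> a n \<ge> 0"
  shows "rds a \<sigma>' \<le> rds a \<sigma>"
  unfolding rds_def
proof (rule suminf_le)
  show "a n * real n powr - \<sigma>' \<le> a n * real n powr - \<sigma>" for n
    using assms(2) assms(3)[of n] by (cases "n = 0") (auto intro!: mult_left_mono powr_mono)
qed (use assms in \<open>auto intro!: summable_rds[OF assms(1)]\<close>)

lemma sum_le_rds:
  assumes "abs_conv a \<sigma>" "finite S" "\<And>n. n \<ge> 1 \<Longrightarrow> a n \<ge> 0"
  shows "(\<Sum>n\<in>S. a n * real n powr (- \<sigma>)) \<le> rds a \<sigma>"
  unfolding rds_def
proof (rule sum_le_suminf[OF summable_rds[OF assms(1) order.refl] assms(2)])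
  show "0 \<le> a n * real n powr - \<sigma>" for n
    using assms(3)[of n] by (cases "n = 0") auto
qed

section \<open>Dirichlet convolution and products of series\<close>

text \<open>The product is an unordered sum over pairs, which absolute summability allows to be
  grouped by the value of d m. Vanishing at 0 restricts the pairs to positive ones, where (d, m)
  corresponds bijectively to (d m, d).\<close>

lemma dirichlet_product_has_sum:
  fixes A B :: "nat \<Rightarrow> 'a :: {real_normed_field, banach}"
  assumes A: "(\<lambda>n. norm (A n)) summable_on UNIV" and B: "(\<lambda>n. norm (B n)) summable_on UNIV" and 0: "A 0 = 0" "B 0 = 0"
  shows "((\<lambda>n. \<Sum>d | d dvd n. A d * B (n div d)) has_sum (infsum A UNIV * infsum B UNIV)) {1..}"
    (is "(?h has_sum ?S) _")
proof -
  have inner: "((\<lambda>m. A d * B m) has_sum (A d * infsum B UNIV)) UNIV" for d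
    using B by (intro has_sum_cmult_right) (simp add: Infinite_Sum.abs_summable_summable has_sum_infsum)
  have abs: "(\<lambda>p. norm (case p of (d, m) \<Rightarrow> A d * B m)) summable_on (UNIV \<times> UNIV)"
  proof (rule Infinite_Sum.abs_summable_on_Sigma_iff[THEN iffD2], intro conjI ballI)
    show "(\<lambda>m. norm (case (d, m) of (d, m) \<Rightarrow> A d * B m)) summable_on UNIV" for d
      using summable_on_cmult_right[OF B, of "norm (A d)"] by (simp add: norm_mult)
    have "(\<lambda>d. norm (norm (A d) * infsum (\<lambda>m. norm (B m)) UNIV)) summable_on UNIV"
      using summable_on_cmult_left[OF A, of "infsum (\<lambda>m. norm (B m)) UNIV"]
      by (simp add: abs_mult infsum_nonneg)
    thus "(\<lambda>d. norm (\<Sum>\<^sub>\<infinity>m. norm (case (d, m) of (d, m) \<Rightarrow> A d * B m))) summable_on UNIV"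
      by (simp add: norm_mult infsum_cmult_right')
  qed
  have S: "((\<lambda>(d, m). A d * B m) has_sum ?S) (UNIV \<times> UNIV)"
  proof (rule has_sum_SigmaI)
    show "((\<lambda>d. A d * infsum B UNIV) has_sum ?S) UNIV"
      using A by (intro has_sum_cmult_left) (simp add: Infinite_Sum.abs_summable_summable has_sum_infsum)
    show "(\<lambda>(d, m). A d * B m) summable_on UNIV \<times> UNIV"
      using abs by (rule Infinite_Sum.abs_summable_summable)
  qed (use inner in auto)
  also have "?this \<longleftrightarrow> ((\<lambda>(d, m). A d * B m) has_sum ?S) ({1..} \<times> {1..})"
  proof (rule has_sum_cong_neutral)
    fix x assume "x \<in> UNIV \<times> UNIV - {1::nat..} \<times> {1::nat..}"
    thus "(case x of (d, m) \<Rightarrow> A d * B m) = 0"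
      using 0 by (cases x) (auto simp: not_less_eq_eq)
  qed auto
  also have "\<dots> \<longleftrightarrow> ((\<lambda>(n, d). A d * B (n div d)) has_sum ?S) (Sigma {1..} (\<lambda>n. {d. d dvd n}))"
    by (rule has_sum_reindex_bij_witness[of _ "\<lambda>(n, d). (d, n div d)" "\<lambda>(d, m). (d * m, d)"])
       (auto simp: Suc_le_eq div_greater_zero_iff intro: dvd_pos_nat dvd_imp_le)
  finally have S': "((\<lambda>(n, d). A d * B (n div d)) has_sum ?S) (Sigma {1..} (\<lambda>n. {d. d dvd n}))" .
  show ?thesis
  proof (rule has_sum_SigmaD[OF S'])
    fix n :: nat assume "n \<in> {1..}"
    hence "finite {d. d dvd n}" by auto
    thus "((\<lambda>d. case (n, d) of (n, d) \<Rightarrow> A d * B (n div d)) has_sum ?h n) {d. d dvd n}"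
      using has_sum_finite[of "{d. d dvd n}" "\<lambda>d. A d * B (n div d)"] by simp
  qed
qed

lemma dirichlet_product_sums:
  fixes A B :: "nat \<Rightarrow> 'a :: {real_normed_field, banach}"
  assumes A: "summable (\<lambda>n. norm (A n))" and B: "summable (\<lambda>n. norm (B n))" and 0: "A 0 = 0" "B 0 = 0"
  shows "(\<lambda>n. if n = 0 then 0 else \<Sum>d | d dvd n. A d * B (n div d)) sums (suminf A * suminf B)"
proof -
  have inf: "infsum f UNIV = suminf f" if "summable (\<lambda>n. norm (f n))" for f :: "nat \<Rightarrow> 'a"
    using norm_summable_imp_has_sum[OF that] summable_sums[OF summable_norm_cancel[OF that]]
    by (simp add: infsumI)
  have abs: "(\<lambda>n. norm (f n)) summable_on UNIV" if "summable (\<lambda>n. norm (f n))" for f :: "nat \<Rightarrow> 'a"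
    using norm_summable_imp_summable_on[of "\<lambda>n. norm (f n)"] that by simp
  have "((\<lambda>n. \<Sum>d | d dvd n. A d * B (n div d)) has_sum (suminf A * suminf B)) {1..}"
    using dirichlet_product_has_sum[OF abs[OF A] abs[OF B] 0] by (simp add: inf A B)
  also have "?this \<longleftrightarrow> ((\<lambda>n. if n = 0 then 0 else \<Sum>d | d dvd n. A d * B (n div d)) has_sum (suminf A * suminf B)) UNIV"
    by (rule has_sum_cong_neutral) auto
  finally show ?thesis by (rule has_sum_imp_sums)
qed

lemma dconv_ds_term:
  "(if n = 0 then 0 else \<Sum>d | d dvd n. (a d * of_nat d powr (- s)) * (b (n div d) * of_nat (n div d) powr (- s)))
     = dconv a b n * of_nat n powr (- s)" for s :: complex
proof (cases "n = 0")
  case False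
  have "(a d * of_nat d powr (- s)) * (b (n div d) * of_nat (n div d) powr (- s)) =
        a d * b (n div d) * of_nat n powr (- s)" if "d dvd n" for d
  proof -
    have "(of_nat n :: complex) = of_nat d * of_nat (n div d)"
      using that by (metis dvd_mult_div_cancel of_nat_mult)
    thus ?thesis by (simp add: powr_times_real)
  qed
  thus ?thesis using False by (auto simp: dconv_def sum_distrib_right intro!: sum.cong)
qed auto

lemma abs_conv_dconv_aux:
  fixes a b :: "nat \<Rightarrow> real"
  assumes "abs_conv a \<sigma>" "abs_conv b \<sigma>"
  shows "summable (\<lambda>n. dconv (\<lambda>n. \<bar>a n\<bar>) (\<lambda>n. \<bar>b n\<bar>) n * real n powr (- \<sigma>))"
proof -
  let ?A = "\<lambda>n. \<bar>a n\<bar> * real n powr (- \<sigma>)" and ?B = "\<lambda>n. \<bar>b n\<bar> * real n powr (- \<sigma>)"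
  have "(\<lambda>n. if n = 0 then 0 else \<Sum>d | d dvd n. ?A d * ?B (n div d)) sums (suminf ?A * suminf ?B)"
    using assms by (intro dirichlet_product_sums) (auto simp: abs_conv_def abs_mult)
  also have "(\<lambda>n. if n = 0 then 0 else \<Sum>d | d dvd n. ?A d * ?B (n div d)) =
     (\<lambda>n. dconv (\<lambda>n. \<bar>a n\<bar>) (\<lambda>n. \<bar>b n\<bar>) n * real n powr (- \<sigma>))"
  proof
    fix n
    have "?A d * ?B (n div d) = \<bar>a d\<bar> * \<bar>b (n div d)\<bar> * real n powr (- \<sigma>)" if "d dvd n" for d
    proof -
      have "real n = real d * real (n div d)"
        using that by (metis dvd_mult_div_cancel of_nat_mult)
      thus ?thesis by (simp add: powr_mult)
    qed
    thus "(if n = 0 then 0 else \<Sum>d | d dvd n. ?A d * ?B (n div d)) =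
      dconv (\<lambda>n. \<bar>a n\<bar>) (\<lambda>n. \<bar>b n\<bar>) n * real n powr (- \<sigma>)"
      by (auto simp: dconv_def sum_distrib_right intro!: sum.cong)
  qed
  finally show ?thesis by (rule sums_summable)
qed

lemma norm_dconv_le:
  fixes a b :: "nat \<Rightarrow> 'a :: real_normed_field"
  shows "norm (dconv a b n) \<le> dconv (\<lambda>n. norm (a n)) (\<lambda>n. norm (b n)) n"
  unfolding dconv_def by (rule order.trans[OF norm_sum]) (simp add: norm_mult)

lemma dconv_nonneg:
  fixes a b :: "nat \<Rightarrow> real"
  assumes "\<And>n. a n \<ge> 0" "\<And>n. b n \<ge> 0"
  shows "dconv a b n \<ge> 0"
  unfolding dconv_def by (intro sum_nonneg mult_nonneg_nonneg assms)

lemma abs_conv_dconv: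
  fixes a b :: "nat \<Rightarrow> 'a :: real_normed_field"
  assumes "abs_conv a \<sigma>" "abs_conv b \<sigma>"
  shows "abs_conv (dconv a b) \<sigma>"
proof -
  have "abs_conv (dconv (\<lambda>n. norm (a n)) (\<lambda>n. norm (b n))) \<sigma>"
    using abs_conv_dconv_aux[of "\<lambda>n. norm (a n)" \<sigma> "\<lambda>n. norm (b n)"] assms
    by (simp add: abs_conv_def dconv_nonneg)
  thus ?thesis
    by (rule abs_conv_comparison[where C = 1]) (simp add: dconv_nonneg norm_dconv_le)
qed

lemma ds_dconv:
  assumes "abs_conv a (Re s)" "abs_conv b (Re s)"
  shows "ds (dconv a b) s = ds a s * ds b s"
proof -
  have "(\<lambda>n. if n = 0 then 0 else \<Sum>d | d dvd n. (a d * of_nat d powr (- s)) *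
            (b (n div d) * of_nat (n div d) powr (- s))) sums (ds a s * ds b s)"
    unfolding ds_def using assms
    by (intro dirichlet_product_sums summable_norm_ds[OF _ order.refl]) auto
  thus ?thesis unfolding dconv_ds_term by (simp add: sums_iff ds_def)
qed

lemma rds_dconv:
  assumes "abs_conv a \<sigma>" "abs_conv b \<sigma>"
  shows "rds (dconv a b) \<sigma> = rds a \<sigma> * rds b \<sigma>"
proof -
  have "complex_of_real (rds (dconv a b) \<sigma>) = ds (\<lambda>n. of_real (dconv a b n)) (of_real \<sigma>)"
    using ds_of_real[OF abs_conv_dconv[OF assms]] by simp
  also have "(\<lambda>n. of_real (dconv a b n)) = dconv (\<lambda>n. complex_of_real (a n)) (\<lambda>n. of_real (b n))"
    by (auto simp: dconv_def)
  also have "ds \<dots> (of_real \<sigma>) = complex_of_real (rds a \<sigma> * rds b \<sigma>)"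
    using assms by (subst ds_dconv) (auto simp: ds_of_real)
  finally show ?thesis by (simp only: of_real_eq_iff)
qed

section \<open>Differentiation, behaviour at +infinity and uniqueness\<close>

lemma abs_conv_ln:
  fixes a :: "nat \<Rightarrow> 'a :: real_normed_field"
  assumes "abs_conv a \<sigma>0" "\<sigma>0 < \<sigma>"
  shows "abs_conv (\<lambda>n. a n * of_real (ln (real n))) \<sigma>"
  unfolding abs_conv_def
proof (rule summable_comparison_test[OF exI[of _ 0]])
  let ?\<delta> = "\<sigma> - \<sigma>0"
  show "summable (\<lambda>n. 1 / ?\<delta> * (norm (a n) * real n powr (- \<sigma>0)))"
    using assms by (intro summable_mult) (auto simp: abs_conv_def)
  show "\<forall>n\<ge>0. norm (norm (a n * of_real (ln (real n))) * real n powr - \<sigma>) \<le>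
      1 / ?\<delta> * (norm (a n) * real n powr (- \<sigma>0))"
  proof safe
    fix n :: nat
    show "norm (norm (a n * of_real (ln (real n))) * real n powr - \<sigma>) \<le>
      1 / ?\<delta> * (norm (a n) * real n powr (- \<sigma>0))"
    proof (cases "n = 0")
      case False
      have "\<bar>ln (real n)\<bar> * real n powr - \<sigma> \<le> (real n powr ?\<delta> / ?\<delta>) * real n powr - \<sigma>"
        using ln_powr_bound[of "real n" ?\<delta>] False assms by (intro mult_right_mono) auto
      also have "\<dots> = 1 / ?\<delta> * real n powr (- \<sigma>0)"
        using False by (simp flip: powr_add)
      finally have "norm (a n) * (\<bar>ln (real n)\<bar> * real n powr - \<sigma>) \<le> norm (a n) * (1 / ?\<delta> * real n powr (- \<sigma>0))"
        by (rule mult_left_mono) auto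
      thus ?thesis by (simp add: norm_mult abs_mult algebra_simps)
    qed auto
  qed
qed

lemma ds_has_field_derivative:
  assumes a: "abs_conv a \<sigma>0" and s: "Re s > \<sigma>0"
  shows "(ds a has_field_derivative - ds (\<lambda>n. a n * of_real (ln (real n))) s) (at s)"
proof -
  \<comment> \<open>The midpoint leaves room on both sides: the series with weights ln n still
    converges absolutely at \<sigma>1, and s is interior to the half-plane to its right.\<close>
  define \<sigma>1 where "\<sigma>1 = (\<sigma>0 + Re s) / 2"
  have \<sigma>1: "\<sigma>0 < \<sigma>1" "\<sigma>1 < Re s" using s by (auto simp: \<sigma>1_def)
  let ?S = "{z. Re z > \<sigma>1}"
  let ?f' = "\<lambda>n z. - (a n * of_real (ln (real n)) * of_nat n powr (- z))"
  have op: "open ?S" by (rule open_halfspace_Re_gt)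
  have "s \<in> ?S" using \<sigma>1 by simp
  have ul: "uniform_limit ?S (\<lambda>n z. \<Sum>i<n. ?f' i z) (\<lambda>z. \<Sum>i. ?f' i z) sequentially"
  proof (rule Weierstrass_m_test)
    show "summable (\<lambda>n. norm (a n * of_real (ln (real n))) * real n powr (- \<sigma>1))"
      using abs_conv_ln[OF a \<sigma>1(1)] by (simp add: abs_conv_def)
    fix n z assume "z \<in> ?S"
    thus "norm (?f' n z) \<le> norm (a n * of_real (ln (real n))) * real n powr (- \<sigma>1)"
      unfolding norm_minus_cancel norm_ds_term[of "\<lambda>n. a n * of_real (ln (real n))"]
      by (intro mult_left_mono powr_minus_antimono_nat) auto
  qed
  have der: "((\<lambda>z. a n * of_nat n powr (- z)) has_field_derivative ?f' n z) (at z within ?S)" for n z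
  proof (cases "n = 0")
    case False
    have "((\<lambda>z. a n * of_nat n powr (- z)) has_field_derivative
        a n * (Ln (of_nat n) * of_nat n powr (- z) * (- 1))) (at z within ?S)"
      using False by (intro DERIV_cmult DERIV_chain'[of uminus] DERIV_minus DERIV_ident
          has_field_derivative_at_within[OF has_field_derivative_powr_right] derivative_eq_intros) auto
    thus ?thesis using False Ln_of_real[of "real n"] by (simp add: mult_ac)
  qed auto
  have sum0: "summable (\<lambda>n. a n * of_nat n powr (- s))"
    using summable_ds[OF a, of s] s by simp
  from has_field_derivative_series[OF convex_halfspace_Re_gt der ul \<open>s \<in> ?S\<close> sum0]
  obtain g where g: "\<forall>x\<in>?S. (\<lambda>n. a n * of_nat n powr (- x)) sums g x \<and>
      (g has_field_derivative (\<Sum>i. ?f' i x)) (at x within ?S)" by blast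
  have "(g has_field_derivative (\<Sum>i. ?f' i s)) (at s within ?S)" using g \<open>s \<in> ?S\<close> by blast
  hence "(g has_field_derivative (\<Sum>i. ?f' i s)) (at s)"
    using at_within_open[OF \<open>s \<in> ?S\<close> op] by simp
  moreover have "\<And>x. x \<in> ?S \<Longrightarrow> g x = ds a x"
    using g by (auto simp: ds_def sums_iff)
  hence "\<forall>\<^sub>F x in nhds s. g x = ds a x"
    using eventually_nhds_in_open[OF op \<open>s \<in> ?S\<close>] by (auto elim!: eventually_mono)
  ultimately have "(ds a has_field_derivative (\<Sum>i. ?f' i s)) (at s)"
    using DERIV_cong_ev[where x = s and f = g and g = "ds a", OF refl _ refl] by blast
  moreover have "(\<Sum>i. ?f' i s) = - ds (\<lambda>n. a n * of_real (ln (real n))) s"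
    unfolding ds_def
    using summable_ds[OF abs_conv_ln[OF a \<sigma>1(1)], of s] \<sigma>1 by (intro suminf_minus) auto
  ultimately show ?thesis by simp
qed

lemma rds_has_real_derivative:
  assumes a: "abs_conv a \<sigma>0" and s: "\<sigma> > \<sigma>0"
  shows "(rds a has_real_derivative - rds (\<lambda>n. a n * ln (real n)) \<sigma>) (at \<sigma>)"
proof -
  let ?a = "\<lambda>n. complex_of_real (a n)"
  have "(ds ?a has_field_derivative - ds (\<lambda>n. ?a n * of_real (ln (real n))) (of_real \<sigma>)) (at (of_real \<sigma>))"
    using assms by (intro ds_has_field_derivative[of _ \<sigma>0]) auto
  hence "((\<lambda>x. ds ?a (of_real x)) has_vector_derivative - ds (\<lambda>n. ?a n * of_real (ln (real n))) (of_real \<sigma>)) (at \<sigma>)"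
    by (rule has_vector_derivative_real_field)
  hence "((\<lambda>x. Re (ds ?a (of_real x))) has_vector_derivative Re (- ds (\<lambda>n. ?a n * of_real (ln (real n))) (of_real \<sigma>))) (at \<sigma>)"
    by (rule bounded_linear.has_vector_derivative[OF bounded_linear_Re])
  moreover have "ds (\<lambda>n. ?a n * of_real (ln (real n))) (of_real \<sigma>) = of_real (rds (\<lambda>n. a n * ln (real n)) \<sigma>)"
    using ds_of_real[of "\<lambda>n. a n * ln (real n)" \<sigma>] abs_conv_ln[OF assms] by simp
  ultimately have "((\<lambda>x. Re (ds ?a (of_real x))) has_real_derivative - rds (\<lambda>n. a n * ln (real n)) \<sigma>) (at \<sigma>)"
    by (simp add: has_real_derivative_iff_has_vector_derivative)
  moreover have "\<forall>\<^sub>F x in nhds \<sigma>. Re (ds ?a (of_real x)) = rds a x"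
    using eventually_nhds_in_open[of "{\<sigma>0<..}" \<sigma>] s
    by (auto elim!: eventually_mono simp: ds_of_real abs_conv_mono[OF a])
  ultimately show ?thesis
    using DERIV_cong_ev[where x = \<sigma> and f = "\<lambda>x. Re (ds ?a (of_real x))" and g = "rds a", OF refl _ refl] by blast
qed

text \<open>All later terms carry at least the factor (N + 1)^(\<sigma>0 - Re s). Applied with N = 1
  this gives the limit at +infinity, applied with the first index not yet treated it gives
  uniqueness of coefficients.\<close>

lemma norm_ds_diff_first_le:
  assumes a: "abs_conv a \<sigma>0" and N: "N \<ge> 1" and z: "\<And>k. 1 \<le> k \<Longrightarrow> k < N \<Longrightarrow> a k = 0" and s: "Re s \<ge> \<sigma>0"
  shows "norm (ds a s - a N * of_nat N powr (- s)) \<le> real (Suc N) powr (\<sigma>0 - Re s) * rds (\<lambda>n. norm (a n)) \<sigma>0"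
proof -
  define b where "b = a(N := 0)"
  have b: "abs_conv b \<sigma>0" by (rule abs_conv_comparison[OF a, of _ 1]) (auto simp: b_def)
  have "ds a s = (\<Sum>n. b n * of_nat n powr (- s) + (if n = N then a N * of_nat N powr (- s) else 0))"
    unfolding ds_def by (intro suminf_cong) (auto simp: b_def)
  also have "\<dots> = ds b s + a N * of_nat N powr (- s)"
    unfolding ds_def using sums_If_finite_set[of "{N}" "\<lambda>_. a N * of_nat N powr (- s)"]
    by (subst suminf_add [symmetric]) (auto simp: summable_ds[OF b s] sums_iff)
  finally have "norm (ds a s - a N * of_nat N powr (- s)) = norm (ds b s)" by simp
  also have "\<dots> \<le> rds (\<lambda>n. norm (b n)) (Re s)"
    using abs_conv_mono[OF b s] by (rule norm_ds_le)
  also have "\<dots> \<le> (\<Sum>n. real (Suc N) powr (\<sigma>0 - Re s) * (norm (a n) * real n powr (- \<sigma>0)))"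
    unfolding rds_def
  proof (rule suminf_le)
    show "summable (\<lambda>n. norm (b n) * real n powr - Re s)"
      using abs_conv_mono[OF b s] by (simp add: abs_conv_def)
    show "summable (\<lambda>n. real (Suc N) powr (\<sigma>0 - Re s) * (norm (a n) * real n powr (- \<sigma>0)))"
      using a by (intro summable_mult) (simp add: abs_conv_def)
    fix n
    show "norm (b n) * real n powr - Re s \<le> real (Suc N) powr (\<sigma>0 - Re s) * (norm (a n) * real n powr (- \<sigma>0))"
    proof (cases "n = 0 \<or> n \<le> N")
      case True
      hence "n = 0 \<or> b n = 0" using z[of n] by (cases "n = N"; cases n) (auto simp: b_def)
      thus ?thesis by auto
    next
      case False
      have "real n powr (- Re s) = real n powr (\<sigma>0 - Re s) * real n powr (- \<sigma>0)"
        using False by (simp flip: powr_add)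
      also have "\<dots> \<le> real (Suc N) powr (\<sigma>0 - Re s) * real n powr (- \<sigma>0)"
        using False s by (intro mult_right_mono powr_mono2') auto
      finally have "norm (a n) * real n powr (- Re s) \<le>
          norm (a n) * (real (Suc N) powr (\<sigma>0 - Re s) * real n powr (- \<sigma>0))"
        by (rule mult_left_mono) auto
      thus ?thesis using False by (simp add: b_def mult_ac)
    qed
  qed
  also have "\<dots> = real (Suc N) powr (\<sigma>0 - Re s) * rds (\<lambda>n. norm (a n)) \<sigma>0"
    unfolding rds_def using a by (intro suminf_mult) (simp add: abs_conv_def)
  finally show ?thesis .
qed

lemma ds_tendsto_first:
  assumes a: "abs_conv a \<sigma>0"
  shows "((\<lambda>\<sigma>. ds a (of_real \<sigma>)) \<longlongrightarrow> a 1) at_top"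
proof -
  have "((\<lambda>\<sigma>. ds a (of_real \<sigma>) - a 1) \<longlongrightarrow> 0) at_top"
  proof (rule Lim_null_comparison)
    show "\<forall>\<^sub>F \<sigma> in at_top. norm (ds a (of_real \<sigma>) - a 1) \<le> 2 powr (\<sigma>0 - \<sigma>) * rds (\<lambda>n. norm (a n)) \<sigma>0"
      using eventually_ge_at_top[of \<sigma>0]
    proof eventually_elim
      case (elim \<sigma>)
      thus ?case using norm_ds_diff_first_le[OF a, of 1 "of_real \<sigma>"] by simp
    qed
    have "((\<lambda>\<sigma>. 2 powr (\<sigma>0 - \<sigma>)) \<longlongrightarrow> 0) at_top" by real_asymp
    thus "((\<lambda>\<sigma>. 2 powr (\<sigma>0 - \<sigma>) * rds (\<lambda>n. norm (a n)) \<sigma>0) \<longlongrightarrow> 0) at_top"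
      by (rule tendsto_mult_left_zero)
  qed
  thus ?thesis by (simp add: LIM_zero_iff)
qed

lemma rds_tendsto_first:
  assumes a: "abs_conv a \<sigma>0"
  shows "(rds a \<longlongrightarrow> a 1) at_top"
proof -
  have "((\<lambda>\<sigma>. ds (\<lambda>n. of_real (a n)) (of_real \<sigma>)) \<longlongrightarrow> of_real (a 1)) at_top"
    using a by (intro ds_tendsto_first[of _ \<sigma>0]) simp
  also have "?this \<longleftrightarrow> ((\<lambda>\<sigma>. complex_of_real (rds a \<sigma>)) \<longlongrightarrow> of_real (a 1)) at_top"
    by (intro tendsto_cong eventually_mono[OF eventually_ge_at_top[of \<sigma>0]] ds_of_real abs_conv_mono[OF a])
  finally show ?thesis using tendsto_of_real_iff by blast
qed

text \<open>Strong induction: if all earlier coefficients vanish, multiplying the series by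
  n^\<sigma> bounds \<open>a n\<close> by a constant times (n / (n + 1))^\<sigma>, which tends to
  0.\<close>

lemma ds_eq_0_imp_coeff_0:
  assumes a: "abs_conv a \<sigma>0" and z: "\<And>\<sigma>. \<sigma> > \<sigma>0 \<Longrightarrow> ds a (of_real \<sigma>) = 0" and "n \<ge> 1"
  shows "a n = 0"
  using \<open>n \<ge> 1\<close>
proof (induction n rule: less_induct)
  case (less n)
  define M where "M = rds (\<lambda>n. norm (a n)) \<sigma>0"
  have "((\<lambda>_. norm (a n)) \<longlongrightarrow> 0) (at_top :: real filter)"
  proof (rule Lim_null_comparison)
    show "\<forall>\<^sub>F \<sigma> in at_top. norm (norm (a n)) \<le> (real n / real (Suc n)) powr \<sigma> * (real (Suc n) powr \<sigma>0 * M)"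
      using eventually_gt_at_top[of \<sigma>0]
    proof eventually_elim
      case (elim \<sigma>)
      have "norm (a n * of_nat n powr (- of_real \<sigma>)) \<le> real (Suc n) powr (\<sigma>0 - \<sigma>) * M"
        using norm_ds_diff_first_le[OF a less.prems, of "of_real \<sigma>"] less.IH elim z[of \<sigma>] less.prems
        by (simp add: M_def)
      hence "norm (a n) \<le> real n powr \<sigma> * (real (Suc n) powr (\<sigma>0 - \<sigma>) * M)"
        using less.prems unfolding norm_ds_term by (simp add: powr_minus field_simps)
      also have "\<dots> = (real n / real (Suc n)) powr \<sigma> * (real (Suc n) powr \<sigma>0 * M)"
        using less.prems by (simp add: powr_divide powr_diff)
      finally show ?case by simp
    qed
    have "((\<lambda>\<sigma>. (real n / real (Suc n)) powr \<sigma>) \<longlongrightarrow> 0) at_top"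
      using less.prems by real_asymp
    thus "((\<lambda>\<sigma>. (real n / real (Suc n)) powr \<sigma> * (real (Suc n) powr \<sigma>0 * M)) \<longlongrightarrow> 0) at_top"
      by (rule tendsto_mult_left_zero)
  qed
  thus ?case by (simp add: tendsto_const_iff)
qed

section \<open>The exponential formula\<close>

lemma dconv_1 [simp]: "dconv a b (Suc 0) = a 1 * b 1"
  by (simp add: dconv_def)

lemma ln_ge_half: "n \<ge> 2 \<Longrightarrow> ln (real n) \<ge> 1 / 2"
proof -
  assume "n \<ge> 2"
  have "1 / 2 \<le> ln (2 :: real)" using ln2_ge_two_thirds by simp
  also have "\<dots> \<le> ln (real n)" using \<open>n \<ge> 2\<close> by simp
  finally show ?thesis .
qed

lemma abs_conv_div_ln:
  fixes b :: "nat \<Rightarrow> 'a :: real_normed_field"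
  assumes "abs_conv b \<sigma>"
  shows "abs_conv (\<lambda>n. b n / of_real (ln (real n))) \<sigma>"
proof (rule abs_conv_comparison[OF assms, of _ 2])
  fix n :: nat assume "n \<ge> 1"
  show "norm (b n / of_real (ln (real n))) \<le> 2 * norm (b n)"
  \<comment> \<open>For n = 1 the quotient is a division by ln 1 = 0, hence 0; for n >= 2 the
    divisor is at least 1 / 2.\<close>
  proof (cases "n = 1")
    case False
    hence l: "ln (real n) \<ge> 1 / 2" using \<open>n \<ge> 1\<close> by (intro ln_ge_half) auto
    have "norm (b n) / \<bar>ln (real n)\<bar> \<le> norm (b n) / (1 / 2)"
      using l by (intro divide_left_mono) auto
    thus ?thesis by (simp add: norm_divide)
  qed auto
qed

context
  fixes a b :: "nat \<Rightarrow> complex"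
  assumes a: "\<And>\<sigma>. \<sigma> > 1 \<Longrightarrow> abs_conv a \<sigma>" and b: "\<And>\<sigma>. \<sigma> > 1 \<Longrightarrow> abs_conv b \<sigma>"
    and a1: "a 1 = 1" and ab: "\<And>n. n \<ge> 1 \<Longrightarrow> a n * of_real (ln (real n)) = dconv b a n"
begin

lemma log_coeff_1: "b 1 = 0"
  using ab[of 1] a1 by simp

lemma ds_cong: "(\<And>n. n \<ge> 1 \<Longrightarrow> f n = g n) \<Longrightarrow> ds f s = ds g s"
  unfolding ds_def by (intro suminf_cong) (metis mult_eq_0_iff not_one_le_zero of_nat_0 powr_0 less_one linorder_not_less)

lemma rds_cong: "(\<And>n. n \<ge> 1 \<Longrightarrow> f n = g n) \<Longrightarrow> rds f s = rds g s"
  unfolding rds_def by (intro suminf_cong) (metis mult_eq_0_iff of_nat_0 powr_0 less_one linorder_not_less)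

lemma ds_mult_ln:
  assumes "Re s > 1"
  shows "ds (\<lambda>n. a n * of_real (ln (real n))) s = ds b s * ds a s"
  using ds_cong[OF ab] ds_dconv[of b s a] a b assms by simp

text \<open>No branch of the logarithm is chosen. The product of the series with exp of minus the
  candidate logarithm has derivative 0 by the relation \<open>ab\<close>, and its constant value 1
  is read off at +infinity.\<close>

lemma ds_eq_exp:
  assumes s: "Re s > 1"
  shows "ds a s = exp (ds (\<lambda>n. b n / of_real (ln (real n))) s)"
proof -
  let ?g = "\<lambda>n. b n / of_real (ln (real n))"
  let ?\<phi> = "\<lambda>s. ds a s * exp (- ds ?g s)"
  have g: "abs_conv ?g \<sigma>" if "\<sigma> > 1" for \<sigma> using abs_conv_div_ln[OF b[OF that]] by simp
  have gln: "ds (\<lambda>n. ?g n * of_real (ln (real n))) z = ds b z" for z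
  proof (rule ds_cong)
    fix n :: nat assume "n \<ge> 1"
    thus "?g n * of_real (ln (real n)) = b n"
      using log_coeff_1 ln_ge_half[of n] by (cases "n = 1") auto
  qed
  have der: "(?\<phi> has_field_derivative 0) (at z within {z. Re z > 1})" if "z \<in> {z. Re z > 1}" for z
  proof -
    define \<sigma>0 where "\<sigma>0 = (1 + Re z) / 2"
    have \<sigma>0: "1 < \<sigma>0" "\<sigma>0 < Re z" using that by (auto simp: \<sigma>0_def)
    have Dg: "(ds ?g has_field_derivative - ds b z) (at z)"
      using ds_has_field_derivative[OF g[OF \<sigma>0(1)] \<sigma>0(2)] unfolding gln .
    have "(?\<phi> has_field_derivative (- (ds b z * ds a z)) * exp (- ds ?g z) +
         (exp (- ds ?g z) * (- (- ds b z))) * ds a z) (at z)"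
      using ds_has_field_derivative[OF a[OF \<sigma>0(1)] \<sigma>0(2)] Dg ds_mult_ln[of z] that
      by (intro DERIV_mult DERIV_fun_exp DERIV_minus) auto
    thus ?thesis by (auto intro!: has_field_derivative_at_within simp: algebra_simps)
  qed
  obtain c where c: "\<And>z. Re z > 1 \<Longrightarrow> ?\<phi> z = c"
    using has_field_derivative_zero_constant[OF convex_halfspace_Re_gt der] by auto
  have "((\<lambda>\<sigma>. ?\<phi> (of_real \<sigma>)) \<longlongrightarrow> a 1 * exp (- ?g 1)) at_top"
    by (intro tendsto_intros ds_tendsto_first[of _ 2] a g) auto
  moreover have "((\<lambda>\<sigma>. ?\<phi> (of_real \<sigma>)) \<longlongrightarrow> c) at_top"
    by (rule tendsto_eventually, rule eventually_mono[OF eventually_gt_at_top[of 1]]) (auto simp: c)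
  ultimately have "c = 1"
    using tendsto_unique[of at_top] a1 by force
  hence "ds a s * exp (- ds ?g s) = 1" using c[OF s] by simp
  thus ?thesis by (simp add: exp_minus field_simps)
qed

text \<open>The same product formed with absolute values. The relation \<open>ab\<close> becomes an
  inequality, so the product is nondecreasing on the real axis, and it tends to 1 at
  +infinity.\<close>

lemma rds_norm_le_exp:
  assumes s: "\<sigma> > 1"
  shows "rds (\<lambda>n. norm (a n)) \<sigma> \<le> exp (rds (\<lambda>n. norm (b n) / ln (real n)) \<sigma>)"
proof -
  let ?a = "\<lambda>n. norm (a n)" and ?b = "\<lambda>n. norm (b n)"
  let ?g = "\<lambda>n. ?b n / ln (real n)"
  let ?\<phi> = "\<lambda>s. rds ?a s * exp (- rds ?g s)"
  have a': "abs_conv ?a \<sigma>" and b': "abs_conv ?b \<sigma>" if "\<sigma> > 1" for \<sigma> using a b that by auto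
  have g: "abs_conv ?g \<sigma>" if "\<sigma> > 1" for \<sigma> using abs_conv_div_ln[OF b'[OF that]] by simp
  have gln: "rds (\<lambda>n. ?g n * ln (real n)) z = rds ?b z" for z
  proof (rule rds_cong)
    fix n :: nat assume "n \<ge> 1"
    thus "?g n * ln (real n) = ?b n"
      using log_coeff_1 ln_ge_half[of n] by (cases "n = 1") auto
  qed
  have aln: "rds (\<lambda>n. ?a n * ln (real n)) z \<le> rds ?b z * rds ?a z" if "z > 1" for z
  proof -
    have "rds (\<lambda>n. ?a n * ln (real n)) z \<le> rds (dconv ?b ?a) z"
    proof (rule rds_mono)
      show "abs_conv (\<lambda>n. ?a n * ln (real n)) z"
        using abs_conv_ln[OF a'[of "(1 + z) / 2"], of z] that by (simp add: field_simps)
      show "abs_conv (dconv ?b ?a) z" using that by (intro abs_conv_dconv a' b')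
      fix n :: nat assume "n \<ge> 1"
      have "?a n * ln (real n) = norm (a n * of_real (ln (real n)))" using \<open>n \<ge> 1\<close> by (simp add: norm_mult)
      also have "\<dots> \<le> dconv ?b ?a n" unfolding ab[OF \<open>n \<ge> 1\<close>] by (rule norm_dconv_le)
      finally show "?a n * ln (real n) \<le> dconv ?b ?a n" .
    qed
    thus ?thesis unfolding rds_dconv[OF b'[OF that] a'[OF that]] .
  qed
  have der: "\<exists>y. (?\<phi> has_real_derivative y) (at z) \<and> y \<ge> 0" if "z > 1" for z
  proof (intro exI conjI)
    define \<sigma>0 where "\<sigma>0 = (1 + z) / 2"
    have \<sigma>0: "1 < \<sigma>0" "\<sigma>0 < z" using that by (auto simp: \<sigma>0_def)
    have Dg: "(rds ?g has_real_derivative - rds ?b z) (at z)"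
      using rds_has_real_derivative[OF g[OF \<sigma>0(1)] \<sigma>0(2)] unfolding gln .
    show "(?\<phi> has_real_derivative (- rds (\<lambda>n. ?a n * ln (real n)) z) * exp (- rds ?g z) +
         (exp (- rds ?g z) * (- (- rds ?b z))) * rds ?a z) (at z)"
      using rds_has_real_derivative[OF a'[OF \<sigma>0(1)] \<sigma>0(2)] Dg
      by (intro DERIV_mult DERIV_fun_exp DERIV_minus) auto
    have "(rds ?b z * rds ?a z - rds (\<lambda>n. ?a n * ln (real n)) z) * exp (- rds ?g z) \<ge> 0"
      using aln[OF that] by (intro mult_nonneg_nonneg) auto
    thus "(- rds (\<lambda>n. ?a n * ln (real n)) z) * exp (- rds ?g z) +
         (exp (- rds ?g z) * (- (- rds ?b z))) * rds ?a z \<ge> 0" by (simp add: algebra_simps)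
  qed
  have mono: "?\<phi> \<sigma> \<le> ?\<phi> z" if "z \<ge> \<sigma>" for z
    using that s by (intro DERIV_nonneg_imp_nondecreasing[of \<sigma> z ?\<phi>]) (auto intro!: der)
  have lim: "(?\<phi> \<longlongrightarrow> ?a 1 * exp (- ?g 1)) at_top"
    by (intro tendsto_intros rds_tendsto_first[of _ 2] a' g) auto
  have "?\<phi> \<sigma> \<le> ?a 1 * exp (- ?g 1)"
    by (rule tendsto_lowerbound[OF lim]) (auto intro!: eventually_mono[OF eventually_ge_at_top[of \<sigma>] mono])
  hence "rds ?a \<sigma> * exp (- rds ?g \<sigma>) \<le> 1" using a1 by simp
  thus ?thesis by (simp add: exp_minus field_simps)
qed

end

section \<open>Sums over blocks and the zeta function\<close>

lemma sum_exp_minus_le: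
  assumes "\<gamma> > (0 :: real)"
  shows "(\<Sum>v<V. exp (- \<gamma> * real v)) \<le> 1 + 1 / \<gamma>"
proof -
  have q: "exp (- \<gamma>) < 1" using assms by simp
  have "(\<Sum>v<V. exp (- \<gamma> * real v)) = (\<Sum>v<V. exp (- \<gamma>) ^ v)"
    by (intro sum.cong refl) (simp add: exp_of_nat_mult [symmetric] mult.commute)
  also have "\<dots> = (1 - exp (- \<gamma>) ^ V) / (1 - exp (- \<gamma>))"
    using q by (subst sum_gp_strict) auto
  also have "\<dots> \<le> 1 / (1 - exp (- \<gamma>))"
    using q by (intro divide_right_mono) auto
  also have "\<dots> \<le> 1 + 1 / \<gamma>"
  proof -
    have "1 + \<gamma> \<le> exp \<gamma>" by (rule exp_ge_add_one_self)
    hence "exp (- \<gamma>) \<le> 1 / (1 + \<gamma>)" using assms by (simp add: exp_minus field_simps)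
    hence "\<gamma> / (1 + \<gamma>) \<le> 1 - exp (- \<gamma>)" using assms by (simp add: field_simps)
    hence "1 / (1 - exp (- \<gamma>)) \<le> 1 / (\<gamma> / (1 + \<gamma>))"
      using assms q by (intro divide_left_mono) auto
    thus ?thesis using assms by (simp add: field_simps)
  qed
  finally show ?thesis .
qed

lemma sum_exp_le:
  assumes "\<gamma> > (0 :: real)"
  shows "(\<Sum>v<V. exp (\<gamma> * (real v + 1))) \<le> exp (\<gamma> * real V) * (1 + 1 / \<gamma>)"
proof -
  have "(\<Sum>v<V. exp (\<gamma> * (real v + 1))) = (\<Sum>v<V. exp (\<gamma> * real V) * exp (- \<gamma> * real (V - Suc v)))"
    by (intro sum.cong refl) (auto simp: of_nat_diff algebra_simps simp flip: exp_add)
  also have "\<dots> = exp (\<gamma> * real V) * (\<Sum>v<V. exp (- \<gamma> * real (V - Suc v)))"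
    by (simp add: sum_distrib_left)
  also have "(\<Sum>v<V. exp (- \<gamma> * real (V - Suc v))) = (\<Sum>v<V. exp (- \<gamma> * real v))"
    by (rule sum.nat_diff_reindex)
  also have "exp (\<gamma> * real V) * \<dots> \<le> exp (\<gamma> * real V) * (1 + 1 / \<gamma>)"
    using assms by (intro mult_left_mono sum_exp_minus_le) auto
  finally show ?thesis .
qed

text \<open>The substitute for partial summation: only the mass of \<open>g\<close> in each block
  (e^v, e^(v+1)] is known, so the weight is replaced by a majorant that is constant on the
  block.\<close>

lemma sum_by_blocks:
  fixes g \<phi> :: "nat \<Rightarrow> real"
  assumes S: "finite S" "\<And>n. n \<in> S \<Longrightarrow> 2 \<le> n \<and> ln (real n) \<le> real V"
    and g: "\<And>n. g n \<ge> 0"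
    and \<beta>: "\<And>v. (\<Sum>n | exp (real v) < real n \<and> real n \<le> exp 1 * exp (real v). g n) \<le> \<beta> v"
    and w: "\<And>n v. n \<in> S \<Longrightarrow> exp (real v) < real n \<Longrightarrow> real n \<le> exp (real v + 1) \<Longrightarrow> \<phi> n \<le> w v"
    and w0: "\<And>v. w v \<ge> 0"
  shows "(\<Sum>n\<in>S. g n * \<phi> n) \<le> (\<Sum>v<V. \<beta> v * w v)"
proof -
  \<comment> \<open>The ceiling minus 1, since the blocks are open on the left: if ln n is an
    integer, n belongs to the block ending there.\<close>
  define blk where "blk = (\<lambda>n. nat (\<lceil>ln (real n)\<rceil> - 1))"
  have blk: "exp (real (blk n)) < real n" "real n \<le> exp (real (blk n) + 1)" "blk n < V" if "n \<in> S" for n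
  proof -
    have n: "n \<ge> 2" "ln (real n) \<le> real V" using S(2)[OF that] by auto
    have l: "ln (real n) > 0" using n by simp
    have b: "real (blk n) < ln (real n)" "ln (real n) \<le> real (blk n) + 1"
      using l unfolding blk_def by linarith+
    show "exp (real (blk n)) < real n" using b n by (metis exp_less_cancel_iff exp_ln_iff less_le_trans of_nat_0_less_iff pos2)
    show "real n \<le> exp (real (blk n) + 1)" using b n by (metis exp_le_cancel_iff exp_ln_iff less_le_trans of_nat_0_less_iff pos2)
    show "blk n < V" using b n by linarith
  qed
  have fin: "finite {n. exp (real v) < real n \<and> real n \<le> exp 1 * exp (real v)}" for v :: nat
    by (rule finite_subset[of _ "{..nat \<lceil>exp 1 * exp (real v)\<rceil>}"]) (auto simp: le_nat_iff, linarith)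
  have "(\<Sum>n\<in>S. g n * \<phi> n) = (\<Sum>v<V. \<Sum>n\<in>{n\<in>S. blk n = v}. g n * \<phi> n)"
    by (rule sum.group [symmetric]) (use S blk in auto)
  also have "\<dots> \<le> (\<Sum>v<V. \<beta> v * w v)"
  proof (rule sum_mono)
    fix v assume "v \<in> {..<V}"
    have "(\<Sum>n\<in>{n\<in>S. blk n = v}. g n * \<phi> n) \<le> (\<Sum>n\<in>{n\<in>S. blk n = v}. g n * w v)"
      using blk by (intro sum_mono mult_left_mono w g) auto
    also have "\<dots> \<le> (\<Sum>n | exp (real v) < real n \<and> real n \<le> exp 1 * exp (real v). g n * w v)"
      using blk by (intro sum_mono2 fin mult_nonneg_nonneg g w0) (auto simp: exp_add mult.commute)
    also have "\<dots> \<le> \<beta> v * w v"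
      unfolding sum_distrib_right [symmetric] by (intro mult_right_mono \<beta> w0)
    finally show "(\<Sum>n\<in>{n\<in>S. blk n = v}. g n * \<phi> n) \<le> \<beta> v * w v" .
  qed
  finally show ?thesis .
qed

lemma real_powr_minus_Suc: "real n powr (- (1 + \<gamma>)) = real n powr (- \<gamma>) / real n"
proof -
  have *: "- (1 + \<gamma>) = - \<gamma> - 1" by simp
  show ?thesis unfolding * powr_diff by (cases "n = 0") auto
qed

lemma real_powr_minus_1_plus: "real n powr (- 1 + \<gamma>) = real n powr \<gamma> / real n"
  using powr_diff[of "real n" \<gamma> 1] by (cases "n = 0") (simp_all add: algebra_simps)

text \<open>The condition at 1 is included because 1 lies in none of the blocks (x, e x] with x >=
  1.\<close>

definition block_bounded :: "(nat \<Rightarrow> real) \<Rightarrow> real \<Rightarrow> bool" where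
  "block_bounded g E \<longleftrightarrow> (\<forall>n. g n \<ge> 0) \<and> g 1 = 0 \<and>
     (\<forall>x\<ge>1. (\<Sum>n | x < real n \<and> real n \<le> exp 1 * x. g n / real n) \<le> E)"

context
  fixes g :: "nat \<Rightarrow> real" and E :: real
  assumes g: "block_bounded g E"
begin

lemma block_bounded_nonneg: "g n \<ge> 0" and block_bounded_1: "g (Suc 0) = 0"
  using g by (auto simp: block_bounded_def)

lemma block_bounded_block: "x \<ge> 1 \<Longrightarrow> (\<Sum>n | x < real n \<and> real n \<le> exp 1 * x. g n / real n) \<le> E"
  using g by (auto simp: block_bounded_def)

lemma block_bounded_E_nonneg: "E \<ge> 0"
  using block_bounded_block[of 1] by (rule order.trans[rotated]) (auto intro!: sum_nonneg simp: block_bounded_nonneg)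

lemma block_sum_aux:
  assumes S: "finite S" "\<And>n. n \<in> S \<Longrightarrow> 1 \<le> n \<and> ln (real n) \<le> real V"
    and w: "\<And>n v. n \<in> S \<Longrightarrow> exp (real v) < real n \<Longrightarrow> real n \<le> exp (real v + 1) \<Longrightarrow> \<phi> n \<le> w v"
    and w0: "\<And>v. w v \<ge> 0"
  shows "(\<Sum>n\<in>S. g n / real n * \<phi> n) \<le> E * (\<Sum>v<V. w v)"
proof -
  have "(\<Sum>n\<in>S. g n / real n * \<phi> n) = (\<Sum>n\<in>S-{1}. g n / real n * \<phi> n)"
    using S(1) by (intro sum.mono_neutral_right) (auto simp: block_bounded_1)
  also have "\<dots> \<le> (\<Sum>v<V. E * w v)"
  proof (rule sum_by_blocks)
    show "2 \<le> n \<and> ln (real n) \<le> real V" if "n \<in> S - {1}" for n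
      using that S(2)[of n] by auto
  qed (use assms block_bounded_block in \<open>auto simp: block_bounded_nonneg\<close>)
  finally show ?thesis by (simp add: sum_distrib_left)
qed

lemma block_sum_powr_minus:
  assumes S: "finite S" and \<gamma>: "\<gamma> > 0"
  shows "(\<Sum>n\<in>S. g n * real n powr (- (1 + \<gamma>))) \<le> E * (1 + 1 / \<gamma>)"
proof -
  define V where "V = nat \<lceil>Max (insert 0 ((\<lambda>n. ln (real n)) ` S))\<rceil>"
  have V: "ln (real n) \<le> real V" if "n \<in> S" for n
  proof -
    have "ln (real n) \<le> Max (insert 0 ((\<lambda>n. ln (real n)) ` S))" using that S by (intro Max_ge) auto
    thus ?thesis unfolding V_def by linarith
  qed
  have "(\<Sum>n\<in>S. g n * real n powr (- (1 + \<gamma>))) = (\<Sum>n\<in>S-{0}. g n / real n * real n powr (- \<gamma>))"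
    using S by (intro sum.mono_neutral_cong_right) (auto simp only: real_powr_minus_Suc, auto)
  also have "\<dots> \<le> E * (\<Sum>v<V. exp (- \<gamma> * real v))"
  proof (rule block_sum_aux)
    fix n v :: nat assume n: "exp (real v) < real n"
    hence "real n > 0" using exp_gt_zero[of "real v"] by linarith
    hence "real v \<le> ln (real n)" using n by (simp add: ln_ge_iff)
    thus "real n powr (- \<gamma>) \<le> exp (- \<gamma> * real v)"
      using \<gamma> \<open>real n > 0\<close> by (simp add: powr_def)
  qed (use S V in auto)
  also have "\<dots> \<le> E * (1 + 1 / \<gamma>)"
    using \<gamma> by (intro mult_left_mono sum_exp_minus_le block_bounded_E_nonneg)
  finally show ?thesis .
qed

lemma block_abs_conv:
  assumes \<gamma>: "\<sigma> > 1"
  shows "abs_conv g \<sigma>" "rds g \<sigma> \<le> E * (1 + 1 / (\<sigma> - 1))"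
proof -
  have b: "(\<Sum>n\<in>S. g n * real n powr (- \<sigma>)) \<le> E * (1 + 1 / (\<sigma> - 1))" if "finite S" for S
    using block_sum_powr_minus[OF that, of "\<sigma> - 1"] \<gamma> by simp
  have s: "summable (\<lambda>n. g n * real n powr (- \<sigma>))"
    by (rule summableI_nonneg_bounded[OF _ b]) (auto simp: block_bounded_nonneg)
  thus "abs_conv g \<sigma>" by (simp add: abs_conv_def block_bounded_nonneg)
  show "rds g \<sigma> \<le> E * (1 + 1 / (\<sigma> - 1))"
    unfolding rds_def by (rule suminf_le_const[OF s b]) simp
qed

lemma block_sum_powr:
  assumes x: "x \<ge> 1" and \<gamma>: "\<gamma> > 0"
  shows "(\<Sum>n | 1 \<le> n \<and> real n \<le> x. g n * real n powr (- 1 + \<gamma>)) \<le> E * exp \<gamma> * x powr \<gamma> * (1 + 1 / \<gamma>)"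
proof -
  let ?S = "{n. 1 \<le> n \<and> real n \<le> x}"
  have S: "finite ?S" by (rule finite_subset[of _ "{..nat \<lceil>x\<rceil>}"]) (auto simp: le_nat_iff, linarith)
  define V where "V = nat \<lceil>ln x\<rceil>"
  have lx: "ln x \<ge> 0" using x by simp
  have V: "ln x \<le> real V" "real V \<le> ln x + 1" using lx unfolding V_def by linarith+
  have "(\<Sum>n\<in>?S. g n * real n powr (- 1 + \<gamma>)) = (\<Sum>n\<in>?S. g n / real n * real n powr \<gamma>)"
    by (simp only: real_powr_minus_1_plus) simp
  also have "\<dots> \<le> E * (\<Sum>v<V. exp (\<gamma> * (real v + 1)))"
  proof (rule block_sum_aux[OF S])
    show "1 \<le> n \<and> ln (real n) \<le> real V" if "n \<in> ?S" for n
    proof -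
      have "ln (real n) \<le> ln x" using that by auto
      hence "ln (real n) \<le> real V" using V(1) by (rule order.trans)
      thus ?thesis using that by simp
    qed
    fix n v :: nat assume n: "n \<in> ?S" "real n \<le> exp (real v + 1)"
    have "ln (real n) \<le> ln (exp (real v + 1))" using n by (subst ln_le_cancel_iff) auto
    hence "ln (real n) \<le> real v + 1" by simp
    thus "real n powr \<gamma> \<le> exp (\<gamma> * (real v + 1))" using n \<gamma> by (simp add: powr_def)
  qed auto
  also have "\<dots> \<le> E * (exp (\<gamma> * real V) * (1 + 1 / \<gamma>))"
    using \<gamma> by (intro mult_left_mono sum_exp_le block_bounded_E_nonneg)
  also have "\<dots> \<le> E * (exp (\<gamma> * (ln x + 1)) * (1 + 1 / \<gamma>))"
    using \<gamma> V by (intro mult_left_mono mult_right_mono block_bounded_E_nonneg) auto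
  also have "exp (\<gamma> * (ln x + 1)) = exp \<gamma> * x powr \<gamma>" using x by (simp add: powr_def exp_add algebra_simps)
  finally show ?thesis by (simp add: mult_ac)
qed

lemma block_sum_log:
  assumes x: "x \<ge> 1"
  shows "(\<Sum>n | 1 \<le> n \<and> real n \<le> x. g n / real n) \<le> E * (1 + ln x)"
proof -
  let ?S = "{n. 1 \<le> n \<and> real n \<le> x}"
  have S: "finite ?S" by (rule finite_subset[of _ "{..nat \<lceil>x\<rceil>}"]) (auto simp: le_nat_iff, linarith)
  define V where "V = nat \<lceil>ln x\<rceil>"
  have lx: "ln x \<ge> 0" using x by simp
  have V: "ln x \<le> real V" "real V \<le> ln x + 1" using lx unfolding V_def by linarith+
  have "(\<Sum>n\<in>?S. g n / real n * 1) \<le> E * (\<Sum>v<V. 1)"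
  proof (rule block_sum_aux[OF S])
    show "1 \<le> n \<and> ln (real n) \<le> real V" if "n \<in> ?S" for n
    proof -
      have "ln (real n) \<le> ln x" using that by auto
      hence "ln (real n) \<le> real V" using V(1) by (rule order.trans)
      thus ?thesis using that by simp
    qed
  qed auto
  also have "\<dots> \<le> E * (1 + ln x)" using V by (simp add: mult_left_mono block_bounded_E_nonneg)
  finally show ?thesis by simp
qed

end

lemma sum_inverse_squares_le: "(\<Sum>v=1..V. 1 / real v ^ 2) \<le> 2"
proof -
  have "V \<ge> 1 \<Longrightarrow> (\<Sum>v=1..V. 1 / real v ^ 2) \<le> 2 - 1 / real V"
  proof (induction V)
    case (Suc V)
    show ?case
    proof (cases "V = 0")
      case False
      have "1 / (real V + 1) ^ 2 \<le> 1 / real V - 1 / (real V + 1)"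
      proof -
        have "1 / (real V + 1) ^ 2 \<le> 1 / (real V * (real V + 1))"
          using False by (intro divide_left_mono) (auto simp: power2_eq_square)
        thus ?thesis using False by (simp add: field_simps)
      qed
      thus ?thesis using Suc False by (simp add: algebra_simps)
    qed auto
  qed auto
  thus ?thesis by (cases "V = 0") (auto intro: order.trans)
qed

text \<open>The leading coefficient must be exactly \<open>a\<close>. The decaying part of the block
  bound meets another factor 1 / v from the logarithm and so only contributes a convergent series;
  the main part is the series of - ln (1 - exp (- \<kappa>)).\<close>

lemma log_weighted_block_sum:
  fixes g :: "nat \<Rightarrow> real" and a a0 \<kappa> :: real
  assumes g: "\<And>n. g n \<ge> 0" "g 1 = 0" and a: "a \<ge> 0" "a0 \<ge> 0"
    and blk: "\<And>x. x \<ge> 1 \<Longrightarrow> (\<Sum>n | x < real n \<and> real n \<le> exp 1 * x. g n / real n) \<le> a + a0 / ln (exp 1 * x)"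
    and \<kappa>: "0 < \<kappa>" "\<kappa> \<le> 1" and conv: "abs_conv (\<lambda>n. g n / ln (real n)) (1 + \<kappa>)"
  shows "rds (\<lambda>n. g n / ln (real n)) (1 + \<kappa>) \<le> a * ln (1 / \<kappa>) + 4 * (a + a0)"
  unfolding rds_def
proof (rule suminf_le_const)
  show "summable (\<lambda>n. g n / ln (real n) * real n powr - (1 + \<kappa>))"
    by (rule summable_rds[OF conv order.refl])
  fix N :: nat
  define V where "V = nat \<lceil>ln (real (Suc N))\<rceil>"
  have V: "ln (real n) \<le> real V" if "n < N" "n > 0" for n
  proof -
    have "ln (real n) \<le> ln (real (Suc N))" using that by (subst ln_le_cancel_iff) auto
    thus ?thesis unfolding V_def by linarith
  qed
  \<comment> \<open>In the block v = 0 the bound 1 / v is meaningless; there 1 / ln n <= 2 because n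
    >= 2.\<close>
  let ?w = "\<lambda>v. if v = 0 then 2 else exp (- \<kappa> * real v) / real v"
  have "(\<Sum>n<N. g n / ln (real n) * real n powr - (1 + \<kappa>)) =
        (\<Sum>n\<in>{2..<N}. g n / real n * (real n powr (- \<kappa>) / ln (real n)))"
  proof (rule sum.mono_neutral_cong_right)
    show "\<forall>i\<in>{..<N} - {2..<N}. g i / ln (real i) * real i powr - (1 + \<kappa>) = 0"
    proof
      fix i assume "i \<in> {..<N} - {2..<N}"
      hence "i = 0 \<or> i = 1" by auto
      thus "g i / ln (real i) * real i powr - (1 + \<kappa>) = 0" by auto
    qed
  qed (auto simp: powr_minus powr_add powr_diff field_simps)
  also have "\<dots> \<le> (\<Sum>v<V. (a + a0 / (real v + 1)) * ?w v)"
  proof (rule sum_by_blocks)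
    show "(\<Sum>n | exp (real v) < real n \<and> real n \<le> exp 1 * exp (real v). g n / real n) \<le> a + a0 / (real v + 1)" for v :: nat
      using blk[of "exp (real v)"] by (simp add: ln_mult add.commute)
    show "2 \<le> n \<and> ln (real n) \<le> real V" if "n \<in> {2..<N}" for n using that V[of n] by auto
    fix n v :: nat assume n: "n \<in> {2..<N}" "exp (real v) < real n"
    have v: "real v \<le> ln (real n)" using n by (simp add: ln_ge_iff)
    show "real n powr (- \<kappa>) / ln (real n) \<le> ?w v"
    proof (cases "v = 0")
      case True
      have "real n powr (- \<kappa>) / ln (real n) \<le> 1 / (1 / 2)"
        using n \<kappa> ln_ge_half[of n] by (intro frac_le) (auto simp: powr_def intro!: mult_nonneg_nonneg)
      thus ?thesis using True by simp
    next
      case False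
      have "real n powr (- \<kappa>) / ln (real n) \<le> exp (- \<kappa> * real v) / real v"
        using n \<kappa> v False by (intro frac_le) (auto simp: powr_def)
      thus ?thesis using False by simp
    qed
  qed (auto simp: g)
  also have "\<dots> \<le> (\<Sum>v\<in>insert 0 {1..V}. (a + a0 / (real v + 1)) * ?w v)"
    using a by (intro sum_mono2) (auto intro!: mult_nonneg_nonneg add_nonneg_nonneg)
  also have "\<dots> = 2 * (a + a0) + (\<Sum>v=1..V. (a + a0 / (real v + 1)) * ?w v)"
    by (subst sum.insert) auto
  also have "(\<Sum>v=1..V. (a + a0 / (real v + 1)) * ?w v) \<le>
      (\<Sum>v=1..V. a * (exp (- \<kappa>) ^ v / real v) + a0 * (1 / real v ^ 2))"
  proof (rule sum_mono)
    fix v assume v: "v \<in> {1..V}"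
    have "a0 / (real v + 1) * (exp (- \<kappa> * real v) / real v) \<le> a0 / real v * (1 / real v)"
      using v \<kappa> a by (intro mult_mono frac_le) auto
    moreover have "(a + a0 / (real v + 1)) * ?w v = a * (exp (- \<kappa> * real v) / real v) +
        a0 / (real v + 1) * (exp (- \<kappa> * real v) / real v)"
      using v by (subst distrib_right) auto
    ultimately show "(a + a0 / (real v + 1)) * ?w v \<le> a * (exp (- \<kappa>) ^ v / real v) + a0 * (1 / real v ^ 2)"
      using v by (simp add: power2_eq_square mult.commute[of \<kappa>] flip: exp_of_nat_mult)
  qed
  also have "\<dots> = a * (\<Sum>v=1..V. exp (- \<kappa>) ^ v / real v) + a0 * (\<Sum>v=1..V. 1 / real v ^ 2)"
    by (simp add: sum.distrib sum_distrib_left)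
  also have "\<dots> \<le> a * (ln (1 / \<kappa>) + 1) + a0 * 2"
  proof (intro add_mono mult_left_mono sum_inverse_squares_le a)
    have q: "\<bar>- exp (- \<kappa>)\<bar> < 1" using \<kappa> by simp
    have s: "(\<lambda>n. exp (- \<kappa>) ^ n / real n) sums (- ln (1 - exp (- \<kappa>)))"
      using sums_minus[OF ln_series'[OF q]] by simp
    have "(\<Sum>v=1..V. exp (- \<kappa>) ^ v / real v) \<le> - ln (1 - exp (- \<kappa>))"
      using sum_le_suminf[OF sums_summable[OF s], of "{1..V}"] by (simp add: sums_unique[OF s, symmetric])
    also have "\<dots> \<le> - ln (\<kappa> / (1 + \<kappa>))"
    proof -
      have "1 + \<kappa> \<le> exp \<kappa>" by (rule exp_ge_add_one_self)
      hence "exp (- \<kappa>) \<le> 1 / (1 + \<kappa>)" using \<kappa> by (simp add: exp_minus field_simps)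
      hence "\<kappa> / (1 + \<kappa>) \<le> 1 - exp (- \<kappa>)" using \<kappa> by (simp add: field_simps)
      hence "ln (\<kappa> / (1 + \<kappa>)) \<le> ln (1 - exp (- \<kappa>))" using \<kappa> by (subst ln_le_cancel_iff) auto
      thus ?thesis by simp
    qed
    also have "\<dots> = ln (1 / \<kappa>) + ln (1 + \<kappa>)" using \<kappa> by (simp add: ln_div)
    also have "ln (1 + \<kappa>) \<le> 1" using ln_add_one_self_le_self[of \<kappa>] \<kappa> by linarith
    finally show "(\<Sum>v=1..V. exp (- \<kappa>) ^ v / real v) \<le> ln (1 / \<kappa>) + 1" by simp
  qed
  finally show "(\<Sum>n<N. g n / ln (real n) * real n powr - (1 + \<kappa>)) \<le> a * ln (1 / \<kappa>) + 4 * (a + a0)"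
    using a by (simp add: algebra_simps)
qed

section \<open>The zeta function to the right of 1\<close>

lemma block_bounded_mangoldt: "block_bounded mangoldt 10"
  using sum_mangoldt_block by (simp add: block_bounded_def mangoldt_nonneg)

lemma abs_conv_const_1: "\<sigma> > 1 \<Longrightarrow> abs_conv (\<lambda>_. 1 :: complex) \<sigma>"
  using summable_real_powr_iff[of "- \<sigma>"] by (simp add: abs_conv_def)

lemma dconv_mangoldt_1:
  "n \<ge> 1 \<Longrightarrow> dconv (\<lambda>n. complex_of_real (mangoldt n)) (\<lambda>_. 1) n = of_real (ln (real n))"
  using mangoldt_sum[of n, where ?'a = complex] by (simp add: dconv_def)

definition zeta1 :: "complex \<Rightarrow> complex" where "zeta1 = ds (\<lambda>_. 1)"

lemma zeta1_eq_exp: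
  assumes "Re s > 1"
  shows "zeta1 s = exp (ds (\<lambda>n. of_real (mangoldt n) / of_real (ln (real n))) s)"
  unfolding zeta1_def
proof (rule ds_eq_exp)
  show "abs_conv (\<lambda>n. complex_of_real (mangoldt n)) \<sigma>" if "\<sigma> > 1" for \<sigma>
    using block_abs_conv(1)[OF block_bounded_mangoldt that] by (simp del: of_real_mangoldt)
qed (use assms dconv_mangoldt_1 abs_conv_const_1 in \<open>auto simp del: of_real_mangoldt\<close>)

lemma vector_differentiable_bound:
  fixes f :: "real \<Rightarrow> 'a :: real_normed_vector"
  assumes f: "\<And>x. x \<in> S \<Longrightarrow> (f has_vector_derivative f' x) (at x within S)"
    and B: "\<And>x. x \<in> S \<Longrightarrow> norm (f' x) \<le> B" and S: "convex S" "x \<in> S" "y \<in> S"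
  shows "norm (f x - f y) \<le> B * norm (x - y)"
proof (rule differentiable_bound[OF S(1), of f "\<lambda>x h. h *\<^sub>R f' x" B])
  show "onorm (\<lambda>h. h *\<^sub>R f' t) \<le> B" if "t \<in> S" for t
    using mult_left_mono[OF B[OF that] abs_ge_zero] by (intro onorm_le) (auto simp: mult.commute)
qed (use f S in \<open>auto simp: has_vector_derivative_def\<close>)

text \<open>\<open>D\<close> is n^(-s) minus the integral of u^(-s) over [n, n + 1]. The first bound
  estimates the two separately and is used for small n; the second, a mean value estimate, is
  summable in n but costs a factor |s|.\<close>

lemma zeta_block_approx:
  fixes s :: complex
  assumes s: "Re s > 1" and n: "n \<ge> 1"
  defines "D \<equiv> of_nat n powr (- s) - (of_nat n powr (1 - s) - of_nat (Suc n) powr (1 - s)) / (s - 1)"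
  shows "norm D \<le> 2 / real n" "norm D \<le> norm s / real n ^ 2"
proof -
  have s1: "s \<noteq> 1" "1 - s \<noteq> 0" using s by auto
  define \<psi> where "\<psi> = (\<lambda>u::real. of_real u powr (1 - s) / (1 - s))"
  have d\<psi>: "(\<psi> has_vector_derivative of_real u powr (- s)) (at u within A)" if "u > 0" for u A
  proof -
    have "((\<lambda>z. z powr (1 - s) / (1 - s)) has_field_derivative ((1 - s) * of_real u powr (1 - s - 1) / (1 - s))) (at (of_real u))"
      using that by (intro DERIV_cdivide has_field_derivative_powr) auto
    thus ?thesis using s1 unfolding \<psi>_def
      by (intro has_vector_derivative_real_field) (auto intro: has_field_derivative_at_within)
  qed
  have dp: "((\<lambda>u::real. of_real u powr (- s)) has_vector_derivative (- s) * of_real u powr (- s - 1)) (at u within A)" if "u > 0" for u A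
  proof -
    have "((\<lambda>z. z powr (- s)) has_field_derivative ((- s) * of_real u powr (- s - 1))) (at (of_real u))"
      using that by (intro has_field_derivative_powr) auto
    thus ?thesis by (intro has_vector_derivative_real_field) (auto intro: has_field_derivative_at_within)
  qed
  have Deq: "D = of_nat n powr (- s) - (\<psi> (real (Suc n)) - \<psi> (real n))"
  proof -
    have "\<psi> u = - (of_real u powr (1 - s) / (s - 1))" for u
      unfolding \<psi>_def by (metis minus_diff_eq minus_divide_right)
    thus ?thesis unfolding D_def by (simp add: diff_divide_distrib)
  qed
  have nle: "norm (of_real u powr (- s)) \<le> 1 / real n" if "u \<ge> real n" for u :: real
  proof -
    have "norm (of_real u powr (- s)) = u powr (- Re s)" using that n by (simp add: norm_powr_real_powr)
    also have "\<dots> \<le> u powr (- 1)" using that n s by (intro powr_mono) auto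
    also have "\<dots> \<le> 1 / real n" using that n by (simp add: powr_minus field_simps)
    finally show ?thesis .
  qed
  have "norm (\<psi> (real (Suc n)) - \<psi> (real n)) \<le> (1 / real n) * norm (real (Suc n) - real n)"
  proof (rule vector_differentiable_bound[where S = "{real n..real (Suc n)}"])
    show "(\<psi> has_vector_derivative of_real u powr (- s)) (at u within {real n..real (Suc n)})"
      if "u \<in> {real n..real (Suc n)}" for u using that n by (intro d\<psi>) auto
  qed (use nle in auto)
  moreover have "norm (complex_of_nat n powr (- s)) \<le> 1 / real n" using nle[of "real n"] by simp
  ultimately show "norm D \<le> 2 / real n" unfolding Deq
    by (intro order.trans[OF norm_triangle_ineq4]) auto
  \<comment> \<open>Its derivative is u^(-s) - n^(-s), and its increment over the unit interval is -
    \<open>D\<close>.\<close>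
  define \<xi> where "\<xi> = (\<lambda>u::real. \<psi> u - of_real u * of_nat n powr (- s))"
  have B: "norm (of_real u powr (- s) - of_nat n powr (- s)) \<le> norm s / real n ^ 2"
    if u: "u \<in> {real n..real (Suc n)}" for u
  proof -
    have "norm (of_real u powr (- s) - of_real (real n) powr (- s)) \<le> (norm s / real n ^ 2) * norm (u - real n)"
    proof (rule vector_differentiable_bound[where S = "{real n..real (Suc n)}"])
      fix t assume t: "t \<in> {real n..real (Suc n)}"
      show "((\<lambda>u. of_real u powr (- s)) has_vector_derivative (- s) * of_real t powr (- s - 1)) (at t within {real n..real (Suc n)})"
        using t n by (intro dp) auto
      have "norm (of_real t powr (- s - 1)) = t powr (- Re s - 1)" using t n by (simp add: norm_powr_real_powr)
      also have "\<dots> \<le> t powr (- 2)" using t n s by (intro powr_mono) auto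
      also have "\<dots> \<le> 1 / real n ^ 2" using t n by (auto simp: powr_minus divide_inverse intro!: le_imp_inverse_le power_mono)
      finally have "norm s * norm (of_real t powr (- s - 1)) \<le> norm s * (1 / real n ^ 2)"
        by (intro mult_left_mono) auto
      thus "norm ((- s) * of_real t powr (- s - 1)) \<le> norm s / real n ^ 2" by (simp add: norm_mult)
    qed (use u in auto)
    also have "\<dots> \<le> (norm s / real n ^ 2) * 1" using u by (intro mult_left_mono) auto
    finally show ?thesis by simp
  qed
  have "norm (\<xi> (real (Suc n)) - \<xi> (real n)) \<le> (norm s / real n ^ 2) * norm (real (Suc n) - real n)"
  proof (rule vector_differentiable_bound[where S = "{real n..real (Suc n)}"])
    show "(\<xi> has_vector_derivative (of_real u powr (- s) - of_nat n powr (- s))) (at u within {real n..real (Suc n)})"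
      if "u \<in> {real n..real (Suc n)}" for u unfolding \<xi>_def using that n
      by (auto intro!: derivative_eq_intros d\<psi>)
  qed (use B in auto)
  also have "\<xi> (real (Suc n)) - \<xi> (real n) = - D" unfolding Deq \<xi>_def by (simp add: algebra_simps)
  finally show "norm D \<le> norm s / real n ^ 2" by simp
qed

lemma sum_inverse_le_ln: "N \<ge> 1 \<Longrightarrow> (\<Sum>n=1..N. 1 / real n) \<le> 1 + ln (real N)"
proof (induction N)
  case (Suc N)
  show ?case
  proof (cases "N = 0")
    case False
    have "ln (real N / real (Suc N)) \<le> real N / real (Suc N) - 1"
      using False by (intro ln_le_minus_one) auto
    also have "\<dots> = - (1 / real (Suc N))" by (simp add: field_simps)
    finally have "1 / real (Suc N) \<le> ln (real (Suc N)) - ln (real N)" using False by (simp add: ln_div)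
    thus ?thesis using Suc False by simp
  qed auto
qed auto

text \<open>The integrals telescope to 1 / (s - 1). The terms n <= N contribute at most 2 (1 + ln N)
  and the later ones at most 1, because |s| <= N. Logarithmic growth is ample, as the bound is used
  inside another logarithm.\<close>

lemma norm_zeta1_le:
  assumes s: "Re s > 1" and N: "N \<ge> 1" "norm s \<le> real N"
  shows "norm (zeta1 s) \<le> 1 / norm (s - 1) + 2 * ln (real N) + 4"
proof -
  let ?t = "\<lambda>n. (of_nat n powr (1 - s) :: complex)"
  define d where "d = (\<lambda>n. of_nat (Suc n) powr (- s) - (?t (Suc n) - ?t (Suc (Suc n))) / (s - 1))"
  have s1: "summable (\<lambda>n. of_nat (Suc n) powr (- s) :: complex)"
    using summable_ds[OF abs_conv_const_1[OF s] order.refl] by (subst summable_Suc_iff) simp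
  have "(\<lambda>n. ?t (Suc n)) \<longlonglongrightarrow> 0"
    using tendsto_neg_powr_complex_of_nat[of "\<lambda>n. Suc n" sequentially "1 - s"] s filterlim_Suc by force
  hence "(\<lambda>n. ?t (Suc n) - ?t (Suc (Suc n))) sums (?t (Suc 0) - 0)" by (rule telescope_sums')
  hence s2: "(\<lambda>n. (?t (Suc n) - ?t (Suc (Suc n))) / (s - 1)) sums (1 / (s - 1))"
    using sums_divide by fastforce
  have "zeta1 s = (\<Sum>n. of_nat (Suc n) powr (- s))"
    unfolding zeta1_def ds_def
    using suminf_split_head[OF summable_ds[OF abs_conv_const_1[OF s] order.refl]] by simp
  hence "(\<lambda>n. of_nat (Suc n) powr (- s)) sums zeta1 s" using s1 by (simp add: sums_iff)
  from sums_diff[OF this s2] have sd: "d sums (zeta1 s - 1 / (s - 1))" by (simp add: d_def)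
  have part: "(\<Sum>n<M. norm (d n)) \<le> 2 * ln (real N) + 4" for M
  proof -
    have "(\<Sum>n<M. norm (d n)) = (\<Sum>n=1..M. norm (d (n - 1)))"
      by (rule sum.reindex_bij_witness[of _ "\<lambda>n. n - 1" Suc]) auto
    also have "\<dots> \<le> (\<Sum>n=1..M. if n \<le> N then 2 / real n else real N / real n ^ 2)"
    proof (rule sum_mono)
      fix n assume "n \<in> {1..M}"
      hence n: "n \<ge> 1" "d (n - 1) = of_nat n powr (- s) - (?t n - ?t (Suc n)) / (s - 1)" by (auto simp: d_def)
      have "norm s / real n ^ 2 \<le> real N / real n ^ 2" using N by (intro divide_right_mono) auto
      thus "norm (d (n - 1)) \<le> (if n \<le> N then 2 / real n else real N / real n ^ 2)"
        using zeta_block_approx[OF s n(1)] unfolding n(2) by auto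
    qed
    also have "\<dots> \<le> (\<Sum>n\<in>{1..N} \<union> {N<..M}. if n \<le> N then 2 / real n else real N / real n ^ 2)"
      by (intro sum_mono2) auto
    also have "\<dots> = (\<Sum>n=1..N. 2 / real n) + (\<Sum>n\<in>{N<..M}. real N / real n ^ 2)"
      by (subst sum.union_disjoint) (auto intro!: arg_cong2[where f="(+)"] sum.cong)
    also have "(\<Sum>n=1..N. 2 / real n) = 2 * (\<Sum>n=1..N. 1 / real n)" by (simp add: sum_distrib_left)
    also have "\<dots> \<le> 2 * (1 + ln (real N))" using sum_inverse_le_ln[of N] N by simp
    also have "(\<Sum>n\<in>{N<..M}. real N / real n ^ 2) \<le> 1"
    proof -
      \<comment> \<open>The conditional keeps the telescoping claim valid for M <= N, where the sum
        is empty and the right side is 0.\<close>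
      have "(\<Sum>n\<in>{N<..M}. 1 / real n ^ 2) \<le> 1 / real N - (if M > N then 1 / real M else 1 / real N)"
      proof (induction M)
        case (Suc M)
        show ?case
        proof (cases "M \<ge> N")
          case True
          have M0: "real M > 0" using True N by linarith
          have "1 / (real (Suc M)) ^ 2 \<le> 1 / (real M * real (Suc M))"
            using M0 by (intro divide_left_mono) (auto simp: power2_eq_square)
          also have "\<dots> = 1 / real M - 1 / real (Suc M)" using M0 by (simp add: field_simps)
          finally have *: "1 / (real (Suc M)) ^ 2 \<le> 1 / real M - 1 / real (Suc M)" .
          have "{N<..Suc M} = insert (Suc M) {N<..M}" using True by auto
          thus ?thesis using Suc True * by (cases "M = N") auto
        qed (use Suc in \<open>auto simp: not_le\<close>)
      qed auto
      also have "\<dots> \<le> 1 / real N" using N by auto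
      finally have "real N * (\<Sum>n\<in>{N<..M}. 1 / real n ^ 2) \<le> real N * (1 / real N)"
        by (intro mult_left_mono) auto
      thus ?thesis using N by (simp add: sum_distrib_left)
    qed
    finally show ?thesis by simp
  qed
  have sn: "summable (\<lambda>n. norm (d n))" by (rule summableI_nonneg_bounded[OF _ part]) auto
  have "norm (zeta1 s - 1 / (s - 1)) \<le> (\<Sum>n. norm (d n))"
    using summable_norm[OF sn] sd by (simp add: sums_iff)
  also have "\<dots> \<le> 2 * ln (real N) + 4" by (rule suminf_le_const[OF sn part])
  finally have "norm (zeta1 s - 1 / (s - 1)) \<le> 2 * ln (real N) + 4" .
  moreover have "norm (zeta1 s) \<le> norm (zeta1 s - 1 / (s - 1)) + norm (1 / (s - 1))"
    by (metis norm_triangle_sub add.commute)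
  ultimately show ?thesis by (simp add: norm_divide)
qed

text \<open>The integral test in telescoped form: M^(-1-\<kappa>) is at most ((M - 1)^(-\<kappa>) -
  M^(-\<kappa>)) / \<kappa>, a consequence of e^y >= 1 + y.\<close>

lemma zeta_real_le:
  assumes "0 < \<kappa>"
  shows "rds (\<lambda>_. 1) (1 + \<kappa>) \<le> 1 + 1 / \<kappa>"
proof -
  have ac: "abs_conv (\<lambda>_. 1 :: real) (1 + \<kappa>)"
    using abs_conv_const_1[of "1 + \<kappa>"] assms by (simp add: abs_conv_def)
  have part: "(\<Sum>n=1..N. real n powr (- (1 + \<kappa>))) \<le> 1 + 1 / \<kappa> - (if N = 0 then 1 else real N powr (- \<kappa>)) / \<kappa>" for N
  proof (induction N)
    case (Suc N)
    show ?case
    proof (cases "N = 0")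
      case False
      let ?M = "real (Suc N)"
      have "ln (1 - 1 / ?M) \<le> - (1 / ?M)" using ln_le_minus_one[of "1 - 1 / ?M"] False by simp
      hence "1 / ?M \<le> ln (?M / real N)" using False by (simp add: ln_div field_simps)
      hence "\<kappa> * (1 / ?M) \<le> \<kappa> * ln (?M / real N)" using assms by (intro mult_left_mono) auto
      hence "\<kappa> / ?M \<le> ln ((?M / real N) powr \<kappa>)" using False by (simp add: ln_powr)
      hence "1 + \<kappa> / ?M \<le> (?M / real N) powr \<kappa>"
        using False by (intro order.trans[OF exp_ge_add_one_self]) (simp add: powr_def)
      hence "(1 + \<kappa> / ?M) * ?M powr (- \<kappa>) \<le> (?M / real N) powr \<kappa> * ?M powr (- \<kappa>)"
        by (rule mult_right_mono) auto
      also have "\<dots> = real N powr (- \<kappa>)" using False by (simp add: powr_divide powr_minus field_simps)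
      finally have "\<kappa> * (?M powr (- \<kappa>) / ?M) \<le> real N powr (- \<kappa>) - ?M powr (- \<kappa>)"
        by (simp add: algebra_simps)
      hence "?M powr (- \<kappa>) / ?M \<le> real N powr (- \<kappa>) / \<kappa> - ?M powr (- \<kappa>) / \<kappa>"
        using assms by (simp add: field_simps del: of_nat_Suc)
      moreover have "?M powr (- (1 + \<kappa>)) = ?M powr (- \<kappa>) / ?M" by (rule real_powr_minus_Suc)
      ultimately show ?thesis using Suc False by (simp del: of_nat_Suc)
    qed (use assms in auto)
  qed auto
  show ?thesis unfolding rds_def
  proof (rule suminf_le_const)
    show "summable (\<lambda>n. 1 * real n powr - (1 + \<kappa>))" by (rule summable_rds[OF ac order.refl])
    fix N
    have "(\<Sum>n<N. 1 * real n powr - (1 + \<kappa>)) \<le> (\<Sum>n\<in>insert 0 {1..N}. real n powr - (1 + \<kappa>))"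
      unfolding mult_1 by (intro sum_mono2) auto
    also have "\<dots> \<le> 1 + 1 / \<kappa>" using part[of N] assms
      by (subst sum.insert) (auto intro: order.trans split: if_splits)
    finally show "(\<Sum>n<N. 1 * real n powr - (1 + \<kappa>)) \<le> 1 + 1 / \<kappa>" .
  qed
qed

lemma norm_zeta1_le_real: "Re s > 1 \<Longrightarrow> norm (zeta1 s) \<le> 1 + 1 / (Re s - 1)"
  using norm_ds_le[OF abs_conv_const_1, of s] zeta_real_le[of "Re s - 1"]
  by (simp add: zeta1_def)

lemma Re_ds_mangoldt_eq_ln_zeta1:
  assumes "Re s > 1"
  shows "Re (ds (\<lambda>n. of_real (mangoldt n) / of_real (ln (real n))) s) = ln (norm (zeta1 s))"
  using zeta1_eq_exp[OF assms] by (simp add: norm_exp_eq_Re)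

lemma abs_conv_mangoldt: "\<sigma> > 1 \<Longrightarrow> abs_conv (mangoldt :: nat \<Rightarrow> real) \<sigma>"
  by (rule block_abs_conv(1)[OF block_bounded_mangoldt])

lemma abs_conv_mangoldt_div_ln: "\<sigma> > 1 \<Longrightarrow> abs_conv (\<lambda>n. mangoldt n / ln (real n)) \<sigma>"
  using abs_conv_div_ln[OF abs_conv_mangoldt, of \<sigma>] by simp

text \<open>Passing through ln zeta gives ln (1 / \<kappa>) the coefficient 1. The block constant 10
  of \<open>block_bounded_mangoldt\<close> would spoil the exponent A of
  \<open>rds_norm_f_le\<close>.\<close>

lemma rds_mangoldt_div_ln_le:
  assumes "0 < \<kappa>"
  shows "rds (\<lambda>n. mangoldt n / ln (real n)) (1 + \<kappa>) \<le> ln (1 + 1 / \<kappa>)"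
proof -
  have eq: "ds (\<lambda>n. of_real (mangoldt n) / of_real (ln (real n))) (of_real (1 + \<kappa>)) =
     of_real (rds (\<lambda>n. mangoldt n / ln (real n)) (1 + \<kappa>))"
    using ds_of_real[OF abs_conv_mangoldt_div_ln, of "1 + \<kappa>"] assms by (simp del: of_real_mangoldt of_real_add)
  have z: "norm (zeta1 (of_real (1 + \<kappa>))) > 0" using zeta1_eq_exp[of "of_real (1 + \<kappa>)"] assms by simp
  have "rds (\<lambda>n. mangoldt n / ln (real n)) (1 + \<kappa>) = ln (norm (zeta1 (of_real (1 + \<kappa>))))"
    using Re_ds_mangoldt_eq_ln_zeta1[of "of_real (1 + \<kappa>)"] assms unfolding eq by simp
  also have "\<dots> \<le> ln (1 + 1 / \<kappa>)"
    using norm_zeta1_le_real[of "of_real (1 + \<kappa>)"] z assms by (subst ln_le_cancel_iff) (auto intro: add_pos_pos)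
  finally show ?thesis .
qed

section \<open>Mean squares of the coefficients\<close>

locale log_coeffs =
  fixes lam :: "nat \<Rightarrow> complex" and A A0 :: real
  assumes A: "A \<ge> 1" and A0: "A0 \<ge> 1"
    and lam_block: "\<And>x. x \<ge> 1 \<Longrightarrow>
      (\<Sum>n | x < real n \<and> real n \<le> exp 1 * x. (norm (lam n))\<^sup>2 * mangoldt n / real n)
        \<le> A\<^sup>2 + A0 / ln (exp 1 * x)"
begin

text \<open>One constant that bounds the block sums of \<open>qL\<close> and of
  \<open>mangoldt\<close>, hence also those of \<open>nL\<close> by the arithmetic-geometric mean
  inequality.\<close>

definition E :: real where "E = A\<^sup>2 + A0 + 10"

definition Lam :: "nat \<Rightarrow> complex" where "Lam n = lam n * mangoldt n"

definition nL :: "nat \<Rightarrow> real" where "nL n = norm (lam n) * mangoldt n"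

definition qL :: "nat \<Rightarrow> real" where "qL n = (norm (lam n))\<^sup>2 * mangoldt n"

lemma norm_Lam: "norm (Lam n) = nL n"
  by (simp add: Lam_def nL_def norm_mult)

lemma nL_nonneg: "nL n \<ge> 0" and qL_nonneg: "qL n \<ge> 0"
  by (simp_all add: nL_def qL_def mangoldt_nonneg)

lemma E_ge: "E \<ge> 12"
proof -
  have "A\<^sup>2 \<ge> 1" using A by simp
  thus ?thesis unfolding E_def using A0 by linarith
qed

text \<open>The parameter distributes the weight between the square and the von Mangoldt function:
  \<theta> = 1 for blocks, 1 / A for the logarithm of F, \<open>sqrt \<delta>\<close> in short
  intervals, where only the second part is known to be small.\<close>

lemma two_nL_le: "\<theta> > 0 \<Longrightarrow> 2 * nL n \<le> \<theta> * qL n + mangoldt n / \<theta>"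
proof -
  assume \<theta>: "\<theta> > 0"
  have "0 \<le> (\<theta> * norm (lam n) - 1)\<^sup>2 * (mangoldt n / \<theta>)"
    using \<theta> by (intro mult_nonneg_nonneg divide_nonneg_nonneg mangoldt_nonneg) auto
  also have "\<dots> = \<theta> * qL n + mangoldt n / \<theta> - 2 * nL n"
    using \<theta> by (simp add: nL_def qL_def power2_eq_square field_simps)
  finally show ?thesis by simp
qed

lemma qL_block: "block_bounded qL E"
  unfolding block_bounded_def
proof safe
  fix x :: real assume x: "x \<ge> 1"
  have l: "ln (exp 1 * x) \<ge> 1" using x by (simp add: ln_mult)
  have "(\<Sum>n | x < real n \<and> real n \<le> exp 1 * x. qL n / real n) \<le> A\<^sup>2 + A0 / ln (exp 1 * x)"
    using lam_block[OF x] by (simp add: qL_def)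
  also have "A0 / ln (exp 1 * x) \<le> A0 / 1" using l A0 by (intro divide_left_mono) auto
  finally show "(\<Sum>n | x < real n \<and> real n \<le> exp 1 * x. qL n / real n) \<le> E" by (simp add: E_def)
qed (auto simp: qL_def mangoldt_nonneg)

lemma nL_block: "block_bounded nL E"
  unfolding block_bounded_def
proof safe
  fix x :: real assume x: "x \<ge> 1"
  have "(\<Sum>n | x < real n \<and> real n \<le> exp 1 * x. nL n / real n) \<le>
        (\<Sum>n | x < real n \<and> real n \<le> exp 1 * x. qL n / real n / 2 + mangoldt n / real n / 2)"
  proof (rule sum_mono)
    fix n
    have "nL n / real n \<le> ((qL n + mangoldt n) / 2) / real n"
      using two_nL_le[of 1 n] by (intro divide_right_mono) auto
    thus "nL n / real n \<le> qL n / real n / 2 + mangoldt n / real n / 2" by (simp add: add_divide_distrib)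
  qed
  also have "\<dots> = (\<Sum>n | x < real n \<and> real n \<le> exp 1 * x. qL n / real n) / 2 +
      (\<Sum>n | x < real n \<and> real n \<le> exp 1 * x. mangoldt n / real n) / 2"
    by (simp add: sum.distrib sum_divide_distrib)
  also have "\<dots> \<le> E / 2 + E / 2"
    using block_bounded_block[OF qL_block x] sum_mangoldt_block[OF x] E_ge by simp
  finally show "(\<Sum>n | x < real n \<and> real n \<le> exp 1 * x. nL n / real n) \<le> E" by simp
qed (auto simp: nL_def mangoldt_nonneg)

lemma abs_conv_nL: "\<sigma> > 1 \<Longrightarrow> abs_conv nL \<sigma>"
  by (rule block_abs_conv(1)[OF nL_block])

lemma abs_conv_Lam: "\<sigma> > 1 \<Longrightarrow> abs_conv Lam \<sigma>"
  using abs_conv_nL[of \<sigma>] by (simp add: norm_Lam abs_conv_def nL_nonneg)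

lemma abs_conv_qL: "\<sigma> > 1 \<Longrightarrow> abs_conv qL \<sigma>"
  by (rule block_abs_conv(1)[OF qL_block])

lemma rds_qL_div_ln_le:
  assumes "0 < \<kappa>" "\<kappa> \<le> 1"
  shows "rds (\<lambda>n. qL n / ln (real n)) (1 + \<kappa>) \<le> A\<^sup>2 * ln (1 / \<kappa>) + 4 * (A\<^sup>2 + A0)"
proof (rule log_weighted_block_sum)
  show "abs_conv (\<lambda>n. qL n / ln (real n)) (1 + \<kappa>)"
    using abs_conv_div_ln[OF abs_conv_qL, of "1 + \<kappa>"] assms by simp
  show "(\<Sum>n | x < real n \<and> real n \<le> exp 1 * x. qL n / real n) \<le> A\<^sup>2 + A0 / ln (exp 1 * x)" if "x \<ge> 1" for x
    using lam_block[OF that] by (simp add: qL_def)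
qed (use assms A0 in \<open>auto simp: qL_nonneg, simp add: qL_def\<close>)

text \<open>With \<theta> = 1 / A the squares and the von Mangoldt function contribute A / 2 each to
  the coefficient of ln (1 / \<kappa>), which makes it exactly A.\<close>

lemma rds_nL_div_ln_le:
  assumes \<kappa>: "0 < \<kappa>" "\<kappa> \<le> 1"
  shows "rds (\<lambda>n. nL n / ln (real n)) (1 + \<kappa>) \<le> A * ln (1 / \<kappa>) + 3 * E"
proof -
  have cq: "abs_conv (\<lambda>n. qL n / ln (real n)) (1 + \<kappa>)"
    using abs_conv_div_ln[OF abs_conv_qL, of "1 + \<kappa>"] assms by simp
  have cm: "abs_conv (\<lambda>n. mangoldt n / ln (real n)) (1 + \<kappa>)"
    using abs_conv_mangoldt_div_ln[of "1 + \<kappa>"] \<kappa> by simp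
  have "rds (\<lambda>n. nL n / ln (real n)) (1 + \<kappa>) \<le>
      (\<Sum>n. (1 / (2 * A)) * (qL n / ln (real n) * real n powr - (1 + \<kappa>)) +
        (A / 2) * (mangoldt n / ln (real n) * real n powr - (1 + \<kappa>)))"
    unfolding rds_def
  proof (rule suminf_le)
    show "summable (\<lambda>n. nL n / ln (real n) * real n powr - (1 + \<kappa>))"
      using summable_rds[OF abs_conv_div_ln[OF abs_conv_nL, of "1 + \<kappa>"] order.refl] \<kappa> by simp
    show "summable (\<lambda>n. (1 / (2 * A)) * (qL n / ln (real n) * real n powr - (1 + \<kappa>)) +
        (A / 2) * (mangoldt n / ln (real n) * real n powr - (1 + \<kappa>)))"
      by (intro summable_add summable_mult summable_rds[OF cq] summable_rds[OF cm] order.refl)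
    fix n :: nat
    show "nL n / ln (real n) * real n powr - (1 + \<kappa>) \<le>
      (1 / (2 * A)) * (qL n / ln (real n) * real n powr - (1 + \<kappa>)) +
        (A / 2) * (mangoldt n / ln (real n) * real n powr - (1 + \<kappa>))"
    proof (cases "n = 0")
      case False
      have "nL n \<le> (1 / (2 * A)) * qL n + (A / 2) * mangoldt n"
        using two_nL_le[of "1 / A" n] A by (simp add: field_simps)
      hence "nL n * (real n powr - (1 + \<kappa>) / ln (real n)) \<le>
         ((1 / (2 * A)) * qL n + (A / 2) * mangoldt n) * (real n powr - (1 + \<kappa>) / ln (real n))"
        using False by (intro mult_right_mono) auto
      thus ?thesis by (simp add: algebra_simps)
    qed auto
  qed
  also have "\<dots> = (1 / (2 * A)) * rds (\<lambda>n. qL n / ln (real n)) (1 + \<kappa>) +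
      (A / 2) * rds (\<lambda>n. mangoldt n / ln (real n)) (1 + \<kappa>)"
    unfolding rds_def using summable_rds[OF cq order.refl] summable_rds[OF cm order.refl]
    by (simp only: suminf_add [symmetric] suminf_mult summable_mult)
  also have "\<dots> \<le> (1 / (2 * A)) * (A\<^sup>2 * ln (1 / \<kappa>) + 4 * (A\<^sup>2 + A0)) + (A / 2) * (ln (1 / \<kappa>) + 1)"
  proof (intro add_mono mult_left_mono rds_qL_div_ln_le \<kappa>)
    have "ln (1 + 1 / \<kappa>) \<le> ln (2 * (1 / \<kappa>))"
      using \<kappa> by (subst ln_le_cancel_iff) (auto simp: field_simps)
    also have "\<dots> = ln 2 + ln (1 / \<kappa>)" using \<kappa> by (subst ln_mult) auto
    also have "\<dots> \<le> ln (1 / \<kappa>) + 1" using ln2_le_25_over_36 by simp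
    finally show "rds (\<lambda>n. mangoldt n / ln (real n)) (1 + \<kappa>) \<le> ln (1 / \<kappa>) + 1"
      using rds_mangoldt_div_ln_le[OF \<kappa>(1)] by simp
  qed (use A in auto)
  also have "\<dots> = A * ln (1 / \<kappa>) + (2 * (A\<^sup>2 + A0) / A + A / 2)"
    using A by (simp add: field_simps power2_eq_square)
  also have "2 * (A\<^sup>2 + A0) / A \<le> 2 * (A\<^sup>2 + A0) / 1"
    using A A0 by (intro divide_left_mono) auto
  also have "A / 2 \<le> A\<^sup>2"
  proof -
    have "1 * A \<le> A * A" using A by (intro mult_right_mono) auto
    thus ?thesis using A unfolding power2_eq_square by linarith
  qed
  finally show ?thesis using A A0 by (simp add: E_def)
qed

end

text \<open>\<open>f_log\<close> is the coefficient form of F' = - F times the series of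
  \<open>Lam\<close>. \<open>f_0\<close> removes the index 0 from smoothed sums, where
  \<open>ln (u / 0)\<close> has a default value and the weight would not vanish.\<close>

locale dirichlet_data = log_coeffs +
  fixes f :: "nat \<Rightarrow> complex"
  assumes f_0: "f 0 = 0" and f_1: "f 1 = 1" and f_conv: "\<And>\<sigma>. \<sigma> > 1 \<Longrightarrow> abs_conv f \<sigma>"
    and f_log: "\<And>n. n \<ge> 1 \<Longrightarrow> f n * of_real (ln (real n)) = dconv Lam f n"
begin

definition F :: "complex \<Rightarrow> complex" where "F = ds f"
definition CF :: real where "CF = exp (3 * E)"

lemma CF_ge_1: "CF \<ge> 1" using E_ge by (simp add: CF_def)

lemma ds_f_ln: "Re s > 1 \<Longrightarrow> ds (\<lambda>n. f n * of_real (ln (real n))) s = ds Lam s * F s"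
  unfolding F_def using ds_mult_ln[of f Lam s] f_conv abs_conv_Lam f_1 f_log by simp

lemma F_nonzero: "Re s > 1 \<Longrightarrow> F s \<noteq> 0"
  and ln_norm_F: "Re s > 1 \<Longrightarrow> ln (norm (F s)) = Re (ds (\<lambda>n. Lam n / of_real (ln (real n))) s)"
  using ds_eq_exp[of f Lam s] f_conv abs_conv_Lam f_1 f_log by (auto simp: F_def norm_exp_eq_Re)

lemma rds_norm_f_le:
  assumes \<kappa>: "0 < \<kappa>" "\<kappa> \<le> 1"
  shows "rds (\<lambda>n. norm (f n)) (1 + \<kappa>) \<le> CF * \<kappa> powr (- A)"
proof -
  have "rds (\<lambda>n. norm (f n)) (1 + \<kappa>) \<le> exp (rds (\<lambda>n. norm (Lam n) / ln (real n)) (1 + \<kappa>))"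
    using rds_norm_le_exp[of f Lam "1 + \<kappa>"] f_conv abs_conv_Lam f_1 f_log \<kappa> by simp
  also have "\<dots> \<le> exp (A * ln (1 / \<kappa>) + 3 * E)"
    using rds_nL_div_ln_le[OF \<kappa>] by (simp add: norm_Lam)
  also have "\<dots> = CF * \<kappa> powr (- A)"
    using \<kappa> by (simp add: CF_def powr_def ln_div flip: exp_add)
  finally show ?thesis .
qed

lemma norm_F_le:
  assumes "1 < Re s" "Re s \<le> 2"
  shows "norm (F s) \<le> CF * (Re s - 1) powr (- A)"
  using norm_ds_le[OF f_conv, of s] rds_norm_f_le[of "Re s - 1"] assms by (simp add: F_def)

lemma finite_nat_le_real: "finite {n. 1 \<le> n \<and> real n \<le> u}"
  by (rule finite_subset[of _ "{..nat \<lceil>u\<rceil>}"]) (auto simp: le_nat_iff, linarith)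

text \<open>Rankin's trick: with \<kappa> = 1 / (1 + ln u) the factor n^\<kappa> is at most e for n
  <= u, so the finite sum is controlled by the full series at 1 + \<kappa>.\<close>

lemma sum_norm_f_div_le:
  assumes u: "u \<ge> 1"
  shows "(\<Sum>n | 1 \<le> n \<and> real n \<le> u. norm (f n) / real n) \<le> 3 * CF * (1 + ln u) powr A"
proof -
  define \<kappa> where "\<kappa> = 1 / (1 + ln u)"
  have lu: "ln u \<ge> 0" using u by simp
  have \<kappa>: "0 < \<kappa>" "\<kappa> \<le> 1" "\<kappa> * ln u \<le> 1" using lu by (auto simp: \<kappa>_def field_simps)
  have "(\<Sum>n | 1 \<le> n \<and> real n \<le> u. norm (f n) / real n) \<le>
        (\<Sum>n | 1 \<le> n \<and> real n \<le> u. 3 * (norm (f n) * real n powr (- (1 + \<kappa>))))"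
  proof (rule sum_mono)
    fix n assume n: "n \<in> {n. 1 \<le> n \<and> real n \<le> u}"
    have "real n powr \<kappa> \<le> u powr \<kappa>" using n \<kappa> by (intro powr_mono2) auto
    also have "\<dots> = exp (\<kappa> * ln u)" using u by (simp add: powr_def)
    also have "\<dots> \<le> exp 1" using \<kappa> by simp
    also have "\<dots> \<le> 3" by (rule exp_le)
    finally have "norm (f n) / real n * 1 \<le> norm (f n) / real n * (3 * real n powr (- \<kappa>))"
      using n by (intro mult_left_mono) (auto simp: powr_minus field_simps)
    also have "\<dots> = 3 * (norm (f n) * real n powr (- (1 + \<kappa>)))" unfolding real_powr_minus_Suc by simp
    finally show "norm (f n) / real n \<le> 3 * (norm (f n) * real n powr (- (1 + \<kappa>)))" by simp
  qed
  also have "\<dots> = 3 * (\<Sum>n | 1 \<le> n \<and> real n \<le> u. norm (f n) * real n powr (- (1 + \<kappa>)))"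
    by (simp add: sum_distrib_left)
  also have "\<dots> \<le> 3 * rds (\<lambda>n. norm (f n)) (1 + \<kappa>)"
    using \<kappa> f_conv finite_nat_le_real by (intro mult_left_mono sum_le_rds) auto
  also have "\<dots> \<le> 3 * (CF * \<kappa> powr (- A))"
    using \<kappa> by (intro mult_left_mono rds_norm_f_le) auto
  also have "\<kappa> powr (- A) = (1 + ln u) powr A"
    using lu by (simp add: \<kappa>_def powr_minus powr_divide)
  finally show ?thesis by simp
qed

lemma sum_norm_f_le:
  assumes u: "u \<ge> 1"
  shows "(\<Sum>n | 1 \<le> n \<and> real n \<le> u. norm (f n)) \<le> 3 * CF * u * (1 + ln u) powr A"
proof -
  have "(\<Sum>n | 1 \<le> n \<and> real n \<le> u. norm (f n)) \<le> (\<Sum>n | 1 \<le> n \<and> real n \<le> u. u * (norm (f n) / real n))"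
  proof (rule sum_mono)
    fix n assume n: "n \<in> {n. 1 \<le> n \<and> real n \<le> u}"
    have "norm (f n) * 1 \<le> norm (f n) * (u / real n)" using n by (intro mult_left_mono) auto
    thus "norm (f n) \<le> u * (norm (f n) / real n)" by (simp add: mult_ac)
  qed
  also have "\<dots> = u * (\<Sum>n | 1 \<le> n \<and> real n \<le> u. norm (f n) / real n)" by (simp add: sum_distrib_left)
  also have "\<dots> \<le> u * (3 * CF * (1 + ln u) powr A)" using u by (intro mult_left_mono sum_norm_f_div_le) auto
  finally show ?thesis by (simp add: mult_ac)
qed

end

section \<open>Mean values on vertical lines\<close>

lemma of_nat_powr_Complex:
  "n \<ge> 1 \<Longrightarrow> of_nat n powr (- Complex \<sigma> t) = of_real (real n powr (- \<sigma>)) * iexp (- ln (real n) * t)"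
proof -
  assume n: "n \<ge> 1"
  have "of_nat n powr (- Complex \<sigma> t) = exp (- Complex \<sigma> t * of_real (ln (real n)))"
    using n Ln_of_real[of "real n"] by (simp add: powr_def)
  also have "- Complex \<sigma> t * of_real (ln (real n)) = of_real (- \<sigma> * ln (real n)) + \<i> * of_real (- ln (real n) * t)"
    by (simp add: complex_eq_iff)
  also have "exp \<dots> = exp (of_real (- \<sigma> * ln (real n))) * iexp (- ln (real n) * t)" by (rule exp_add)
  also have "exp (of_real (- \<sigma> * ln (real n))) = complex_of_real (real n powr (- \<sigma>))"
    using n by (simp only: exp_of_real) (simp add: powr_def)
  finally show ?thesis .
qed

text \<open>Opening the square and integrating termwise leaves the Fourier transform of the
  Gaussian, which is positive, so taking absolute values of the coefficients preserves the
  localization of the frequencies.\<close>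

lemma gaussian_mean_square:
  fixes c :: "'i \<Rightarrow> complex" and \<theta> :: "'i \<Rightarrow> real" and a :: real
  assumes a: "a > 0" and S: "finite S"
  shows "integrable lborel (\<lambda>t. exp (- (a * t)\<^sup>2 / 2) * (norm (\<Sum>d\<in>S. c d * iexp (- \<theta> d * t)))\<^sup>2)"
    and "(LINT t|lborel. exp (- (a * t)\<^sup>2 / 2) * (norm (\<Sum>d\<in>S. c d * iexp (- \<theta> d * t)))\<^sup>2) \<le>
      sqrt (2 * pi) / a * (\<Sum>d\<in>S. \<Sum>e\<in>S. norm (c d) * norm (c e) * exp (- ((\<theta> d - \<theta> e) / a)\<^sup>2 / 2))"
proof -
  let ?G = "\<lambda>t. exp (- (a * t)\<^sup>2 / 2) * (norm (\<Sum>d\<in>S. c d * iexp (- \<theta> d * t)))\<^sup>2"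
  let ?K = "\<lambda>d e t. (c d * cnj (c e)) * (iexp ((\<theta> e - \<theta> d) * t) * complex_of_real (exp (- (a * t)\<^sup>2 / 2)))"
  have eq: "complex_of_real (?G t) = (\<Sum>d\<in>S. \<Sum>e\<in>S. ?K d e t)" for t
  proof -
    have "complex_of_real ((norm (\<Sum>d\<in>S. c d * iexp (- \<theta> d * t)))\<^sup>2) =
        (\<Sum>d\<in>S. c d * iexp (- \<theta> d * t)) * (\<Sum>e\<in>S. cnj (c e) * iexp (\<theta> e * t))"
      unfolding complex_norm_square by (simp add: exp_cnj)
    also have "\<dots> = (\<Sum>d\<in>S. \<Sum>e\<in>S. (c d * cnj (c e)) * iexp ((\<theta> e - \<theta> d) * t))"
      unfolding sum_product
      by (intro sum.cong refl) (simp add: algebra_simps exp_diff exp_minus field_simps)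
    finally show ?thesis by (simp add: sum_distrib_left mult_ac)
  qed
  have int: "integrable lborel (?K d e)" for d e
    using gauss_fourier(1)[OF a, of "\<theta> e - \<theta> d"] by (rule integrable_mult_right)
  have intc: "integrable lborel (\<lambda>t. complex_of_real (?G t))" unfolding eq
    by (intro Bochner_Integration.integrable_sum int)
  thus intG: "integrable lborel ?G" using complex_of_real_integrable_eq by blast
  have "complex_of_real (LINT t|lborel. ?G t) = (LINT t|lborel. complex_of_real (?G t))"
    by (rule integral_complex_of_real [symmetric])
  also have "\<dots> = (\<Sum>d\<in>S. \<Sum>e\<in>S. (LINT t|lborel. ?K d e t))" unfolding eq
    by (simp only: Bochner_Integration.integral_sum int Bochner_Integration.integrable_sum)
  also have "\<dots> = (\<Sum>d\<in>S. \<Sum>e\<in>S. (c d * cnj (c e)) * of_real (sqrt (2 * pi) / a * exp (- ((\<theta> e - \<theta> d) / a)\<^sup>2 / 2)))"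
    by (simp only: integral_mult_right_zero gauss_fourier(2)[OF a])
  finally have *: "complex_of_real (LINT t|lborel. ?G t) = \<dots>" .
  have "(LINT t|lborel. ?G t) \<le> norm (complex_of_real (LINT t|lborel. ?G t))" by simp
  also have "\<dots> \<le> (\<Sum>d\<in>S. \<Sum>e\<in>S. norm (c d) * norm (c e) * (sqrt (2 * pi) / a * exp (- ((\<theta> d - \<theta> e) / a)\<^sup>2 / 2)))"
    unfolding * 
  proof (intro sum_norm_le)
    fix d e
    have "((\<theta> e - \<theta> d) / a)\<^sup>2 = ((\<theta> d - \<theta> e) / a)\<^sup>2" by (simp add: power_divide power2_commute)
    thus "norm ((c d * cnj (c e)) * of_real (sqrt (2 * pi) / a * exp (- ((\<theta> e - \<theta> d) / a)\<^sup>2 / 2))) \<le>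
      norm (c d) * norm (c e) * (sqrt (2 * pi) / a * exp (- ((\<theta> d - \<theta> e) / a)\<^sup>2 / 2))"
      using a by (simp add: norm_mult norm_divide abs_mult)
  qed
  also have "\<dots> = sqrt (2 * pi) / a * (\<Sum>d\<in>S. \<Sum>e\<in>S. norm (c d) * norm (c e) * exp (- ((\<theta> d - \<theta> e) / a)\<^sup>2 / 2))"
    by (simp add: sum_distrib_left mult_ac)
  finally show "(LINT t|lborel. ?G t) \<le> sqrt (2 * pi) / a * (\<Sum>d\<in>S. \<Sum>e\<in>S. norm (c d) * norm (c e) * exp (- ((\<theta> d - \<theta> e) / a)\<^sup>2 / 2))" .
qed

lemma sum_exp_minus_abs_le: "(\<Sum>r\<in>{-N..N::int}. exp (- \<bar>real_of_int r\<bar>)) \<le> 4"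
proof -
  have "{-N..N} \<subseteq> uminus ` int ` {..<nat (N + 1)} \<union> int ` {..<nat (N + 1)}"
  proof
    fix r assume r: "r \<in> {-N..N}"
    show "r \<in> uminus ` int ` {..<nat (N + 1)} \<union> int ` {..<nat (N + 1)}"
    proof (cases "r \<ge> 0")
      case True
      hence "r = int (nat r)" "nat r < nat (N + 1)" using r by auto
      thus ?thesis by blast
    next
      case False
      hence "r = - int (nat (- r))" "nat (- r) < nat (N + 1)" using r by auto
      thus ?thesis by blast
    qed
  qed
  hence "(\<Sum>r\<in>{-N..N::int}. exp (- \<bar>real_of_int r\<bar>)) \<le>
      (\<Sum>r\<in>uminus ` int ` {..<nat (N + 1)} \<union> int ` {..<nat (N + 1)}. exp (- \<bar>real_of_int r\<bar>))"
    by (intro sum_mono2) auto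
  also have "\<dots> \<le> (\<Sum>r\<in>uminus ` int ` {..<nat (N + 1)}. exp (- \<bar>real_of_int r\<bar>)) + (\<Sum>r\<in>int ` {..<nat (N + 1)}. exp (- \<bar>real_of_int r\<bar>))"
    by (subst sum.union_inter [symmetric]) (auto intro: sum_nonneg)
  also have "\<dots> = (\<Sum>v<nat (N + 1). exp (- 1 * real v)) + (\<Sum>v<nat (N + 1). exp (- 1 * real v))"
    by (simp add: sum.reindex inj_on_def image_image)
  also have "\<dots> \<le> (1 + 1 / 1) + (1 + 1 / 1)" by (intro add_mono sum_exp_minus_le) auto
  finally show ?thesis by simp
qed

text \<open>The row sum for Schur's test. The numbers ln e are sorted into cells of length 1 / T
  measured from ln d; each cell has mass at most 10 ln T / T, and the Gaussian makes the number of
  effective cells bounded. The factor 18 is 4.5 times 4.\<close>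

lemma schur_mangoldt:
  assumes T: "T \<ge> 10" and S: "finite S" "\<And>e. e \<in> S \<Longrightarrow> real e \<ge> T" and d: "d > 0"
  shows "(\<Sum>e\<in>S. mangoldt e / real e * exp (- ((ln d - ln (real e)) * T)\<^sup>2 / 2)) \<le> 10 * ln T / T * 18"
proof -
  define r where "r = (\<lambda>e. \<lfloor>T * (ln (real e) - ln d)\<rfloor>)"
  obtain N where N: "r ` S \<subseteq> {-N..N}"
  proof -
    have "\<bar>x\<bar> \<le> (\<Sum>y\<in>r ` S. \<bar>y\<bar>)" if "x \<in> r ` S" for x
      using that S by (intro member_le_sum) auto
    hence "r ` S \<subseteq> {- (\<Sum>y\<in>r ` S. \<bar>y\<bar>)..(\<Sum>y\<in>r ` S. \<bar>y\<bar>)}" by (auto simp: abs_le_iff minus_le_iff)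
    thus ?thesis by (rule that)
  qed
  have "(\<Sum>e\<in>S. mangoldt e / real e * exp (- ((ln d - ln (real e)) * T)\<^sup>2 / 2)) =
    (\<Sum>k\<in>{-N..N}. \<Sum>e\<in>{e\<in>S. r e = k}. mangoldt e / real e * exp (- ((ln d - ln (real e)) * T)\<^sup>2 / 2))"
    by (rule sum.group [symmetric]) (use S N in auto)
  also have "\<dots> \<le> (\<Sum>k\<in>{-N..N}. (10 * ln T / T) * (exp (3 / 2) * exp (- \<bar>real_of_int k\<bar>)))"
  proof (rule sum_mono)
    fix k
    \<comment> \<open>The short-interval bound needs a left end of at least T. Replacing a smaller
      left end by T loses no element, since all elements are at least T.\<close>
    define z where "z = max T (d * exp (real_of_int k / T))"
    have cell: "z \<le> real e \<and> real e \<le> exp (1 / T) * z" if "e \<in> S" "r e = k" for e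
    proof -
      have e: "real e \<ge> T" "real e > 0" using S(2)[OF that(1)] T by auto
      have "real_of_int k \<le> T * (ln (real e) - ln d)" "T * (ln (real e) - ln d) < real_of_int k + 1"
        using that(2) unfolding r_def by linarith+
      hence "real_of_int k / T + ln d \<le> ln (real e)" "ln (real e) \<le> 1 / T + (real_of_int k / T + ln d)"
        using T by (auto simp: field_simps)
      hence "exp (real_of_int k / T + ln d) \<le> real e" "real e \<le> exp (1 / T + (real_of_int k / T + ln d))"
        using e by (metis exp_le_cancel_iff exp_ln)+
      hence 1: "d * exp (real_of_int k / T) \<le> real e" "real e \<le> exp (1 / T) * (d * exp (real_of_int k / T))"
        using d by (simp_all add: exp_add mult_ac)
      have "exp (1 / T) * (d * exp (real_of_int k / T)) \<le> exp (1 / T) * z" unfolding z_def by (intro mult_left_mono) auto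
      hence "real e \<le> exp (1 / T) * z" using 1 by linarith
      thus ?thesis using 1 e unfolding z_def by auto
    qed
    have w: "exp (- ((ln d - ln (real e)) * T)\<^sup>2 / 2) \<le> exp (3 / 2) * exp (- \<bar>real_of_int k\<bar>)" if "r e = k" for e
    proof -
      define y where "y = T * (ln (real e) - ln d)"
      have "real_of_int k \<le> y" "y < real_of_int k + 1" using that unfolding r_def y_def by linarith+
      hence yk: "\<bar>real_of_int k\<bar> - 1 \<le> \<bar>y\<bar>" by linarith
      \<comment> \<open>This yields y^2 / 2 >= |y| - 1 / 2; together with |y| >= |k| - 1 it explains
        the constant exp (3 / 2).\<close>
      have "0 \<le> (\<bar>y\<bar> - 1)\<^sup>2" by simp
      hence "- y\<^sup>2 / 2 \<le> 3 / 2 + - \<bar>real_of_int k\<bar>" using yk by (simp add: power2_eq_square algebra_simps abs_mult_self_eq)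
      moreover have "((ln d - ln (real e)) * T)\<^sup>2 = y\<^sup>2" unfolding y_def by (simp add: power2_eq_square algebra_simps)
      ultimately show ?thesis by (simp flip: exp_add)
    qed
    have "(\<Sum>e\<in>{e\<in>S. r e = k}. mangoldt e / real e * exp (- ((ln d - ln (real e)) * T)\<^sup>2 / 2)) \<le>
      (\<Sum>e\<in>{e\<in>S. r e = k}. mangoldt e / real e * (exp (3 / 2) * exp (- \<bar>real_of_int k\<bar>)))"
      by (intro sum_mono mult_left_mono w) (auto simp: mangoldt_nonneg)
    also have "\<dots> = (\<Sum>e\<in>{e\<in>S. r e = k}. mangoldt e / real e) * (exp (3 / 2) * exp (- \<bar>real_of_int k\<bar>))"
      by (simp add: sum_distrib_right)
    also have "(\<Sum>e\<in>{e\<in>S. r e = k}. mangoldt e / real e) \<le> (\<Sum>n | z \<le> real n \<and> real n \<le> exp (1 / T) * z. mangoldt n / real n)"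
    proof (rule sum_mono2)
      show "finite {n. z \<le> real n \<and> real n \<le> exp (1 / T) * z}"
        by (rule finite_subset[of _ "{..nat \<lceil>exp (1 / T) * z\<rceil>}"]) (auto simp: le_nat_iff, linarith)
    qed (use cell in \<open>auto simp: mangoldt_nonneg\<close>)
    also have "\<dots> \<le> 10 * ln T / T"
      using T by (intro sum_mangoldt_short_interval) (auto simp: z_def)
    finally show "(\<Sum>e\<in>{e\<in>S. r e = k}. mangoldt e / real e * exp (- ((ln d - ln (real e)) * T)\<^sup>2 / 2)) \<le>
        (10 * ln T / T) * (exp (3 / 2) * exp (- \<bar>real_of_int k\<bar>))" by (simp add: mult_right_mono)
  qed
  also have "\<dots> = (10 * ln T / T) * (exp (3 / 2) * (\<Sum>k\<in>{-N..N}. exp (- \<bar>real_of_int k\<bar>)))"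
    by (simp add: sum_distrib_left)
  also have "\<dots> \<le> (10 * ln T / T) * (4.5 * 4)"
  proof -
    have "exp (3 / 2 :: real) \<le> 4.5"
    proof -
      have "exp (3 / 2 :: real) ^ 2 = exp 1 ^ 3" by (simp flip: exp_of_nat_mult)
      also have "\<dots> \<le> (272 / 100) ^ 3" using e_less_272 by (intro power_mono) auto
      also have "\<dots> \<le> (4.5 :: real) ^ 2" by (simp add: power2_eq_square power3_eq_cube)
      finally show ?thesis by (rule power2_le_imp_le) auto
    qed
    moreover have "ln T \<ge> 0" using T by simp
    ultimately show ?thesis using T sum_exp_minus_abs_le[of N]
      by (intro mult_left_mono mult_mono sum_nonneg) auto
  qed
  finally show ?thesis by simp
qed

text \<open>No information on \<open>lam\<close> in short intervals is available. Each off-diagonal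
  product is therefore split so that one variable carries the full square of \<open>lam\<close> and
  the other only the von Mangoldt function, to which the Schur row sum applies.\<close>

lemma (in log_coeffs) mean_square_Lam:
  assumes T: "T \<ge> 10" and S: "finite S" "\<And>e. e \<in> S \<Longrightarrow> real e \<ge> T"
  shows "(LINT t|lborel. indicator {-T..T} t * (norm (\<Sum>d\<in>S. Lam d * of_nat d powr (- Complex \<sigma> t)))\<^sup>2) \<le>
    1080 * ln T * (\<Sum>d\<in>S. qL d * real d powr (1 - 2 * \<sigma>))"
proof -
  let ?c = "\<lambda>d. Lam d * of_real (real d powr (- \<sigma>))"
  let ?W = "\<lambda>d e. exp (- ((ln (real d) - ln (real e)) * T)\<^sup>2 / 2)"
  have S1: "d \<ge> 1" if "d \<in> S" for d using S(2)[OF that] T by linarith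
  have eq: "(\<Sum>d\<in>S. Lam d * of_nat d powr (- Complex \<sigma> t)) = (\<Sum>d\<in>S. ?c d * iexp (- ln (real d) * t))" for t
    by (intro sum.cong refl) (simp only: of_nat_powr_Complex[OF S1] mult.assoc)
  have g: "integrable lborel (\<lambda>t. exp (- (1 / T * t)\<^sup>2 / 2) * (norm (\<Sum>d\<in>S. ?c d * iexp (- ln (real d) * t)))\<^sup>2)"
    "(LINT t|lborel. exp (- (1 / T * t)\<^sup>2 / 2) * (norm (\<Sum>d\<in>S. ?c d * iexp (- ln (real d) * t)))\<^sup>2) \<le>
      sqrt (2 * pi) / (1 / T) * (\<Sum>d\<in>S. \<Sum>e\<in>S. norm (?c d) * norm (?c e) * exp (- ((ln (real d) - ln (real e)) / (1 / T))\<^sup>2 / 2))"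
    using gaussian_mean_square[of "1 / T" S ?c "\<lambda>d. ln (real d)"] T S by auto
  have e1: "exp (1 / 2 :: real) \<le> 5 / 3"
  proof (rule power2_le_imp_le)
    have "exp (1 / 2 :: real) ^ 2 = exp 1" by (simp flip: exp_of_nat_mult)
    also have "\<dots> \<le> (5 / 3) ^ 2" using e_less_272 by (simp add: power2_eq_square)
    finally show "exp (1 / 2 :: real) ^ 2 \<le> (5 / 3) ^ 2" .
  qed auto
  have pi: "sqrt (2 * pi) \<le> 3"
  proof (rule real_le_lsqrt)
    show "2 * pi \<le> 3\<^sup>2" using pi_less_4 by simp
  qed auto
  have "(LINT t|lborel. indicator {-T..T} t * (norm (\<Sum>d\<in>S. Lam d * of_nat d powr (- Complex \<sigma> t)))\<^sup>2) \<le>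
      (LINT t|lborel. exp (1 / 2) * (exp (- (1 / T * t)\<^sup>2 / 2) * (norm (\<Sum>d\<in>S. ?c d * iexp (- ln (real d) * t)))\<^sup>2))"
    unfolding eq
  proof (rule integral_mono')
    show "integrable lborel (\<lambda>t. exp (1 / 2) * (exp (- (1 / T * t)\<^sup>2 / 2) * (norm (\<Sum>d\<in>S. ?c d * iexp (- ln (real d) * t)))\<^sup>2))"
      using g(1) by (rule integrable_mult_right)
    fix t :: real
    have "1 \<le> exp (1 / 2) * exp (- (1 / T * t)\<^sup>2 / 2)" if "t \<in> {-T..T}"
    proof -
      have "\<bar>1 / T * t\<bar> \<le> 1" using that T by (auto simp: abs_le_iff field_simps)
      hence "(1 / T * t)\<^sup>2 \<le> 1" by (simp add: abs_square_le_1)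
      thus ?thesis by (simp flip: exp_add)
    qed
    from mult_right_mono[OF this, of "(norm (\<Sum>d\<in>S. ?c d * iexp (- ln (real d) * t)))\<^sup>2"]
    show "indicator {-T..T} t * (norm (\<Sum>d\<in>S. ?c d * iexp (- ln (real d) * t)))\<^sup>2 \<le>
      exp (1 / 2) * (exp (- (1 / T * t)\<^sup>2 / 2) * (norm (\<Sum>d\<in>S. ?c d * iexp (- ln (real d) * t)))\<^sup>2)"
      by (cases "t \<in> {-T..T}") (auto simp: mult.assoc)
  qed auto
  also have "\<dots> = exp (1 / 2) * (LINT t|lborel. exp (- (1 / T * t)\<^sup>2 / 2) * (norm (\<Sum>d\<in>S. ?c d * iexp (- ln (real d) * t)))\<^sup>2)"
    by (rule integral_mult_right_zero)
  also have "\<dots> \<le> (5 / 3) * (3 * T * (\<Sum>d\<in>S. \<Sum>e\<in>S. norm (?c d) * norm (?c e) * ?W d e))"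
  proof (rule mult_mono[OF e1 order.trans[OF g(2)]])
    show "sqrt (2 * pi) / (1 / T) * (\<Sum>d\<in>S. \<Sum>e\<in>S. norm (?c d) * norm (?c e) * exp (- ((ln (real d) - ln (real e)) / (1 / T))\<^sup>2 / 2))
       \<le> 3 * T * (\<Sum>d\<in>S. \<Sum>e\<in>S. norm (?c d) * norm (?c e) * ?W d e)"
      using T pi by (auto intro!: mult_right_mono sum_nonneg)
  qed (auto intro!: integral_nonneg_AE)
  also have "(\<Sum>d\<in>S. \<Sum>e\<in>S. norm (?c d) * norm (?c e) * ?W d e) \<le>
     (\<Sum>d\<in>S. \<Sum>e\<in>S. (qL d * real d powr (1 - 2 * \<sigma>) * (mangoldt e / real e * ?W d e) +
        qL e * real e powr (1 - 2 * \<sigma>) * (mangoldt d / real d * ?W e d)) / 2)"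
  proof (intro sum_mono)
    fix d e assume de: "d \<in> S" "e \<in> S"
    hence d1: "real d > 0" "real e > 0" using S1 by (auto simp: Suc_le_eq)
    let ?d = "real d powr (- \<sigma>)" and ?e = "real e powr (- \<sigma>)"
    have p: "real d powr (1 - 2 * \<sigma>) = real d * ?d\<^sup>2" "real e powr (1 - 2 * \<sigma>) = real e * ?e\<^sup>2"
    proof -
      have *: "1 - 2 * \<sigma> = 1 + (- \<sigma> + - \<sigma>)" by simp
      show "real d powr (1 - 2 * \<sigma>) = real d * ?d\<^sup>2" "real e powr (1 - 2 * \<sigma>) = real e * ?e\<^sup>2"
        unfolding * powr_add power2_eq_square using d1 by simp_all
    qed
    have W: "?W e d = ?W d e" by (simp add: power2_eq_square algebra_simps)
    \<comment> \<open>The factors d and e in the square are chosen so that its expansion produces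
      \<open>qL\<close> of one variable times \<open>mangoldt e / real e\<close> of the
      other.\<close>
    have "0 \<le> (norm (lam d) * real d * ?d - norm (lam e) * real e * ?e)\<^sup>2 * (mangoldt d * mangoldt e / (real d * real e))"
      using d1 by (intro mult_nonneg_nonneg divide_nonneg_nonneg mangoldt_nonneg) auto
    also have "\<dots> = qL d * (real d * ?d\<^sup>2) * (mangoldt e / real e) +
       qL e * (real e * ?e\<^sup>2) * (mangoldt d / real d) - 2 * (norm (?c d) * norm (?c e))"
      using d1 unfolding norm_mult norm_Lam by (simp add: qL_def nL_def power2_eq_square field_simps)
    finally have "norm (?c d) * norm (?c e) * ?W d e \<le>
      ((qL d * (real d * ?d\<^sup>2) * (mangoldt e / real e) + qL e * (real e * ?e\<^sup>2) * (mangoldt d / real d)) / 2) * ?W d e"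
      by (intro mult_right_mono) auto
    also have "\<dots> = (qL d * (real d * ?d\<^sup>2) * (mangoldt e / real e * ?W d e) +
        qL e * (real e * ?e\<^sup>2) * (mangoldt d / real d * ?W e d)) / 2"
      unfolding W by (simp add: algebra_simps add_divide_distrib)
    finally show "norm (?c d) * norm (?c e) * ?W d e \<le> (qL d * real d powr (1 - 2 * \<sigma>) * (mangoldt e / real e * ?W d e) +
        qL e * real e powr (1 - 2 * \<sigma>) * (mangoldt d / real d * ?W e d)) / 2"
      unfolding p .
  qed
  also have "\<dots> = (\<Sum>d\<in>S. qL d * real d powr (1 - 2 * \<sigma>) * (\<Sum>e\<in>S. mangoldt e / real e * ?W d e))"
  proof -
    have dbl: "(x + x) / 2 = x" for x :: real by simp
    let ?H = "\<lambda>d e. qL d * real d powr (1 - 2 * \<sigma>) * (mangoldt e / real e * ?W d e)"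
    have "(\<Sum>d\<in>S. \<Sum>e\<in>S. (?H d e + ?H e d) / 2) = ((\<Sum>d\<in>S. \<Sum>e\<in>S. ?H d e) + (\<Sum>d\<in>S. \<Sum>e\<in>S. ?H e d)) / 2"
      by (simp only: sum.distrib sum_divide_distrib [symmetric])
    also have "(\<Sum>d\<in>S. \<Sum>e\<in>S. ?H e d) = (\<Sum>d\<in>S. \<Sum>e\<in>S. ?H d e)" by (rule sum.swap)
    also have "((\<Sum>d\<in>S. \<Sum>e\<in>S. ?H d e) + (\<Sum>d\<in>S. \<Sum>e\<in>S. ?H d e)) / 2 = (\<Sum>d\<in>S. \<Sum>e\<in>S. ?H d e)"
      by (rule dbl)
    finally show ?thesis by (simp only: sum_distrib_left)
  qed
  also have "\<dots> \<le> (\<Sum>d\<in>S. qL d * real d powr (1 - 2 * \<sigma>) * (10 * ln T / T * 18))"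
    using S T S1 by (intro sum_mono mult_left_mono schur_mangoldt) (auto simp: qL_nonneg Suc_le_eq)
  also have "\<dots> = (\<Sum>d\<in>S. qL d * real d powr (1 - 2 * \<sigma>)) * (10 * ln T / T * 18)"
    by (simp only: sum_distrib_right)
  finally have *: "(LINT t|lborel. indicator {-T..T} t * (norm (\<Sum>d\<in>S. Lam d * of_nat d powr (- Complex \<sigma> t)))\<^sup>2)
    \<le> 5 / 3 * (3 * T * ((\<Sum>d\<in>S. qL d * real d powr (1 - 2 * \<sigma>)) * (10 * ln T / T * 18)))"
    using T by (simp add: mult_left_mono)
  \<comment> \<open>900 = 5/3 * 3 * 180, from exp (1/2), \<open>sqrt (2 * pi)\<close> and the row
    sum.\<close>
  also have "\<dots> = 900 * ln T * (\<Sum>d\<in>S. qL d * real d powr (1 - 2 * \<sigma>))" using T by simp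
  also have "\<dots> \<le> 1080 * ln T * (\<Sum>d\<in>S. qL d * real d powr (1 - 2 * \<sigma>))"
    using T by (intro mult_right_mono sum_nonneg) (auto simp: qL_nonneg)
  finally show ?thesis .
qed

section \<open>Large values at separated points\<close>

lemma ln_le_mono: "0 < x \<Longrightarrow> x \<le> y \<Longrightarrow> ln x \<le> ln (y :: real)"
  by (rule ln_le_cancel_iff [THEN iffD2]) (auto intro: less_le_trans)

definition strip_box :: "real \<Rightarrow> real \<Rightarrow> complex set" where
  "strip_box \<kappa> T = {s. 1 + \<kappa> \<le> Re s \<and> Re s \<le> 2 \<and> \<bar>Im s\<bar> \<le> T}"

lemma compact_strip_box: "compact (strip_box \<kappa> T)"
proof -
  have "strip_box \<kappa> T = cbox (Complex (1 + \<kappa>) (- T)) (Complex 2 T)"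
    by (auto simp: strip_box_def cbox_complex_eq abs_le_iff)
  thus ?thesis by simp
qed

context dirichlet_data
begin

lemma continuous_on_F: "continuous_on {s. Re s > 1} F"
proof (intro continuous_at_imp_continuous_on ballI)
  fix s assume s: "s \<in> {s. Re s > 1}"
  show "isCont F s" unfolding F_def
    using s by (intro DERIV_isCont[OF ds_has_field_derivative[of f "(1 + Re s) / 2"]] f_conv) auto
qed

text \<open>The choice may break off when the excluded strips cover the box. Separation is therefore
  asserted only in the presence of some admissible \<open>z\<close>: its existence shows that every
  earlier maximization took place on a nonempty set.\<close>

lemma successive_maxima:
  fixes R :: nat
  assumes \<kappa>: "0 < \<kappa>" "\<kappa> \<le> 1" and T: "T \<ge> 0"
  shows "\<exists>s. (\<forall>k\<in>{1..R}. s k \<in> strip_box \<kappa> T) \<and>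
    (\<forall>z\<in>strip_box \<kappa> T. (\<forall>k\<in>{1..R}. \<bar>Im z - Im (s k)\<bar> \<ge> \<rho>) \<longrightarrow>
       (\<forall>k\<in>{1..R}. norm (F z) \<le> norm (F (s k))) \<and>
       (\<forall>k\<in>{1..R}. \<forall>l\<in>{1..R}. k \<noteq> l \<longrightarrow> \<bar>Im (s k) - Im (s l)\<bar> \<ge> \<rho>))"
proof (induction R)
  case (Suc R)
  then obtain s where s: "\<And>k. k \<in> {1..R} \<Longrightarrow> s k \<in> strip_box \<kappa> T"
    and S: "\<forall>z\<in>strip_box \<kappa> T. (\<forall>k\<in>{1..R}. \<bar>Im z - Im (s k)\<bar> \<ge> \<rho>) \<longrightarrow>
       (\<forall>k\<in>{1..R}. norm (F z) \<le> norm (F (s k))) \<and>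
       (\<forall>k\<in>{1..R}. \<forall>l\<in>{1..R}. k \<noteq> l \<longrightarrow> \<bar>Im (s k) - Im (s l)\<bar> \<ge> \<rho>)"
    by (elim exE conjE) blast
  have max: "norm (F z) \<le> norm (F (s k))"
    if "z \<in> strip_box \<kappa> T" "\<forall>k\<in>{1..R}. \<bar>Im z - Im (s k)\<bar> \<ge> \<rho>" "k \<in> {1..R}" for z k
    using S that by blast
  have sep: "\<bar>Im (s k) - Im (s l)\<bar> \<ge> \<rho>"
    if "z \<in> strip_box \<kappa> T" "\<forall>k\<in>{1..R}. \<bar>Im z - Im (s k)\<bar> \<ge> \<rho>" "k \<in> {1..R}" "l \<in> {1..R}" "k \<noteq> l" for z k l
    using S that by blast
  define B where "B = strip_box \<kappa> T \<inter> (\<Inter>k\<in>{1..R}. {z. \<bar>Im z - Im (s k)\<bar> \<ge> \<rho>})"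
  have B: "z \<in> B \<longleftrightarrow> z \<in> strip_box \<kappa> T \<and> (\<forall>k\<in>{1..R}. \<bar>Im z - Im (s k)\<bar> \<ge> \<rho>)" for z
    by (auto simp: B_def)
  have insert: "{1..Suc R} = insert (Suc R) {1..R}" by auto
  show ?case
  proof (cases "B = {}")
    case True
    \<comment> \<open>No admissible point is left, so the new point may be arbitrary: the
      conditional part of the claim is vacuous from here on.\<close>
    have "Complex 2 0 \<in> strip_box \<kappa> T" using \<kappa> T by (auto simp: strip_box_def)
    moreover have "\<not> (\<forall>k\<in>{1..Suc R}. \<rho> \<le> \<bar>Im z - Im ((s(Suc R := Complex 2 0)) k)\<bar>)"
      if "z \<in> strip_box \<kappa> T" for z
    proof
      assume *: "\<forall>k\<in>{1..Suc R}. \<rho> \<le> \<bar>Im z - Im ((s(Suc R := Complex 2 0)) k)\<bar>"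
      have "\<rho> \<le> \<bar>Im z - Im (s k)\<bar>" if "k \<in> {1..R}" for k
        using bspec[OF *, of k] that by auto
      thus False using True B that by blast
    qed
    ultimately show ?thesis
      using s by (intro exI[of _ "s(Suc R := Complex 2 0)"]) (auto simp: insert simp del: fun_upd_apply, auto)
  next
    case False
    have "closed (\<Inter>k\<in>{1..R}. {z. \<bar>Im z - Im (s k)\<bar> \<ge> \<rho>})"
      by (intro closed_INT ballI closed_Collect_le continuous_intros)
    hence "compact B" unfolding B_def by (intro compact_Int_closed compact_strip_box)
    moreover have "continuous_on B (\<lambda>z. norm (F z))"
      using \<kappa> by (intro continuous_on_norm continuous_on_subset[OF continuous_on_F]) (auto simp: B_def strip_box_def)
    ultimately obtain z0 where z0: "z0 \<in> B" "\<And>z. z \<in> B \<Longrightarrow> norm (F z) \<le> norm (F z0)"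
      using continuous_attains_sup[of B "\<lambda>z. norm (F z)"] False by blast
    show ?thesis
    proof (intro exI[of _ "s(Suc R := z0)"] conjI ballI impI)
      show "(s(Suc R := z0)) k \<in> strip_box \<kappa> T" if "k \<in> {1..Suc R}" for k
        using that s z0(1) B by (auto simp: insert)
    next
      fix z k assume z: "z \<in> strip_box \<kappa> T" "\<forall>k\<in>{1..Suc R}. \<rho> \<le> \<bar>Im z - Im ((s(Suc R := z0)) k)\<bar>" and k: "k \<in> {1..Suc R}"
      have zB: "\<forall>k\<in>{1..R}. \<rho> \<le> \<bar>Im z - Im (s k)\<bar>"
      proof
        fix k assume "k \<in> {1..R}"
        thus "\<rho> \<le> \<bar>Im z - Im (s k)\<bar>" using bspec[OF z(2), of k] by auto
      qed
      show "norm (F z) \<le> norm (F ((s(Suc R := z0)) k))"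
        using max[OF z(1) zB] z0(2)[of z] B z(1) zB k by (cases "k = Suc R") auto
    next
      fix z k l assume z: "z \<in> strip_box \<kappa> T" "\<forall>k\<in>{1..Suc R}. \<rho> \<le> \<bar>Im z - Im ((s(Suc R := z0)) k)\<bar>"
        and kl: "k \<in> {1..Suc R}" "l \<in> {1..Suc R}" "k \<noteq> l"
      have zB: "\<forall>k\<in>{1..R}. \<rho> \<le> \<bar>Im z - Im (s k)\<bar>"
      proof
        fix k assume "k \<in> {1..R}"
        thus "\<rho> \<le> \<bar>Im z - Im (s k)\<bar>" using bspec[OF z(2), of k] by auto
      qed
      have z0B: "\<And>k. k \<in> {1..R} \<Longrightarrow> \<rho> \<le> \<bar>Im z0 - Im (s k)\<bar>" using z0(1) B by blast
      show "\<rho> \<le> \<bar>Im ((s(Suc R := z0)) k) - Im ((s(Suc R := z0)) l)\<bar>"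
        using sep[OF z(1) zB, of k l] z0B[of k] z0B[of l] kl
        by (cases "k = Suc R"; cases "l = Suc R") (auto simp: abs_minus_commute)
    qed
  qed
qed auto

text \<open>A large-values inequality by duality. Cauchy--Schwarz separates \<open>lam\<close>,
  which meets the mean square bound, from the square of the sum \<open>Y n\<close>. Opening that
  square gives ln |zeta| at differences of the points: about ln (1 / \<kappa>) on the diagonal, only
  ln (1 / \<rho>) off it, because separation keeps those arguments away from the pole.\<close>

lemma sum_ln_norm_F_le:
  fixes s :: "nat \<Rightarrow> complex"
  assumes \<kappa>: "0 < \<kappa>" "\<kappa> \<le> 1" and \<rho>: "0 < \<rho>" "\<rho> \<le> 1" and \<theta>: "\<theta> > 0"
    and s: "\<And>k. k \<in> {1..R} \<Longrightarrow> s k \<in> strip_box \<kappa> T"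
    and sep: "\<And>k l. k \<in> {1..R} \<Longrightarrow> l \<in> {1..R} \<Longrightarrow> k \<noteq> l \<Longrightarrow> \<bar>Im (s k) - Im (s l)\<bar> \<ge> \<rho>"
    and T: "T \<ge> 1"
  shows "2 * (\<Sum>k=1..R. ln (norm (F (s k)))) \<le> \<theta> * (A\<^sup>2 * ln (1 / \<kappa>) + 4 * (A\<^sup>2 + A0)) +
     (real R * ln (1 + 1 / \<kappa>) + (real R)\<^sup>2 * ln (1 / \<rho> + 2 * ln (2 * T + 4) + 4)) / \<theta>"
proof -
  \<comment> \<open>The Cauchy--Schwarz weight n^(1+\<kappa>) accounts for the subtraction. The real
    part stays at least 1 + \<kappa> because both points have real part at least 1 +
    \<kappa>.\<close>
  define w where "w = (\<lambda>k l. s k + cnj (s l) - of_real (1 + \<kappa>))"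
  let ?c = "1 + \<kappa>" and ?M = "ln (1 / \<rho> + 2 * ln (2 * T + 4) + 4)"
  define Y where "Y = (\<lambda>n. \<Sum>k=1..R. (of_nat n :: complex) powr (- s k))"
  define m where "m = (\<lambda>n. complex_of_real (mangoldt n / ln (real n)))"
  let ?g = "\<lambda>n. Lam n / of_real (ln (real n))"
  have Res: "Re (s k) \<ge> ?c" "Re (s k) \<le> 2" "\<bar>Im (s k)\<bar> \<le> T" if "k \<in> {1..R}" for k
    using s[OF that] by (auto simp: strip_box_def)
  have Rew: "Re (w k l) \<ge> ?c" if "k \<in> {1..R}" "l \<in> {1..R}" for k l
    using Res(1)[OF that(1)] Res(1)[OF that(2)] by (simp add: w_def)
  have cg: "abs_conv ?g ?c" using abs_conv_div_ln[OF abs_conv_Lam, of ?c] \<kappa> by simp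
  have cm: "abs_conv m ?c" unfolding m_def using abs_conv_mangoldt_div_ln[of ?c] \<kappa> by (simp only: abs_conv_of_real_iff)
  have cq: "abs_conv (\<lambda>n. qL n / ln (real n)) ?c"
    using abs_conv_div_ln[OF abs_conv_qL, of ?c] \<kappa> by simp
  have sumg: "summable (\<lambda>n. ?g n * of_nat n powr (- s k))" if "k \<in> {1..R}" for k
    using summable_ds[OF cg Res(1)[OF that]] .
  have summ: "summable (\<lambda>n. m n * of_nat n powr (- w k l))" if "k \<in> {1..R}" "l \<in> {1..R}" for k l
    using summable_ds[OF cm Rew[OF that]] .
  have sumRe: "summable (\<lambda>n. Re (\<Sum>k=1..R. \<Sum>l=1..R. m n * of_nat n powr (- w k l)))"
    by (intro summable_Re summable_sum summ)
  have key: "Re (?g n * Y n) \<le> (\<theta> / 2) * (qL n / ln (real n) * real n powr (- ?c)) +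
      (1 / (2 * \<theta>)) * Re (\<Sum>k=1..R. \<Sum>l=1..R. m n * of_nat n powr (- w k l))" for n
  proof (cases "n = 0")
    case False
    define u where "u = real n powr (- ?c)"
    have u: "u > 0" using False by (simp add: u_def)
    define y where "y = norm (Y n)"
    have "(\<Sum>k=1..R. \<Sum>l=1..R. (of_nat n :: complex) powr (- w k l)) = of_real (y\<^sup>2 / u)"
    proof -
      have *: "(of_nat n :: complex) powr (- w k l) = of_nat n powr (- s k) * cnj (of_nat n powr (- s l)) * of_real (1 / u)" for k l
      proof -
        have "- w k l = - s k + (- cnj (s l)) + of_real ?c" by (simp add: w_def)
        hence "(of_nat n :: complex) powr (- w k l) = of_nat n powr (- s k) * of_nat n powr (- cnj (s l)) * of_nat n powr (of_real ?c)"
          by (simp only: powr_add)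
        also have "(of_nat n :: complex) powr (- cnj (s l)) = cnj (of_nat n powr (- s l))"
          using cnj_powr[of "of_nat n" "- s l"] False by (auto simp: complex_is_Real_iff)
        also have "(of_nat n :: complex) powr (of_real ?c) = of_real (real n powr ?c)"
          using powr_of_real[of "real n" ?c] by simp
        also have "real n powr ?c = 1 / u" unfolding u_def using False powr_minus_divide[of "real n" ?c] by simp
        finally show ?thesis .
      qed
      have "(\<Sum>k=1..R. \<Sum>l=1..R. (of_nat n :: complex) powr (- w k l)) = Y n * cnj (Y n) * of_real (1 / u)"
      proof -
        have "Y n * cnj (Y n) = (\<Sum>k=1..R. \<Sum>l=1..R. of_nat n powr (- s k) * cnj (of_nat n powr (- s l)))"
          unfolding Y_def cnj_sum by (rule sum_product)
        thus ?thesis unfolding * by (simp only: sum_distrib_right)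
      qed
      also have "Y n * cnj (Y n) = of_real (y\<^sup>2)" unfolding y_def by (simp only: complex_norm_square)
      finally show ?thesis by simp
    qed
    hence rhs: "(\<Sum>k=1..R. \<Sum>l=1..R. m n * of_nat n powr (- w k l)) = of_real (mangoldt n / ln (real n) * (y\<^sup>2 / u))"
      by (simp only: sum_distrib_left [symmetric] m_def of_real_mult)
    \<comment> \<open>The factor u = n^(-1-\<kappa>) balances the two parts, since y is a sum of R
      terms of absolute value at most u.\<close>
    have "0 \<le> (\<theta> * u * norm (lam n) - y)\<^sup>2 * (mangoldt n / (\<theta> * u))"
      using \<theta> u by (intro mult_nonneg_nonneg divide_nonneg_nonneg mangoldt_nonneg) auto
    also have "\<dots> = \<theta> * u * qL n + mangoldt n * y\<^sup>2 / (\<theta> * u) - 2 * (nL n * y)"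
      using \<theta> u by (simp add: qL_def nL_def power2_eq_square field_simps)
    finally have "nL n * y \<le> (\<theta> / 2) * (u * qL n) + (1 / (2 * \<theta>)) * (mangoldt n * (y\<^sup>2 / u))"
      using \<theta> u by (simp add: field_simps)
    hence "(nL n * y) / ln (real n) \<le> ((\<theta> / 2) * (u * qL n) + (1 / (2 * \<theta>)) * (mangoldt n * (y\<^sup>2 / u))) / ln (real n)"
      using False by (intro divide_right_mono) auto
    moreover have "Re (?g n * Y n) \<le> nL n * y / ln (real n)"
    proof -
      have "Re (?g n * Y n) \<le> norm (?g n * Y n)" by (rule complex_Re_le_cmod)
      also have "\<dots> = nL n * y / ln (real n)"
        using False by (simp add: norm_mult norm_divide norm_Lam y_def)
      finally show ?thesis .
    qed
    ultimately show ?thesis unfolding rhs Re_complex_of_real u_def [symmetric]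
      by (simp add: add_divide_distrib mult_ac)
  qed (simp add: Y_def)
  have "(\<Sum>k=1..R. ln (norm (F (s k)))) = Re (\<Sum>k=1..R. ds ?g (s k))"
  proof -
    have "ln (norm (F (s k))) = Re (ds ?g (s k))" if "k \<in> {1..R}" for k
      using ln_norm_F[of "s k"] Res(1)[OF that] \<kappa> by simp
    thus ?thesis by simp
  qed
  also have "(\<Sum>k=1..R. ds ?g (s k)) = (\<Sum>n. \<Sum>k=1..R. ?g n * of_nat n powr (- s k))"
    unfolding ds_def by (rule suminf_sum [symmetric]) (rule sumg)
  also have "\<dots> = (\<Sum>n. ?g n * Y n)" by (simp only: Y_def sum_distrib_left)
  also have "Re \<dots> = (\<Sum>n. Re (?g n * Y n))"
  proof (rule Re_suminf)
    show "summable (\<lambda>n. ?g n * Y n)" unfolding Y_def sum_distrib_left by (intro summable_sum sumg)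
  qed
  also have "\<dots> \<le> (\<Sum>n. (\<theta> / 2) * (qL n / ln (real n) * real n powr (- ?c)) +
      (1 / (2 * \<theta>)) * Re (\<Sum>k=1..R. \<Sum>l=1..R. m n * of_nat n powr (- w k l)))"
  proof (rule suminf_le[OF key])
    show "summable (\<lambda>n. Re (?g n * Y n))"
      unfolding Y_def sum_distrib_left by (intro summable_Re summable_sum sumg)
    show "summable (\<lambda>n. (\<theta> / 2) * (qL n / ln (real n) * real n powr (- ?c)) +
      (1 / (2 * \<theta>)) * Re (\<Sum>k=1..R. \<Sum>l=1..R. m n * of_nat n powr (- w k l)))"
      by (intro summable_add summable_mult summable_rds[OF cq order.refl] summable_Re summable_sum summ)
  qed
  also have "\<dots> = (\<theta> / 2) * rds (\<lambda>n. qL n / ln (real n)) ?c +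
      (1 / (2 * \<theta>)) * (\<Sum>n. Re (\<Sum>k=1..R. \<Sum>l=1..R. m n * of_nat n powr (- w k l)))"
    unfolding rds_def
    by (simp only: suminf_add[OF summable_mult[OF summable_rds[OF cq order.refl]] summable_mult[OF sumRe], symmetric]
        suminf_mult[OF summable_rds[OF cq order.refl]] suminf_mult[OF sumRe])
  also have "(\<Sum>n. Re (\<Sum>k=1..R. \<Sum>l=1..R. m n * of_nat n powr (- w k l))) =
      Re (\<Sum>n. \<Sum>k=1..R. \<Sum>l=1..R. m n * of_nat n powr (- w k l))"
    by (rule Re_suminf [symmetric]) (intro summable_sum summ)
  also have "(\<Sum>n. \<Sum>k=1..R. \<Sum>l=1..R. m n * of_nat n powr (- w k l)) = (\<Sum>k=1..R. \<Sum>l=1..R. ds m (w k l))"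
    unfolding ds_def by (subst suminf_sum; (intro summable_sum summ)?; (intro sum.cong refl suminf_sum summ)?)
  also have "Re (\<Sum>k=1..R. \<Sum>l=1..R. ds m (w k l)) = (\<Sum>k=1..R. \<Sum>l=1..R. Re (ds m (w k l)))" by simp
  also have "\<dots> \<le> (\<Sum>k=1..R. \<Sum>l=1..R. (if l = k then ln (1 + 1 / \<kappa>) else 0) + ?M)"
  proof (intro sum_mono)
    fix k l assume kl: "k \<in> {1..R}" "l \<in> {1..R}"
    have R1: "Re (w k l) > 1" using Rew[OF kl] \<kappa> by simp
    have "Re (ds m (w k l)) = ln (norm (zeta1 (w k l)))"
      using Re_ds_mangoldt_eq_ln_zeta1[OF R1] by (simp add: m_def)
    have z0: "norm (zeta1 (w k l)) > 0" using zeta1_eq_exp[OF R1] by simp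
    have M: "?M \<ge> 0" using T \<rho> by (intro ln_ge_zero) (simp add: add_increasing)
    have lk: "ln (1 + 1 / \<kappa>) \<ge> 0" using \<kappa> by simp
    have "ln (norm (zeta1 (w k l))) \<le> (if l = k then ln (1 + 1 / \<kappa>) else 0) + ?M"
    proof (cases "l = k")
      case True
      have "norm (zeta1 (w k l)) \<le> 1 + 1 / (Re (w k l) - 1)" by (rule norm_zeta1_le_real[OF R1])
      also have "\<dots> \<le> 1 + 1 / \<kappa>" using Rew[OF kl] \<kappa> by (intro add_left_mono divide_left_mono) auto
      finally have "ln (norm (zeta1 (w k l))) \<le> ln (1 + 1 / \<kappa>)" using z0 \<kappa> by (subst ln_le_cancel_iff) (auto intro: add_pos_pos)
      thus ?thesis using True M by simp
    next
      case False
      have im: "\<rho> \<le> \<bar>Im (w k l)\<bar>" using sep[OF kl] False by (auto simp: w_def)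
      \<comment> \<open>The argument has real part at most 3 and imaginary part at most 2 T in
        absolute value.\<close>
      define N where "N = nat \<lceil>2 * T + 3\<rceil>"
      have N: "2 * T + 3 \<le> real N" "real N \<le> 2 * T + 4" "N \<ge> 1" using T unfolding N_def by linarith+
      have "norm (w k l) \<le> \<bar>Re (w k l)\<bar> + \<bar>Im (w k l)\<bar>" by (rule cmod_le)
      also have "\<bar>Re (w k l)\<bar> \<le> 3" using Res[OF kl(1)] Res[OF kl(2)] \<kappa> by (auto simp: w_def)
      also have "\<bar>Im (w k l)\<bar> \<le> 2 * T" using Res[OF kl(1)] Res[OF kl(2)] by (auto simp: w_def)
      finally have "norm (w k l) \<le> real N" using N by linarith
      hence "norm (zeta1 (w k l)) \<le> 1 / norm (w k l - 1) + 2 * ln (real N) + 4"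
        using norm_zeta1_le[OF R1 N(3)] by simp
      also have "1 / norm (w k l - 1) \<le> 1 / \<rho>"
      proof -
        have "\<rho> \<le> norm (w k l - 1)" using im abs_Im_le_cmod[of "w k l - 1"] by simp
        thus ?thesis using \<rho> by (intro divide_left_mono mult_pos_pos) linarith+
      qed
      also have "ln (real N) \<le> ln (2 * T + 4)" using N T by (subst ln_le_cancel_iff) auto
      finally have "norm (zeta1 (w k l)) \<le> 1 / \<rho> + 2 * ln (2 * T + 4) + 4" by simp
      hence "ln (norm (zeta1 (w k l))) \<le> ?M" by (rule ln_le_mono[OF z0])
      thus ?thesis using False by simp
    qed
    thus "Re (ds m (w k l)) \<le> (if l = k then ln (1 + 1 / \<kappa>) else 0) + ?M"
      using Re_ds_mangoldt_eq_ln_zeta1[OF R1] by (simp add: m_def)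
  qed
  also have "\<dots> = real R * ln (1 + 1 / \<kappa>) + (real R)\<^sup>2 * ?M"
    by (simp add: sum.distrib power2_eq_square algebra_simps)
  also have "(\<theta> / 2) * rds (\<lambda>n. qL n / ln (real n)) ?c \<le> (\<theta> / 2) * (A\<^sup>2 * ln (1 / \<kappa>) + 4 * (A\<^sup>2 + A0))"
    using \<theta> \<kappa> by (intro mult_left_mono rds_qL_div_ln_le) auto
  finally have "(\<Sum>k=1..R. ln (norm (F (s k)))) \<le> (\<theta> / 2) * (A\<^sup>2 * ln (1 / \<kappa>) + 4 * (A\<^sup>2 + A0)) +
      (1 / (2 * \<theta>)) * (real R * ln (1 + 1 / \<kappa>) + (real R)\<^sup>2 * ?M)" using \<theta> by (simp add: divide_right_mono)
  moreover have "2 * ((\<theta> / 2) * x + (1 / (2 * \<theta>)) * y) = \<theta> * x + y / \<theta>" for x y by (simp add: distrib_left)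
  ultimately show ?thesis by (metis mult_le_cancel_left_pos zero_less_numeral)
qed

end

section \<open>Sums over short intervals\<close>

lemma sum_dconv:
  fixes a b :: "nat \<Rightarrow> 'a :: comm_semiring_1"
  assumes S: "S \<subseteq> {1..N}"
  shows "(\<Sum>n\<in>S. dconv a b n) = (\<Sum>d=1..N. a d * (\<Sum>m\<in>{m\<in>{1..N}. d * m \<in> S}. b m))"
proof -
  have fin: "finite S" using S by (rule finite_subset) auto
  have "(\<Sum>n\<in>S. dconv a b n) = (\<Sum>(n, d)\<in>Sigma S (\<lambda>n. {d. d dvd n}). a d * b (n div d))"
    unfolding dconv_def by (subst sum.Sigma) (use S fin in \<open>auto simp: Suc_le_eq\<close>)
  also have "\<dots> = (\<Sum>(d, m)\<in>Sigma {1..N} (\<lambda>d. {m\<in>{1..N}. d * m \<in> S}). a d * b m)"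
  proof (rule sum.reindex_bij_witness[of _ "\<lambda>(d, m). (d * m, d)" "\<lambda>(n, d). (d, n div d)"])
    fix x assume x: "x \<in> Sigma S (\<lambda>n. {d. d dvd n})"
    obtain n d where nd: "x = (n, d)" by (cases x)
    have n: "n \<in> S" "d dvd n" "n \<ge> 1" "n \<le> N" using x S nd by auto
    have d: "1 \<le> d" "d \<le> N" using n dvd_imp_le[of d n] by (auto simp: Suc_le_eq intro!: Nat.gr0I)
    have "1 \<le> n div d" "n div d \<le> N"
      using n d div_le_dividend[of n d] by (auto simp: Suc_le_eq div_greater_zero_iff dvd_imp_le simp del: div_le_dividend)
    thus "(case x of (n, d) \<Rightarrow> (d, n div d)) \<in> Sigma {1..N} (\<lambda>d. {m\<in>{1..N}. d * m \<in> S})"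
      using n d nd by auto
  qed auto
  also have "\<dots> = (\<Sum>d=1..N. a d * (\<Sum>m\<in>{m\<in>{1..N}. d * m \<in> S}. b m))"
    unfolding sum_distrib_left by (rule sum.Sigma [symmetric]) auto
  finally show ?thesis .
qed

lemma finite_nat_le: "finite {n. real n \<le> u}"
  by (rule finite_subset[of _ "{..nat \<lceil>u\<rceil>}"]) (auto simp: le_nat_iff, linarith)

lemma exp_le_2: "x \<le> 1 / 2 \<Longrightarrow> exp x \<le> (2 :: real)"
proof -
  assume "x \<le> 1 / 2"
  hence "exp x \<le> exp (1 / 2)" by simp
  also have "exp (1 / 2 :: real) \<le> 2"
  proof (rule power2_le_imp_le)
    have "exp (1 / 2 :: real) ^ 2 = exp 1" by (simp flip: exp_of_nat_mult)
    thus "exp (1 / 2 :: real) ^ 2 \<le> 2 ^ 2" using exp_le by simp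
  qed auto
  finally show ?thesis .
qed

text \<open>Neighbourhoods are taken on the logarithmic scale, so that d m lies near u exactly when
  m lies near u / d, with the same \<delta>.\<close>

definition near :: "real \<Rightarrow> real \<Rightarrow> nat set" where
  "near \<delta> u = {n. 1 \<le> n \<and> \<bar>ln (real n) - ln u\<bar> \<le> \<delta>}"

lemma near_bounds:
  assumes "n \<in> near \<delta> u" "u > 0" "0 \<le> \<delta>" "\<delta> \<le> 1 / 4"
  shows "exp (- \<delta>) * u \<le> real n" "real n \<le> exp \<delta> * u" "real n \<le> 2 * u"
proof -
  have n: "real n > 0" "ln u - \<delta> \<le> ln (real n)" "ln (real n) \<le> ln u + \<delta>"
    using assms(1) by (auto simp: near_def abs_le_iff)
  have "exp (ln u - \<delta>) \<le> real n" "real n \<le> exp (ln u + \<delta>)"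
    using n by (metis exp_le_cancel_iff exp_ln)+
  thus *: "exp (- \<delta>) * u \<le> real n" "real n \<le> exp \<delta> * u"
    using assms(2) by (simp_all add: exp_diff exp_add exp_minus field_simps)
  have "exp \<delta> \<le> 2" by (rule exp_le_2) (use assms in auto)
  hence "exp \<delta> * u \<le> 2 * u" using assms by (intro mult_right_mono) auto
  thus "real n \<le> 2 * u" using * by linarith
qed

lemma finite_near:
  assumes "u > 0" "0 \<le> \<delta>" "\<delta> \<le> 1 / 4"
  shows "finite (near \<delta> u)"
  by (rule finite_subset[OF _ finite_nat_le[of "2 * u"]]) (use near_bounds[OF _ assms] in auto)

text \<open>Only the von Mangoldt part is small in a short interval; for the squares nothing better
  than the bound for a whole block is known. The weight \<open>sqrt \<delta>\<close> balances the
  two and is all the saving that can be had this way.\<close>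

lemma (in log_coeffs) sum_nL_near_le:
  assumes \<delta>: "0 < \<delta>" "\<delta> \<le> 1 / 20" "T * \<delta> \<ge> 1" and z: "z > 0"
    and S: "S \<subseteq> {d. d \<in> near \<delta> z \<and> real d \<ge> T}"
  shows "(\<Sum>d\<in>S. nL d) \<le> z * (sqrt \<delta> * (E + 20 * ln (1 / \<delta>)))"
proof (cases "S = {}")
  case True
  have "ln (1 / \<delta>) \<ge> 0" using \<delta> by simp
  thus ?thesis using True z \<delta> E_ge by (auto intro!: mult_nonneg_nonneg)
next
  case False
  have fin: "finite S" using finite_subset[OF _ finite_near[OF z, of \<delta>]] S \<delta> by auto
  have b: "exp (- \<delta>) * z \<le> real d" "real d \<le> exp \<delta> * z" "real d \<le> 2 * z" "real d \<ge> T" "d \<ge> 1" if "d \<in> S" for d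
    using near_bounds[of d \<delta> z] S that \<delta> z by (auto simp: near_def)
  have T0: "T > 0" "1 / \<delta> \<le> T" using \<delta> by (auto simp: field_simps zero_less_mult_iff intro: ccontr) (smt (verit) mult_nonneg_nonpos2)+
  obtain d0 where d0: "d0 \<in> S" using False by blast
  have e2: "exp (2 * \<delta>) \<le> 2" by (rule exp_le_2) (use \<delta> in auto)
  have zT: "exp (- \<delta>) * z \<ge> T / 2"
  proof -
    have "T \<le> exp \<delta> * z" using b[OF d0] by linarith
    also have "exp \<delta> * z = exp (2 * \<delta>) * (exp (- \<delta>) * z)" by (simp flip: exp_add)
    also have "\<dots> \<le> 2 * (exp (- \<delta>) * z)" using e2 z by (intro mult_right_mono) auto
    finally show ?thesis by simp
  qed
  have Lb: "(\<Sum>d\<in>S. mangoldt d / real d) \<le> 20 * \<delta> * ln (1 / \<delta>)"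
  proof -
    \<comment> \<open>The neighbourhood has total logarithmic length 2 \<delta>.\<close>
    define T' where "T' = 1 / (2 * \<delta>)"
    have T': "T' \<ge> 10" using \<delta> by (simp add: T'_def field_simps)
    have "(\<Sum>d\<in>S. mangoldt d / real d) \<le>
       (\<Sum>n | exp (- \<delta>) * z \<le> real n \<and> real n \<le> exp (1 / T') * (exp (- \<delta>) * z). mangoldt n / real n)"
    proof (rule sum_mono2)
      show "finite {n. exp (- \<delta>) * z \<le> real n \<and> real n \<le> exp (1 / T') * (exp (- \<delta>) * z)}"
        by (rule finite_subset[OF _ finite_nat_le]) auto
      have "exp (1 / T') * (exp (- \<delta>) * z) = exp \<delta> * z" by (simp add: T'_def mult.assoc [symmetric] flip: exp_add)
      thus "S \<subseteq> {n. exp (- \<delta>) * z \<le> real n \<and> real n \<le> exp (1 / T') * (exp (- \<delta>) * z)}"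
        using b by (simp only:) auto
    qed (auto simp: mangoldt_nonneg)
    also have "\<dots> \<le> 10 * ln T' / T'"
    proof (rule sum_mangoldt_short_interval[OF T'])
      have "T' = (1 / \<delta>) / 2" by (simp add: T'_def)
      also have "\<dots> \<le> T / 2" using T0 by simp
      finally show "T' \<le> exp (- \<delta>) * z" using zT by linarith
    qed
    also have "\<dots> = 20 * \<delta> * ln T'" by (simp add: T'_def)
    also have "\<dots> \<le> 20 * \<delta> * ln (1 / \<delta>)"
    proof -
      have "T' \<le> 1 / \<delta>" using \<delta> by (simp add: T'_def field_simps)
      hence "ln T' \<le> ln (1 / \<delta>)" using T' \<delta> by (subst ln_le_cancel_iff) auto
      thus ?thesis using \<delta> by (intro mult_left_mono) auto
    qed
    finally show ?thesis .
  qed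
  have Qb: "(\<Sum>d\<in>S. qL d / real d) \<le> E"
  proof -
    \<comment> \<open>With z in the logarithmic middle, the neighbourhood lies inside the single
      block (x, e x].\<close>
    define x where "x = exp (- (1 / 2)) * z"
    have e: "exp (- (1/2)) \<le> exp (- \<delta>)" using \<delta> by simp
    have "20 \<le> 1 / \<delta>" using \<delta> by (simp add: field_simps)
    hence "T / 2 \<ge> 10" using T0 by linarith
    have "exp (- \<delta>) \<le> exp (1 / 2) * exp (- (1/2))" using \<delta> by (simp flip: exp_add)
    hence "exp (- \<delta>) * z \<le> exp (1 / 2) * x" unfolding x_def using mult_right_mono[of _ _ z] z by (simp add: mult.assoc)
    moreover have "exp (1 / 2) * x \<le> 2 * x"
      using z exp_le_2[of "1 / 2"] by (intro mult_right_mono) (auto simp: x_def)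
    ultimately have "10 \<le> 2 * x" using \<open>T / 2 \<ge> 10\<close> zT by linarith
    hence x: "x \<ge> 1" by simp
    have "(\<Sum>d\<in>S. qL d / real d) \<le> (\<Sum>n | x < real n \<and> real n \<le> exp 1 * x. qL n / real n)"
    proof (rule sum_mono2)
      show "finite {n. x < real n \<and> real n \<le> exp 1 * x}" by (rule finite_subset[OF _ finite_nat_le]) auto
      show "S \<subseteq> {n. x < real n \<and> real n \<le> exp 1 * x}"
      proof
        fix d assume "d \<in> S"
        note bd = b[OF this]
        have "x < exp (- \<delta>) * z" unfolding x_def using \<delta> z by (intro mult_strict_right_mono) auto
        moreover have "exp \<delta> * z \<le> exp 1 * x"
        proof -
          have "exp \<delta> \<le> exp (1 :: real) * exp (- (1/2))" using \<delta> by (simp flip: exp_add)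
          from mult_right_mono[OF this, of z] z show ?thesis by (simp add: x_def mult.assoc)
        qed
        ultimately show "d \<in> {n. x < real n \<and> real n \<le> exp 1 * x}" using bd by auto
      qed
    qed (auto simp: qL_nonneg)
    also have "\<dots> \<le> E" by (rule block_bounded_block[OF qL_block x])
    finally show ?thesis .
  qed
  have "2 * (\<Sum>d\<in>S. nL d) = (\<Sum>d\<in>S. 2 * nL d)" by (simp add: sum_distrib_left)
  also have "\<dots> \<le> (\<Sum>d\<in>S. 2 * z * (sqrt \<delta> * (qL d / real d) + (mangoldt d / real d) / sqrt \<delta>))"
  proof (rule sum_mono)
    fix d assume d: "d \<in> S"
    have "2 * nL d \<le> sqrt \<delta> * qL d + mangoldt d / sqrt \<delta>" using \<delta> by (intro two_nL_le) simp
    also have "\<dots> = real d * (sqrt \<delta> * (qL d / real d) + (mangoldt d / real d) / sqrt \<delta>)"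
      using b(5)[OF d] by (simp add: field_simps)
    also have "\<dots> \<le> 2 * z * (sqrt \<delta> * (qL d / real d) + (mangoldt d / real d) / sqrt \<delta>)"
      using b(3)[OF d] \<delta> by (intro mult_right_mono) (auto intro!: add_nonneg_nonneg divide_nonneg_nonneg mult_nonneg_nonneg simp: qL_nonneg mangoldt_nonneg)
    finally show "2 * nL d \<le> 2 * z * (sqrt \<delta> * (qL d / real d) + (mangoldt d / real d) / sqrt \<delta>)" .
  qed
  also have "\<dots> = 2 * z * (sqrt \<delta> * (\<Sum>d\<in>S. qL d / real d) + (\<Sum>d\<in>S. mangoldt d / real d) / sqrt \<delta>)"
    by (simp add: sum_distrib_left sum.distrib sum_divide_distrib distrib_left)
  also have "\<dots> \<le> 2 * z * (sqrt \<delta> * E + (20 * \<delta> * ln (1 / \<delta>)) / sqrt \<delta>)"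
    using z \<delta> Lb Qb by (intro mult_left_mono add_mono divide_right_mono) auto
  also have "(20 * \<delta> * ln (1 / \<delta>)) / sqrt \<delta> = 20 * sqrt \<delta> * ln (1 / \<delta>)"
    using real_div_sqrt[of \<delta>] \<delta> by (simp add: field_simps)
  finally show ?thesis by (simp add: algebra_simps)
qed

context dirichlet_data
begin

definition short_sum :: "real \<Rightarrow> real \<Rightarrow> real" where
  "short_sum \<delta> u = (\<Sum>n\<in>near \<delta> u. norm (f n))"

lemma norm_f_ln_le:
  assumes "n \<ge> 1"
  shows "norm (f n) * ln (real n) \<le> dconv nL (\<lambda>n. norm (f n)) n"
proof -
  have "norm (f n) * ln (real n) = norm (f n * of_real (ln (real n)))" using assms by (simp add: norm_mult)
  also have "\<dots> \<le> dconv nL (\<lambda>n. norm (f n)) n"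
    unfolding f_log[OF assms] using norm_dconv_le[of Lam f n] by (simp add: norm_Lam)
  finally show ?thesis .
qed

text \<open>For large d the order of summation is reversed: with m fixed, d runs through a short
  interval around u / m, and the saving comes from \<open>nL\<close> rather than from
  \<open>f\<close>.\<close>

lemma convolution_short_sum_le:
  assumes \<delta>: "0 < \<delta>" "\<delta> \<le> 1 / 20" "T * \<delta> \<ge> 1" and u: "u > 0" "N \<ge> 1" "ln (real N) \<le> \<L>" and \<L>: "\<L> \<ge> 0"
  shows "(\<Sum>d\<in>{d\<in>{1..N'}. real d \<ge> T}. nL d * (\<Sum>m\<in>{m\<in>{1..N}. d * m \<in> near \<delta> u}. norm (f m))) \<le>
    u * (sqrt \<delta> * (E + 20 * ln (1 / \<delta>)) * (3 * CF * (1 + \<L>) powr A))"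
proof -
  let ?B = "sqrt \<delta> * (E + 20 * ln (1 / \<delta>))"
  have "ln (1 / \<delta>) \<ge> 0" using \<delta> by simp
  hence B0: "?B \<ge> 0" using \<delta> E_ge by auto
  have "(\<Sum>d\<in>{d\<in>{1..N'}. real d \<ge> T}. nL d * (\<Sum>m\<in>{m\<in>{1..N}. d * m \<in> near \<delta> u}. norm (f m))) =
    (\<Sum>d\<in>{d\<in>{1..N'}. real d \<ge> T}. \<Sum>m\<in>{m\<in>{1..N}. d * m \<in> near \<delta> u}. nL d * norm (f m))"
    by (simp add: sum_distrib_left)
  also have "\<dots> = (\<Sum>m=1..N. \<Sum>d\<in>{d\<in>{d\<in>{1..N'}. real d \<ge> T}. d * m \<in> near \<delta> u}. nL d * norm (f m))"
    by (rule sum.swap_restrict) auto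
  also have "\<dots> = (\<Sum>m=1..N. norm (f m) * (\<Sum>d\<in>{d\<in>{d\<in>{1..N'}. real d \<ge> T}. d * m \<in> near \<delta> u}. nL d))"
    by (simp add: sum_distrib_left mult.commute)
  also have "\<dots> \<le> (\<Sum>m=1..N. norm (f m) * (u / real m * ?B))"
  proof (intro sum_mono mult_left_mono)
    fix m assume m: "m \<in> {1..N}"
    show "(\<Sum>d\<in>{d\<in>{d\<in>{1..N'}. real d \<ge> T}. d * m \<in> near \<delta> u}. nL d) \<le> u / real m * ?B"
    proof (rule sum_nL_near_le[OF \<delta>])
      show "{d\<in>{d\<in>{1..N'}. real d \<ge> T}. d * m \<in> near \<delta> u} \<subseteq> {d \<in> near \<delta> (u / real m). T \<le> real d}"
        using m u by (auto simp: near_def ln_div ln_mult algebra_simps)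
    qed (use m u in auto)
  qed auto
  also have "\<dots> = (\<Sum>m=1..N. u * (?B * (norm (f m) / real m)))"
    by (intro sum.cong refl) simp
  also have "\<dots> = u * (?B * (\<Sum>m=1..N. norm (f m) / real m))"
    by (simp only: sum_distrib_left)
  also have "(\<Sum>m=1..N. norm (f m) / real m) = (\<Sum>m | 1 \<le> m \<and> real m \<le> real N. norm (f m) / real m)"
    by (intro sum.cong) auto
  also have "u * (?B * \<dots>) \<le> u * (?B * (3 * CF * (1 + ln (real N)) powr A))"
    using u B0 by (intro mult_left_mono sum_norm_f_div_le) auto
  also have "\<dots> \<le> u * (?B * (3 * CF * (1 + \<L>) powr A))"
    using u B0 \<L> CF_ge_1 A by (intro mult_left_mono powr_mono2) auto
  finally show ?thesis by (simp add: mult_ac)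
qed

text \<open>On the neighbourhood ln n exceeds ln u - 1, so \<open>f * ln = Lam * f\<close> trades
  one logarithm for a convolution. Divisors up to T lead to the same problem at u / d; for the
  larger ones the short interval is exploited in d.\<close>

lemma short_sum_recursion:
  assumes \<delta>: "0 < \<delta>" "\<delta> \<le> 1 / 20" "T * \<delta> \<ge> 1" and T: "T \<ge> 1" and u: "u \<ge> 1" "ln u \<le> \<L>"
  shows "(ln u - 1) * short_sum \<delta> u \<le> (\<Sum>d | 1 \<le> d \<and> real d \<le> T. nL d * short_sum \<delta> (u / real d)) +
     u * (sqrt \<delta> * (E + 20 * ln (1 / \<delta>)) * (3 * CF * (2 + \<L>) powr A))"
proof -
  define N where "N = nat \<lfloor>2 * u\<rfloor>"
  have N: "real N \<le> 2 * u" "N \<ge> 1" using u by (auto simp: N_def le_nat_floor)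
  have lN: "ln (real N) \<le> 1 + \<L>"
  proof -
    have "ln (real N) \<le> ln (2 * u)" using N u by (subst ln_le_cancel_iff) auto
    also have "\<dots> = ln 2 + ln u" using u by (simp add: ln_mult)
    also have "\<dots> \<le> 1 + \<L>" using u ln2_le_25_over_36 by simp
    finally show ?thesis .
  qed
  have \<L>0: "\<L> \<ge> 0" using u ln_ge_zero[of u] by linarith
  have nearN: "near \<delta> u \<subseteq> {1..N}"
  proof
    fix n assume n: "n \<in> near \<delta> u"
    hence "real n \<le> 2 * u" using near_bounds[OF n] u \<delta> by auto
    thus "n \<in> {1..N}" using n by (auto simp: near_def N_def le_nat_floor)
  qed
  let ?I = "\<lambda>d. \<Sum>m\<in>{m\<in>{1..N}. d * m \<in> near \<delta> u}. norm (f m)"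
  have "(ln u - 1) * short_sum \<delta> u = (\<Sum>n\<in>near \<delta> u. norm (f n) * (ln u - 1))"
    by (simp add: short_sum_def sum_distrib_left mult.commute)
  also have "\<dots> \<le> (\<Sum>n\<in>near \<delta> u. dconv nL (\<lambda>n. norm (f n)) n)"
  proof (rule sum_mono)
    fix n assume n: "n \<in> near \<delta> u"
    have "norm (f n) * (ln u - 1) \<le> norm (f n) * ln (real n)"
      using n \<delta> by (intro mult_left_mono) (auto simp: near_def)
    also have "\<dots> \<le> dconv nL (\<lambda>n. norm (f n)) n" using n by (intro norm_f_ln_le) (auto simp: near_def)
    finally show "norm (f n) * (ln u - 1) \<le> dconv nL (\<lambda>n. norm (f n)) n" .
  qed
  also have "\<dots> = (\<Sum>d=1..N. nL d * ?I d)" by (rule sum_dconv[OF nearN])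
  also have "\<dots> \<le> (\<Sum>d\<in>{d\<in>{1..N}. real d \<le> T} \<union> {d\<in>{1..N}. real d \<ge> T}. nL d * ?I d)"
    by (intro sum_mono2) (auto intro!: mult_nonneg_nonneg sum_nonneg simp: nL_nonneg)
  also have "\<dots> \<le> (\<Sum>d\<in>{d\<in>{1..N}. real d \<le> T}. nL d * ?I d) + (\<Sum>d\<in>{d\<in>{1..N}. real d \<ge> T}. nL d * ?I d)"
    by (subst sum.union_inter [symmetric]) (auto intro!: sum_nonneg mult_nonneg_nonneg simp: nL_nonneg)
  also have "(\<Sum>d\<in>{d\<in>{1..N}. real d \<ge> T}. nL d * ?I d) \<le>
      u * (sqrt \<delta> * (E + 20 * ln (1 / \<delta>)) * (3 * CF * (1 + (1 + \<L>)) powr A))"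
    using u N lN \<L>0 by (intro convolution_short_sum_le \<delta>) auto
  also have "(\<Sum>d\<in>{d\<in>{1..N}. real d \<le> T}. nL d * ?I d) \<le> (\<Sum>d\<in>{d\<in>{1..N}. real d \<le> T}. nL d * short_sum \<delta> (u / real d))"
  proof (intro sum_mono mult_left_mono)
    fix d assume d: "d \<in> {d\<in>{1..N}. real d \<le> T}"
    show "?I d \<le> short_sum \<delta> (u / real d)" unfolding short_sum_def
      using d u \<delta> by (intro sum_mono2 finite_near) (auto simp: near_def ln_div ln_mult algebra_simps)
  qed (rule nL_nonneg)
  also have "\<dots> \<le> (\<Sum>d | 1 \<le> d \<and> real d \<le> T. nL d * short_sum \<delta> (u / real d))"
    by (intro sum_mono2 finite_nat_le_real) (auto intro!: mult_nonneg_nonneg sum_nonneg simp: nL_nonneg short_sum_def)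
  finally show ?thesis by simp
qed

lemma short_sum_trivial:
  assumes \<delta>: "0 < \<delta>" "\<delta> \<le> 1 / 20" and u: "u \<ge> 1" "ln u \<le> \<L>"
  shows "short_sum \<delta> u \<le> u * (6 * CF * (2 + \<L>) powr A)"
proof -
  have lu: "ln (2 * u) \<le> 1 + \<L>" "ln (2 * u) \<ge> 0"
    using u ln2_le_25_over_36 by (auto simp: ln_mult)
  have "short_sum \<delta> u \<le> (\<Sum>n | 1 \<le> n \<and> real n \<le> 2 * u. norm (f n))" unfolding short_sum_def
  proof (rule sum_mono2[OF finite_nat_le_real])
    show "near \<delta> u \<subseteq> {n. 1 \<le> n \<and> real n \<le> 2 * u}"
      using near_bounds(3)[of _ \<delta> u] u \<delta> by (auto simp: near_def)
  qed (use finite_nat_le_real in auto)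
  also have "\<dots> \<le> 3 * CF * (2 * u) * (1 + ln (2 * u)) powr A" using u by (intro sum_norm_f_le) auto
  also have "\<dots> \<le> 3 * CF * (2 * u) * (2 + \<L>) powr A"
    using u CF_ge_1 A lu by (intro mult_left_mono powr_mono2) auto
  finally show ?thesis by (simp add: mult_ac)
qed

text \<open>Each application of the recursion gains the factor a and lowers ln u by at most ln T, so
  k applications are possible when ln u >= Y + k ln T. The trivial bound is inserted only at the
  end.\<close>

lemma short_sum_bound:
  assumes \<delta>: "0 < \<delta>" "\<delta> \<le> 1 / 20" "T * \<delta> \<ge> 1" and T: "T \<ge> 1"
    and Y: "Y \<ge> 2" and a: "E * (1 + ln T) / (Y - 1) \<le> a" "a \<le> 1 / 2"
    and b: "sqrt \<delta> * (E + 20 * ln (1 / \<delta>)) * (3 * CF * (2 + \<L>) powr A) \<le> b / 2"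
    and u: "Y + real k * ln T \<le> ln u" "ln u \<le> \<L>" "u > 0"
  shows "short_sum \<delta> u \<le> u * (6 * CF * (2 + \<L>) powr A * a ^ k + b)"
  using u
proof (induction k arbitrary: u)
  case 0
  have "ln u \<ge> 0" using 0(1) Y by linarith
  hence u1: "u \<ge> 1" using ln_ge_zero_iff[OF 0(3)] by simp
  have "0 \<le> sqrt \<delta> * (E + 20 * ln (1 / \<delta>)) * (3 * CF * (2 + \<L>) powr A)"
    using \<delta> E_ge CF_ge_1 by (intro mult_nonneg_nonneg add_nonneg_nonneg) auto
  hence "b \<ge> 0" using b by linarith
  thus ?case using short_sum_trivial[OF \<delta>(1,2) u1 0(2)] u1
    by (simp add: distrib_left add_increasing2)
next
  case (Suc k)
  let ?\<Phi> = "6 * CF * (2 + \<L>) powr A"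
  have lT: "ln T \<ge> 0" using T by simp
  have "ln u \<ge> Y" using Suc.prems lT by (simp add: add_nonneg_nonneg) (smt (verit) mult_nonneg_nonneg of_nat_0_le_iff)
  moreover have "u \<ge> 1" using calculation Y ln_ge_zero_iff[OF Suc.prems(3)] by linarith
  ultimately have lu: "ln u \<ge> Y" "u \<ge> 1" by auto
  let ?\<beta> = "sqrt \<delta> * (E + 20 * ln (1 / \<delta>)) * (3 * CF * (2 + \<L>) powr A)"
  have \<beta>0: "?\<beta> \<ge> 0" using \<delta> E_ge CF_ge_1 by (intro mult_nonneg_nonneg add_nonneg_nonneg) auto
  have a0: "a \<ge> 0"
  proof -
    have "0 \<le> E * (1 + ln T) / (Y - 1)" using E_ge lT Y by (intro divide_nonneg_nonneg mult_nonneg_nonneg) auto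
    thus ?thesis using a by linarith
  qed
  have b0: "b \<ge> 0" using b \<beta>0 by linarith
  have r0: "?\<Phi> * a ^ k + b \<ge> 0" using CF_ge_1 a0 b0 by (intro add_nonneg_nonneg mult_nonneg_nonneg) auto
  have "(ln u - 1) * short_sum \<delta> u \<le> (\<Sum>d | 1 \<le> d \<and> real d \<le> T. nL d * short_sum \<delta> (u / real d)) + u * ?\<beta>"
    by (rule short_sum_recursion[OF \<delta> T lu(2) Suc.prems(2)])
  also have "(\<Sum>d | 1 \<le> d \<and> real d \<le> T. nL d * short_sum \<delta> (u / real d)) \<le>
      (\<Sum>d | 1 \<le> d \<and> real d \<le> T. nL d * (u / real d * (?\<Phi> * a ^ k + b)))"
  proof (intro sum_mono mult_left_mono nL_nonneg Suc.IH)
    fix d assume d: "d \<in> {d. 1 \<le> d \<and> real d \<le> T}"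
    have l: "ln (u / real d) = ln u - ln (real d)" using d Suc.prems by (simp add: ln_div)
    have "ln (real d) \<le> ln T" "ln (real d) \<ge> 0" using d by auto
    thus "Y + real k * ln T \<le> ln (u / real d)" "ln (u / real d) \<le> \<L>"
      using l Suc.prems by (auto simp: distrib_right)
    show "0 < u / real d" using d Suc.prems by auto
  qed
  also have "\<dots> = (\<Sum>d | 1 \<le> d \<and> real d \<le> T. u * (?\<Phi> * a ^ k + b) * (nL d / real d))"
    by (intro sum.cong refl) simp
  also have "\<dots> = u * (?\<Phi> * a ^ k + b) * (\<Sum>d | 1 \<le> d \<and> real d \<le> T. nL d / real d)"
    by (simp only: sum_distrib_left)
  also have "\<dots> \<le> u * (?\<Phi> * a ^ k + b) * (E * (1 + ln T))"
    using lu r0 T by (intro mult_left_mono block_sum_log[OF nL_block]) auto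
  also have "u * ?\<beta> \<le> u * (b / 2)" using lu b by (intro mult_left_mono) auto
  finally have main: "(ln u - 1) * short_sum \<delta> u \<le> u * (?\<Phi> * a ^ k + b) * (E * (1 + ln T)) + u * (b / 2)" by simp
  have "(Y - 1) * short_sum \<delta> u \<le> (ln u - 1) * short_sum \<delta> u"
    using lu by (intro mult_right_mono) (auto simp: short_sum_def intro: sum_nonneg)
  also note main
  also have "u * (?\<Phi> * a ^ k + b) * (E * (1 + ln T)) \<le> u * (?\<Phi> * a ^ k + b) * ((Y - 1) * a)"
  proof -
    have "E * (1 + ln T) \<le> (Y - 1) * a" using a(1) Y by (simp add: field_simps)
    thus ?thesis using lu r0 by (intro mult_left_mono) auto
  qed
  also have "u * (b / 2) \<le> (Y - 1) * (u * (b / 2))"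
    using Y lu b0 mult_right_mono[of 1 "Y - 1" "u * (b / 2)"] by simp
  also have "u * (?\<Phi> * a ^ k + b) * ((Y - 1) * a) + (Y - 1) * (u * (b / 2)) = (Y - 1) * (u * (?\<Phi> * a ^ Suc k + (a * b + b / 2)))"
    by (simp add: algebra_simps)
  finally have "short_sum \<delta> u \<le> u * (?\<Phi> * a ^ Suc k + (a * b + b / 2))" using Y by simp
  \<comment> \<open>The additive error is reproduced: a b + b / 2 <= b because a <= 1 / 2.\<close>
  also have "\<dots> \<le> u * (?\<Phi> * a ^ Suc k + b)"
    using lu mult_right_mono[OF a(2) b0] by (intro mult_left_mono) auto
  finally show ?case .
qed

end

section \<open>Smoothing error and Perron's formula for Dirichlet series\<close>

text \<open>Outside |v| <= \<delta> the Chernoff bound with r = 1 / h gives exp (- |v| / h). Half of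
  this exponent is turned into \<delta> / (2 h); the other half is at least 2 |v| and pays for the
  Rankin factor exp (c v).\<close>

lemma smooth_step_error:
  assumes h: "0 < h" "h \<le> 1 / 4" and c: "0 \<le> c" "c \<le> 2"
  shows "\<bar>(if v \<ge> 0 then 1 else 0) - smooth_step h v\<bar> \<le>
     (if \<bar>v\<bar> \<le> \<delta> then 1 else 0) + 2 * exp (- \<delta> / (2 * h)) * exp (c * v)"
proof (cases "\<bar>v\<bar> \<le> \<delta>")
  case True
  have "\<bar>(if v \<ge> 0 then 1 else 0) - smooth_step h v\<bar> \<le> 1"
    using smooth_step_nonneg[OF h(1), of v] smooth_step_le_1[OF h(1), of v] by auto
  thus ?thesis using True by (simp add: add_increasing2)
next
  case False
  have e2: "exp (1 / 2 :: real) \<le> 2" by (rule exp_le_2) simp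
  have "\<bar>(if v \<ge> 0 then 1 else 0) - smooth_step h v\<bar> \<le> exp (- \<bar>v\<bar> / h + 1 / 2)"
  proof (cases "v \<ge> 0")
    case True
    have "1 - smooth_step h v \<le> exp (- (1 / h) * v + (1 / h)\<^sup>2 * h\<^sup>2 / 2)"
      using h by (intro one_minus_smooth_step_le_exp) auto
    thus ?thesis using True h smooth_step_le_1[OF h(1), of v] by (simp add: power_divide)
  next
    case False
    have "smooth_step h v \<le> exp ((1 / h) * v + (1 / h)\<^sup>2 * h\<^sup>2 / 2)"
      using h by (intro smooth_step_le_exp) auto
    thus ?thesis using False h smooth_step_nonneg[OF h(1), of v] by (simp add: power_divide)
  qed
  also have "\<dots> = exp (1 / 2) * exp (- \<bar>v\<bar> / h)" by (simp flip: exp_add)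
  also have "\<dots> \<le> 2 * (exp (- \<delta> / (2 * h)) * exp (c * v))"
  proof (intro mult_mono e2)
    have "4 * h * \<bar>v\<bar> \<le> 1 * \<bar>v\<bar>" using h by (intro mult_right_mono) auto
    hence "2 * \<bar>v\<bar> \<le> \<bar>v\<bar> / (2 * h)" using h by (simp add: field_simps)
    moreover have "\<delta> / (2 * h) \<le> \<bar>v\<bar> / (2 * h)" using False h by (intro divide_right_mono) auto
    moreover have "- (c * v) \<le> 2 * \<bar>v\<bar>"
      using c mult_right_mono[of c 2 "\<bar>v\<bar>"] mult_left_mono[of "- v" "\<bar>v\<bar>" c] by linarith
    moreover have "\<bar>v\<bar> / h = \<bar>v\<bar> / (2 * h) + \<bar>v\<bar> / (2 * h)" by simp
    moreover have "- \<bar>v\<bar> / h = - (\<bar>v\<bar> / h)" "- \<delta> / (2 * h) = - (\<delta> / (2 * h))" by simp_all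
    ultimately have "- \<bar>v\<bar> / h \<le> - \<delta> / (2 * h) + c * v" by linarith
    thus "exp (- \<bar>v\<bar> / h) \<le> exp (- \<delta> / (2 * h)) * exp (c * v)" by (simp flip: exp_add)
  qed auto
  finally show ?thesis using False by (simp add: mult.assoc)
qed

text \<open>Termwise application of the kernel formula. It asks only for c > 0 and absolute
  convergence at c, so that shifted coefficients can later be treated on lines to the left of
  1.\<close>

lemma perron_ds:
  assumes h: "h > 0" and c: "c > 0" and a: "abs_conv a c" and u: "u > 0" and a0: "a 0 = 0"
  shows "summable (\<lambda>n. norm (a n) * smooth_step h (ln (u / real n)))"
    and "integrable lborel (\<lambda>t. exp (Complex c t * of_real (ln u)) * ds a (Complex c t) * mellin_kernel h (Complex c t))"
    and "(\<Sum>n. a n * of_real (smooth_step h (ln (u / real n)))) =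
      (LINT t|lborel. exp (Complex c t * of_real (ln u)) * ds a (Complex c t) * mellin_kernel h (Complex c t)) / of_real (2 * pi)"
proof -
  let ?k = "\<lambda>t. mellin_kernel h (Complex c t)"
  let ?e = "\<lambda>t. exp (Complex c t * of_real (ln u))"
  let ?f = "\<lambda>n t. (a n * of_nat n powr (- Complex c t)) * (?e t * ?k t)"
  have ki: "integrable lborel ?k" using integrable_mellin_kernel[OF h c] .
  have ne: "norm (?e t) = u powr c" for t using u by (simp add: norm_exp_eq_Re powr_def)
  have nf: "norm (?f n t) = (norm (a n) * real n powr (- c)) * (u powr c * norm (?k t))" for n t
    unfolding norm_mult ne norm_powr_real_powr by (simp add: norm_powr_real_powr norm_mult)
  have sa: "summable (\<lambda>n. norm (a n) * real n powr (- c))" using a by (simp add: abs_conv_def)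
  have meas: "(\<lambda>t. of_nat n powr (- Complex c t)) \<in> borel_measurable borel" for n
  proof (cases "n = 0")
    case False
    have "(\<lambda>t. of_nat n powr (- Complex c t)) = (\<lambda>t. exp (- Complex c t * ln (of_nat n)))"
      using False by (simp add: powr_def)
    thus ?thesis unfolding Complex_eq by simp
  qed simp
  have km: "?k \<in> borel_measurable lborel" using ki by (rule borel_measurable_integrable)
  have em: "?e \<in> borel_measurable lborel" unfolding Complex_eq by measurable
  have int: "integrable lborel (?f n)" for n
  proof (rule Bochner_Integration.integrable_bound)
    show "integrable lborel (\<lambda>t. (norm (a n) * real n powr (- c)) * (u powr c * norm (?k t)))"
      using ki by (intro integrable_mult_right integrable_norm)
    show "?f n \<in> borel_measurable lborel"
      using km em meas by (intro borel_measurable_times borel_measurable_const) auto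
    show "AE t in lborel. norm (?f n t) \<le> norm ((norm (a n) * real n powr (- c)) * (u powr c * norm (?k t)))"
      unfolding nf by (intro AE_I2) (simp add: abs_mult)
  qed
  have term_eq: "a n * of_real (smooth_step h (ln (u / real n))) = (LINT t|lborel. ?f n t) / of_real (2 * pi)" for n
  proof (cases "n = 0")
    case False
    have "exp (Complex c t * of_real (ln (u / real n))) = ?e t * of_nat n powr (- Complex c t)" for t
    proof -
      have "ln (u / real n) = ln u - ln (real n)" using u False by (simp add: ln_div)
      hence "Complex c t * of_real (ln (u / real n)) = Complex c t * of_real (ln u) + - Complex c t * of_real (ln (real n))"
        by (simp add: right_diff_distrib)
      hence "exp (Complex c t * of_real (ln (u / real n))) = ?e t * exp (- Complex c t * of_real (ln (real n)))"
        by (simp only: exp_add)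
      also have "exp (- Complex c t * of_real (ln (real n))) = of_nat n powr (- Complex c t)"
        using False Ln_of_real[of "real n"] by (simp add: powr_def)
      finally show ?thesis .
    qed
    hence "?f n t = a n * (exp (Complex c t * of_real (ln (u / real n))) * ?k t)" for t by (simp add: mult_ac)
    hence "(LINT t|lborel. ?f n t) = a n * (LINT t|lborel. exp (Complex c t * of_real (ln (u / real n))) * ?k t)"
      by (simp only: integral_mult_right_zero)
    thus ?thesis unfolding smooth_step_perron[OF h c] by simp
  qed (simp add: a0)
  have smn: "summable (\<lambda>n. norm (?f n t))" for t
    unfolding nf using sa by (rule summable_mult2)
  have sint: "summable (\<lambda>n. (LINT t|lborel. norm (?f n t)))"
    unfolding nf by (simp only: integral_mult_right_zero) (rule summable_mult2[OF sa])
  have sf: "(\<Sum>n. ?f n t) = ?e t * ds a (Complex c t) * ?k t" for t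
  proof -
    have "summable (\<lambda>n. a n * of_nat n powr (- Complex c t))" using summable_ds[OF a, of "Complex c t"] by simp
    thus ?thesis unfolding ds_def by (subst suminf_mult2 [symmetric]) (auto simp: mult_ac)
  qed
  note S = sums_integral[of lborel ?f, OF int AE_I2[OF smn] sint]
    integrable_suminf[of lborel ?f, OF int AE_I2[OF smn] sint]
  show "integrable lborel (\<lambda>t. ?e t * ds a (Complex c t) * ?k t)" using S(2) unfolding sf .
  have "(\<lambda>n. (LINT t|lborel. ?f n t) / of_real (2 * pi)) sums ((LINT t|lborel. ?e t * ds a (Complex c t) * ?k t) / of_real (2 * pi))"
    using S(1) unfolding sf by (rule sums_divide)
  thus "(\<Sum>n. a n * of_real (smooth_step h (ln (u / real n)))) = (LINT t|lborel. ?e t * ds a (Complex c t) * ?k t) / of_real (2 * pi)"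
    unfolding term_eq by (rule sums_unique [symmetric])
  have "summable (\<lambda>n. norm ((LINT t|lborel. ?f n t) / of_real (2 * pi)))"
  proof (rule summable_comparison_test[OF exI[of _ 0]])
    show "summable (\<lambda>n. (LINT t|lborel. norm (?f n t)))" by (rule sint)
    show "\<forall>n\<ge>0. norm (norm ((LINT t|lborel. ?f n t) / of_real (2 * pi))) \<le> (LINT t|lborel. norm (?f n t))"
    proof safe
      fix n
      have "norm ((LINT t|lborel. ?f n t) / of_real (2 * pi)) = norm (LINT t|lborel. ?f n t) / (2 * pi)"
        by (simp add: norm_divide norm_mult)
      also have "\<dots> \<le> norm (LINT t|lborel. ?f n t) / 1" using pi_gt3 by (intro divide_left_mono) auto
      also have "\<dots> \<le> (LINT t|lborel. norm (?f n t))" by simp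
      finally show "norm (norm ((LINT t|lborel. ?f n t) / of_real (2 * pi))) \<le> (LINT t|lborel. norm (?f n t))" by simp
    qed
  qed
  thus "summable (\<lambda>n. norm (a n) * smooth_step h (ln (u / real n)))"
    unfolding term_eq [symmetric] by (simp add: norm_mult smooth_step_nonneg[OF h])
qed

section \<open>Pointwise bounds from the Perron integral\<close>

lemma lborel_norm_integral_le:
  fixes f :: "real \<Rightarrow> complex"
  assumes "integrable lborel f" "integrable lborel g" "\<And>t. norm (f t) \<le> g t"
  shows "norm (LINT t|lborel. f t) \<le> (LINT t|lborel. g t)"
  by (rule order.trans[OF integral_norm_bound]) (intro integral_mono integrable_norm assms)

text \<open>The range of c covers both lines in use, 1 + 1 / ln u and 1 - \<alpha> + 1 / ln x with
  \<alpha> <= 1 / 4.\<close>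

lemma norm_mellin_kernel_le:
  assumes h: "0 < h" "h \<le> 1 / 4" and c: "3 / 4 \<le> c" "c \<le> 2"
  shows "norm (mellin_kernel h (Complex c t)) \<le> 3 * exp (- (h * t)\<^sup>2 / 2) / sqrt (1 + t\<^sup>2)"
proof -
  have "h * c \<le> (1 / 4) * 2" using h c by (intro mult_mono) auto
  hence "(h * c)\<^sup>2 \<le> (1 / 2)\<^sup>2" using h c by (intro power_mono) auto
  hence e: "exp (h\<^sup>2 * c\<^sup>2 / 2) \<le> 2" by (intro exp_le_2) (simp add: power_mult_distrib [symmetric] power_divide)
  have s: "sqrt (1 + t\<^sup>2) > 0" by (simp add: add_pos_nonneg)
  have "(3 / 4 * sqrt (1 + t\<^sup>2))\<^sup>2 \<le> c\<^sup>2 + t\<^sup>2"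
  proof -
    have "(3 / 4)\<^sup>2 \<le> c\<^sup>2" using c by (intro power_mono) auto
    moreover have "(3 / 4 * sqrt (1 + t\<^sup>2))\<^sup>2 = (3 / 4)\<^sup>2 * (1 + t\<^sup>2)"
      by (simp only: power_mult_distrib) (simp add: add_nonneg_nonneg)
    moreover have "(3 / 4)\<^sup>2 * (1 + t\<^sup>2) \<le> (3 / 4)\<^sup>2 + t\<^sup>2" by (simp add: power2_eq_square)
    ultimately show ?thesis by linarith
  qed
  hence n: "3 / 4 * sqrt (1 + t\<^sup>2) \<le> norm (Complex c t)"
    unfolding complex_norm by (intro real_le_rsqrt) simp
  have "norm (mellin_kernel h (Complex c t)) = exp (h\<^sup>2 * c\<^sup>2 / 2) * exp (- (h * t)\<^sup>2 / 2) / norm (Complex c t)"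
    by (rule norm_mellin_kernel[OF h(1)])
  also have "\<dots> \<le> 2 * exp (- (h * t)\<^sup>2 / 2) / (3 / 4 * sqrt (1 + t\<^sup>2))"
    using n s by (intro frac_le mult_right_mono e) auto
  also have "\<dots> \<le> 3 * exp (- (h * t)\<^sup>2 / 2) / sqrt (1 + t\<^sup>2)"
    using s by (simp add: field_simps)
  finally show ?thesis .
qed

lemma integral_inverse_sqrt:
  assumes T: "T \<ge> 1"
  shows "integrable lborel (\<lambda>t. indicator {-T..T} t * (1 / sqrt (1 + t\<^sup>2)))"
    and "(LINT t|lborel. indicator {-T..T} t * (1 / sqrt (1 + t\<^sup>2))) \<le> 2 * ln (3 * T)"
proof -
  have "has_bochner_integral lborel (\<lambda>t. indicator {-T..T} t *\<^sub>R (1 / sqrt (1 + t\<^sup>2))) (arsinh T - arsinh (- T))"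
  proof (rule has_bochner_integral_FTC_Icc)
    show "(arsinh has_vector_derivative 1 / sqrt (1 + x\<^sup>2)) (at x within {- T..T})" for x
      using arsinh_real_has_field_derivative[of x "{-T..T}"]
      by (simp add: has_real_derivative_iff_has_vector_derivative [symmetric] add.commute)
    show "continuous_on {- T..T} (\<lambda>t. 1 / sqrt (1 + t\<^sup>2))"
      by (intro continuous_intros) (auto simp: add_pos_nonneg less_imp_neq[symmetric])
  qed (use T in auto)
  hence hb: "has_bochner_integral lborel (\<lambda>t. indicator {-T..T} t * (1 / sqrt (1 + t\<^sup>2))) (2 * arsinh T)"
    by (simp add: arsinh_minus_real)
  thus "integrable lborel (\<lambda>t. indicator {-T..T} t * (1 / sqrt (1 + t\<^sup>2)))"
    by (simp add: has_bochner_integral_iff)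
  have "arsinh T = ln (T + sqrt (T\<^sup>2 + 1))" by (simp add: arsinh_real_def)
  also have "\<dots> \<le> ln (3 * T)"
  proof -
    have "1 \<le> T\<^sup>2" using T by simp
    moreover have "(2 * T)\<^sup>2 = 4 * T\<^sup>2" by simp
    ultimately have "T\<^sup>2 + 1 \<le> (2 * T)\<^sup>2" by linarith
    hence "sqrt (T\<^sup>2 + 1) \<le> 2 * T" using T by (intro real_le_lsqrt) auto
    thus ?thesis using T by (intro ln_le_mono) (auto intro: add_pos_nonneg)
  qed
  finally have "arsinh T \<le> ln (3 * T)" .
  thus "(LINT t|lborel. indicator {-T..T} t * (1 / sqrt (1 + t\<^sup>2))) \<le> 2 * ln (3 * T)"
    using hb by (simp add: has_bochner_integral_iff)
qed

text \<open>Beyond T half of the Gaussian exponent is frozen at T as the saving, and the other half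
  is kept to make the tail integrable.\<close>

lemma gauss_tail:
  fixes h T :: real
  assumes h: "h > 0"
  shows "integrable lborel (\<lambda>t. exp (- (h * T)\<^sup>2 / 4) * exp (- (h * t)\<^sup>2 / 4))"
    and "(LINT t|lborel. exp (- (h * T)\<^sup>2 / 4) * exp (- (h * t)\<^sup>2 / 4)) \<le> 4 * exp (- (h * T)\<^sup>2 / 4) / h"
    and "\<not> \<bar>t\<bar> \<le> T \<Longrightarrow> T \<ge> 0 \<Longrightarrow> exp (- (h * t)\<^sup>2 / 2) \<le> exp (- (h * T)\<^sup>2 / 4) * exp (- (h * t)\<^sup>2 / 4)"
proof -
  have h2: "h / sqrt 2 > 0" using h by simp
  have eq: "exp (- (h / sqrt 2 * t)\<^sup>2 / 2) = exp (- (h * t)\<^sup>2 / 4)" for t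
    by (simp add: power_mult_distrib power_divide)
  have i: "integrable lborel (\<lambda>t. exp (- (h * t)\<^sup>2 / 4))" "(LINT t|lborel. exp (- (h * t)\<^sup>2 / 4)) = sqrt (2 * pi) / (h / sqrt 2)"
    using integrable_gauss[OF h2] integral_gauss[OF h2] unfolding eq by auto
  show "integrable lborel (\<lambda>t. exp (- (h * T)\<^sup>2 / 4) * exp (- (h * t)\<^sup>2 / 4))" using i(1) by simp
  have "sqrt (2 * pi) / (h / sqrt 2) = sqrt (4 * pi) / h"
    by (simp add: real_sqrt_mult [symmetric])
  also have "sqrt (4 * pi) \<le> sqrt (4 * 4)" using pi_less_4 by (intro real_sqrt_le_mono) auto
  also have "sqrt (4 * 4 :: real) = 4" by (simp add: real_sqrt_unique)
  finally have "(LINT t|lborel. exp (- (h * t)\<^sup>2 / 4)) \<le> 4 / h" using h i(2) by (simp add: divide_right_mono)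
  from mult_left_mono[OF this, of "exp (- (h * T)\<^sup>2 / 4)"]
  show "(LINT t|lborel. exp (- (h * T)\<^sup>2 / 4) * exp (- (h * t)\<^sup>2 / 4)) \<le> 4 * exp (- (h * T)\<^sup>2 / 4) / h"
    by (simp add: mult.commute)
  assume t: "\<not> \<bar>t\<bar> \<le> T" "T \<ge> 0"
  have "\<bar>h * T\<bar> \<le> \<bar>h * t\<bar>" using t h by (simp add: abs_mult)
  hence "(h * T)\<^sup>2 \<le> (h * t)\<^sup>2" by (simp only: abs_le_square_iff)
  thus "exp (- (h * t)\<^sup>2 / 2) \<le> exp (- (h * T)\<^sup>2 / 4) * exp (- (h * t)\<^sup>2 / 4)" by (simp flip: exp_add)
qed

context dirichlet_data
begin

definition smooth_sum :: "real \<Rightarrow> real \<Rightarrow> complex" where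
  "smooth_sum h u = (\<Sum>n. f n * of_real (smooth_step h (ln (u / real n))))"

lemma summable_smooth:
  assumes "h > 0" "u > 0"
  shows "summable (\<lambda>n. norm (f n) * smooth_step h (ln (u / real n)))"
  using assms by (intro perron_ds(1)[of h 2]) (auto simp: f_0 f_conv)

text \<open>Within logarithmic distance \<delta> of u the weights may differ by 1, which costs a
  short sum; elsewhere the difference is exponentially small and is summed against n^(-c).\<close>

lemma summatory_minus_smooth_sum:
  assumes h: "0 < h" "h \<le> 1 / 4" and c: "1 < c" "c \<le> 2" and u: "u > 0" and \<delta>: "0 < \<delta>" "\<delta> \<le> 1 / 4"
  shows "norm (summatory f u - smooth_sum h u) \<le>
     short_sum \<delta> u + 2 * exp (- \<delta> / (2 * h)) * (u powr c * rds (\<lambda>n. norm (f n)) c)"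
proof -
  let ?W = "\<lambda>n. smooth_step h (ln (u / real n))"
  let ?g = "\<lambda>n. if n \<in> {n. 1 \<le> n \<and> real n \<le> u} then f n else 0"
  let ?e = "2 * exp (- \<delta> / (2 * h))"
  have s1: "?g sums (\<Sum>n | 1 \<le> n \<and> real n \<le> u. f n)"
    using sums_If_finite_set[OF finite_nat_le_real[of u], of f] by simp
  have s2: "(\<lambda>n. f n * of_real (?W n)) sums smooth_sum h u"
  proof -
    have "summable (\<lambda>n. norm (f n * of_real (?W n)))"
      using summable_smooth[OF h(1) u] smooth_step_nonneg[OF h(1)] by (simp add: norm_mult)
    thus ?thesis unfolding smooth_sum_def by (intro summable_sums) (rule summable_norm_cancel)
  qed
  let ?near = "\<lambda>n. if n \<in> near \<delta> u then norm (f n) else 0"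
  have s3: "?near sums short_sum \<delta> u" unfolding short_sum_def
    using u \<delta> by (intro sums_If_finite_set finite_near) auto
  have s4: "(\<lambda>n. ?e * (u powr c * (norm (f n) * real n powr (- c)))) sums (?e * (u powr c * rds (\<lambda>n. norm (f n)) c))"
    using summable_rds[of "\<lambda>n. norm (f n)" c c] f_conv[of c] c unfolding rds_def
    by (intro sums_mult summable_sums) auto
  have d: "(\<lambda>n. ?g n - f n * of_real (?W n)) sums (summatory f u - smooth_sum h u)"
    unfolding summatory_def by (intro sums_diff s1 s2)
  have le: "norm (?g n - f n * of_real (?W n)) \<le> ?near n + ?e * (u powr c * (norm (f n) * real n powr (- c)))" for n
  proof (cases "n = 0")
    case False
    define v where "v = ln (u / real n)"
    have v: "v = ln u - ln (real n)" using u False by (simp add: v_def ln_div)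
    have *: "n \<in> {n. 1 \<le> n \<and> real n \<le> u} \<longleftrightarrow> v \<ge> 0" using False u unfolding v by auto
    have "?g n - f n * of_real (?W n) = f n * of_real ((if v \<ge> 0 then 1 else 0) - smooth_step h v)"
      unfolding * v_def [symmetric] by (cases "v \<ge> 0") (simp_all add: right_diff_distrib)
    hence "norm (?g n - f n * of_real (?W n)) = norm (f n) * \<bar>(if v \<ge> 0 then 1 else 0) - smooth_step h v\<bar>"
      by (simp only: norm_mult norm_of_real)
    also have "\<dots> \<le> norm (f n) * ((if \<bar>v\<bar> \<le> \<delta> then 1 else 0) + ?e * exp (c * v))"
      using h c by (intro mult_left_mono smooth_step_error) auto
    also have "exp (c * v) = u powr c * real n powr (- c)"
      using u False by (simp add: v powr_def right_diff_distrib flip: exp_add)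
    also have "\<bar>v\<bar> \<le> \<delta> \<longleftrightarrow> n \<in> near \<delta> u" using False by (auto simp: near_def v abs_minus_commute)
    finally show ?thesis by (cases "n \<in> near \<delta> u") (simp_all add: distrib_left mult_ac)
  qed (simp add: f_0)
  have sm: "summable (\<lambda>n. ?near n + ?e * (u powr c * (norm (f n) * real n powr (- c))))"
    using sums_add[OF s3 s4] by (rule sums_summable)
  have sn: "summable (\<lambda>n. norm (?g n - f n * of_real (?W n)))"
    by (rule summable_comparison_test[OF exI[of _ 0] sm]) (use le in auto)
  have "norm (summatory f u - smooth_sum h u) \<le> (\<Sum>n. norm (?g n - f n * of_real (?W n)))"
    using summable_norm[OF sn] sums_unique[OF d] by simp
  also have "\<dots> \<le> short_sum \<delta> u + ?e * (u powr c * rds (\<lambda>n. norm (f n)) c)"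
    using suminf_le[OF le sn sm] sums_unique[OF sums_add[OF s3 s4]] by simp
  finally show ?thesis .
qed

lemma rds_norm_f_le':
  assumes "1 \<le> l" "l \<le> \<L>"
  shows "rds (\<lambda>n. norm (f n)) (1 + 1 / l) \<le> CF * \<L> powr A"
proof -
  have "rds (\<lambda>n. norm (f n)) (1 + 1 / l) \<le> CF * (1 / l) powr (- A)"
    using assms by (intro rds_norm_f_le) auto
  also have "(1 / l) powr (- A) = l powr A" using assms by (simp add: powr_minus powr_divide)
  also have "CF * l powr A \<le> CF * \<L> powr A"
    using assms A CF_ge_1 by (intro mult_left_mono powr_mono2) auto
  finally show ?thesis .
qed

text \<open>Three errors relative to u M: short intervals at the cutoff, leakage of the smoothing,
  and truncation of the Perron integral at height T.\<close>

definition tail_const :: "real \<Rightarrow> real \<Rightarrow> real \<Rightarrow> real \<Rightarrow> real \<Rightarrow> real" where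
  "tail_const \<L> T h \<delta> b = b + CF * \<L> powr A * (6 * exp (- \<delta> / (2 * h)) + 6 * exp (- (h * T)\<^sup>2 / 4) / h)"

text \<open>Stated for general coefficients and shifts because it is needed twice, for
  \<open>c i\<close> and for \<open>c i\<close> times \<mu> i. The line of integration is 1 + 1 / ln
  u, on which u^s has size e u.\<close>

lemma pointwise_bound:
  fixes c :: "'i \<Rightarrow> complex" and \<mu> :: "'i \<Rightarrow> real"
  assumes I: "finite I" "\<And>i. i \<in> I \<Longrightarrow> \<mu> i \<ge> 0" and M: "(\<Sum>i\<in>I. norm (c i) * exp (- \<mu> i)) \<le> M"
    and h: "0 < h" "h \<le> 1 / 4" and \<delta>: "0 < \<delta>" "\<delta> \<le> 1 / 4" and T: "T \<ge> 1"
    and u: "1 \<le> ln u" "ln u \<le> \<L>" "u > 0"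
    and K: "\<And>s. s \<in> strip_box (1 / \<L>) T \<Longrightarrow> norm (F s * (\<Sum>i\<in>I. c i * exp (- of_real (\<mu> i) * s))) \<le> K"
    and b0: "b \<ge> 0" and b: "\<And>i. i \<in> I \<Longrightarrow> short_sum \<delta> (u * exp (- \<mu> i)) \<le> u * exp (- \<mu> i) * b"
  shows "norm (\<Sum>i\<in>I. c i * summatory f (u * exp (- \<mu> i))) \<le>
     u * (3 * K * ln (3 * T) + M * tail_const \<L> T h \<delta> b)"
proof -
  define cc where "cc = 1 + 1 / ln u"
  have cc: "1 < cc" "cc \<le> 2" "1 + 1 / \<L> \<le> cc" "3 / 4 \<le> cc"
  proof -
    have "0 < 1 / ln u" "1 / ln u \<le> 1 / 1" "1 / \<L> \<le> 1 / ln u"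
    proof -
      have l: "0 < ln u" "0 < \<L>" using u by linarith+
      show "0 < 1 / ln u" using l by simp
      show "1 / ln u \<le> 1 / 1" by (rule divide_left_mono) (use l u in auto)
      show "1 / \<L> \<le> 1 / ln u" by (rule divide_left_mono) (use l u in auto)
    qed
    thus "1 < cc" "cc \<le> 2" "1 + 1 / \<L> \<le> cc" "3 / 4 \<le> cc" by (auto simp: cc_def)
  qed
  have L1: "\<L> \<ge> 1" using u by linarith
  define G where "G = CF * \<L> powr A"
  have G: "rds (\<lambda>n. norm (f n)) cc \<le> G" unfolding cc_def G_def using u by (intro rds_norm_f_le') auto
  have G0: "G \<ge> 0" using CF_ge_1 by (simp add: G_def)
  have fc: "abs_conv f cc" using cc by (intro f_conv) auto
  define P where "P = (\<lambda>s. \<Sum>i\<in>I. c i * exp (- of_real (\<mu> i) * s))"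
  have K0: "K \<ge> 0"
    using K[of 2] L1 T by (intro order.trans[OF norm_ge_zero K[of 2]]) (auto simp: strip_box_def)
  have M0: "M \<ge> 0" by (rule order.trans[OF _ M]) (intro sum_nonneg, auto)
  define e0 where "e0 = exp (- (h * T)\<^sup>2 / 4)"
  have ucc: "u powr cc = u * exp 1"
  proof -
    have "cc * ln u = ln u + 1" using u(1) by (simp add: cc_def field_simps)
    thus ?thesis using u by (simp add: powr_def exp_add)
  qed
  have ue: "u * exp (- \<mu> i) > 0" for i using u by simp
  have P_le: "norm (P (Complex cc t)) \<le> M" for t
  proof -
    have "norm (P (Complex cc t)) \<le> (\<Sum>i\<in>I. norm (c i) * exp (- \<mu> i))"
      unfolding P_def
    proof (rule sum_norm_le)
      fix i assume i: "i \<in> I"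
      have "\<mu> i * 1 \<le> \<mu> i * cc" using I(2)[OF i] cc by (intro mult_left_mono) auto
      thus "norm (c i * exp (- of_real (\<mu> i) * Complex cc t)) \<le> norm (c i) * exp (- \<mu> i)"
        by (auto simp: norm_mult norm_exp_eq_Re intro!: mult_left_mono)
    qed
    thus ?thesis using M by linarith
  qed
  have F_le: "norm (F (Complex cc t)) \<le> G" for t
    using norm_ds_le[OF f_conv, of "Complex cc t"] cc G by (simp add: F_def)
  let ?k = "\<lambda>t. mellin_kernel h (Complex cc t)"
  let ?e = "\<lambda>t. exp (Complex cc t * of_real (ln u))"
  let ?J = "\<lambda>i t. c i * (exp (Complex cc t * of_real (ln (u * exp (- \<mu> i)))) * ds f (Complex cc t) * ?k t)"
  have intJ: "integrable lborel (?J i)" for i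
    using perron_ds(2)[OF h(1) _ fc ue f_0] cc by (intro integrable_mult_right) auto
  have Jsum: "(\<Sum>i\<in>I. ?J i t) = ?e t * (F (Complex cc t) * P (Complex cc t)) * ?k t" for t
  proof -
    have "exp (Complex cc t * of_real (ln (u * exp (- \<mu> i)))) = ?e t * exp (- of_real (\<mu> i) * Complex cc t)" for i
    proof -
      have l: "ln (u * exp (- \<mu> i)) = ln u - \<mu> i" using u by (simp add: ln_mult)
      have "Complex cc t * of_real (ln (u * exp (- \<mu> i))) = Complex cc t * of_real (ln u) + (- of_real (\<mu> i) * Complex cc t)"
        unfolding l by (simp add: algebra_simps)
      thus ?thesis by (simp only: exp_add)
    qed
    thus ?thesis unfolding P_def F_def by (simp add: sum_distrib_left sum_distrib_right mult_ac)
  qed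
  \<comment> \<open>For |t| <= T the bound K on the mollified F meets 1 / sqrt (1 + t^2), whose
    integral is logarithmic in T; beyond T trivial bounds are paid for by the Gaussian.\<close>
  define B where "B = (\<lambda>t. (3 * K) * (indicator {-T..T} t * (1 / sqrt (1 + t\<^sup>2))) +
      (3 * G * M) * (e0 * exp (- (h * t)\<^sup>2 / 4)))"
  have i1: "integrable lborel (\<lambda>t. (3 * K) * (indicator {-T..T} t * (1 / sqrt (1 + t\<^sup>2))))"
    using integral_inverse_sqrt(1)[OF T] by (rule integrable_mult_right)
  have i2: "integrable lborel (\<lambda>t. (3 * G * M) * (e0 * exp (- (h * t)\<^sup>2 / 4)))"
    unfolding e0_def using gauss_tail(1)[OF h(1), of T] by (rule integrable_mult_right)
  have intB: "integrable lborel B" unfolding B_def by (rule Bochner_Integration.integrable_add[OF i1 i2])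
  have bound: "norm ((F (Complex cc t) * P (Complex cc t)) * ?k t) \<le> B t" for t
  proof -
    have s1: "sqrt (1 + t\<^sup>2) \<ge> 1" by simp
    have k1: "norm (?k t) \<le> 3 * exp (- (h * t)\<^sup>2 / 2) / sqrt (1 + t\<^sup>2)"
      using norm_mellin_kernel_le[OF h cc(4) cc(2)] .
    show ?thesis
    proof (cases "\<bar>t\<bar> \<le> T")
      case True
      have "norm (F (Complex cc t) * P (Complex cc t)) \<le> K"
        unfolding P_def using True cc by (intro K) (auto simp: strip_box_def)
      moreover have "norm (?k t) \<le> 3 * 1 / sqrt (1 + t\<^sup>2)"
        by (rule order.trans[OF k1]) (use s1 in \<open>intro divide_right_mono mult_left_mono, auto\<close>)
      ultimately have "norm ((F (Complex cc t) * P (Complex cc t)) * ?k t) \<le> K * (3 * 1 / sqrt (1 + t\<^sup>2))"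
        unfolding norm_mult[of "F (Complex cc t) * P (Complex cc t)"] using K0 by (intro mult_mono) auto
      also have "\<dots> = (3 * K) * (indicator {-T..T} t * (1 / sqrt (1 + t\<^sup>2)))"
        using True by (simp add: abs_le_iff minus_le_iff)
      also have "\<dots> \<le> B t" unfolding B_def e0_def using G0 M0 by simp
      finally show ?thesis .
    next
      case False
      have "norm (F (Complex cc t) * P (Complex cc t)) \<le> G * M"
        unfolding norm_mult using F_le P_le G0 by (intro mult_mono) auto
      moreover have "norm (?k t) \<le> 3 * (e0 * exp (- (h * t)\<^sup>2 / 4)) / 1"
        by (rule order.trans[OF k1]) (use s1 gauss_tail(3)[OF h(1) False] T in \<open>intro frac_le mult_left_mono, auto simp: e0_def\<close>)
      ultimately have "norm ((F (Complex cc t) * P (Complex cc t)) * ?k t) \<le> (G * M) * (3 * (e0 * exp (- (h * t)\<^sup>2 / 4)) / 1)"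
        unfolding norm_mult[of "F (Complex cc t) * P (Complex cc t)"] using G0 M0 by (intro mult_mono) auto
      also have "\<dots> \<le> B t" using K0 T by (auto simp: B_def)
      finally show ?thesis .
    qed
  qed
  have IB: "(LINT t|lborel. B t) \<le> 3 * K * (2 * ln (3 * T)) + 3 * G * M * (4 * e0 / h)"
  proof -
    have "(LINT t|lborel. B t) = (3 * K) * (LINT t|lborel. indicator {-T..T} t * (1 / sqrt (1 + t\<^sup>2))) +
      (3 * G * M) * (LINT t|lborel. e0 * exp (- (h * t)\<^sup>2 / 4))"
      unfolding B_def Bochner_Integration.integral_add[OF i1 i2] by (simp only: integral_mult_right_zero)
    also have "\<dots> \<le> (3 * K) * (2 * ln (3 * T)) + (3 * G * M) * (4 * e0 / h)"
      using K0 G0 M0 integral_inverse_sqrt(2)[OF T] gauss_tail(2)[OF h(1), of T]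
      by (intro add_mono mult_left_mono) (auto simp: e0_def)
    finally show ?thesis .
  qed
  have W: "(\<Sum>i\<in>I. c i * smooth_sum h (u * exp (- \<mu> i))) =
      (LINT t|lborel. ?e t * (F (Complex cc t) * P (Complex cc t)) * ?k t) / of_real (2 * pi)"
  proof -
    have W1: "c i * smooth_sum h (u * exp (- \<mu> i)) = (LINT t|lborel. ?J i t) / of_real (2 * pi)" for i
    proof -
      have "0 < cc" using cc by simp
      show ?thesis unfolding smooth_sum_def perron_ds(3)[OF h(1) \<open>0 < cc\<close> fc ue[of i] f_0]
        by (simp only: integral_mult_right_zero times_divide_eq_right)
    qed
    have "(\<Sum>i\<in>I. c i * smooth_sum h (u * exp (- \<mu> i))) = (\<Sum>i\<in>I. (LINT t|lborel. ?J i t)) / of_real (2 * pi)"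
      by (simp only: sum_divide_distrib W1)
    also have "(\<Sum>i\<in>I. (LINT t|lborel. ?J i t)) = (LINT t|lborel. (\<Sum>i\<in>I. ?J i t))"
      using intJ by (subst Bochner_Integration.integral_sum) auto
    finally show ?thesis unfolding Jsum .
  qed
  have "norm (\<Sum>i\<in>I. c i * smooth_sum h (u * exp (- \<mu> i))) \<le> u * (3 * K * ln (3 * T) + 6 * G * M * e0 / h)"
  proof -
    have ne: "norm (?e t) = u * exp 1" for t using ucc u by (simp add: norm_exp_eq_Re powr_def)
    have "norm (LINT t|lborel. ?e t * (F (Complex cc t) * P (Complex cc t)) * ?k t) \<le> (LINT t|lborel. (u * exp 1) * B t)"
    proof (rule lborel_norm_integral_le)
      show "integrable lborel (\<lambda>t. ?e t * (F (Complex cc t) * P (Complex cc t)) * ?k t)"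
        unfolding Jsum [symmetric] by (intro Bochner_Integration.integrable_sum intJ)
      show "integrable lborel (\<lambda>t. (u * exp 1) * B t)" using intB by (rule integrable_mult_right)
      show "norm (?e t * (F (Complex cc t) * P (Complex cc t)) * ?k t) \<le> (u * exp 1) * B t" for t
        unfolding mult.assoc[of "?e t"] norm_mult[of "?e t"] ne using bound u by (intro mult_left_mono) auto
    qed
    also have "\<dots> = (u * exp 1) * (LINT t|lborel. B t)" by (rule integral_mult_right_zero)
    also have "\<dots> \<le> (u * 3) * (3 * K * (2 * ln (3 * T)) + 3 * G * M * (4 * e0 / h))"
    proof (rule mult_mono)
      show "0 \<le> (LINT t|lborel. B t)" using bound by (intro integral_nonneg_AE AE_I2) (rule order.trans[OF norm_ge_zero bound])
    qed (use u IB exp_le in auto)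
    finally have n: "norm (LINT t|lborel. ?e t * (F (Complex cc t) * P (Complex cc t)) * ?k t) \<le>
        6 * (u * (3 * K * ln (3 * T) + 6 * G * M * e0 / h))" by (simp add: algebra_simps)
    have "norm (\<Sum>i\<in>I. c i * smooth_sum h (u * exp (- \<mu> i))) =
        norm (LINT t|lborel. ?e t * (F (Complex cc t) * P (Complex cc t)) * ?k t) / (2 * pi)"
      unfolding W by (simp add: norm_divide norm_mult)
    also have "\<dots> \<le> norm (LINT t|lborel. ?e t * (F (Complex cc t) * P (Complex cc t)) * ?k t) / 6"
      using pi_gt3 by (intro divide_left_mono) auto
    finally show ?thesis using n by linarith
  qed
  moreover have "norm ((\<Sum>i\<in>I. c i * summatory f (u * exp (- \<mu> i))) - (\<Sum>i\<in>I. c i * smooth_sum h (u * exp (- \<mu> i)))) \<le>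
      u * (M * (b + G * (6 * exp (- \<delta> / (2 * h)))))"
  proof -
    have "norm ((\<Sum>i\<in>I. c i * summatory f (u * exp (- \<mu> i))) - (\<Sum>i\<in>I. c i * smooth_sum h (u * exp (- \<mu> i)))) \<le>
        (\<Sum>i\<in>I. norm (c i) * (u * exp (- \<mu> i) * (b + G * (6 * exp (- \<delta> / (2 * h))))))"
      unfolding sum_subtractf [symmetric]
    proof (rule sum_norm_le)
      fix i assume i: "i \<in> I"
      let ?u = "u * exp (- \<mu> i)"
      have "?u powr cc \<le> ?u * 3"
      proof -
        have "?u powr cc = ?u * ?u powr (1 / ln u)" unfolding cc_def powr_add using ue[of i] by simp
        also have "?u powr (1 / ln u) \<le> u powr (1 / ln u)"
        proof (rule powr_mono2)
          have "1 \<le> u" using ln_ge_zero_iff[OF u(3)] u(1) by linarith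
          thus "0 \<le> 1 / ln u" by simp
        qed (use ue[of i] u I(2)[OF i] in auto)
        also have "u powr (1 / ln u) = exp 1"
        proof -
          have "u \<noteq> 1" using u(1) by auto
          thus ?thesis using u by (simp add: powr_def)
        qed
        finally show ?thesis using ue[of i] exp_le by (meson mult_left_mono less_imp_le order.trans)
      qed
      hence "?u powr cc * rds (\<lambda>n. norm (f n)) cc \<le> ?u * 3 * G"
        using G ue[of i] f_conv[of cc] cc by (intro mult_mono rds_nonneg) auto
      hence "2 * exp (- \<delta> / (2 * h)) * (?u powr cc * rds (\<lambda>n. norm (f n)) cc) \<le> 2 * exp (- \<delta> / (2 * h)) * (?u * 3 * G)"
        by (intro mult_left_mono) auto
      hence "norm (summatory f ?u - smooth_sum h ?u) \<le> ?u * (b + G * (6 * exp (- \<delta> / (2 * h))))"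
      proof -
        have "2 * exp (- \<delta> / (2 * h)) * (?u * 3 * G) = ?u * (G * (6 * exp (- \<delta> / (2 * h))))" by simp
        moreover have "?u * (b + G * (6 * exp (- \<delta> / (2 * h)))) = ?u * b + ?u * (G * (6 * exp (- \<delta> / (2 * h))))"
          by (rule distrib_left)
        ultimately show ?thesis
          using summatory_minus_smooth_sum[OF h cc(1,2) ue[of i] \<delta>] b[OF i] \<open>_ \<le> 2 * exp (- \<delta> / (2 * h)) * (?u * 3 * G)\<close>
          by linarith
      qed
      from mult_left_mono[OF this, of "norm (c i)"]
      show "norm (c i * summatory f ?u - c i * smooth_sum h ?u) \<le> norm (c i) * (?u * (b + G * (6 * exp (- \<delta> / (2 * h)))))"
        by (simp add: norm_mult flip: right_diff_distrib)
    qed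
    also have "\<dots> = u * ((\<Sum>i\<in>I. norm (c i) * exp (- \<mu> i)) * (b + G * (6 * exp (- \<delta> / (2 * h)))))"
      unfolding sum_distrib_left sum_distrib_right by (intro sum.cong refl) (simp only: mult_ac)
    also have "\<dots> \<le> u * (M * (b + G * (6 * exp (- \<delta> / (2 * h)))))"
      using M u G0 b0 by (intro mult_left_mono mult_right_mono) auto
    finally show ?thesis .
  qed
  ultimately have "norm (\<Sum>i\<in>I. c i * summatory f (u * exp (- \<mu> i))) \<le>
     u * (3 * K * ln (3 * T) + 6 * G * M * e0 / h) + u * (M * (b + G * (6 * exp (- \<delta> / (2 * h)))))"
    by (smt (verit) norm_triangle_sub)
  also have "\<dots> = u * (3 * K * ln (3 * T) + M * tail_const \<L> T h \<delta> b)"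
    unfolding tail_const_def G_def e0_def by (simp add: algebra_simps)
  finally show ?thesis .
qed

end

section \<open>The logarithmic kernel\<close>

lemma ds_term_shift:
  "complex_of_real (real n powr (- r)) * of_nat n powr (- s) = of_nat n powr (- (s + of_real r))"
proof -
  have "complex_of_real (real n powr (- r)) = of_nat n powr (of_real (- r))"
    using powr_of_real[of "real n" "- r"] by simp
  moreover have "- (s + of_real r) = of_real (- r) + - s" by simp
  ultimately show ?thesis by (simp only: powr_add)
qed

lemma ds_shift: "ds (\<lambda>n. a n * of_real (real n powr (- r))) s = ds a (s + of_real r)"
  unfolding ds_def mult.assoc ds_term_shift ..

lemma has_bochner_integral_log_weight:
  fixes z :: complex and l :: real
  shows "has_bochner_integral lborel (\<lambda>\<alpha>. indicator {0..1/4::real} \<alpha> *\<^sub>R (z * of_real (2 * l * exp (- 2 * \<alpha> * l))))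
      (z * of_real (1 - exp (- l / 2)))"
proof -
  have "has_bochner_integral lborel (\<lambda>\<alpha>. indicator {0..1/4::real} \<alpha> *\<^sub>R (z * of_real (2 * l * exp (- 2 * \<alpha> * l))))
      (z * of_real (- exp (- 2 * (1/4) * l)) - z * of_real (- exp (- 2 * 0 * l)))"
  proof (rule has_bochner_integral_FTC_Icc)
    fix x :: real
    have "((\<lambda>\<alpha>. - exp (- 2 * \<alpha> * l)) has_vector_derivative 2 * l * exp (- 2 * x * l)) (at x within {0..1/4})"
      unfolding has_real_derivative_iff_has_vector_derivative [symmetric]
      by (auto intro!: derivative_eq_intros)
    hence "((\<lambda>\<alpha>. complex_of_real (- exp (- 2 * \<alpha> * l))) has_vector_derivative complex_of_real (2 * l * exp (- 2 * x * l))) (at x within {0..1/4})"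
      by (rule bounded_linear.has_vector_derivative[OF bounded_linear_of_real])
    thus "((\<lambda>\<alpha>. z * complex_of_real (- exp (- 2 * \<alpha> * l))) has_vector_derivative z * complex_of_real (2 * l * exp (- 2 * x * l))) (at x within {0..1/4})"
      by (rule has_vector_derivative_mult_right)
  qed (auto intro!: continuous_intros)
  thus ?thesis by (simp add: algebra_simps)
qed

context dirichlet_data
begin

text \<open>
  Integration over \<open>\<alpha> \<in> {0..1/4}\<close> recovers the smoothed sum of \<open>f\<close> up to the factor \<open>1 - exp (- y / 2)\<close> with
  \<open>y = ln n + \<mu>\<close>; the weight \<open>ln n\<close> gained in this way turns \<open>f\<close> into \<open>Lam * f\<close>.
\<close>

definition logq :: "real \<Rightarrow> real \<Rightarrow> real \<Rightarrow> real \<Rightarrow> complex" where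
  "logq h u \<mu> \<alpha> = (\<Sum>n. f n * of_real (smooth_step h (ln (u / real n)) ) * of_real (2 * (ln (real n) + \<mu>) * exp (- 2 * \<alpha> * (ln (real n) + \<mu>))))"

lemma abs_conv_f_ln: "\<sigma> > 1 \<Longrightarrow> abs_conv (\<lambda>n. f n * of_real (ln (real n))) \<sigma>"
  by (rule abs_conv_ln[of f "(1 + \<sigma>) / 2"]) (auto intro!: f_conv)

lemma summable_log_weight:
  assumes h: "h > 0" and u: "u > 0" and \<mu>: "\<mu> \<ge> 0"
  shows "summable (\<lambda>n. norm (f n) * smooth_step h (ln (u / real n)) * (ln (real n) + \<mu>))"
proof -
  have "summable (\<lambda>n. norm (f n * of_real (ln (real n))) * smooth_step h (ln (u / real n)) + \<mu> * (norm (f n) * smooth_step h (ln (u / real n))))"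
    using h u by (intro summable_add summable_mult summable_smooth perron_ds(1)[of h 2]) (auto intro: abs_conv_f_ln)
  also have "(\<lambda>n. norm (f n * of_real (ln (real n))) * smooth_step h (ln (u / real n)) + \<mu> * (norm (f n) * smooth_step h (ln (u / real n)))) =
     (\<lambda>n. norm (f n) * smooth_step h (ln (u / real n)) * (ln (real n) + \<mu>))"
  proof
    fix n
    show "norm (f n * of_real (ln (real n))) * smooth_step h (ln (u / real n)) + \<mu> * (norm (f n) * smooth_step h (ln (u / real n))) =
     norm (f n) * smooth_step h (ln (u / real n)) * (ln (real n) + \<mu>)"
      by (cases "n = 0") (auto simp: norm_mult f_0 algebra_simps)
  qed
  finally show ?thesis .
qed

lemma logq_integral:
  assumes h: "h > 0" and u: "u > 0" and \<mu>: "\<mu> \<ge> 0"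
  shows "integrable lborel (\<lambda>\<alpha>. indicator {0..1/4::real} \<alpha> *\<^sub>R logq h u \<mu> \<alpha>)"
    and "(LINT \<alpha>|lborel. indicator {0..1/4::real} \<alpha> *\<^sub>R logq h u \<mu> \<alpha>) =
      (\<Sum>n. f n * of_real (smooth_step h (ln (u / real n))) * of_real (1 - exp (- (ln (real n) + \<mu>) / 2)))"
proof -
  let ?l = "\<lambda>n. ln (real n) + \<mu>" and ?z = "\<lambda>n. f n * of_real (smooth_step h (ln (u / real n)))"
  let ?\<phi> = "\<lambda>n \<alpha>. indicator {0..1/4::real} \<alpha> *\<^sub>R (?z n * of_real (2 * ?l n * exp (- 2 * \<alpha> * ?l n)))"
  let ?b = "\<lambda>n. norm (f n) * smooth_step h (ln (u / real n)) * ?l n"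
  have W0: "smooth_step h v \<ge> 0" for v by (rule smooth_step_nonneg[OF h])
  have hb: "has_bochner_integral lborel (?\<phi> n) (?z n * of_real (1 - exp (- ?l n / 2)))" for n
    by (rule has_bochner_integral_log_weight)
  have int: "integrable lborel (?\<phi> n)" for n using hb by (rule integrable.intros)
  have sb: "summable ?b" by (rule summable_log_weight[OF h u \<mu>])
  have nb: "norm (?z n * of_real (2 * ?l n * exp (- 2 * \<alpha> * ?l n))) \<le> 2 * ?b n" if "\<alpha> \<ge> 0" for n \<alpha>
  proof (cases "n = 0")
    case False
    have l: "?l n \<ge> 0" using False \<mu> by auto
    hence "exp (- 2 * \<alpha> * ?l n) \<le> 1" using that by simp
    hence "2 * ?l n * exp (- 2 * \<alpha> * ?l n) \<le> 2 * ?l n * 1" using l by (intro mult_left_mono) auto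
    moreover have "norm (?z n * of_real (2 * ?l n * exp (- 2 * \<alpha> * ?l n))) =
      (norm (f n) * smooth_step h (ln (u / real n))) * (2 * ?l n * exp (- 2 * \<alpha> * ?l n))"
      using l W0 by (simp only: norm_mult norm_of_real) (simp add: abs_mult)
    ultimately have "norm (?z n * of_real (2 * ?l n * exp (- 2 * \<alpha> * ?l n))) \<le> (norm (f n) * smooth_step h (ln (u / real n))) * (2 * ?l n * 1)"
      using W0 by (metis mult_left_mono norm_ge_zero mult_nonneg_nonneg)
    also have "\<dots> = 2 * ?b n" by (simp only: mult_ac mult_1_right)
    finally show ?thesis .
  qed (simp add: f_0)
  have n\<phi>: "norm (?\<phi> n \<alpha>) \<le> indicator {0..1/4::real} \<alpha> * (2 * ?b n)" for n \<alpha>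
    using nb[of \<alpha> n] by (auto simp: indicator_def)
  have ii: "integrable lborel (\<lambda>\<alpha>::real. indicator {0..1/4::real} \<alpha> * y)" "(LINT \<alpha>|lborel. indicator {0..1/4::real} \<alpha> * y) = y / 4" for y :: real
    by (auto simp: integrable_indicator_iff)
  have sn: "summable (\<lambda>n. norm (?\<phi> n \<alpha>))" for \<alpha>
    by (rule summable_comparison_test[OF exI[of _ 0] summable_mult[OF summable_mult[OF sb, of 2], of "indicator {0..1/4::real} \<alpha>"]])
       (use n\<phi> in auto)
  have si: "summable (\<lambda>n. (LINT \<alpha>|lborel. norm (?\<phi> n \<alpha>)))"
  proof (rule summable_comparison_test[OF exI[of _ 0]])
    show "summable (\<lambda>n. 2 * ?b n / 4)" by (intro summable_divide summable_mult sb)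
    show "\<forall>n\<ge>0. norm (LINT \<alpha>|lborel. norm (?\<phi> n \<alpha>)) \<le> 2 * ?b n / 4"
    proof safe
      fix n
      have "(LINT \<alpha>|lborel. norm (?\<phi> n \<alpha>)) \<le> (LINT \<alpha>|lborel. indicator {0..1/4::real} \<alpha> * (2 * ?b n))"
        by (intro integral_mono integrable_norm int ii n\<phi>)
      also have "\<dots> = 2 * ?b n / 4" by (rule ii)
      finally show "norm (LINT \<alpha>|lborel. norm (?\<phi> n \<alpha>)) \<le> 2 * ?b n / 4" by simp
    qed
  qed
  have S: "(\<Sum>n. ?\<phi> n \<alpha>) = indicator {0..1/4::real} \<alpha> *\<^sub>R logq h u \<mu> \<alpha>" for \<alpha>
  proof (cases "\<alpha> \<in> {0..1/4}")
    case True
    thus ?thesis by (simp add: logq_def)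
  qed simp
  show "integrable lborel (\<lambda>\<alpha>. indicator {0..1/4::real} \<alpha> *\<^sub>R logq h u \<mu> \<alpha>)"
    using integrable_suminf[of lborel ?\<phi>, OF int AE_I2[OF sn] si] unfolding S .
  have "(\<lambda>n. (LINT \<alpha>|lborel. ?\<phi> n \<alpha>)) sums (LINT \<alpha>|lborel. indicator {0..1/4::real} \<alpha> *\<^sub>R logq h u \<mu> \<alpha>)"
    using sums_integral[of lborel ?\<phi>, OF int AE_I2[OF sn] si] unfolding S .
  moreover have "(LINT \<alpha>|lborel. ?\<phi> n \<alpha>) = ?z n * of_real (1 - exp (- ?l n / 2))" for n
    using hb by (rule has_bochner_integral_integral_eq)
  ultimately show "(LINT \<alpha>|lborel. indicator {0..1/4::real} \<alpha> *\<^sub>R logq h u \<mu> \<alpha>) =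
      (\<Sum>n. ?z n * of_real (1 - exp (- ?l n / 2)))"
    by (simp add: sums_unique)
qed

text \<open>The weight exp (- 2 \<alpha> ln n) shifts the argument by 2 \<alpha>, so the line Re s =
  c may lie to the left of 1. Adding \<mu> to ln n matches the shift of the cutoff, and the weighted
  coefficients again have F as a factor.\<close>

lemma logq_perron:
  assumes h: "h > 0" and u: "u > 0" and \<mu>: "\<mu> \<ge> 0" and \<alpha>: "\<alpha> \<ge> 0" and c: "c > 0" "c + 2 * \<alpha> > 1"
  defines "J \<equiv> (\<lambda>t. exp (Complex c t * of_real (ln u)) * (of_real (exp (- 2 * \<alpha> * \<mu>)) *
     (F (Complex (c + 2 * \<alpha>) t) * (ds Lam (Complex (c + 2 * \<alpha>) t) + of_real \<mu>))) * mellin_kernel h (Complex c t))"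
  shows "integrable lborel J" and "logq h u \<mu> \<alpha> = 2 * ((LINT t|lborel. J t) / of_real (2 * pi))"
proof -
  let ?c' = "c + 2 * \<alpha>"
  \<comment> \<open>Chosen so that its series at s is, up to exp (- 2 \<alpha> \<mu>), the series of
    f (ln + \<mu>) at s + 2 \<alpha>.\<close>
  define a where "a = (\<lambda>n. of_real (exp (- 2 * \<alpha> * \<mu>)) * ((f n * of_real (ln (real n)) + of_real \<mu> * f n) * of_real (real n powr (- (2 * \<alpha>)))))"
  have a0: "a 0 = 0" by (simp add: a_def)
  have cf: "abs_conv (\<lambda>n. f n * of_real (ln (real n)) + of_real \<mu> * f n) ?c'"
  proof -
    have "summable (\<lambda>n. norm (f n * of_real (ln (real n))) * real n powr - ?c' + \<mu> * (norm (f n) * real n powr - ?c'))"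
      using abs_conv_f_ln[OF c(2)] f_conv[OF c(2)] unfolding abs_conv_def by (intro summable_add summable_mult) auto
    thus ?thesis unfolding abs_conv_def
    proof (rule summable_comparison_test[OF exI[of _ 0], rotated], safe)
      fix n
      have "norm (f n * of_real (ln (real n)) + of_real \<mu> * f n) \<le> norm (f n * of_real (ln (real n))) + \<mu> * norm (f n)"
        using \<mu> by (intro order.trans[OF norm_triangle_ineq]) (simp add: norm_mult)
      from mult_right_mono[OF this, of "real n powr - ?c'"]
      show "norm (norm (f n * of_real (ln (real n)) + of_real \<mu> * f n) * real n powr - ?c') \<le>
        norm (f n * of_real (ln (real n))) * real n powr - ?c' + \<mu> * (norm (f n) * real n powr - ?c')"
        by (simp add: algebra_simps)
    qed
  qed
  have ac: "abs_conv a c" unfolding abs_conv_def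
  proof -
    have "norm (a n) * real n powr (- c) = exp (- 2 * \<alpha> * \<mu>) * (norm (f n * of_real (ln (real n)) + of_real \<mu> * f n) * real n powr (- ?c'))" for n
    proof -
      have "real n powr (- (2 * \<alpha>)) * real n powr (- c) = real n powr (- ?c')" by (simp add: algebra_simps flip: powr_add)
      thus ?thesis by (simp add: a_def norm_mult)
    qed
    thus "summable (\<lambda>n. norm (a n) * real n powr - c)" using cf by (auto simp: abs_conv_def intro: summable_mult)
  qed
  have dsa: "ds a (Complex c t) = of_real (exp (- 2 * \<alpha> * \<mu>)) *
     (F (Complex ?c' t) * (ds Lam (Complex ?c' t) + of_real \<mu>))" for t
  proof -
    have s1: "summable (\<lambda>n. f n * of_real (ln (real n)) * of_nat n powr (- Complex ?c' t))"
      "summable (\<lambda>n. f n * of_nat n powr (- Complex ?c' t))"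
      using summable_ds[OF abs_conv_f_ln[OF c(2)], of "Complex ?c' t"] summable_ds[OF f_conv[OF c(2)], of "Complex ?c' t"] by auto
    have cx: "Complex c t + of_real (2 * \<alpha>) = Complex ?c' t" by (simp add: complex_eq_iff)
    have "ds a (Complex c t) = of_real (exp (- 2 * \<alpha> * \<mu>)) *
        ds (\<lambda>n. (f n * of_real (ln (real n)) + of_real \<mu> * f n) * of_real (real n powr (- (2 * \<alpha>)))) (Complex c t)"
    proof -
      have "summable (\<lambda>n. (f n * of_real (ln (real n)) + of_real \<mu> * f n) * of_nat n powr (- Complex ?c' t))"
        using summable_ds[OF cf, of "Complex ?c' t"] by simp
      moreover have "(f n * of_real (ln (real n)) + of_real \<mu> * f n) * of_real (real n powr (- (2 * \<alpha>))) * of_nat n powr (- Complex c t) =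
         (f n * of_real (ln (real n)) + of_real \<mu> * f n) * of_nat n powr (- Complex ?c' t)" for n
      proof -
        have "complex_of_real (real n powr (- (2 * \<alpha>))) * of_nat n powr (- Complex c t) = of_nat n powr (- Complex ?c' t)"
          unfolding cx [symmetric] by (rule ds_term_shift)
        thus ?thesis by (simp only: mult.assoc)
      qed
      ultimately have "summable (\<lambda>n. (f n * of_real (ln (real n)) + of_real \<mu> * f n) * of_real (real n powr (- (2 * \<alpha>))) * of_nat n powr (- Complex c t))"
        by (simp only:)
      thus ?thesis unfolding ds_def a_def by (simp only: mult.assoc suminf_mult)
    qed
    also have "ds (\<lambda>n. (f n * of_real (ln (real n)) + of_real \<mu> * f n) * of_real (real n powr (- (2 * \<alpha>)))) (Complex c t) =
        ds (\<lambda>n. f n * of_real (ln (real n)) + of_real \<mu> * f n) (Complex ?c' t)"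
      unfolding ds_shift cx ..
    also have "\<dots> = ds (\<lambda>n. f n * of_real (ln (real n))) (Complex ?c' t) + of_real \<mu> * F (Complex ?c' t)"
      unfolding ds_def F_def
      by (subst suminf_mult[OF s1(2), symmetric], subst suminf_add[OF s1(1) summable_mult[OF s1(2)]]) (simp add: algebra_simps)
    also have "\<dots> = F (Complex ?c' t) * (ds Lam (Complex ?c' t) + of_real \<mu>)"
      using ds_f_ln[of "Complex ?c' t"] c by (simp add: algebra_simps)
    finally show ?thesis .
  qed
  show "integrable lborel J" using perron_ds(2)[OF h c(1) ac u a0] unfolding dsa J_def .
  have "logq h u \<mu> \<alpha> = (\<Sum>n. 2 * (a n * of_real (smooth_step h (ln (u / real n)))))"
    unfolding logq_def
  proof (intro suminf_cong)
    fix n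
    show "f n * of_real (smooth_step h (ln (u / real n))) * of_real (2 * (ln (real n) + \<mu>) * exp (- 2 * \<alpha> * (ln (real n) + \<mu>)))
      = 2 * (a n * of_real (smooth_step h (ln (u / real n))))"
    proof (cases "n = 0")
      case False
      have "exp (- 2 * \<alpha> * (ln (real n) + \<mu>)) = exp (- 2 * \<alpha> * \<mu>) * real n powr (- (2 * \<alpha>))"
        using False by (simp add: powr_def algebra_simps flip: exp_add)
      thus ?thesis by (simp add: a_def algebra_simps)
    qed (simp add: f_0 a0)
  qed
  also have "\<dots> = 2 * (\<Sum>n. a n * of_real (smooth_step h (ln (u / real n))))"
  proof (rule suminf_mult)
    have "summable (\<lambda>n. norm (a n * of_real (smooth_step h (ln (u / real n)))))"
      using perron_ds(1)[OF h c(1) ac u a0] smooth_step_nonneg[OF h] by (simp add: norm_mult)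
    thus "summable (\<lambda>n. a n * of_real (smooth_step h (ln (u / real n))))" by (rule summable_norm_cancel)
  qed
  finally show "logq h u \<mu> \<alpha> = 2 * ((LINT t|lborel. J t) / of_real (2 * pi))"
    using perron_ds(3)[OF h c(1) ac u a0] unfolding dsa J_def by simp
qed

text \<open>The mean square bound applies to finite sums over d >= T. Small d are bounded trivially,
  and the cutoff N can be chosen independently of t because the tail is dominated by the series of
  absolute values.\<close>

lemma Lam_split:
  assumes \<gamma>: "0 < \<gamma>" and T: "T \<ge> 1"
  obtains N where "\<And>t. norm (ds Lam (Complex (1 + \<gamma>) t)) \<le>
    E * (1 + ln T) + 1 + norm (\<Sum>d\<in>{d\<in>{..<N}. real d \<ge> T}. Lam d * of_nat d powr (- Complex (1 + \<gamma>) t))"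
proof -
  have ac: "abs_conv nL (1 + \<gamma>)" using \<gamma> by (intro abs_conv_nL) auto
  have s: "summable (\<lambda>n. nL n * real n powr (- (1 + \<gamma>)))" by (rule summable_rds[OF ac order.refl])
  from suminf_exist_split[OF zero_less_one s] obtain N where
    N: "norm (\<Sum>n. nL (n + N) * real (n + N) powr (- (1 + \<gamma>))) < 1" by auto
  show ?thesis
  proof (rule that[of N])
    fix t
    let ?s = "Complex (1 + \<gamma>) t"
    let ?g = "\<lambda>n. Lam n * of_nat n powr (- ?s)"
    have ng: "norm (?g n) = nL n * real n powr (- (1 + \<gamma>))" for n unfolding norm_ds_term norm_Lam by simp
    have sg: "summable ?g" using s unfolding ng [symmetric] by (rule summable_norm_cancel)
    have "ds Lam ?s = (\<Sum>n. ?g (n + N)) + (\<Sum>n<N. ?g n)"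
      unfolding ds_def by (rule suminf_split_initial_segment[OF sg])
    also have "(\<Sum>n<N. ?g n) = (\<Sum>n\<in>{n\<in>{..<N}. real n \<ge> T}. ?g n) + (\<Sum>n\<in>{n\<in>{..<N}. \<not> real n \<ge> T}. ?g n)"
      by (subst sum.union_disjoint [symmetric]) (auto intro!: sum.cong)
    finally have "norm (ds Lam ?s) \<le> norm (\<Sum>n. ?g (n + N)) + (norm (\<Sum>n\<in>{n\<in>{..<N}. real n \<ge> T}. ?g n) + norm (\<Sum>n\<in>{n\<in>{..<N}. \<not> real n \<ge> T}. ?g n))"
      by (auto intro!: order.trans[OF norm_triangle_ineq] add_left_mono norm_triangle_ineq)
    moreover have "norm (\<Sum>n. ?g (n + N)) \<le> 1"
    proof -
      have "summable (\<lambda>n. norm (?g (n + N)))" unfolding ng using s by (subst summable_iff_shift)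
      from summable_norm[OF this] show ?thesis using N unfolding ng by simp
    qed
    moreover have "norm (\<Sum>n\<in>{n\<in>{..<N}. \<not> real n \<ge> T}. ?g n) \<le> E * (1 + ln T)"
    proof -
      have "norm (\<Sum>n\<in>{n\<in>{..<N}. \<not> real n \<ge> T}. ?g n) \<le> (\<Sum>n\<in>{n\<in>{..<N}. \<not> real n \<ge> T}. nL n / real n)"
      proof (rule sum_norm_le)
        fix n assume "n \<in> {n\<in>{..<N}. \<not> real n \<ge> T}"
        have "nL n * real n powr (- (1 + \<gamma>)) \<le> nL n * (1 / real n)"
        proof (intro mult_left_mono nL_nonneg)
          show "real n powr (- (1 + \<gamma>)) \<le> 1 / real n"
            using \<gamma> unfolding real_powr_minus_Suc by (cases "n = 0") (auto intro!: divide_right_mono simp: powr_def)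
        qed
        thus "norm (?g n) \<le> nL n / real n" unfolding ng by simp
      qed
      also have "\<dots> = (\<Sum>n\<in>{n\<in>{..<N}. \<not> real n \<ge> T} - {0}. nL n / real n)"
        by (intro sum.mono_neutral_right) auto
      also have "\<dots> \<le> (\<Sum>n | 1 \<le> n \<and> real n \<le> T. nL n / real n)"
        by (intro sum_mono2 finite_nat_le_real) (auto simp: nL_nonneg)
      also have "\<dots> \<le> E * (1 + ln T)" by (rule block_sum_log[OF nL_block T])
      finally show ?thesis .
    qed
    ultimately show "norm (ds Lam ?s) \<le> E * (1 + ln T) + 1 + norm (\<Sum>n\<in>{n\<in>{..<N}. real n \<ge> T}. ?g n)" by linarith
  qed
qed

end

section \<open>The bilinear term\<close>

lemma integrable_indicator_dirichlet_poly:
  assumes S: "\<And>d. d \<in> S \<Longrightarrow> d \<ge> 1"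
  shows "integrable lborel (\<lambda>t. indicator {-T..T} t * (norm (\<Sum>d\<in>S. a d * of_nat d powr (- Complex \<sigma> t)))\<^sup>2)"
proof -
  have "(\<Sum>d\<in>S. a d * of_nat d powr (- Complex \<sigma> t)) = (\<Sum>d\<in>S. a d * (of_real (real d powr (- \<sigma>)) * iexp (- ln (real d) * t)))" for t
    by (intro sum.cong refl) (simp only: of_nat_powr_Complex[OF S])
  moreover have "set_integrable lborel {-T..T} (\<lambda>t. (norm (\<Sum>d\<in>S. a d * (of_real (real d powr (- \<sigma>)) * iexp (- ln (real d) * t))))\<^sup>2)"
    by (rule borel_integrable_atLeastAtMost') (intro continuous_intros)
  ultimately show ?thesis by (simp add: set_integrable_def)
qed

context dirichlet_data
begin

text \<open>The first summand comes from |t| <= T, the second from trivial bounds beyond T. The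
  outer factor 3 is 9 / 3, from exp 2 <= 9 and pi > 3.\<close>

definition quad_const :: "real \<Rightarrow> real \<Rightarrow> real \<Rightarrow> real \<Rightarrow> real \<Rightarrow> real" where
  "quad_const \<L> T h K M = 3 * (3 * K / 2 * (5400 * E * ln T + 4 * (E * (1 + ln T) + 2)\<^sup>2 * ln (3 * T)) +
     24 * E * (1 + \<L>) * (2 * E * (1 + \<L>) * M * (CF * \<L> powr A)) * exp (- (h * T)\<^sup>2 / 4) / h)"

text \<open>The mollified F is taken out by its supremum K over the box, which leaves a product of
  two Dirichlet series with coefficients \<open>Lam\<close> on different lines. Cauchy--Schwarz
  reduces it to two mean squares, each losing only 1 / (\<alpha> + 1 / ln x) where a direct estimate
  would lose the square of that.\<close>

lemma quadratic_bound:
  fixes c :: "'i \<Rightarrow> complex" and \<mu> :: "'i \<Rightarrow> real"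
  assumes I: "finite I" "\<And>i. i \<in> I \<Longrightarrow> 0 \<le> \<mu> i" "\<And>i. i \<in> I \<Longrightarrow> \<mu> i \<le> \<L>"
    and M: "(\<Sum>i\<in>I. norm (c i) * exp (- \<mu> i)) \<le> M"
    and h: "0 < h" "h \<le> 1 / 4" and T: "T \<ge> 10"
    and x: "8 \<le> ln x" "ln x \<le> \<L>" "x > 0"
    and K: "\<And>s. s \<in> strip_box (1 / \<L>) T \<Longrightarrow> norm (F s * (\<Sum>i\<in>I. c i * exp (- of_real (\<mu> i) * s))) \<le> K"
    and K1: "\<And>s. s \<in> strip_box (1 / \<L>) T \<Longrightarrow> norm (F s * (\<Sum>i\<in>I. c i * of_real (\<mu> i) * exp (- of_real (\<mu> i) * s))) \<le> K"
    and \<alpha>: "0 \<le> \<alpha>" "\<alpha> \<le> 1 / 4"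
  shows "norm (\<Sum>d | T \<le> real d \<and> real d \<le> x. Lam d * (\<Sum>i\<in>I. c i * logq h (x * exp (- \<mu> i) / real d) (\<mu> i) \<alpha>)) \<le>
     x * quad_const \<L> T h K M / (\<alpha> + 1 / ln x)"
proof -
  let ?D = "{d. T \<le> real d \<and> real d \<le> x}"
  have finD: "finite ?D" by (rule finite_subset[OF _ finite_nat_le[of x]]) auto
  have D1: "d \<ge> 1" if "d \<in> ?D" for d using that T by (cases d) auto
  define \<beta> where "\<beta> = 1 / ln x"
  define \<gamma> where "\<gamma> = \<alpha> + \<beta>"
  \<comment> \<open>The two lines are 1 - \<alpha> + \<beta> and 1 + \<alpha> + \<beta>; their
    distance 2 \<alpha> is the shift inside \<open>logq\<close>, and \<beta> keeps the second one to
    the right of 1 at \<alpha> = 0.\<close>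
  define cc where "cc = 1 - \<alpha> + \<beta>"
  have lx0: "ln x > 0" using x by linarith
  have L8: "\<L> \<ge> 8" using x by linarith
  have \<beta>: "0 < \<beta>" "\<beta> \<le> 1 / 8" "1 / \<L> \<le> \<beta>"
  proof -
    show "0 < \<beta>" unfolding \<beta>_def by (rule divide_pos_pos[OF zero_less_one lx0])
    show "\<beta> \<le> 1 / 8" unfolding \<beta>_def by (rule divide_left_mono) (use x lx0 in auto)
    show "1 / \<L> \<le> \<beta>" unfolding \<beta>_def by (rule divide_left_mono) (use x lx0 L8 in auto)
  qed
  have \<gamma>: "0 < \<gamma>" "\<gamma> \<le> 3 / 8" "\<beta> \<le> \<gamma>" using \<alpha> \<beta> by (auto simp: \<gamma>_def)
  have inv\<gamma>: "1 / \<gamma> \<le> \<L>"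
  proof -
    have "1 / \<gamma> \<le> 1 / \<beta>" using \<gamma> \<beta> by (intro divide_left_mono) auto
    also have "1 / \<beta> = ln x" by (simp add: \<beta>_def)
    finally show ?thesis using x by linarith
  qed
  have cc: "3 / 4 \<le> cc" "cc \<le> 2" "cc > 0" "cc + 2 * \<alpha> = 1 + \<gamma>" "cc + 2 * \<alpha> > 1"
    using \<alpha> \<beta> \<gamma> by (auto simp: cc_def \<gamma>_def)
  define G where "G = CF * \<L> powr A"
  have G0: "G \<ge> 0" using CF_ge_1 by (simp add: G_def)
  have E0: "E \<ge> 0" using E_ge by simp
  have M0: "M \<ge> 0" by (rule order.trans[OF _ M]) (intro sum_nonneg, auto)
  have K0: "K \<ge> 0"
    using K[of 2] L8 T by (intro order.trans[OF norm_ge_zero K[of 2]]) (auto simp: strip_box_def)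
  have lT: "ln T \<ge> 0" "ln (3 * T) \<ge> 0" using T by auto
  define P where "P = (\<lambda>s. \<Sum>i\<in>I. c i * exp (- of_real (\<mu> i) * s))"
  define P1 where "P1 = (\<lambda>s. \<Sum>i\<in>I. c i * of_real (\<mu> i) * exp (- of_real (\<mu> i) * s))"
  define z where "z = (\<lambda>t. Complex (1 + \<gamma>) t)"
  define H where "H = (\<lambda>t. F (z t) * P (z t) * ds Lam (z t) + F (z t) * P1 (z t))"
  define Dd where "Dd = (\<lambda>t. \<Sum>d\<in>?D. Lam d * of_nat d powr (- Complex cc t))"
  let ?k = "\<lambda>t. mellin_kernel h (Complex cc t)"
  let ?e = "\<lambda>t. exp (Complex cc t * of_real (ln x))"
  define u where "u = (\<lambda>i d. x * exp (- \<mu> i) / real d)"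
  have u0: "u i d > 0" if "d \<in> ?D" for i d using D1[OF that] x by (auto simp: u_def)
  define J where "J = (\<lambda>d i t. exp (Complex cc t * of_real (ln (u i d))) * (of_real (exp (- 2 * \<alpha> * \<mu> i)) *
     (F (Complex (cc + 2 * \<alpha>) t) * (ds Lam (Complex (cc + 2 * \<alpha>) t) + of_real (\<mu> i)))) * ?k t)"
  have intJ: "integrable lborel (J d i)" if "d \<in> ?D" "i \<in> I" for d i
    unfolding J_def by (rule logq_perron(1)[OF h(1) u0[OF that(1)] I(2)[OF that(2)] \<alpha>(1) cc(3) cc(5)])
  have logq_eq: "logq h (u i d) (\<mu> i) \<alpha> = (LINT t|lborel. J d i t) / of_real pi" if "d \<in> ?D" "i \<in> I" for d i
    unfolding J_def logq_perron(2)[OF h(1) u0[OF that(1)] I(2)[OF that(2)] \<alpha>(1) cc(3) cc(5)] by simp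
  have JH: "(\<Sum>d\<in>?D. \<Sum>i\<in>I. Lam d * c i * J d i t) = ?e t * (Dd t * H t * ?k t)" for t
  proof -
    have J_eq: "J d i t = ?e t * of_nat d powr (- Complex cc t) * (exp (- of_real (\<mu> i) * z t) * (F (z t) * (ds Lam (z t) + of_real (\<mu> i)))) * ?k t"
      if "d \<in> ?D" for d i
    proof -
      have l: "ln (u i d) = ln x - \<mu> i - ln (real d)" using D1[OF that] x by (simp add: u_def ln_div ln_mult)
      have "Complex cc t * of_real (ln (u i d)) + of_real (- 2 * \<alpha> * \<mu> i) =
          Complex cc t * of_real (ln x) + (- Complex cc t * of_real (ln (real d))) + (- of_real (\<mu> i) * z t)"
        unfolding l z_def by (simp add: complex_eq_iff algebra_simps cc_def \<gamma>_def)
      hence "exp (Complex cc t * of_real (ln (u i d))) * of_real (exp (- 2 * \<alpha> * \<mu> i)) =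
          ?e t * exp (- Complex cc t * of_real (ln (real d))) * exp (- of_real (\<mu> i) * z t)"
        by (simp only: exp_add [symmetric] exp_of_real [symmetric])
      also have "exp (- Complex cc t * of_real (ln (real d))) = of_nat d powr (- Complex cc t)"
        using D1[OF that] Ln_of_real[of "real d"] by (simp add: powr_def)
      finally show ?thesis unfolding J_def cc(4) z_def [symmetric] by (simp only: mult.assoc [symmetric])
    qed
    have "(\<Sum>d\<in>?D. \<Sum>i\<in>I. Lam d * c i * J d i t) =
       (\<Sum>d\<in>?D. \<Sum>i\<in>I. (?e t * ?k t) * ((Lam d * of_nat d powr (- Complex cc t)) *
          (c i * exp (- of_real (\<mu> i) * z t) * (F (z t) * (ds Lam (z t) + of_real (\<mu> i))))))"
      by (intro sum.cong refl) (simp only: J_eq mult_ac)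
    also have "\<dots> = (?e t * ?k t) * (Dd t * (\<Sum>i\<in>I. c i * exp (- of_real (\<mu> i) * z t) * (F (z t) * (ds Lam (z t) + of_real (\<mu> i)))))"
      unfolding Dd_def by (simp only: sum_distrib_left [symmetric] sum_product)
    also have "(\<Sum>i\<in>I. c i * exp (- of_real (\<mu> i) * z t) * (F (z t) * (ds Lam (z t) + of_real (\<mu> i)))) = H t"
      unfolding H_def P_def P1_def sum_distrib_left sum_distrib_right sum.distrib [symmetric]
      by (intro sum.cong refl) (simp add: algebra_simps)
    finally show ?thesis by (simp only: mult_ac)
  qed
  have T1: "T \<ge> 1" using T by simp
  obtain N where N: "\<And>t. norm (ds Lam (z t)) \<le> E * (1 + ln T) + 1 +
      norm (\<Sum>d\<in>{d\<in>{..<N}. real d \<ge> T}. Lam d * of_nat d powr (- Complex (1 + \<gamma>) t))"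
    using Lam_split[OF \<gamma>(1) T1] unfolding z_def by blast
  define Lb where "Lb = (\<lambda>t. \<Sum>d\<in>{d\<in>{..<N}. real d \<ge> T}. Lam d * of_nat d powr (- Complex (1 + \<gamma>) t))"
  define S0 where "S0 = E * (1 + ln T) + 2"
  have S00: "S0 \<ge> 0" using E0 lT by (simp add: S0_def)
  define H1 where "H1 = 2 * E * (1 + \<L>) * M * G"
  have H10: "H1 \<ge> 0" using E0 L8 M0 G0 by (simp add: H1_def)
  define e0 where "e0 = exp (- (h * T)\<^sup>2 / 4)"
  \<comment> \<open>The mean square of \<open>Dd\<close> is larger than that of \<open>Lb\<close> by
    the square of x^\<gamma>; this weight in Cauchy--Schwarz makes both contribute
    x^\<gamma>.\<close>
  define \<theta> where "\<theta> = x powr (- \<gamma>)"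
  have \<theta>0: "\<theta> > 0" using x by (simp add: \<theta>_def)
  have xg: "x powr \<gamma> = 1 / \<theta>" by (simp add: \<theta>_def powr_minus_divide)
  define C3 where "C3 = 3 * (2 * E * x powr \<gamma> * (1 + \<L>)) * H1"
  have C30: "C3 \<ge> 0" using E0 L8 H10 by (simp add: C3_def)
  have Hin: "norm (H t) \<le> K * (S0 + norm (Lb t))" if "\<bar>t\<bar> \<le> T" for t
  proof -
    have zb: "z t \<in> strip_box (1 / \<L>) T" using that \<gamma> \<beta> by (auto simp: strip_box_def z_def)
    have "norm (H t) \<le> norm (F (z t) * P (z t)) * norm (ds Lam (z t)) + norm (F (z t) * P1 (z t))"
      unfolding H_def by (rule order.trans[OF norm_triangle_ineq]) (simp add: norm_mult)
    also have "\<dots> \<le> K * (E * (1 + ln T) + 1 + norm (Lb t)) + K"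
      using K[OF zb] K1[OF zb] N[of t] K0 unfolding P_def P1_def Lb_def by (intro add_mono mult_mono) auto
    also have "\<dots> = K * (S0 + norm (Lb t))" by (simp add: S0_def algebra_simps)
    finally show ?thesis .
  qed
  have Hout: "norm (H t) \<le> H1" for t
  proof -
    have F_le: "norm (F (z t)) \<le> G"
    proof -
      have "norm (F (z t)) \<le> rds (\<lambda>n. norm (f n)) (1 + \<gamma>)"
        using norm_ds_le[OF f_conv, of "z t"] \<gamma> by (simp add: F_def z_def)
      also have "\<dots> \<le> rds (\<lambda>n. norm (f n)) (1 + 1 / ln x)"
        using \<gamma> \<beta> unfolding \<beta>_def [symmetric] by (intro rds_antimono) (auto intro!: f_conv)
      also have "\<dots> \<le> G" unfolding G_def using x by (intro rds_norm_f_le') auto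
      finally show ?thesis .
    qed
    have ex: "norm (exp (- of_real (\<mu> i) * z t)) \<le> exp (- \<mu> i)" if "i \<in> I" for i
    proof -
      have "\<mu> i * 1 \<le> \<mu> i * (1 + \<gamma>)" using I(2)[OF that] \<gamma> by (intro mult_left_mono) auto
      thus ?thesis by (simp add: norm_exp_eq_Re z_def)
    qed
    have P_le: "norm (P (z t)) \<le> M"
    proof -
      have "norm (P (z t)) \<le> (\<Sum>i\<in>I. norm (c i) * exp (- \<mu> i))" unfolding P_def
        by (rule sum_norm_le) (unfold norm_mult, intro mult_left_mono ex, auto)
      thus ?thesis using M by linarith
    qed
    have P1_le: "norm (P1 (z t)) \<le> \<L> * M"
    proof -
      have "norm (P1 (z t)) \<le> (\<Sum>i\<in>I. \<L> * (norm (c i) * exp (- \<mu> i)))" unfolding P1_def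
      proof (rule sum_norm_le)
        fix i assume i: "i \<in> I"
        have "norm (c i * of_real (\<mu> i) * exp (- of_real (\<mu> i) * z t)) = norm (c i) * \<mu> i * norm (exp (- of_real (\<mu> i) * z t))"
          using I(2)[OF i] by (simp add: norm_mult)
        also have "\<dots> \<le> norm (c i) * \<L> * exp (- \<mu> i)"
          using I(2,3)[OF i] L8 by (intro mult_mono ex[OF i]) auto
        finally show "norm (c i * of_real (\<mu> i) * exp (- of_real (\<mu> i) * z t)) \<le> \<L> * (norm (c i) * exp (- \<mu> i))"
          by (simp only: mult_ac)
      qed
      also have "\<dots> = \<L> * (\<Sum>i\<in>I. norm (c i) * exp (- \<mu> i))" by (simp only: sum_distrib_left)
      also have "\<dots> \<le> \<L> * M" using M L8 by (intro mult_left_mono) auto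
      finally show ?thesis .
    qed
    have L_le: "norm (ds Lam (z t)) \<le> E * (1 + \<L>)"
    proof -
      have "norm (ds Lam (z t)) \<le> rds nL (1 + \<gamma>)"
        using norm_ds_le[OF abs_conv_Lam, of "z t"] \<gamma> by (simp add: z_def norm_Lam)
      also have "\<dots> \<le> E * (1 + 1 / (1 + \<gamma> - 1))" using \<gamma> by (intro block_abs_conv(2)[OF nL_block]) auto
      also have "\<dots> \<le> E * (1 + \<L>)" using inv\<gamma> E0 by (intro mult_left_mono) auto
      finally show ?thesis .
    qed
    have "norm (H t) \<le> norm (F (z t)) * norm (P (z t)) * norm (ds Lam (z t)) + norm (F (z t)) * norm (P1 (z t))"
      unfolding H_def by (rule order.trans[OF norm_triangle_ineq]) (simp add: norm_mult)
    also have "\<dots> \<le> G * M * (E * (1 + \<L>)) + G * (\<L> * M)"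
      using F_le P_le P1_le L_le G0 M0 by (intro add_mono mult_mono mult_nonneg_nonneg) auto
    also have "G * (\<L> * M) \<le> G * M * (E * (1 + \<L>))"
    proof -
      have "\<L> \<le> 1 * (1 + \<L>)" by simp
      also have "\<dots> \<le> E * (1 + \<L>)" using E_ge L8 by (intro mult_right_mono) auto
      finally have "\<L> \<le> E * (1 + \<L>)" .
      from mult_left_mono[OF this, of "G * M"] show ?thesis using G0 M0 by (simp add: mult_ac)
    qed
    finally show ?thesis by (simp add: H1_def mult_ac)
  qed
  have Dout: "norm (Dd t) \<le> 2 * E * x powr \<gamma> * (1 + \<L>)" for t
  proof -
    have x1: "x \<ge> 1" using ln_ge_zero_iff[OF x(3)] lx0 by linarith
    have "norm (Dd t) \<le> (\<Sum>d\<in>?D. nL d * real d powr (- 1 + \<gamma>))" unfolding Dd_def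
    proof (rule sum_norm_le)
      fix d assume d: "d \<in> ?D"
      have "real d powr (- cc) \<le> real d powr (- 1 + \<gamma>)"
        using D1[OF d] \<beta> by (intro powr_mono) (auto simp: cc_def \<gamma>_def)
      from mult_left_mono[OF this nL_nonneg[of d]]
      show "norm (Lam d * of_nat d powr (- Complex cc t)) \<le> nL d * real d powr (- 1 + \<gamma>)"
        unfolding norm_ds_term norm_Lam by simp
    qed
    also have "\<dots> \<le> (\<Sum>n | 1 \<le> n \<and> real n \<le> x. nL n * real n powr (- 1 + \<gamma>))"
      using D1 by (intro sum_mono2 finite_nat_le_real) (auto simp: nL_nonneg)
    also have "\<dots> \<le> E * exp \<gamma> * x powr \<gamma> * (1 + 1 / \<gamma>)" by (rule block_sum_powr[OF nL_block x1 \<gamma>(1)])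
    also have "\<dots> \<le> E * 2 * x powr \<gamma> * (1 + \<L>)"
      using exp_le_2[of \<gamma>] \<gamma> inv\<gamma> E0 by (intro mult_mono mult_nonneg_nonneg) auto
    finally show ?thesis by (simp add: mult_ac)
  qed
  let ?ind = "\<lambda>t. indicator {-T..T} t :: real"
  \<comment> \<open>Within |t| <= T: \<open>B1\<close> is the sum over d, \<open>B2\<close> the
    bounded part and \<open>B3\<close> the large part of the series of \<open>Lam\<close>.
    \<open>B4\<close> covers the tail.\<close>
  define B1 where "B1 = (\<lambda>t. (3 * K / 2 * \<theta>) * (?ind t * (norm (Dd t))\<^sup>2))"
  define B2 where "B2 = (\<lambda>t. (3 * K / \<theta> * S0\<^sup>2) * (?ind t * (1 / sqrt (1 + t\<^sup>2))))"
  define B3 where "B3 = (\<lambda>t. (3 * K / \<theta>) * (?ind t * (norm (Lb t))\<^sup>2))"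
  define B4 where "B4 = (\<lambda>t. C3 * (e0 * exp (- (h * t)\<^sup>2 / 4)))"
  have Lb1: "d \<ge> 1" if "d \<in> {d\<in>{..<N}. real d \<ge> T}" for d using that T by (cases d) auto
  have iB: "integrable lborel B1" "integrable lborel B2" "integrable lborel B3" "integrable lborel B4"
    unfolding B1_def B2_def B3_def B4_def Dd_def Lb_def e0_def
    by (rule integrable_mult_right integrable_indicator_dirichlet_poly D1 Lb1
        integral_inverse_sqrt(1)[OF T1] gauss_tail(1)[OF h(1)] | assumption)+
  have bound: "norm (Dd t * H t * ?k t) \<le> B1 t + B2 t + B3 t + B4 t" for t
  proof -
    have k1: "norm (?k t) \<le> 3 * exp (- (h * t)\<^sup>2 / 2) / sqrt (1 + t\<^sup>2)"
      using norm_mellin_kernel_le[OF h cc(1) cc(2)] .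
    have s1: "sqrt (1 + t\<^sup>2) \<ge> 1" by simp
    show ?thesis
    proof (cases "\<bar>t\<bar> \<le> T")
      case True
      define w where "w = 1 / sqrt (1 + t\<^sup>2)"
      have w: "0 < w" "w \<le> 1" using s1 by (auto simp: w_def add_pos_nonneg)
      have "norm (?k t) \<le> 3 * 1 / sqrt (1 + t\<^sup>2)"
        by (rule order.trans[OF k1]) (use s1 in \<open>intro divide_right_mono mult_left_mono, auto\<close>)
      hence kw: "norm (?k t) \<le> 3 * w" by (simp add: w_def)
      let ?a = "norm (Dd t)" and ?b = "norm (Lb t)"
      have "norm (Dd t * H t * ?k t) \<le> ?a * (K * (S0 + ?b)) * (3 * w)"
        unfolding norm_mult using Hin[OF True] kw K0 S00 by (intro mult_mono mult_nonneg_nonneg) auto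
      also have "\<dots> = 3 * K * (?a * ((S0 + ?b) * w))" by simp
      also have "?a * ((S0 + ?b) * w) \<le> (\<theta> / 2) * ?a\<^sup>2 + (S0\<^sup>2 * w + ?b\<^sup>2) / \<theta>"
      proof -
        have "0 \<le> (\<theta> * ?a - (S0 + ?b) * w)\<^sup>2 / (2 * \<theta>)" using \<theta>0 by simp
        also have "\<dots> = (\<theta> / 2) * ?a\<^sup>2 + ((S0 + ?b) * w)\<^sup>2 / (2 * \<theta>) - ?a * ((S0 + ?b) * w)"
          using \<theta>0 by (simp add: power2_eq_square field_simps)
        finally have "?a * ((S0 + ?b) * w) \<le> (\<theta> / 2) * ?a\<^sup>2 + ((S0 + ?b) * w)\<^sup>2 / (2 * \<theta>)" by simp
        also have "((S0 + ?b) * w)\<^sup>2 / (2 * \<theta>) \<le> (2 * (S0\<^sup>2 * w + ?b\<^sup>2)) / (2 * \<theta>)"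
        proof (rule divide_right_mono)
          have "(S0 + ?b)\<^sup>2 \<le> 2 * (S0\<^sup>2 + ?b\<^sup>2)"
            using zero_le_power2[of "S0 - ?b"] by (simp add: power2_eq_square algebra_simps)
          hence "(S0 + ?b)\<^sup>2 * w\<^sup>2 \<le> 2 * (S0\<^sup>2 + ?b\<^sup>2) * w\<^sup>2" by (rule mult_right_mono) auto
          also have "\<dots> = 2 * (S0\<^sup>2 * w\<^sup>2 + ?b\<^sup>2 * w\<^sup>2)" by (simp add: algebra_simps)
          \<comment> \<open>The constant S0 must keep a factor w, as its integral over |t| <= T
            would otherwise be of size T. For \<open>Lb\<close> the mean square is already bounded,
            so w is dropped.\<close>
          also have "\<dots> \<le> 2 * (S0\<^sup>2 * w + ?b\<^sup>2 * 1)"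
            using w by (intro mult_left_mono add_mono) (auto simp: power2_eq_square mult_left_le mult_le_one)
          finally show "((S0 + ?b) * w)\<^sup>2 \<le> 2 * (S0\<^sup>2 * w + ?b\<^sup>2)" by (simp add: power_mult_distrib)
        qed (use \<theta>0 in auto)
        also have "(2 * (S0\<^sup>2 * w + ?b\<^sup>2)) / (2 * \<theta>) = (S0\<^sup>2 * w + ?b\<^sup>2) / \<theta>" by (rule mult_divide_mult_cancel_left) simp
        finally show ?thesis by simp
      qed
      also have "3 * K * ((\<theta> / 2) * ?a\<^sup>2 + (S0\<^sup>2 * w + ?b\<^sup>2) / \<theta>) = B1 t + B2 t + B3 t"
        using True by (simp add: B1_def B2_def B3_def w_def abs_le_iff minus_le_iff add_divide_distrib algebra_simps)
      also have "\<dots> \<le> B1 t + B2 t + B3 t + B4 t" using C30 by (simp add: B4_def e0_def)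
      finally show ?thesis using K0 by (simp add: mult_left_mono)
    next
      case False
      have kk: "norm (?k t) \<le> 3 * (e0 * exp (- (h * t)\<^sup>2 / 4)) / 1"
        by (rule order.trans[OF k1]) (use s1 gauss_tail(3)[OF h(1) False] T in \<open>intro frac_le mult_left_mono, auto simp: e0_def\<close>)
      have "norm (Dd t * H t * ?k t) \<le> (2 * E * x powr \<gamma> * (1 + \<L>)) * H1 * (3 * (e0 * exp (- (h * t)\<^sup>2 / 4)) / 1)"
        unfolding norm_mult using Dout Hout kk H10 E0 L8 by (intro mult_mono mult_nonneg_nonneg) auto
      also have "\<dots> = B4 t" by (simp add: B4_def C3_def)
      also have "\<dots> \<le> B1 t + B2 t + B3 t + B4 t" using K0 \<theta>0 by (simp add: B1_def B2_def B3_def)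
      finally show ?thesis .
    qed
  qed
  have x1: "x \<ge> 1" using ln_ge_zero_iff[OF x(3)] lx0 by linarith
  have inv2: "1 + 1 / (2 * \<gamma>) \<le> 1 / \<gamma>" using \<gamma> by (simp add: field_simps)
  have e1: "exp (2 * \<gamma>) \<le> 3" using exp_le \<gamma> by (intro order.trans[OF _ exp_le]) simp
  have I1: "(LINT t|lborel. B1 t) \<le> (3 * K / 2 * \<theta>) * (1080 * ln T * (3 * E * (x powr \<gamma>)\<^sup>2 / \<gamma>))"
  proof -
    have "(\<Sum>d\<in>?D. qL d * real d powr (1 - 2 * cc)) \<le> (\<Sum>d\<in>?D. qL d * real d powr (- 1 + 2 * \<gamma>))"
      using D1 \<beta> by (intro sum_mono mult_left_mono powr_mono qL_nonneg) (auto simp: cc_def \<gamma>_def)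
    also have "\<dots> \<le> (\<Sum>n | 1 \<le> n \<and> real n \<le> x. qL n * real n powr (- 1 + 2 * \<gamma>))"
      using D1 by (intro sum_mono2 finite_nat_le_real) (auto simp: qL_nonneg)
    also have "\<dots> \<le> E * exp (2 * \<gamma>) * x powr (2 * \<gamma>) * (1 + 1 / (2 * \<gamma>))"
      using \<gamma> by (intro block_sum_powr[OF qL_block x1]) auto
    also have "\<dots> \<le> E * 3 * x powr (2 * \<gamma>) * (1 / \<gamma>)"
      using inv2 e1 E0 \<gamma> by (intro mult_mono mult_nonneg_nonneg) auto
    also have "x powr (2 * \<gamma>) = (x powr \<gamma>)\<^sup>2" by (simp add: power2_eq_square flip: powr_add)
    finally have s: "(\<Sum>d\<in>?D. qL d * real d powr (1 - 2 * cc)) \<le> 3 * E * (x powr \<gamma>)\<^sup>2 / \<gamma>" by (simp add: mult_ac)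
    have "(LINT t|lborel. ?ind t * (norm (Dd t))\<^sup>2) \<le> 1080 * ln T * (\<Sum>d\<in>?D. qL d * real d powr (1 - 2 * cc))"
      unfolding Dd_def using T finD by (intro mean_square_Lam) auto
    also have "\<dots> \<le> 1080 * ln T * (3 * E * (x powr \<gamma>)\<^sup>2 / \<gamma>)" using s lT by (intro mult_left_mono) auto
    finally show ?thesis unfolding B1_def integral_mult_right_zero using K0 \<theta>0 by (intro mult_left_mono) auto
  qed
  have I2: "(LINT t|lborel. B2 t) \<le> (3 * K / \<theta> * S0\<^sup>2) * (2 * ln (3 * T))"
    unfolding B2_def integral_mult_right_zero using K0 \<theta>0 T by (intro mult_left_mono integral_inverse_sqrt(2)) auto
  have I3: "(LINT t|lborel. B3 t) \<le> (3 * K / \<theta>) * (1080 * ln T * (E / \<gamma>))"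
  proof -
    let ?S = "{d\<in>{..<N}. real d \<ge> T}"
    have "(\<Sum>d\<in>?S. qL d * real d powr (1 - 2 * (1 + \<gamma>))) = (\<Sum>d\<in>?S. qL d * real d powr (- (1 + 2 * \<gamma>)))"
      by (simp add: algebra_simps)
    also have "\<dots> \<le> E * (1 + 1 / (2 * \<gamma>))" using \<gamma> by (intro block_sum_powr_minus[OF qL_block]) auto
    also have "\<dots> \<le> E * (1 / \<gamma>)" using inv2 E0 by (intro mult_left_mono) auto
    finally have s: "(\<Sum>d\<in>?S. qL d * real d powr (1 - 2 * (1 + \<gamma>))) \<le> E / \<gamma>" by simp
    have "(LINT t|lborel. ?ind t * (norm (Lb t))\<^sup>2) \<le> 1080 * ln T * (\<Sum>d\<in>?S. qL d * real d powr (1 - 2 * (1 + \<gamma>)))"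
      unfolding Lb_def using T by (intro mean_square_Lam) auto
    also have "\<dots> \<le> 1080 * ln T * (E / \<gamma>)" using s lT by (intro mult_left_mono) auto
    finally show ?thesis unfolding B3_def integral_mult_right_zero using K0 \<theta>0 by (intro mult_left_mono) auto
  qed
  have I4: "(LINT t|lborel. B4 t) \<le> C3 * (4 * e0 / h)"
    unfolding B4_def integral_mult_right_zero e0_def using C30 gauss_tail(2)[OF h(1), of T] by (intro mult_left_mono) auto
  define Z where "Z = 3 * K / 2 * (5400 * E * ln T + 4 * S0\<^sup>2 * ln (3 * T)) + 24 * E * (1 + \<L>) * H1 * e0 / h"
  have IB: "(LINT t|lborel. B1 t + B2 t + B3 t + B4 t) \<le> x powr \<gamma> * (Z / \<gamma>)"
  proof -
    have "(LINT t|lborel. B1 t + B2 t + B3 t + B4 t) = (LINT t|lborel. B1 t) + (LINT t|lborel. B2 t) + (LINT t|lborel. B3 t) + (LINT t|lborel. B4 t)"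
      using iB by (simp only: Bochner_Integration.integral_add Bochner_Integration.integrable_add)
    also have "\<dots> \<le> (3 * K / 2 * \<theta>) * (1080 * ln T * (3 * E * (x powr \<gamma>)\<^sup>2 / \<gamma>)) + (3 * K / \<theta> * S0\<^sup>2) * (2 * ln (3 * T)) +
      (3 * K / \<theta>) * (1080 * ln T * (E / \<gamma>)) + C3 * (4 * e0 / h)" by (intro add_mono I1 I2 I3 I4)
    also have "\<dots> = x powr \<gamma> * (3 * K / 2 * (5400 * E * ln T) / \<gamma> + (3 * K / 2 * (4 * S0\<^sup>2 * ln (3 * T)) + 24 * E * (1 + \<L>) * H1 * e0 / h) * 1)"
      unfolding C3_def xg using \<theta>0 \<gamma> h by (simp add: field_simps power2_eq_square)
    also have "\<dots> \<le> x powr \<gamma> * (3 * K / 2 * (5400 * E * ln T) / \<gamma> + (3 * K / 2 * (4 * S0\<^sup>2 * ln (3 * T)) + 24 * E * (1 + \<L>) * H1 * e0 / h) * (1 / \<gamma>))"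
      using \<gamma> K0 lT E0 L8 H10 h x by (intro mult_left_mono add_left_mono add_nonneg_nonneg divide_nonneg_pos mult_nonneg_nonneg) (auto simp: e0_def)
    also have "\<dots> = x powr \<gamma> * (Z / \<gamma>)" using \<gamma> by (simp add: Z_def field_simps)
    finally show ?thesis .
  qed
  have ne: "norm (?e t) = x powr cc" for t using x by (simp add: norm_exp_eq_Re powr_def)
  have "(\<Sum>d\<in>?D. Lam d * (\<Sum>i\<in>I. c i * logq h (u i d) (\<mu> i) \<alpha>)) =
      (\<Sum>d\<in>?D. \<Sum>i\<in>I. (LINT t|lborel. Lam d * c i * J d i t) / of_real pi)"
    unfolding sum_distrib_left
    by (intro sum.cong refl) (simp add: logq_eq mult.assoc)
  also have "\<dots> = (LINT t|lborel. (\<Sum>d\<in>?D. \<Sum>i\<in>I. Lam d * c i * J d i t)) / of_real pi"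
    by (subst Bochner_Integration.integral_sum, (intro Bochner_Integration.integrable_sum integrable_mult_right intJ; simp)?)
       (simp add: sum_divide_distrib Bochner_Integration.integral_sum intJ)
  also have "\<dots> = (LINT t|lborel. ?e t * (Dd t * H t * ?k t)) / of_real pi" unfolding JH ..
  finally have eq: "(\<Sum>d\<in>?D. Lam d * (\<Sum>i\<in>I. c i * logq h (u i d) (\<mu> i) \<alpha>)) = \<dots>" .
  have intE: "integrable lborel (\<lambda>t. ?e t * (Dd t * H t * ?k t))"
    unfolding JH [symmetric] by (intro Bochner_Integration.integrable_sum integrable_mult_right intJ)
  have "norm (LINT t|lborel. ?e t * (Dd t * H t * ?k t)) \<le> (LINT t|lborel. x powr cc * (B1 t + B2 t + B3 t + B4 t))"
  proof (rule lborel_norm_integral_le[OF intE])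
    show "integrable lborel (\<lambda>t. x powr cc * (B1 t + B2 t + B3 t + B4 t))"
      using iB by (intro integrable_mult_right Bochner_Integration.integrable_add)
    show "norm (?e t * (Dd t * H t * ?k t)) \<le> x powr cc * (B1 t + B2 t + B3 t + B4 t)" for t
      unfolding norm_mult[of "?e t"] ne by (intro mult_left_mono bound) auto
  qed
  also have "\<dots> \<le> x powr cc * (x powr \<gamma> * (Z / \<gamma>))"
    unfolding integral_mult_right_zero by (intro mult_left_mono IB) auto
  also have "\<dots> = (x powr cc * x powr \<gamma>) * (Z / \<gamma>)" by simp
  \<comment> \<open>The exponents add up to 1 + 2 / ln x: what the left line saves is exactly what
    the sum over d costs.\<close>
  also have "x powr cc * x powr \<gamma> = x * exp 2"
  proof -
    have "cc + \<gamma> = 1 + 2 * \<beta>" by (simp add: cc_def \<gamma>_def)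
    hence "x powr cc * x powr \<gamma> = x * x powr (2 * \<beta>)" using x by (simp flip: powr_add) (simp add: powr_add)
    also have "x powr (2 * \<beta>) = exp 2" using x lx0 by (simp add: powr_def \<beta>_def)
    finally show ?thesis .
  qed
  also have "x * exp 2 * (Z / \<gamma>) \<le> x * 9 * (Z / \<gamma>)"
  proof (intro mult_right_mono mult_left_mono)
    have "exp 2 = exp 1 * exp (1 :: real)" by (simp flip: exp_add)
    also have "\<dots> \<le> 3 * 3" by (intro mult_mono exp_le) auto
    finally show "exp 2 \<le> (9 :: real)" by simp
    show "0 \<le> Z / \<gamma>" unfolding Z_def using \<gamma> K0 lT E0 L8 H10 h
      by (intro divide_nonneg_pos add_nonneg_nonneg mult_nonneg_nonneg) (auto simp: e0_def)
  qed (use x in auto)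
  finally have nn: "norm (LINT t|lborel. ?e t * (Dd t * H t * ?k t)) \<le> x * 9 * (Z / \<gamma>)" .
  have "norm (\<Sum>d\<in>?D. Lam d * (\<Sum>i\<in>I. c i * logq h (u i d) (\<mu> i) \<alpha>)) = norm (LINT t|lborel. ?e t * (Dd t * H t * ?k t)) / pi"
    unfolding eq by (simp add: norm_divide)
  also have "\<dots> \<le> norm (LINT t|lborel. ?e t * (Dd t * H t * ?k t)) / 3"
    using pi_gt3 by (intro divide_left_mono) auto
  also have "\<dots> \<le> x * 9 * (Z / \<gamma>) / 3" using nn by (intro divide_right_mono) auto
  also have "\<dots> = x * (3 * Z) / \<gamma>" by simp
  also have "3 * Z = quad_const \<L> T h K M"
    by (simp add: Z_def quad_const_def S0_def H1_def G_def e0_def)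
  finally show ?thesis unfolding u_def \<gamma>_def \<beta>_def .
qed

end

section \<open>The logarithmically weighted oscillation\<close>

lemma has_integral_ln_indicator:
  assumes m: "1 \<le> m" "m \<le> x"
  shows "((\<lambda>u. if m \<le> u then 1 / u else 0) has_integral ln (x / m)) {1..x :: real}"
proof -
  have "((\<lambda>u. 1 / u) has_integral (ln x - ln m)) {m..x}"
    using m by (intro fundamental_theorem_of_calculus)
       (auto intro!: derivative_eq_intros simp: has_real_derivative_iff_has_vector_derivative [symmetric] divide_inverse)
  hence "((\<lambda>u. if u \<in> {m..x} then 1 / u else 0) has_integral ln (x / m)) {1..x}"
    using m by (subst has_integral_restrict) (auto simp: ln_div)
  thus ?thesis by (rule has_integral_cong[THEN iffD1, rotated]) (use m in auto)
qed

context dirichlet_data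
begin

lemma summatory_altdef:
  assumes "v \<le> x"
  shows "summatory f v = (\<Sum>n | 1 \<le> n \<and> real n \<le> x. if real n \<le> v then f n else 0)"
  unfolding summatory_def
  using assms by (intro sum.mono_neutral_cong_left finite_nat_le_real) auto

text \<open>Since ln (v / n) is an integral of 1 / u, the weighted sum is the integral of the
  oscillation at u against du / u over [1, x]. A bound linear in u therefore loses no
  logarithm.\<close>

lemma log_integral_bound:
  fixes c :: "'i \<Rightarrow> complex" and \<mu> :: "'i \<Rightarrow> real"
  assumes I: "finite I" "\<And>i. i \<in> I \<Longrightarrow> 0 \<le> \<mu> i" and x: "x \<ge> 1" and K: "K \<ge> 0"
    and O: "\<And>u. 1 \<le> u \<Longrightarrow> u \<le> x \<Longrightarrow> norm (\<Sum>i\<in>I. c i * summatory f (u * exp (- \<mu> i))) \<le> K * u"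
  shows "norm (\<Sum>i\<in>I. c i * (\<Sum>n | 1 \<le> n \<and> real n \<le> x * exp (- \<mu> i). f n * of_real (ln (x * exp (- \<mu> i) / real n)))) \<le> K * x"
proof -
  let ?N = "{n. 1 \<le> n \<and> real n \<le> x}"
  let ?Z = "\<Sum>i\<in>I. c i * (\<Sum>n | 1 \<le> n \<and> real n \<le> x * exp (- \<mu> i). f n * of_real (ln (x * exp (- \<mu> i) / real n)))"
  let ?Zn = "\<lambda>i n. if real n * exp (\<mu> i) \<le> x then ln (x / (real n * exp (\<mu> i))) else 0"
  let ?h = "\<lambda>i n u. (if real n * exp (\<mu> i) \<le> u then 1 / u else 0)"
  have exle: "real n \<le> v * exp (- \<mu> i) \<longleftrightarrow> real n * exp (\<mu> i) \<le> v" for n i v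
    by (simp add: exp_minus field_simps)
  have xle: "x * exp (- \<mu> i) \<le> x" if "i \<in> I" for i using I(2)[OF that] x by simp
  have Zeq: "?Z = (\<Sum>i\<in>I. \<Sum>n\<in>?N. c i * f n * of_real (?Zn i n))"
  proof (intro sum.cong refl)
    fix i assume i: "i \<in> I"
    have "(\<Sum>n | 1 \<le> n \<and> real n \<le> x * exp (- \<mu> i). f n * of_real (ln (x * exp (- \<mu> i) / real n))) = (\<Sum>n\<in>?N. f n * of_real (?Zn i n))"
    proof (intro sum.mono_neutral_cong_left finite_nat_le_real ballI)
      show "{n. 1 \<le> n \<and> real n \<le> x * exp (- \<mu> i)} \<subseteq> ?N" using xle[OF i] by auto
      fix n assume "n \<in> ?N - {n. 1 \<le> n \<and> real n \<le> x * exp (- \<mu> i)}"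
      thus "f n * of_real (?Zn i n) = 0" by (simp add: exle)
    next
      fix n assume n: "n \<in> {n. 1 \<le> n \<and> real n \<le> x * exp (- \<mu> i)}"
      have "x * exp (- \<mu> i) / real n = x / (real n * exp (\<mu> i))" by (simp add: exp_minus field_simps)
      thus "f n * of_real (ln (x * exp (- \<mu> i) / real n)) = f n * of_real (?Zn i n)"
        using n by (simp only: mem_Collect_eq exle if_True)
    qed
    thus "c i * (\<Sum>n | 1 \<le> n \<and> real n \<le> x * exp (- \<mu> i). f n * of_real (ln (x * exp (- \<mu> i) / real n))) =
      (\<Sum>n\<in>?N. c i * f n * of_real (?Zn i n))" by (simp only: sum_distrib_left mult.assoc)
  qed
  have hi: "(?h i n has_integral ?Zn i n) {1..x}" if "i \<in> I" "n \<in> ?N" for i n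
  proof (cases "real n * exp (\<mu> i) \<le> x")
    case True
    have "1 * 1 \<le> real n * exp (\<mu> i)" using that I(2)[OF that(1)] by (intro mult_mono) auto
    thus ?thesis using True has_integral_ln_indicator[of "real n * exp (\<mu> i)" x] by simp
  next
    case False
    thus ?thesis by (auto intro!: has_integral_eq[OF _ has_integral_0])
  qed
  have "((\<lambda>u. \<Sum>i\<in>I. \<Sum>n\<in>?N. c i * f n * of_real (?h i n u)) has_integral ?Z) {1..x}"
    unfolding Zeq
  proof (intro has_integral_sum I finite_nat_le_real has_integral_mult_right)
    fix i n assume "i \<in> I" "n \<in> ?N"
    show "((\<lambda>u. complex_of_real (?h i n u)) has_integral complex_of_real (?Zn i n)) {1..x}"
      using has_integral_linear[OF hi[OF \<open>i \<in> I\<close> \<open>n \<in> ?N\<close>] bounded_linear_of_real] by (simp add: o_def)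
  qed
  hence "((\<lambda>u. \<Sum>i\<in>I. \<Sum>n\<in>?N. c i * f n * of_real (?h i n u)) has_integral ?Z) (cbox 1 x)" by simp
  hence "norm ?Z \<le> K * Henstock_Kurzweil_Integration.content (cbox 1 x)"
  proof (rule has_integral_bound[OF K])
    fix u assume u: "u \<in> cbox 1 x"
    hence u1: "1 \<le> u" "u \<le> x" by auto
    have "(\<Sum>i\<in>I. \<Sum>n\<in>?N. c i * f n * of_real (?h i n u)) = (\<Sum>i\<in>I. c i * summatory f (u * exp (- \<mu> i))) / of_real u"
    proof -
      have "u * exp (- \<mu> i) \<le> x" if "i \<in> I" for i
      proof -
        have "u * exp (- \<mu> i) \<le> u * 1" using I(2)[OF that] u1 by (intro mult_left_mono) auto
        thus ?thesis using u1 by linarith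
      qed
      hence "(\<Sum>i\<in>I. c i * summatory f (u * exp (- \<mu> i))) / of_real u =
        (\<Sum>i\<in>I. c i * (\<Sum>n\<in>?N. if real n \<le> u * exp (- \<mu> i) then f n else 0)) / of_real u"
        by (intro arg_cong2[where f = "(/)"] sum.cong refl arg_cong2[where f = "times"] summatory_altdef)
      also have "\<dots> = (\<Sum>i\<in>I. \<Sum>n\<in>?N. c i * f n * of_real (?h i n u))"
        unfolding sum_divide_distrib sum_distrib_left exle by (intro sum.cong refl) auto
      finally show ?thesis ..
    qed
    hence "norm (\<Sum>i\<in>I. \<Sum>n\<in>?N. c i * f n * of_real (?h i n u)) = norm (\<Sum>i\<in>I. c i * summatory f (u * exp (- \<mu> i))) / u"
      using u1 by (simp add: norm_divide)
    also have "\<dots> \<le> K" using O[OF u1] u1 by (simp add: field_simps)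
    finally show "norm (\<Sum>i\<in>I. \<Sum>n\<in>?N. c i * f n * of_real (?h i n u)) \<le> K" .
  qed
  also have "Henstock_Kurzweil_Integration.content (cbox 1 x) = x - 1" using x by simp
  also have "K * (x - 1) \<le> K * x" using K by (intro mult_left_mono) auto
  finally show ?thesis .
qed

lemma sum_f_ln_eq:
  assumes v: "v \<le> real N"
  shows "(\<Sum>n | 1 \<le> n \<and> real n \<le> v. f n * of_real (ln (real n))) = (\<Sum>d=1..N. Lam d * summatory f (v / real d))"
proof -
  let ?S = "{n. 1 \<le> n \<and> real n \<le> v}"
  have S: "?S \<subseteq> {1..N}"
  proof
    fix n assume "n \<in> ?S"
    hence "1 \<le> n" "real n \<le> real N" using v by auto
    thus "n \<in> {1..N}" by simp
  qed
  have "(\<Sum>n\<in>?S. f n * of_real (ln (real n))) = (\<Sum>n\<in>?S. dconv Lam f n)"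
    by (intro sum.cong refl f_log) auto
  also have "\<dots> = (\<Sum>d=1..N. Lam d * (\<Sum>m\<in>{m\<in>{1..N}. d * m \<in> ?S}. f m))" by (rule sum_dconv[OF S])
  also have "\<dots> = (\<Sum>d=1..N. Lam d * summatory f (v / real d))"
    unfolding summatory_def
  proof (intro sum.cong refl arg_cong2[where f = "times"])
    fix d assume d: "d \<in> {1..N}"
    show "{m\<in>{1..N}. d * m \<in> ?S} = {n. 1 \<le> n \<and> real n \<le> v / real d}"
    proof (intro equalityI subsetI)
      fix m assume m: "m \<in> {n. 1 \<le> n \<and> real n \<le> v / real d}"
      hence "real (d * m) \<le> v" using d by (simp add: field_simps)
      moreover have "1 * real m \<le> real d * real m" using d by (intro mult_right_mono) auto
      hence "real m \<le> real (d * m)" by simp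
      ultimately have "real m \<le> real N" using v by linarith
      thus "m \<in> {m\<in>{1..N}. d * m \<in> ?S}" using m d \<open>real (d * m) \<le> v\<close> by (auto simp: Suc_le_eq)
    next
      fix m assume "m \<in> {m\<in>{1..N}. d * m \<in> ?S}"
      thus "m \<in> {n. 1 \<le> n \<and> real n \<le> v / real d}" using d by (auto simp: field_simps)
    qed
  qed
  finally show ?thesis .
qed

lemma sum_nL_short_sum_le:
  assumes \<delta>: "0 < \<delta>" "\<delta> \<le> 1 / 20" "T * \<delta> \<ge> 1" and T: "T \<ge> 1" and u: "0 < u" "u \<le> x" and x: "ln x \<le> \<L>" "x \<ge> 1"
  shows "(\<Sum>d | T \<le> real d \<and> real d \<le> x. nL d * short_sum \<delta> (u / real d)) \<le>
     u * (sqrt \<delta> * (E + 20 * ln (1 / \<delta>)) * (3 * CF * (2 + \<L>) powr A))"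
proof -
  define N where "N = nat \<lfloor>2 * x\<rfloor>"
  have N: "real N \<le> 2 * x" "N \<ge> 1" using x by (auto simp: N_def le_nat_floor)
  have lx: "ln x \<ge> 0" using x by simp
  have lN: "ln (real N) \<le> 1 + \<L>"
  proof -
    have "ln (real N) \<le> ln (2 * x)" using N x by (subst ln_le_cancel_iff) auto
    also have "\<dots> = ln 2 + ln x" using x by (simp add: ln_mult)
    also have "\<dots> \<le> 1 + \<L>" using x ln2_le_25_over_36 by linarith
    finally show ?thesis .
  qed
  have d1: "d \<in> {d\<in>{1..N}. real d \<ge> T}" if "T \<le> real d" "real d \<le> x" for d
  proof -
    have "d \<ge> 1" using that T by (cases d) auto
    thus ?thesis using that x by (auto simp: N_def le_nat_floor)
  qed
  have "(\<Sum>d | T \<le> real d \<and> real d \<le> x. nL d * short_sum \<delta> (u / real d)) \<le>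
     (\<Sum>d\<in>{d\<in>{1..N}. real d \<ge> T}. nL d * short_sum \<delta> (u / real d))"
    using d1 by (intro sum_mono2) (auto intro!: mult_nonneg_nonneg nL_nonneg sum_nonneg simp: short_sum_def)
  also have "\<dots> \<le> (\<Sum>d\<in>{d\<in>{1..N}. real d \<ge> T}. nL d * (\<Sum>m\<in>{m\<in>{1..N}. d * m \<in> near \<delta> u}. norm (f m)))"
  proof (intro sum_mono mult_left_mono nL_nonneg)
    fix d assume d: "d \<in> {d\<in>{1..N}. real d \<ge> T}"
    show "short_sum \<delta> (u / real d) \<le> (\<Sum>m\<in>{m\<in>{1..N}. d * m \<in> near \<delta> u}. norm (f m))"
      unfolding short_sum_def
    proof (rule sum_mono2)
      show "near \<delta> (u / real d) \<subseteq> {m\<in>{1..N}. d * m \<in> near \<delta> u}"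
      proof
        fix m assume m: "m \<in> near \<delta> (u / real d)"
        have "real m \<le> 2 * (u / real d)" using near_bounds(3)[OF m] d u \<delta> by auto
        also have "u / real d \<le> u / 1" using d u by (intro divide_left_mono) auto
        also have "2 * (u / 1) \<le> 2 * x" using u by simp
        finally have "m \<le> N" by (simp add: N_def le_nat_floor)
        thus "m \<in> {m\<in>{1..N}. d * m \<in> near \<delta> u}"
          using m d u by (auto simp: near_def ln_mult ln_div Suc_le_eq algebra_simps)
      qed
    qed auto
  qed
  also have "\<dots> \<le> u * (sqrt \<delta> * (E + 20 * ln (1 / \<delta>)) * (3 * CF * (1 + (1 + \<L>)) powr A))"
  proof (intro convolution_short_sum_le \<delta>)
    show "0 \<le> 1 + \<L>" using lx x by linarith
  qed (use N lN u in auto)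
  finally show ?thesis by simp
qed

text \<open>Damping by n^(-1/2) and the Chernoff bound with r = 3 / 4 leave n^(-5/4), inside the
  region of absolute convergence. The power u^(3/4) then makes the sum over d dominated by its
  largest terms, without a logarithm.\<close>

lemma damped_smooth_sum_le:
  assumes h: "0 < h" "h \<le> 1 / 4" and u: "u > 0" and \<mu>: "\<mu> \<ge> 0"
  shows "summable (\<lambda>n. f n * of_real (smooth_step h (ln (u / real n))) * of_real (exp (- (ln (real n) + \<mu>) / 2)))"
    and "norm (\<Sum>n. f n * of_real (smooth_step h (ln (u / real n))) * of_real (exp (- (ln (real n) + \<mu>) / 2))) \<le>
     2 * CF * 4 powr A * u powr (3 / 4) * exp (- \<mu> / 2)"
proof -
  let ?g = "\<lambda>n. f n * of_real (smooth_step h (ln (u / real n))) * of_real (exp (- (ln (real n) + \<mu>) / 2))"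
  have fc: "abs_conv (\<lambda>n. norm (f n)) (5 / 4)" using f_conv[of "5 / 4"] by simp
  have s: "summable (\<lambda>n. (2 * u powr (3 / 4) * exp (- \<mu> / 2)) * (norm (f n) * real n powr (- (5 / 4))))"
    by (intro summable_mult summable_rds[OF fc order.refl])
  have le: "norm (?g n) \<le> (2 * u powr (3 / 4) * exp (- \<mu> / 2)) * (norm (f n) * real n powr (- (5 / 4)))" for n
  proof (cases "n = 0")
    case False
    have "smooth_step h (ln (u / real n)) \<le> exp ((3 / 4) * ln (u / real n) + (3 / 4)\<^sup>2 * h\<^sup>2 / 2)"
      using h by (intro smooth_step_le_exp) auto
    also have "\<dots> = exp ((3 / 4)\<^sup>2 * h\<^sup>2 / 2) * (u powr (3 / 4) * real n powr (- (3 / 4)))"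
    proof -
      have l: "ln (u / real n) = ln u - ln (real n)" using u False by (simp add: ln_div)
      show ?thesis unfolding l using u False by (simp add: powr_def right_diff_distrib flip: exp_add)
    qed
    also have "\<dots> \<le> 2 * (u powr (3 / 4) * real n powr (- (3 / 4)))"
    proof (intro mult_right_mono exp_le_2)
      have "h\<^sup>2 \<le> (1 / 4)\<^sup>2" using h by (intro power_mono) auto
      thus "(3 / 4)\<^sup>2 * h\<^sup>2 / 2 \<le> 1 / 2" by (simp add: power2_eq_square)
    qed auto
    finally have W: "smooth_step h (ln (u / real n)) \<le> 2 * (u powr (3 / 4) * real n powr (- (3 / 4)))" .
    have ex: "exp (- (ln (real n) + \<mu>) / 2) = real n powr (- (1 / 2)) * exp (- \<mu> / 2)"
      using False by (simp add: powr_def flip: exp_add)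
    have "norm (?g n) = norm (f n) * smooth_step h (ln (u / real n)) * (real n powr (- (1 / 2)) * exp (- \<mu> / 2))"
      unfolding norm_mult norm_of_real ex [symmetric] using smooth_step_nonneg[OF h(1)] by simp
    also have "\<dots> \<le> norm (f n) * (2 * (u powr (3 / 4) * real n powr (- (3 / 4)))) * (real n powr (- (1 / 2)) * exp (- \<mu> / 2))"
      using W by (intro mult_right_mono mult_left_mono) auto
    also have "\<dots> = (2 * u powr (3 / 4) * exp (- \<mu> / 2)) * (norm (f n) * (real n powr (- (3 / 4)) * real n powr (- (1 / 2))))"
      by (simp only: mult_ac)
    also have "real n powr (- (3 / 4)) * real n powr (- (1 / 2)) = real n powr (- (5 / 4))"
      by (simp flip: powr_add)
    finally show ?thesis .
  qed (simp add: f_0)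
  have sn: "summable (\<lambda>n. norm (?g n))" by (rule summable_comparison_test[OF exI[of _ 0] s]) (use le in auto)
  thus "summable ?g" by (rule summable_norm_cancel)
  have "norm (suminf ?g) \<le> (\<Sum>n. norm (?g n))" by (rule summable_norm[OF sn])
  also have "\<dots> \<le> (\<Sum>n. (2 * u powr (3 / 4) * exp (- \<mu> / 2)) * (norm (f n) * real n powr (- (5 / 4))))"
    by (rule suminf_le[OF le sn s])
  also have "\<dots> = (2 * u powr (3 / 4) * exp (- \<mu> / 2)) * rds (\<lambda>n. norm (f n)) (5 / 4)"
    unfolding rds_def by (rule suminf_mult[OF summable_rds[OF fc order.refl]])
  also have "\<dots> \<le> (2 * u powr (3 / 4) * exp (- \<mu> / 2)) * (CF * 4 powr A)"
  proof (intro mult_left_mono)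
    have "rds (\<lambda>n. norm (f n)) (1 + 1 / 4) \<le> CF * (1 / 4) powr (- A)" by (rule rds_norm_f_le) auto
    thus "rds (\<lambda>n. norm (f n)) (5 / 4) \<le> CF * 4 powr A" by (simp add: powr_minus powr_divide)
  qed auto
  finally show "norm (suminf ?g) \<le> 2 * CF * 4 powr A * u powr (3 / 4) * exp (- \<mu> / 2)" by (simp add: mult_ac)
qed

text \<open>The weight 1 is written as exp (- y / 2) + (1 - exp (- y / 2)) with y = ln n + \<mu>;
  the second part is what the integral over \<alpha> reproduces.\<close>

lemma smooth_sum_split:
  assumes h: "0 < h" "h \<le> 1 / 4" and u: "u > 0" and \<mu>: "\<mu> \<ge> 0"
  shows "smooth_sum h u = (\<Sum>n. f n * of_real (smooth_step h (ln (u / real n))) * of_real (exp (- (ln (real n) + \<mu>) / 2)))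
     + (LINT \<alpha>|lborel. indicator {0..1/4} \<alpha> *\<^sub>R logq h u \<mu> \<alpha>)"
proof -
  let ?z = "\<lambda>n. f n * of_real (smooth_step h (ln (u / real n)))"
  have sz: "summable ?z"
  proof (rule summable_norm_cancel)
    show "summable (\<lambda>n. norm (?z n))"
      using summable_smooth[OF h(1) u] smooth_step_nonneg[OF h(1)] by (simp add: norm_mult)
  qed
  note s1 = damped_smooth_sum_le(1)[OF assms]
  have "(\<Sum>n. ?z n * of_real (1 - exp (- (ln (real n) + \<mu>) / 2))) = (\<Sum>n. ?z n - ?z n * of_real (exp (- (ln (real n) + \<mu>) / 2)))"
    by (simp add: right_diff_distrib)
  also have "\<dots> = smooth_sum h u - (\<Sum>n. ?z n * of_real (exp (- (ln (real n) + \<mu>) / 2)))"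
    unfolding smooth_sum_def by (rule suminf_diff[OF sz s1, symmetric])
  finally show ?thesis unfolding logq_integral(2)[OF h(1) u \<mu>] by simp
qed

lemma integral_inverse_shift:
  fixes \<beta> :: real
  assumes \<beta>: "\<beta> > 0"
  shows "has_bochner_integral lborel (\<lambda>\<alpha>. indicator {0..1/4} \<alpha> * (1 / (\<alpha> + \<beta>))) (ln (1 + 1 / (4 * \<beta>)))"
proof -
  have "has_bochner_integral lborel (\<lambda>\<alpha>. indicator {0..1/4} \<alpha> *\<^sub>R (1 / (\<alpha> + \<beta>))) (ln (1 / 4 + \<beta>) - ln (0 + \<beta>))"
  proof (rule has_bochner_integral_FTC_Icc)
    show "((\<lambda>\<alpha>. ln (\<alpha> + \<beta>)) has_vector_derivative 1 / (y + \<beta>)) (at y within {0..1/4})" if "0 \<le> y" "y \<le> 1 / 4" for y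
      unfolding has_real_derivative_iff_has_vector_derivative [symmetric]
      using that \<beta> by (auto intro!: derivative_eq_intros)
  qed (use \<beta> in \<open>auto intro!: continuous_intros\<close>)
  moreover have "ln (1 / 4 + \<beta>) - ln (0 + \<beta>) = ln ((1 / 4 + \<beta>) / \<beta>)" using \<beta> by (subst ln_div) auto
  moreover have "(1 / 4 + \<beta>) / \<beta> = 1 + 1 / (4 * \<beta>)" using \<beta> by (simp add: field_simps)
  ultimately show ?thesis by simp
qed

text \<open>Assembles the bounds for all parts of the sum weighted by ln x. The pointwise bound
  \<open>O\<close> is required for all u in [1, x], since it is used both inside an integral over u
  and at the points x / d.\<close>

lemma log_oscillation_bound:
  fixes c :: "'i \<Rightarrow> complex" and \<mu> :: "'i \<Rightarrow> real"
  assumes I: "finite I" "\<And>i. i \<in> I \<Longrightarrow> 0 \<le> \<mu> i" "\<And>i. i \<in> I \<Longrightarrow> \<mu> i \<le> \<L>"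
    and M: "(\<Sum>i\<in>I. norm (c i) * exp (- \<mu> i)) \<le> M"
    and h: "0 < h" "h \<le> 1 / 4" and \<delta>: "0 < \<delta>" "\<delta> \<le> 1 / 20" "T * \<delta> \<ge> 1" and T: "T \<ge> 10"
    and x: "8 \<le> ln x" "ln x \<le> \<L>" "x > 0"
    and K: "\<And>s. s \<in> strip_box (1 / \<L>) T \<Longrightarrow> norm (F s * (\<Sum>i\<in>I. c i * exp (- of_real (\<mu> i) * s))) \<le> K"
    and K1: "\<And>s. s \<in> strip_box (1 / \<L>) T \<Longrightarrow> norm (F s * (\<Sum>i\<in>I. c i * of_real (\<mu> i) * exp (- of_real (\<mu> i) * s))) \<le> K"
    and O: "\<And>u. 1 \<le> u \<Longrightarrow> u \<le> x \<Longrightarrow> norm (\<Sum>i\<in>I. c i * summatory f (u * exp (- \<mu> i))) \<le> Kp * u"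
    and O1: "norm (\<Sum>i\<in>I. c i * of_real (\<mu> i) * summatory f (x * exp (- \<mu> i))) \<le> Kp * x"
  shows "ln x * norm (\<Sum>i\<in>I. c i * summatory f (x * exp (- \<mu> i))) \<le>
     x * (Kp * (2 + E * (1 + ln T)) +
       M * (sqrt \<delta> * (E + 20 * ln (1 / \<delta>)) * (3 * CF * (2 + \<L>) powr A) +
            6 * exp (- \<delta> / (2 * h)) * (CF * \<L> powr A) * (E * (1 + \<L>)) + 20 * E * CF * 4 powr A) +
       quad_const \<L> T h K M * ln (1 + \<L>))"
proof -
  have lx0: "ln x > 0" using x by linarith
  have x1: "x \<ge> 1" using ln_ge_zero_iff[OF x(3)] lx0 by linarith
  have L8: "\<L> \<ge> 8" using x by linarith
  have T1: "T \<ge> 1" using T by simp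
  have \<delta>4: "\<delta> \<le> 1 / 4" using \<delta> by simp
  have E0: "E \<ge> 0" using E_ge by simp
  have M0: "M \<ge> 0" by (rule order.trans[OF _ M]) (intro sum_nonneg, auto)
  have Kp0: "Kp \<ge> 0" using O[of 1] x1 by (intro order.trans[OF norm_ge_zero O[of 1, simplified]]) auto
  define Ob where "Ob = (\<lambda>u. \<Sum>i\<in>I. c i * summatory f (u * exp (- \<mu> i)))"
  define xi where "xi = (\<lambda>i. x * exp (- \<mu> i))"
  have xi: "0 < xi i" "xi i \<le> x" if "i \<in> I" for i
    using I(2)[OF that] x by (auto simp: xi_def mult_left_le)
  define Z where "Z = (\<Sum>i\<in>I. c i * (\<Sum>n | 1 \<le> n \<and> real n \<le> xi i. f n * of_real (ln (xi i / real n))))"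
  define O1' where "O1' = (\<Sum>i\<in>I. c i * of_real (\<mu> i) * summatory f (xi i))"
  define V where "V = (\<Sum>i\<in>I. c i * (\<Sum>n | 1 \<le> n \<and> real n \<le> xi i. f n * of_real (ln (real n))))"
  \<comment> \<open>For n in the shifted sum, ln x is the sum of ln (xi / n), \<mu> and ln n; the
    three resulting pieces are \<open>Z\<close>, \<open>O1'\<close> and \<open>V\<close>.\<close>
  have split: "of_real (ln x) * Ob x = Z + O1' + V"
  proof -
    have term_eq: "of_real (ln x) * (c i * summatory f (xi i)) =
       c i * (\<Sum>n | 1 \<le> n \<and> real n \<le> xi i. f n * of_real (ln (xi i / real n))) + c i * of_real (\<mu> i) * summatory f (xi i) +
       c i * (\<Sum>n | 1 \<le> n \<and> real n \<le> xi i. f n * of_real (ln (real n)))" if i: "i \<in> I" for i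
    proof -
      have "of_real (ln x) * summatory f (xi i) = (\<Sum>n | 1 \<le> n \<and> real n \<le> xi i.
          f n * of_real (ln (xi i / real n)) + of_real (\<mu> i) * f n + f n * of_real (ln (real n)))"
        unfolding summatory_def sum_distrib_left
      proof (intro sum.cong refl)
        fix n assume n: "n \<in> {n. 1 \<le> n \<and> real n \<le> xi i}"
        have "ln (xi i) = ln x - \<mu> i" using x by (simp add: xi_def ln_mult)
        moreover have "ln (xi i / real n) = ln (xi i) - ln (real n)" using n xi[OF i] by (simp add: ln_div)
        ultimately have "ln x = ln (xi i / real n) + \<mu> i + ln (real n)" by simp
        hence "complex_of_real (ln x) = of_real (ln (xi i / real n)) + of_real (\<mu> i) + of_real (ln (real n))"
          by (simp only: of_real_add)
        thus "of_real (ln x) * f n = f n * of_real (ln (xi i / real n)) + of_real (\<mu> i) * f n + f n * of_real (ln (real n))"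
          by (simp only:) (simp add: algebra_simps)
      qed
      also have "\<dots> = (\<Sum>n | 1 \<le> n \<and> real n \<le> xi i. f n * of_real (ln (xi i / real n))) + of_real (\<mu> i) * summatory f (xi i) +
         (\<Sum>n | 1 \<le> n \<and> real n \<le> xi i. f n * of_real (ln (real n)))"
        unfolding summatory_def sum_distrib_left by (simp only: sum.distrib)
      finally have *: "of_real (ln x) * summatory f (xi i) = \<dots>" .
      have "of_real (ln x) * (c i * summatory f (xi i)) = c i * (of_real (ln x) * summatory f (xi i))" by simp
      also note *
      finally show ?thesis by (simp only: distrib_left mult.assoc)
    qed
    have "of_real (ln x) * Ob x = (\<Sum>i\<in>I. of_real (ln x) * (c i * summatory f (xi i)))"
      unfolding Ob_def xi_def by (rule sum_distrib_left)
    also have "\<dots> = Z + O1' + V"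
      unfolding Z_def O1'_def V_def sum.distrib [symmetric] by (intro sum.cong refl term_eq)
    finally show ?thesis .
  qed
  have Zb: "norm Z \<le> Kp * x" unfolding Z_def xi_def
    by (rule log_integral_bound[OF I(1,2) x1 Kp0 O]) auto
  have O1b: "norm O1' \<le> Kp * x" using O1 by (simp add: O1'_def xi_def)
  let ?A = "{d. 1 \<le> d \<and> real d \<le> x}" and ?D = "{d. T \<le> real d \<and> real d \<le> x}"
  have D1: "d \<ge> 1" if "d \<in> ?D" for d using that T by (cases d) auto
  have finD: "finite ?D" by (rule finite_subset[OF _ finite_nat_le[of x]]) auto
  define u where "u = (\<lambda>i d. x * exp (- \<mu> i) / real d)"
  have u_alt: "u i d = xi i / real d" for i d by (simp add: u_def xi_def)
  have u0: "u i d > 0" if "d \<in> ?D" "i \<in> I" for i d using D1[OF that(1)] xi[OF that(2)] by (auto simp: u_alt)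
  have V_eq: "V = (\<Sum>d\<in>?A. Lam d * Ob (x / real d))"
  proof -
    define N where "N = nat \<lceil>x\<rceil>"
    have N: "x \<le> real N" unfolding N_def by linarith
    have "V = (\<Sum>i\<in>I. c i * (\<Sum>d=1..N. Lam d * summatory f (xi i / real d)))"
      unfolding V_def
    proof (rule sum.cong[OF refl], rule arg_cong2[where f = "times", OF refl], rule sum_f_ln_eq)
      fix i assume "i \<in> I"
      thus "xi i \<le> real N" using xi(2)[of i] N by linarith
    qed
    also have "\<dots> = (\<Sum>d=1..N. Lam d * Ob (x / real d))"
    proof -
      have "(\<Sum>i\<in>I. c i * (\<Sum>d=1..N. Lam d * summatory f (xi i / real d))) = (\<Sum>d=1..N. \<Sum>i\<in>I. c i * (Lam d * summatory f (xi i / real d)))"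
        unfolding sum_distrib_left by (rule sum.swap)
      also have "\<dots> = (\<Sum>d=1..N. Lam d * Ob (x / real d))"
        unfolding Ob_def sum_distrib_left xi_def by (intro sum.cong refl) simp
      finally show ?thesis .
    qed
    also have "\<dots> = (\<Sum>d\<in>?A. Lam d * Ob (x / real d))"
    proof (rule sum.mono_neutral_right)
      show "?A \<subseteq> {1..N}"
      proof
        fix d assume "d \<in> ?A"
        hence "1 \<le> d" "real d \<le> real N" using N by auto
        thus "d \<in> {1..N}" by simp
      qed
      show "\<forall>d\<in>{1..N} - ?A. Lam d * Ob (x / real d) = 0"
      proof
        fix d assume "d \<in> {1..N} - ?A"
        hence d: "real d > x" "d \<ge> 1" by auto
        have "summatory f (x / real d * exp (- \<mu> i)) = 0" if "i \<in> I" for i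
        proof -
          have "x / real d * exp (- \<mu> i) = xi i / real d" by (simp add: xi_def)
          also have "\<dots> \<le> x / real d" using xi[OF that] d by (intro divide_right_mono) auto
          also have "\<dots> < 1" using d x by simp
          finally have *: "x / real d * exp (- \<mu> i) < 1" .
          have "{n. 1 \<le> n \<and> real n \<le> x / real d * exp (- \<mu> i)} = {}"
          proof (intro equals0I)
            fix n assume "n \<in> {n. 1 \<le> n \<and> real n \<le> x / real d * exp (- \<mu> i)}"
            hence "real n < 1" "1 \<le> n" using * by auto
            thus False by simp
          qed
          thus ?thesis unfolding summatory_def by (simp only: sum.empty)
        qed
        thus "Lam d * Ob (x / real d) = 0" by (simp add: Ob_def)
      qed
    qed auto
    finally show ?thesis .
  qed
  \<comment> \<open>Below T the pointwise bound at x / d costs the sum of \<open>nL d / d\<close>,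
    about ln T. Used for all d it would cost ln x, exactly the factor to be gained.\<close>
  have V_split: "V = (\<Sum>d\<in>{d\<in>?A. real d < T}. Lam d * Ob (x / real d)) + (\<Sum>d\<in>?D. Lam d * Ob (x / real d))"
  proof -
    have "?A = {d\<in>?A. real d < T} \<union> ?D" using D1 by (auto simp: Suc_le_eq)
    hence "V = (\<Sum>d\<in>{d\<in>?A. real d < T} \<union> ?D. Lam d * Ob (x / real d))" unfolding V_eq by (rule sum.cong) auto
    also have "\<dots> = (\<Sum>d\<in>{d\<in>?A. real d < T}. Lam d * Ob (x / real d)) + (\<Sum>d\<in>?D. Lam d * Ob (x / real d))"
    proof (rule sum.union_disjoint[OF _ finD])
      show "finite {d\<in>?A. real d < T}" by (rule finite_subset[OF _ finite_nat_le_real[of x]]) auto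
    qed auto
    finally show ?thesis .
  qed
  have Vs: "norm (\<Sum>d\<in>{d\<in>?A. real d < T}. Lam d * Ob (x / real d)) \<le> Kp * x * (E * (1 + ln T))"
  proof -
    have "norm (\<Sum>d\<in>{d\<in>?A. real d < T}. Lam d * Ob (x / real d)) \<le> (\<Sum>d\<in>{d\<in>?A. real d < T}. Kp * x * (nL d / real d))"
    proof (rule sum_norm_le)
      fix d assume d: "d \<in> {d\<in>?A. real d < T}"
      hence "1 \<le> x / real d" "x / real d \<le> x" using x by (auto simp: field_simps)
      hence "norm (Ob (x / real d)) \<le> Kp * (x / real d)" unfolding Ob_def by (rule O)
      hence "nL d * norm (Ob (x / real d)) \<le> nL d * (Kp * (x / real d))" by (intro mult_left_mono nL_nonneg)
      thus "norm (Lam d * Ob (x / real d)) \<le> Kp * x * (nL d / real d)" by (simp add: norm_mult norm_Lam mult_ac)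
    qed
    also have "\<dots> \<le> (\<Sum>d | 1 \<le> d \<and> real d \<le> T. Kp * x * (nL d / real d))"
      using Kp0 x by (intro sum_mono2 finite_nat_le_real) (auto intro!: mult_nonneg_nonneg divide_nonneg_nonneg nL_nonneg)
    also have "\<dots> = Kp * x * (\<Sum>d | 1 \<le> d \<and> real d \<le> T. nL d / real d)" by (simp only: sum_distrib_left)
    also have "\<dots> \<le> Kp * x * (E * (1 + ln T))" using Kp0 x by (intro mult_left_mono block_sum_log[OF nL_block T1]) auto
    finally show ?thesis .
  qed
  define Os where "Os = (\<lambda>d. \<Sum>i\<in>I. c i * smooth_sum h (u i d))"
  define \<beta>s where "\<beta>s = sqrt \<delta> * (E + 20 * ln (1 / \<delta>)) * (3 * CF * (2 + \<L>) powr A)"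
  define G where "G = CF * \<L> powr A"
  have G0: "G \<ge> 0" using CF_ge_1 by (simp add: G_def)
  let ?e = "2 * exp (- \<delta> / (2 * h))"
  define cc where "cc = 1 + 1 / ln x"
  have cc: "1 < cc" "cc \<le> 2"
  proof -
    have "0 < 1 / ln x" by (rule divide_pos_pos[OF zero_less_one lx0])
    thus "1 < cc" by (simp add: cc_def)
    have "1 / ln x \<le> 1 / 1" by (rule divide_left_mono) (use x lx0 in auto)
    thus "cc \<le> 2" by (simp add: cc_def)
  qed
  have Gc: "rds (\<lambda>n. norm (f n)) cc \<le> G" unfolding cc_def G_def using x by (intro rds_norm_f_le') auto
  have rf0: "rds (\<lambda>n. norm (f n)) cc \<ge> 0" using cc f_conv[of cc] by (intro rds_nonneg) auto
  have Mw: "(\<Sum>i\<in>I. norm (c i) * (xi i * B)) \<le> x * (M * B)" if "B \<ge> 0" for B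
  proof -
    have "(\<Sum>i\<in>I. norm (c i) * (xi i * B)) = x * ((\<Sum>i\<in>I. norm (c i) * exp (- \<mu> i)) * B)"
      unfolding sum_distrib_left sum_distrib_right xi_def by (intro sum.cong refl) (simp only: mult_ac)
    also have "\<dots> \<le> x * (M * B)" using M that x by (intro mult_left_mono mult_right_mono) auto
    finally show ?thesis .
  qed
  have Err: "norm (\<Sum>d\<in>?D. Lam d * (Ob (x / real d) - Os d)) \<le> x * (M * (\<beta>s + 3 * ?e * G * (E * (1 + \<L>))))"
  proof -
    have "norm (\<Sum>d\<in>?D. Lam d * (Ob (x / real d) - Os d)) \<le>
      (\<Sum>d\<in>?D. nL d * (\<Sum>i\<in>I. norm (c i) * (short_sum \<delta> (u i d) + ?e * (u i d powr cc * G))))"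
    proof (rule sum_norm_le)
      fix d assume d: "d \<in> ?D"
      have "Ob (x / real d) - Os d = (\<Sum>i\<in>I. c i * (summatory f (u i d) - smooth_sum h (u i d)))"
        by (simp add: Ob_def Os_def u_def sum_subtractf right_diff_distrib)
      also have "norm \<dots> \<le> (\<Sum>i\<in>I. norm (c i) * (short_sum \<delta> (u i d) + ?e * (u i d powr cc * G)))"
      proof (rule sum_norm_le)
        fix i assume i: "i \<in> I"
        have "norm (summatory f (u i d) - smooth_sum h (u i d)) \<le> short_sum \<delta> (u i d) + ?e * (u i d powr cc * rds (\<lambda>n. norm (f n)) cc)"
          by (rule summatory_minus_smooth_sum[OF h cc u0[OF d i] \<delta>(1) \<delta>4])
        also have "\<dots> \<le> short_sum \<delta> (u i d) + ?e * (u i d powr cc * G)"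
          using Gc by (intro add_left_mono mult_left_mono) auto
        finally show "norm (c i * (summatory f (u i d) - smooth_sum h (u i d))) \<le> norm (c i) * (short_sum \<delta> (u i d) + ?e * (u i d powr cc * G))"
          unfolding norm_mult by (intro mult_left_mono) auto
      qed
      finally show "norm (Lam d * (Ob (x / real d) - Os d)) \<le> nL d * (\<Sum>i\<in>I. norm (c i) * (short_sum \<delta> (u i d) + ?e * (u i d powr cc * G)))"
        unfolding norm_mult norm_Lam by (intro mult_left_mono nL_nonneg)
    qed
    \<comment> \<open>The sum over d goes inside: a single \<open>short_sum\<close> at x / d may
      have a short range, and the saving appears only on average over d.\<close>
    also have "\<dots> = (\<Sum>i\<in>I. norm (c i) * ((\<Sum>d\<in>?D. nL d * short_sum \<delta> (u i d)) + ?e * G * (\<Sum>d\<in>?D. nL d * u i d powr cc)))"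
    proof -
      have "(\<Sum>d\<in>?D. nL d * (\<Sum>i\<in>I. norm (c i) * (short_sum \<delta> (u i d) + ?e * (u i d powr cc * G)))) =
        (\<Sum>i\<in>I. \<Sum>d\<in>?D. nL d * (norm (c i) * (short_sum \<delta> (u i d) + ?e * (u i d powr cc * G))))"
        unfolding sum_distrib_left by (rule sum.swap)
      also have "\<dots> = (\<Sum>i\<in>I. \<Sum>d\<in>?D. norm (c i) * (nL d * short_sum \<delta> (u i d) + ?e * G * (nL d * u i d powr cc)))"
        by (intro sum.cong refl) (simp add: algebra_simps)
      also have "\<dots> = (\<Sum>i\<in>I. norm (c i) * ((\<Sum>d\<in>?D. nL d * short_sum \<delta> (u i d)) + ?e * G * (\<Sum>d\<in>?D. nL d * u i d powr cc)))"
        by (simp only: sum_distrib_left [symmetric] sum.distrib)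
      finally show ?thesis .
    qed
    also have "\<dots> \<le> (\<Sum>i\<in>I. norm (c i) * (xi i * (\<beta>s + 3 * ?e * G * (E * (1 + \<L>)))))"
    proof (intro sum_mono mult_left_mono)
      fix i assume i: "i \<in> I"
      have a: "(\<Sum>d\<in>?D. nL d * short_sum \<delta> (u i d)) \<le> xi i * \<beta>s"
        unfolding u_alt \<beta>s_def by (rule sum_nL_short_sum_le[OF \<delta> T1 xi[OF i] x(2) x1])
      have "(\<Sum>d\<in>?D. nL d * u i d powr cc) = xi i powr cc * (\<Sum>d\<in>?D. nL d * real d powr (- cc))"
        unfolding sum_distrib_left u_alt using xi[OF i]
        by (intro sum.cong refl) (simp add: powr_divide powr_minus field_simps)
      also have "\<dots> \<le> (xi i * 3) * (E * (1 + \<L>))"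
      proof (rule mult_mono)
        have "xi i powr cc = xi i * xi i powr (1 / ln x)" unfolding cc_def powr_add using xi[OF i] by simp
        also have "xi i powr (1 / ln x) \<le> x powr (1 / ln x)" using xi[OF i] x1 by (intro powr_mono2) auto
        also have "x powr (1 / ln x) = exp 1" using x lx0 by (simp add: powr_def)
        finally show "xi i powr cc \<le> xi i * 3" using xi[OF i] exp_le by (meson mult_left_mono less_imp_le order.trans)
        have "(\<Sum>d\<in>?D. nL d * real d powr (- cc)) \<le> rds nL cc"
          using cc finD by (intro sum_le_rds abs_conv_nL nL_nonneg)
        also have "\<dots> \<le> E * (1 + 1 / (cc - 1))" by (rule block_abs_conv(2)[OF nL_block cc(1)])
        also have "1 / (cc - 1) = ln x" by (simp add: cc_def)
        also have "E * (1 + ln x) \<le> E * (1 + \<L>)" using E0 x by (intro mult_left_mono) auto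
        finally show "(\<Sum>d\<in>?D. nL d * real d powr (- cc)) \<le> E * (1 + \<L>)" .
      qed (use xi[OF i] in \<open>auto intro!: sum_nonneg mult_nonneg_nonneg nL_nonneg\<close>)
      finally have "?e * G * (\<Sum>d\<in>?D. nL d * u i d powr cc) \<le> ?e * G * ((xi i * 3) * (E * (1 + \<L>)))"
        using G0 by (intro mult_left_mono) auto
      also have "\<dots> = xi i * (3 * ?e * G * (E * (1 + \<L>)))" by (simp only: mult_ac)
      finally have "(\<Sum>d\<in>?D. nL d * short_sum \<delta> (u i d)) + ?e * G * (\<Sum>d\<in>?D. nL d * u i d powr cc) \<le>
         xi i * \<beta>s + xi i * (3 * ?e * G * (E * (1 + \<L>)))" using a by (intro add_mono)
      thus "(\<Sum>d\<in>?D. nL d * short_sum \<delta> (u i d)) + ?e * G * (\<Sum>d\<in>?D. nL d * u i d powr cc) \<le> xi i * (\<beta>s + 3 * ?e * G * (E * (1 + \<L>)))"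
        by (simp only: distrib_left)
    qed auto
    also have "\<dots> \<le> x * (M * (\<beta>s + 3 * ?e * G * (E * (1 + \<L>))))"
    proof (rule Mw)
      have "ln (1 / \<delta>) \<ge> 0" using \<delta> by simp
      thus "0 \<le> \<beta>s + 3 * ?e * G * (E * (1 + \<L>))"
        unfolding \<beta>s_def using \<delta> E0 CF_ge_1 G0 L8 by (intro add_nonneg_nonneg mult_nonneg_nonneg) auto
    qed
    finally show ?thesis .
  qed
  define Pa where "Pa = (\<lambda>i d. \<Sum>n. f n * of_real (smooth_step h (ln (u i d / real n))) * of_real (exp (- (ln (real n) + \<mu> i) / 2)))"
  define Pb where "Pb = (\<lambda>i d. LINT \<alpha>|lborel. indicator {0..1/4} \<alpha> *\<^sub>R logq h (u i d) (\<mu> i) \<alpha>)"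
  have Os_split: "(\<Sum>d\<in>?D. Lam d * Os d) = (\<Sum>d\<in>?D. Lam d * (\<Sum>i\<in>I. c i * Pa i d)) + (\<Sum>d\<in>?D. Lam d * (\<Sum>i\<in>I. c i * Pb i d))"
  proof -
    have "smooth_sum h (u i d) = Pa i d + Pb i d" if "d \<in> ?D" "i \<in> I" for i d
      unfolding Pa_def Pb_def by (rule smooth_sum_split[OF h u0[OF that] I(2)[OF that(2)]])
    hence "Lam d * Os d = Lam d * (\<Sum>i\<in>I. c i * Pa i d) + Lam d * (\<Sum>i\<in>I. c i * Pb i d)" if "d \<in> ?D" for d
      using that by (simp add: Os_def sum.distrib distrib_left)
    thus ?thesis by (simp add: sum.distrib)
  qed
  have Pa_b: "norm (\<Sum>d\<in>?D. Lam d * (\<Sum>i\<in>I. c i * Pa i d)) \<le> x * (M * (20 * E * CF * 4 powr A))"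
  proof -
    let ?C = "2 * CF * 4 powr A"
    have C0: "?C \<ge> 0" using CF_ge_1 by simp
    have "norm (\<Sum>d\<in>?D. Lam d * (\<Sum>i\<in>I. c i * Pa i d)) \<le> (\<Sum>d\<in>?D. nL d * (\<Sum>i\<in>I. norm (c i) * exp (- \<mu> i) * (?C * (x powr (3/4) * real d powr (- (3 / 4))))))"
    proof (rule sum_norm_le)
      fix d assume d: "d \<in> ?D"
      have "norm (\<Sum>i\<in>I. c i * Pa i d) \<le> (\<Sum>i\<in>I. norm (c i) * exp (- \<mu> i) * (?C * (x powr (3/4) * real d powr (- (3 / 4)))))"
      proof (rule sum_norm_le)
        fix i assume i: "i \<in> I"
        have "norm (Pa i d) \<le> ?C * u i d powr (3 / 4) * exp (- \<mu> i / 2)"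
          unfolding Pa_def by (rule damped_smooth_sum_le(2)[OF h u0[OF d i] I(2)[OF i]])
        also have "u i d powr (3 / 4) = x powr (3 / 4) * real d powr (- (3 / 4)) * exp (- (3 / 4) * \<mu> i)"
        proof -
          have l: "ln (u i d) = ln x - \<mu> i - ln (real d)" using D1[OF d] x by (simp add: u_def ln_div ln_mult)
          have "real d > 0" using D1[OF d] by simp
          thus ?thesis using u0[OF d i] x by (simp add: powr_def l algebra_simps flip: exp_add)
        qed
        also have "?C * (x powr (3 / 4) * real d powr (- (3 / 4)) * exp (- (3 / 4) * \<mu> i)) * exp (- \<mu> i / 2) =
           exp (- (5 / 4) * \<mu> i) * (?C * (x powr (3 / 4) * real d powr (- (3 / 4))))"
          by (simp add: exp_add [symmetric] mult_ac)
        also have "\<dots> \<le> exp (- \<mu> i) * (?C * (x powr (3 / 4) * real d powr (- (3 / 4))))"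
          using CF_ge_1 I(2)[OF i] by (intro mult_right_mono mult_nonneg_nonneg) auto
        finally show "norm (c i * Pa i d) \<le> norm (c i) * exp (- \<mu> i) * (?C * (x powr (3/4) * real d powr (- (3 / 4))))"
          unfolding norm_mult mult.assoc[of "norm (c i)"] by (intro mult_left_mono) auto
      qed
      thus "norm (Lam d * (\<Sum>i\<in>I. c i * Pa i d)) \<le> nL d * (\<Sum>i\<in>I. norm (c i) * exp (- \<mu> i) * (?C * (x powr (3/4) * real d powr (- (3 / 4)))))"
        unfolding norm_mult norm_Lam by (intro mult_left_mono nL_nonneg)
    qed
    also have "\<dots> = (\<Sum>i\<in>I. norm (c i) * exp (- \<mu> i)) * (?C * x powr (3 / 4) * (\<Sum>d\<in>?D. nL d * real d powr (- (3 / 4))))"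
      by (simp only: sum_distrib_right [symmetric]) (simp only: sum_distrib_left mult_ac)
    also have "\<dots> \<le> M * (?C * x powr (3 / 4) * (10 * E * x powr (1 / 4)))"
    proof (intro mult_mono M mult_left_mono)
      have "(\<Sum>d\<in>?D. nL d * real d powr (- (3 / 4))) \<le> (\<Sum>n | 1 \<le> n \<and> real n \<le> x. nL n * real n powr (- 1 + 1 / 4))"
        using D1 sum_mono2[OF finite_nat_le_real[of x], of ?D "\<lambda>n. nL n * real n powr (- 1 + 1 / 4)"]
        by (auto simp: nL_nonneg)
      also have "\<dots> \<le> E * exp (1 / 4) * x powr (1 / 4) * (1 + 1 / (1 / 4))" by (rule block_sum_powr[OF nL_block x1]) simp
      also have "\<dots> \<le> E * 2 * x powr (1 / 4) * (1 + 1 / (1 / 4))"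
        using exp_le_2[of "1 / 4"] E0 by (intro mult_right_mono mult_left_mono) auto
      finally show "(\<Sum>d\<in>?D. nL d * real d powr (- (3 / 4))) \<le> 10 * E * x powr (1 / 4)" by simp
    qed (use CF_ge_1 M0 in \<open>auto intro!: sum_nonneg mult_nonneg_nonneg nL_nonneg\<close>)
    also have "\<dots> = M * (20 * E * CF * 4 powr A * (x powr (3 / 4) * x powr (1 / 4)))" by simp
    also have "x powr (3 / 4) * x powr (1 / 4) = x" using x by (simp flip: powr_add)
    finally show ?thesis by (simp only: mult_ac)
  qed
  have Pb_b: "norm (\<Sum>d\<in>?D. Lam d * (\<Sum>i\<in>I. c i * Pb i d)) \<le> x * (quad_const \<L> T h K M * ln (1 + \<L>))"
  proof -
    let ?q = "quad_const \<L> T h K M"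
    let ?Q = "\<lambda>\<alpha>. \<Sum>d\<in>?D. Lam d * (\<Sum>i\<in>I. c i * logq h (u i d) (\<mu> i) \<alpha>)"
    have int: "integrable lborel (\<lambda>\<alpha>. indicator {0..1/4::real} \<alpha> *\<^sub>R logq h (u i d) (\<mu> i) \<alpha>)" if "d \<in> ?D" "i \<in> I" for i d
      by (rule logq_integral(1)[OF h(1) u0[OF that] I(2)[OF that(2)]])
    have indQ: "indicator {0..1/4} \<alpha> *\<^sub>R ?Q \<alpha> = (\<Sum>d\<in>?D. \<Sum>i\<in>I. (Lam d * c i) * (indicator {0..1/4} \<alpha> *\<^sub>R logq h (u i d) (\<mu> i) \<alpha>))" for \<alpha> :: real
      by (simp add: scaleR_sum_right sum_distrib_left mult.assoc)
    have intQ: "integrable lborel (\<lambda>\<alpha>. indicator {0..1/4::real} \<alpha> *\<^sub>R ?Q \<alpha>)"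
      unfolding indQ by (intro Bochner_Integration.integrable_sum integrable_mult_right int)
    have eq: "(\<Sum>d\<in>?D. Lam d * (\<Sum>i\<in>I. c i * Pb i d)) = (LINT \<alpha>|lborel. indicator {0..1/4} \<alpha> *\<^sub>R ?Q \<alpha>)"
    proof -
      have "(LINT \<alpha>|lborel. indicator {0..1/4} \<alpha> *\<^sub>R ?Q \<alpha>) =
        (\<Sum>d\<in>?D. LINT \<alpha>|lborel. (\<Sum>i\<in>I. (Lam d * c i) * (indicator {0..1/4} \<alpha> *\<^sub>R logq h (u i d) (\<mu> i) \<alpha>)))"
        unfolding indQ by (rule Bochner_Integration.integral_sum) (intro Bochner_Integration.integrable_sum integrable_mult_right int)
      also have "\<dots> = (\<Sum>d\<in>?D. \<Sum>i\<in>I. LINT \<alpha>|lborel. (Lam d * c i) * (indicator {0..1/4} \<alpha> *\<^sub>R logq h (u i d) (\<mu> i) \<alpha>))"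
        by (intro sum.cong refl Bochner_Integration.integral_sum integrable_mult_right int)
      also have "\<dots> = (\<Sum>d\<in>?D. Lam d * (\<Sum>i\<in>I. c i * Pb i d))"
        unfolding Pb_def integral_mult_right_zero by (simp only: sum_distrib_left mult.assoc)
      finally show ?thesis ..
    qed
    have "norm (\<Sum>d\<in>?D. Lam d * (\<Sum>i\<in>I. c i * Pb i d)) \<le> (LINT \<alpha>|lborel. (x * ?q) * (indicator {0..1/4} \<alpha> * (1 / (\<alpha> + 1 / ln x))))"
      unfolding eq
    proof (rule lborel_norm_integral_le[OF intQ])
      have b0: "1 / ln x > 0" by (rule divide_pos_pos[OF zero_less_one lx0])
      show "integrable lborel (\<lambda>\<alpha>. (x * ?q) * (indicator {0..1/4} \<alpha> * (1 / (\<alpha> + 1 / ln x))))"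
        by (rule integrable_mult_right) (rule integrable.intros[OF integral_inverse_shift[OF b0]])
      fix \<alpha> :: real
      show "norm (indicator {0..1/4} \<alpha> *\<^sub>R ?Q \<alpha>) \<le> (x * ?q) * (indicator {0..1/4} \<alpha> * (1 / (\<alpha> + 1 / ln x)))"
      proof (cases "\<alpha> \<in> {0..1/4}")
        case True
        hence "norm (?Q \<alpha>) \<le> x * ?q / (\<alpha> + 1 / ln x)" unfolding u_def
          by (intro quadratic_bound[OF I M h T x K K1]) auto
        thus ?thesis using True by simp
      qed simp
    qed
    \<comment> \<open>Integrating 1 / (\<alpha> + 1 / ln x) over the short range of \<alpha> leaves
      only a logarithm of ln x.\<close>
    also have "\<dots> = (x * ?q) * (LINT \<alpha>|lborel. indicator {0..1/4} \<alpha> * (1 / (\<alpha> + 1 / ln x)))"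
      by (rule integral_mult_right_zero)
    also have "\<dots> = (x * ?q) * ln (1 + 1 / (4 * (1 / ln x)))"
      by (rule arg_cong[OF has_bochner_integral_integral_eq[OF integral_inverse_shift[OF divide_pos_pos[OF zero_less_one lx0]]]])
    also have "\<dots> \<le> (x * ?q) * ln (1 + \<L>)"
    proof (intro mult_left_mono ln_le_mono)
      have "1 / (4 * (1 / ln x)) = ln x / 4" by simp
      thus "1 + 1 / (4 * (1 / ln x)) \<le> 1 + \<L>" "0 < 1 + 1 / (4 * (1 / ln x))" using x lx0 by linarith+
      have "1 / \<L> \<le> 1" using L8 by simp
      hence "2 \<in> strip_box (1 / \<L>) T" using T by (simp add: strip_box_def)
      hence K0: "K \<ge> 0" by (rule order.trans[OF norm_ge_zero K])
      have lT: "ln T \<ge> 0" "ln (3 * T) \<ge> 0" using T by simp_all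
      have E2: "24 * E * (1 + \<L>) * (2 * E * (1 + \<L>) * M * (CF * \<L> powr A)) \<ge> 0"
        using E0 L8 M0 CF_ge_1 by (intro mult_nonneg_nonneg) auto
      have K2: "3 * K / 2 * (5400 * E * ln T + 4 * (E * (1 + ln T) + 2)\<^sup>2 * ln (3 * T)) \<ge> 0"
        using K0 lT E0 by (intro mult_nonneg_nonneg add_nonneg_nonneg) auto
      have "?q \<ge> 0" unfolding quad_const_def
        by (rule mult_nonneg_nonneg[OF _ add_nonneg_nonneg[OF K2 divide_nonneg_pos[OF mult_nonneg_nonneg[OF E2 exp_ge_zero] h(1)]]]) simp
      thus "0 \<le> x * ?q" using x by simp
    qed
    finally show ?thesis by (simp only: mult.assoc)
  qed
  have "(\<Sum>d\<in>?D. Lam d * Ob (x / real d)) = (\<Sum>d\<in>?D. Lam d * (Ob (x / real d) - Os d)) + (\<Sum>d\<in>?D. Lam d * Os d)"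
    by (simp add: right_diff_distrib sum_subtractf)
  hence total: "of_real (ln x) * Ob x = Z + O1' + ((\<Sum>d\<in>{d\<in>?A. real d < T}. Lam d * Ob (x / real d)) +
     ((\<Sum>d\<in>?D. Lam d * (Ob (x / real d) - Os d)) + ((\<Sum>d\<in>?D. Lam d * (\<Sum>i\<in>I. c i * Pa i d)) + (\<Sum>d\<in>?D. Lam d * (\<Sum>i\<in>I. c i * Pb i d)))))"
    unfolding split V_split Os_split by simp
  have "ln x * norm (Ob x) = norm (of_real (ln x) * Ob x)" using lx0 by (simp add: norm_mult)
  also have "\<dots> \<le> (Kp * x + Kp * x) + (Kp * x * (E * (1 + ln T)) + (x * (M * (\<beta>s + 3 * ?e * G * (E * (1 + \<L>)))) +
     (x * (M * (20 * E * CF * 4 powr A)) + x * (quad_const \<L> T h K M * ln (1 + \<L>)))))"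
    unfolding total by (intro norm_triangle_mono Zb O1b Vs Err Pa_b Pb_b)
  also have "\<dots> = x * (Kp * (2 + E * (1 + ln T)) +
       M * (\<beta>s + 6 * exp (- \<delta> / (2 * h)) * G * (E * (1 + \<L>)) + 20 * E * CF * 4 powr A) +
       quad_const \<L> T h K M * ln (1 + \<L>))"
    by (simp add: distrib_left mult_ac)
  finally show ?thesis unfolding Ob_def \<beta>s_def G_def .
qed

end

section \<open>The oscillation polynomial\<close>

lemma has_sum_ds:
  assumes "abs_conv a (Re s)"
  shows "((\<lambda>n. a n / of_nat n powr s) has_sum ds a s) {1..}"
proof -
  have "((\<lambda>n. a n * of_nat n powr (- s)) has_sum ds a s) UNIV"
    unfolding ds_def
    by (rule norm_summable_imp_has_sum[OF summable_norm_ds[OF assms order.refl] summable_sums[OF summable_ds[OF assms order.refl]]])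
  also have "?this \<longleftrightarrow> ?thesis"
    by (rule has_sum_cong_neutral) (auto simp: powr_minus divide_inverse not_le)
  finally show ?thesis .
qed

lemma abs_conv_iff_summable_on:
  "abs_conv a \<sigma> \<longleftrightarrow> (\<lambda>n. norm (a n / of_nat n powr complex_of_real \<sigma>)) summable_on {1..}"
proof -
  have "abs_conv a \<sigma> \<longleftrightarrow> (\<lambda>n. norm (a n) * real n powr (- \<sigma>)) summable_on UNIV"
    unfolding abs_conv_def by (rule summable_on_UNIV_nonneg_real_iff [symmetric]) simp
  also have "\<dots> \<longleftrightarrow> (\<lambda>n. norm (a n / of_nat n powr complex_of_real \<sigma>)) summable_on {1..}"
    by (rule summable_on_cong_neutral)
       (auto simp: norm_mult norm_inverse norm_powr_real_powr powr_minus divide_inverse not_le)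
  finally show ?thesis .
qed

text \<open>The logarithmic derivative is given only on some half-plane. Uniqueness of coefficients
  turns it into the identity \<open>f_log\<close> at every n, which in turn is valid information on
  all of Re s > 1.\<close>

lemma dirichlet_data_fun_upd:
  assumes "A \<ge> 1" "A0 \<ge> 1" and f1: "f 1 = 1"
    and conv: "\<And>s. Re s > 1 \<Longrightarrow> (\<lambda>n. norm (f n / of_nat n powr s)) summable_on {1..}"
    and lam: "log_deriv_coeffs f lam"
    and block: "\<And>x. x \<ge> 1 \<Longrightarrow>
      (\<Sum>n | x < real n \<and> real n \<le> exp 1 * x. (cmod (lam n))\<^sup>2 * mangoldt n / real n)
        \<le> A\<^sup>2 + A0 / ln (exp 1 * x)"
  shows "dirichlet_data lam A A0 (f(0 := 0))"
proof -
  interpret log_coeffs lam A A0 by unfold_locales (use assms in auto)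
  let ?f = "f(0 := 0)"
  have f: "abs_conv f \<sigma>" if "\<sigma> > 1" for \<sigma>
    unfolding abs_conv_iff_summable_on using that by (intro conv) simp
  have f': "abs_conv ?f \<sigma>" if "\<sigma> > 1" for \<sigma>
    by (rule abs_conv_comparison[OF f[OF that], of _ 1]) auto
  from lam obtain \<sigma>0 where \<sigma>0: "\<sigma>0 \<ge> 1" and ld: "\<And>s. Re s > \<sigma>0 \<Longrightarrow> dirichlet_series f s \<noteq> 0 \<and>
      ((\<lambda>n. lam n * mangoldt n / of_nat n powr s) has_sum
           - (deriv (dirichlet_series f) s / dirichlet_series f s)) {1..}"
    unfolding log_deriv_coeffs_def by (elim conjE exE) blast
  have eq: "dirichlet_series f s = ds f s" if "Re s > 1" for s
    unfolding dirichlet_series_def by (rule infsumI[OF has_sum_ds[OF f[OF that]]])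
  \<comment> \<open>The coefficientwise defect of the identity; its series vanishes on the given
    half-plane.\<close>
  define a where "a = (\<lambda>n. f n * of_real (ln (real n)) - dconv Lam ?f n)"
  have fl: "abs_conv (\<lambda>n. f n * complex_of_real (ln (real n))) \<sigma>" if "\<sigma> > 1" for \<sigma>
    using that by (intro abs_conv_ln[of f "(1 + \<sigma>) / 2"] f) auto
  have dc: "abs_conv (dconv Lam ?f) \<sigma>" if "\<sigma> > 1" for \<sigma>
    using that by (intro abs_conv_dconv abs_conv_Lam f')
  have a: "abs_conv a \<sigma>" if "\<sigma> > 1" for \<sigma>
    unfolding abs_conv_def
  proof (rule summable_comparison_test[OF exI[of _ 0]])
    show "summable (\<lambda>n. norm (f n * complex_of_real (ln (real n))) * real n powr (- \<sigma>) + norm (dconv Lam ?f n) * real n powr (- \<sigma>))"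
      using fl[OF that] dc[OF that] unfolding abs_conv_def by (rule summable_add)
    show "\<forall>n\<ge>0. norm (norm (a n) * real n powr - \<sigma>) \<le>
        norm (f n * complex_of_real (ln (real n))) * real n powr (- \<sigma>) + norm (dconv Lam ?f n) * real n powr (- \<sigma>)"
      unfolding a_def distrib_right [symmetric] by (auto intro!: mult_right_mono norm_triangle_ineq4)
  qed
  have z: "ds a s = 0" if s: "Re s > \<sigma>0" for s
  proof -
    have s1: "Re s > 1" using s \<sigma>0 by simp
    have "(ds f has_field_derivative - ds (\<lambda>n. f n * of_real (ln (real n))) s) (at s)"
      using s1 by (intro ds_has_field_derivative[of f "(1 + Re s) / 2"] f) auto
    hence "(dirichlet_series f has_field_derivative - ds (\<lambda>n. f n * of_real (ln (real n))) s) (at s)"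
      by (rule has_field_derivative_transform_within_open[of _ _ _ "{z. Re z > 1}"])
         (use s1 eq in \<open>auto simp: open_halfspace_Re_gt\<close>)
    hence D: "deriv (dirichlet_series f) s = - ds (\<lambda>n. f n * of_real (ln (real n))) s"
      by (rule DERIV_imp_deriv)
    have nz: "ds f s \<noteq> 0" using ld[OF s] eq[OF s1] by simp
    have "((\<lambda>n. Lam n / of_nat n powr s) has_sum (ds (\<lambda>n. f n * of_real (ln (real n))) s / ds f s)) {1..}"
      using ld[OF s] by (simp add: Lam_def D eq[OF s1])
    hence "ds Lam s = ds (\<lambda>n. f n * of_real (ln (real n))) s / ds f s"
      by (rule has_sum_unique[OF has_sum_ds[OF abs_conv_Lam[OF s1]]])
    hence "ds (\<lambda>n. f n * of_real (ln (real n))) s = ds Lam s * ds f s" using nz by simp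
    also have "ds f s = ds ?f s" unfolding ds_def by (intro suminf_cong) auto
    also have "ds Lam s * ds ?f s = ds (dconv Lam ?f) s"
      by (rule ds_dconv [symmetric, OF abs_conv_Lam[OF s1] f'[OF s1]])
    finally have e: "ds (\<lambda>n. f n * of_real (ln (real n))) s = ds (dconv Lam ?f) s" .
    have "ds a s = ds (\<lambda>n. f n * of_real (ln (real n))) s - ds (dconv Lam ?f) s"
      unfolding ds_def a_def left_diff_distrib
      by (rule suminf_diff [symmetric]) (rule summable_ds[OF fl[OF s1] order.refl], rule summable_ds[OF dc[OF s1] order.refl])
    thus ?thesis using e by simp
  qed
  show ?thesis
  proof unfold_locales
    fix n :: nat assume n: "n \<ge> 1"
    have "a n = 0" by (rule ds_eq_0_imp_coeff_0[of a "\<sigma>0 + 1", OF a z n]) (use \<sigma>0 in auto)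
    thus "?f n * of_real (ln (real n)) = dconv Lam ?f n" using n by (simp add: a_def)
  qed (use f1 f' in auto)
qed

lemma norm_exp_minus_1_le:
  fixes u :: complex
  assumes "Re u \<le> 0"
  shows "norm (1 - exp u) \<le> norm u"
proof -
  have "norm (exp u - exp 0) \<le> 1 * norm (u - 0)"
  proof (rule field_differentiable_bound[of "{z. Re z \<le> 0}" exp exp])
    show "convex {z. Re z \<le> 0}" by (rule convex_halfspace_Re_le)
  qed (use assms in \<open>auto intro!: has_field_derivative_at_within DERIV_exp\<close>)
  thus ?thesis by (simp add: norm_minus_commute)
qed

definition osc_index :: "nat \<Rightarrow> nat \<Rightarrow> (nat \<Rightarrow> nat) set" where
  "osc_index R L = Pi\<^sub>E {1..R} (\<lambda>k. {0..L})"

definition osc_coeff :: "nat \<Rightarrow> nat \<Rightarrow> real \<Rightarrow> (nat \<Rightarrow> real) \<Rightarrow> (nat \<Rightarrow> nat) \<Rightarrow> complex" where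
  "osc_coeff R L w \<tau> j = (-1) ^ (\<Sum>k=1..R. j k) * of_nat (vec_binomial R (\<lambda>_. L) j) *
     of_real w powr (\<Sum>k=1..R. of_nat (j k) * (1 + \<i> * of_real (\<tau> k)))"

text \<open>The logarithm of the scaling w^(j_1 + ... + j_R), so that rescaling x becomes
  multiplication by exp of minus the shift.\<close>

definition osc_shift :: "nat \<Rightarrow> real \<Rightarrow> (nat \<Rightarrow> nat) \<Rightarrow> real" where
  "osc_shift R w j = real (\<Sum>k=1..R. j k) * ln w"

text \<open>This is w^(1 + i t - s), the variable of the binomial expansion belonging to one
  coordinate.\<close>

definition osc_factor :: "real \<Rightarrow> real \<Rightarrow> complex \<Rightarrow> complex" where
  "osc_factor w t s = exp (of_real (ln w) * (1 + \<i> * of_real t - s))"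

lemma finite_osc_index: "finite (osc_index R L)"
  unfolding osc_index_def by (rule finite_PiE) auto

lemma osc_shift_nonneg: "ln w \<ge> 0 \<Longrightarrow> osc_shift R w j \<ge> 0"
  by (simp add: osc_shift_def sum_nonneg del: of_nat_sum)

lemma osc_shift_le:
  assumes "ln w \<ge> 0" "j \<in> osc_index R L"
  shows "osc_shift R w j \<le> real (L * R) * ln w"
proof -
  have "(\<Sum>k=1..R. j k) \<le> (\<Sum>k=1..R. L)" using assms by (intro sum_mono) (auto simp: osc_index_def PiE_iff)
  hence "(\<Sum>k=1..R. j k) \<le> L * R" by (simp add: mult.commute)
  hence "real (\<Sum>k=1..R. j k) \<le> real (L * R)" by (simp only: of_nat_le_iff)
  thus ?thesis unfolding osc_shift_def using assms(1) by (rule mult_right_mono)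
qed

lemma oscillation_eq:
  assumes w: "w > 0"
  shows "oscillation f R (\<lambda>_. L) x w \<tau> = (\<Sum>j\<in>osc_index R L. osc_coeff R L w \<tau> j * summatory f (x * exp (- osc_shift R w j)))"
  unfolding oscillation_def osc_index_def osc_coeff_def
proof (intro sum.cong refl arg_cong2[of _ _ _ _ "times"] arg_cong[of _ _ "summatory f"])
  fix j
  have "exp (osc_shift R w j) = w ^ (\<Sum>k=1..R. j k)"
    unfolding osc_shift_def exp_of_nat_mult using w by simp
  thus "x / w ^ (\<Sum>k=1..R. j k) = x * exp (- osc_shift R w j)"
    by (simp add: exp_minus divide_inverse)
qed

lemma summatory_fun_upd_0: "summatory (f(0 := a)) = summatory f"
  by (intro ext) (auto simp: summatory_def intro!: sum.cong)

lemma vec_binomial_PiE: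
  fixes z :: "nat \<Rightarrow> 'a :: comm_semiring_1"
  shows "(\<Sum>j\<in>osc_index R L. of_nat (vec_binomial R (\<lambda>_. L) j) * (\<Prod>k=1..R. z k ^ j k)) = (\<Prod>k=1..R. (1 + z k) ^ L)"
proof -
  have "(\<Prod>k=1..R. (1 + z k) ^ L) = (\<Prod>k=1..R. \<Sum>i\<in>{0..L}. of_nat (L choose i) * z k ^ i)"
  proof (intro prod.cong refl)
    fix k
    have "(1 + z k) ^ L = (z k + 1) ^ L" by (simp add: add.commute)
    also have "\<dots> = (\<Sum>i\<le>L. of_nat (L choose i) * z k ^ i * 1 ^ (L - i))" by (rule binomial_ring)
    finally show "(1 + z k) ^ L = (\<Sum>i\<in>{0..L}. of_nat (L choose i) * z k ^ i)"
      by (simp add: atLeast0AtMost)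
  qed
  also have "\<dots> = (\<Sum>j\<in>osc_index R L. \<Prod>k=1..R. of_nat (L choose j k) * z k ^ j k)"
    unfolding osc_index_def by (rule prod_sum_PiE) auto
  also have "\<dots> = (\<Sum>j\<in>osc_index R L. of_nat (vec_binomial R (\<lambda>_. L) j) * (\<Prod>k=1..R. z k ^ j k))"
    by (simp add: vec_binomial_def prod.distrib)
  finally show ?thesis ..
qed

text \<open>The modulus of the power of w cancels the shift exactly, leaving a plain sum of binomial
  coefficients that does not depend on w or \<tau>.\<close>

lemma sum_norm_osc_coeff:
  assumes w: "w > 0"
  shows "(\<Sum>j\<in>osc_index R L. norm (osc_coeff R L w \<tau> j) * exp (- osc_shift R w j)) = 2 ^ (L * R)"
proof -
  have "norm (osc_coeff R L w \<tau> j) * exp (- osc_shift R w j) = of_nat (vec_binomial R (\<lambda>_. L) j) * (\<Prod>k=1..R. 1 ^ j k)" for j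
  proof -
    have "norm (complex_of_real w powr (\<Sum>k=1..R. of_nat (j k) * (1 + \<i> * of_real (\<tau> k)))) = w powr (\<Sum>k=1..R. real (j k))"
      using w by (simp add: norm_powr_real_powr)
    also have "\<dots> = exp (osc_shift R w j)" using w by (simp add: powr_def osc_shift_def)
    finally show ?thesis by (simp add: osc_coeff_def norm_mult norm_power exp_minus)
  qed
  hence "(\<Sum>j\<in>osc_index R L. norm (osc_coeff R L w \<tau> j) * exp (- osc_shift R w j)) =
    (\<Sum>j\<in>osc_index R L. of_nat (vec_binomial R (\<lambda>_. L) j) * (\<Prod>k=1..R. 1 ^ j k))" by simp
  also have "\<dots> = (\<Prod>k=1..R. (1 + 1) ^ L)" by (rule vec_binomial_PiE)
  finally show ?thesis by (simp add: power_mult)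
qed

lemma osc_polynomial_eq:
  assumes w: "w > 0"
  shows "(\<Sum>j\<in>osc_index R L. osc_coeff R L w \<tau> j * exp (- of_real (osc_shift R w j) * s)) =
    (\<Prod>k=1..R. (1 - osc_factor w (\<tau> k) s) ^ L)"
proof -
  have "osc_coeff R L w \<tau> j * exp (- of_real (osc_shift R w j) * s) =
    of_nat (vec_binomial R (\<lambda>_. L) j) * (\<Prod>k=1..R. (- osc_factor w (\<tau> k) s) ^ j k)" for j
  proof -
    have "(\<Prod>k=1..R. (- osc_factor w (\<tau> k) s) ^ j k) = (\<Prod>k=1..R. (-1) ^ j k * osc_factor w (\<tau> k) s ^ j k)"
      by (intro prod.cong refl) (rule power_minus)
    also have "\<dots> = (-1) ^ (\<Sum>k=1..R. j k) * (\<Prod>k=1..R. osc_factor w (\<tau> k) s ^ j k)"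
      by (simp add: prod.distrib power_sum)
    also have "(\<Prod>k=1..R. osc_factor w (\<tau> k) s ^ j k) = (\<Prod>k=1..R. exp (of_nat (j k) * (of_real (ln w) * (1 + \<i> * of_real (\<tau> k) - s))))"
      by (simp only: osc_factor_def exp_of_nat_mult)
    also have "\<dots> = exp (\<Sum>k=1..R. of_nat (j k) * (of_real (ln w) * (1 + \<i> * of_real (\<tau> k) - s)))"
      by (simp only: exp_sum finite_atLeastAtMost)
    also have "(\<Sum>k=1..R. of_nat (j k) * (of_real (ln w) * (1 + \<i> * of_real (\<tau> k) - s))) =
       (\<Sum>k=1..R. of_nat (j k) * (1 + \<i> * of_real (\<tau> k))) * of_real (ln w) + (- of_real (osc_shift R w j) * s)"
    proof -
      have "(\<Sum>k=1..R. of_nat (j k) * (of_real (ln w) * (1 + \<i> * of_real (\<tau> k) - s))) =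
        (\<Sum>k=1..R. of_nat (j k) * (1 + \<i> * of_real (\<tau> k)) * of_real (ln w) - of_nat (j k) * (of_real (ln w) * s))"
        by (intro sum.cong refl) (simp add: algebra_simps)
      thus ?thesis by (simp add: sum_subtractf sum_distrib_right osc_shift_def mult.assoc)
    qed
    also have "exp \<dots> = of_real w powr (\<Sum>k=1..R. of_nat (j k) * (1 + \<i> * of_real (\<tau> k))) * exp (- of_real (osc_shift R w j) * s)"
      using w by (simp only: exp_add) (simp add: powr_def Ln_of_real)
    finally show ?thesis unfolding osc_coeff_def by (simp only: mult_ac)
  qed
  hence "(\<Sum>j\<in>osc_index R L. osc_coeff R L w \<tau> j * exp (- of_real (osc_shift R w j) * s)) =
    (\<Sum>j\<in>osc_index R L. of_nat (vec_binomial R (\<lambda>_. L) j) * (\<Prod>k=1..R. (- osc_factor w (\<tau> k) s) ^ j k))" by simp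
  also have "\<dots> = (\<Prod>k=1..R. (1 + - osc_factor w (\<tau> k) s) ^ L)" by (rule vec_binomial_PiE)
  finally show ?thesis by simp
qed

text \<open>Differentiating exp (- \<mu> s) produces the weight \<mu>, so the identity follows from
  uniqueness of the derivative, computed once from the sum and once from the product.\<close>

lemma osc_polynomial_deriv_eq:
  assumes w: "w > 0"
  shows "(\<Sum>j\<in>osc_index R L. osc_coeff R L w \<tau> j * of_real (osc_shift R w j) * exp (- of_real (osc_shift R w j) * s)) =
    - (\<Sum>k=1..R. of_nat L * of_real (ln w) * osc_factor w (\<tau> k) s * (1 - osc_factor w (\<tau> k) s) ^ (L - 1) *
        (\<Prod>l\<in>{1..R} - {k}. (1 - osc_factor w (\<tau> l) s) ^ L))"
    (is "?P1 = - ?Q1")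
proof -
  have "((\<lambda>s. \<Sum>j\<in>osc_index R L. osc_coeff R L w \<tau> j * exp (- of_real (osc_shift R w j) * s)) has_field_derivative - ?P1) (at s)"
    unfolding sum_negf [symmetric]
    by (intro DERIV_sum) (auto intro!: derivative_eq_intros simp: mult_ac)
  hence 1: "((\<lambda>s. \<Prod>k=1..R. (1 - osc_factor w (\<tau> k) s) ^ L) has_field_derivative - ?P1) (at s)"
    by (simp only: osc_polynomial_eq[OF w])
  have "((\<lambda>s. \<Prod>k=1..R. (1 - osc_factor w (\<tau> k) s) ^ L) has_field_derivative
     (\<Sum>k=1..R. (of_nat L * (1 - osc_factor w (\<tau> k) s) ^ (L - 1) * (of_real (ln w) * osc_factor w (\<tau> k) s)) *
        (\<Prod>l\<in>{1..R} - {k}. (1 - osc_factor w (\<tau> l) s) ^ L))) (at s)"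
    unfolding has_field_derivative_def
  proof (rule has_derivative_eq_rhs[OF has_derivative_prod])
    fix k
    show "((\<lambda>s. (1 - osc_factor w (\<tau> k) s) ^ L) has_derivative
      times (of_nat L * (1 - osc_factor w (\<tau> k) s) ^ (L - 1) * (of_real (ln w) * osc_factor w (\<tau> k) s))) (at s)"
      unfolding osc_factor_def has_field_derivative_def [symmetric] by (auto intro!: derivative_eq_intros simp: mult_ac)
  qed (simp add: fun_eq_iff sum_distrib_left mult_ac)
  hence 2: "((\<lambda>s. \<Prod>k=1..R. (1 - osc_factor w (\<tau> k) s) ^ L) has_field_derivative ?Q1) (at s)"
    by (simp only: mult_ac)
  show ?thesis using DERIV_unique[OF 1 2] by (simp only: minus_equation_iff[of ?P1] eq_commute)
qed

text \<open>Only the factor at \<open>k0\<close> is known to be small, all others are at most 2. The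
  exponent is L - 1 since differentiation can remove one power; it is used in both bounds for
  uniformity.\<close>

lemma osc_polynomial_bounds:
  assumes w: "w > 0" "ln w \<ge> 0" and L: "L \<ge> 1" and s: "Re s \<ge> 1"
    and k: "k0 \<in> {1..R}" and d: "norm (1 - osc_factor w (\<tau> k0) s) \<le> d" "d \<le> 2"
  shows "norm (\<Sum>j\<in>osc_index R L. osc_coeff R L w \<tau> j * exp (- of_real (osc_shift R w j) * s)) \<le> 2 ^ (L * R) * d ^ (L - 1)"
    and "norm (\<Sum>j\<in>osc_index R L. osc_coeff R L w \<tau> j * of_real (osc_shift R w j) * exp (- of_real (osc_shift R w j) * s))
      \<le> 2 ^ (L * R) * d ^ (L - 1) * (real (L * R) * ln w)"
proof -
  let ?z = "\<lambda>k. osc_factor w (\<tau> k) s"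
  have d0: "d \<ge> 0" using d(1) norm_ge_zero order.trans by blast
  have z1: "norm (?z k) \<le> 1" for k
    using w s by (simp add: osc_factor_def mult_nonneg_nonpos)
  have z2: "norm (1 - ?z k) \<le> 2" for k
    using norm_triangle_ineq4[of 1 "?z k"] z1[of k] by simp
  have dL: "norm (1 - ?z k0) ^ L \<le> 2 * d ^ (L - 1)"
  proof -
    have "norm (1 - ?z k0) ^ L = norm (1 - ?z k0) * norm (1 - ?z k0) ^ (L - 1)" using L by (cases L) auto
    also have "\<dots> \<le> 2 * d ^ (L - 1)" using z2 d by (intro mult_mono power_mono) auto
    finally show ?thesis .
  qed
  have L2: "norm (1 - ?z k) ^ L \<le> 2 ^ L" for k using z2 by (intro power_mono) auto
  have p: "(2 :: real) * 2 ^ (L - 1) = 2 ^ L" using L by (cases L) auto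
  have prodk0: "(\<Prod>k\<in>B. norm (1 - ?z k) ^ L) \<le> 2 * d ^ (L - 1) * 2 ^ (L * (card B - 1))"
    if "finite B" "k0 \<in> B" for B
  proof -
    have "(\<Prod>k\<in>B. norm (1 - ?z k) ^ L) = norm (1 - ?z k0) ^ L * (\<Prod>k\<in>B - {k0}. norm (1 - ?z k) ^ L)"
      using that by (rule prod.remove)
    also have "\<dots> \<le> (2 * d ^ (L - 1)) * (\<Prod>k\<in>B - {k0}. 2 ^ L)"
      using d0 by (intro mult_mono dL prod_mono prod_nonneg) (auto intro: L2)
    also have "(\<Prod>k\<in>B - {k0}. (2 :: real) ^ L) = 2 ^ (L * (card B - 1))" using that by (simp add: power_mult)
    finally show ?thesis .
  qed
  have R: "R \<ge> 1" using k by simp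
  have "norm (\<Prod>k=1..R. (1 - ?z k) ^ L) = (\<Prod>k=1..R. norm (1 - ?z k) ^ L)" by (simp add: prod_norm norm_power flip: prod_norm)
  also have "\<dots> \<le> 2 * d ^ (L - 1) * 2 ^ (L * (card {1..R} - 1))" by (rule prodk0) (use k in auto)
  also have "\<dots> = d ^ (L - 1) * 2 ^ Suc (L * (R - 1))" by simp
  also have "\<dots> \<le> d ^ (L - 1) * 2 ^ (L * R)"
  proof (intro mult_left_mono power_increasing)
    show "Suc (L * (R - 1)) \<le> L * R" using L R by (cases R) auto
  qed (use d0 in auto)
  finally show "norm (\<Sum>j\<in>osc_index R L. osc_coeff R L w \<tau> j * exp (- of_real (osc_shift R w j) * s)) \<le> 2 ^ (L * R) * d ^ (L - 1)"
    unfolding osc_polynomial_eq[OF w(1)] by (simp only: mult.commute)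
  have "norm (\<Sum>k=1..R. of_nat L * of_real (ln w) * ?z k * (1 - ?z k) ^ (L - 1) * (\<Prod>l\<in>{1..R} - {k}. (1 - ?z l) ^ L))
    \<le> (\<Sum>k=1..R. real L * ln w * 1 * (2 ^ (L * R) * d ^ (L - 1)))"
  proof (rule sum_norm_le)
    fix k assume k1: "k \<in> {1..R}"
    have "norm ((1 - ?z k) ^ (L - 1)) * (\<Prod>l\<in>{1..R} - {k}. norm (1 - ?z l) ^ L) \<le> 2 ^ (L * R) * d ^ (L - 1)"
    proof (cases "k = k0")
      case True
      have "norm ((1 - ?z k) ^ (L - 1)) * (\<Prod>l\<in>{1..R} - {k}. norm (1 - ?z l) ^ L) \<le> d ^ (L - 1) * (\<Prod>l\<in>{1..R} - {k}. 2 ^ L)"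
        using d True d0 unfolding norm_power by (intro mult_mono power_mono prod_mono prod_nonneg) (auto intro: L2)
      also have "\<dots> = d ^ (L - 1) * 2 ^ (L * (R - 1))" using k1 by (simp add: power_mult)
      also have "\<dots> \<le> d ^ (L - 1) * 2 ^ (L * R)" using d0 by (intro mult_left_mono power_increasing) auto
      finally show ?thesis by (simp only: mult.commute)
    next
      case False
      hence R2: "R \<ge> 2" using k k1 by auto
      have "norm ((1 - ?z k) ^ (L - 1)) * (\<Prod>l\<in>{1..R} - {k}. norm (1 - ?z l) ^ L) \<le>
        2 ^ (L - 1) * (2 * d ^ (L - 1) * 2 ^ (L * (card ({1..R} - {k}) - 1)))"
        unfolding norm_power using False k
        by (intro mult_mono power_mono prodk0 prod_nonneg) (auto intro: z2)
      also have "\<dots> = (2 * 2 ^ (L - 1)) * 2 ^ (L * (R - 1 - 1)) * d ^ (L - 1)" using k1 by simp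
      also have "\<dots> = 2 ^ (L + L * (R - 1 - 1)) * d ^ (L - 1)" unfolding p by (simp only: power_add)
      also have "\<dots> \<le> 2 ^ (L * R) * d ^ (L - 1)"
      proof (intro mult_right_mono power_increasing)
        have "R = Suc (Suc (R - 2))" using R2 by simp
        then obtain r where "R = Suc (Suc r)" by blast
        thus "L + L * (R - 1 - 1) \<le> L * R" by simp
      qed (use d0 in auto)
      finally show ?thesis .
    qed
    note bound = this
    have "(real L * ln w * norm (?z k)) * (norm ((1 - ?z k) ^ (L - 1)) * (\<Prod>l\<in>{1..R} - {k}. norm (1 - ?z l) ^ L)) \<le>
      (real L * ln w * 1) * (2 ^ (L * R) * d ^ (L - 1))"
      by (rule mult_mono[OF mult_left_mono[OF z1] bound]) (use w in \<open>auto intro!: mult_nonneg_nonneg prod_nonneg\<close>)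
    moreover have "norm (of_nat L * of_real (ln w) * ?z k * (1 - ?z k) ^ (L - 1) * (\<Prod>l\<in>{1..R} - {k}. (1 - ?z l) ^ L)) =
      (real L * ln w * norm (?z k)) * (norm ((1 - ?z k) ^ (L - 1)) * (\<Prod>l\<in>{1..R} - {k}. norm (1 - ?z l) ^ L))"
      using w by (simp add: norm_mult norm_power flip: prod_norm)
    ultimately show "norm (of_nat L * of_real (ln w) * ?z k * (1 - ?z k) ^ (L - 1) * (\<Prod>l\<in>{1..R} - {k}. (1 - ?z l) ^ L)) \<le>
      real L * ln w * 1 * (2 ^ (L * R) * d ^ (L - 1))" by (simp only:)
  qed
  also have "\<dots> = 2 ^ (L * R) * d ^ (L - 1) * (real (L * R) * ln w)" by simp
  finally show "norm (\<Sum>j\<in>osc_index R L. osc_coeff R L w \<tau> j * of_real (osc_shift R w j) * exp (- of_real (osc_shift R w j) * s))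
      \<le> 2 ^ (L * R) * d ^ (L - 1) * (real (L * R) * ln w)"
    unfolding osc_polynomial_deriv_eq[OF w(1)] norm_minus_cancel .
qed

section \<open>The generating function times the oscillation polynomial\<close>

context dirichlet_data
begin

text \<open>At separation \<L>^(-1/R) the R^2 pairs cost as much as the diagonal, R ln \<L> in total
  each. Since F at z is at most F at every chosen point, averaging over the R points bounds
  it.\<close>

lemma maximal_points_bound:
  fixes s :: "nat \<Rightarrow> complex" and \<epsilon> :: real
  assumes \<L>: "\<L> \<ge> 8" and T: "T \<ge> 1" and \<epsilon>: "\<epsilon> > 0" and R: "real R \<ge> 10 * A\<^sup>2 / \<epsilon>\<^sup>2" "R \<ge> 1"
    and s: "\<And>k. k \<in> {1..R} \<Longrightarrow> s k \<in> strip_box (1 / \<L>) T"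
    and sep: "\<And>k l. k \<in> {1..R} \<Longrightarrow> l \<in> {1..R} \<Longrightarrow> k \<noteq> l \<Longrightarrow> \<bar>Im (s k) - Im (s l)\<bar> \<ge> \<L> powr (- (1 / real R))"
    and z: "Re z > 1" and max: "\<And>k. k \<in> {1..R} \<Longrightarrow> norm (F z) \<le> norm (F (s k))"
    and large: "ln (1 + \<L>) \<le> (1 + \<epsilon>\<^sup>2 / (1000 * A\<^sup>2)) * ln \<L>"
      "ln (\<L> powr (1 / real R) + 2 * ln (2 * T + 4) + 4) \<le> (1 / real R + \<epsilon>\<^sup>2 / (1000 * A\<^sup>2 * real R)) * ln \<L>"
      "4 * (A\<^sup>2 + A0) \<le> A\<^sup>2 / 1000 * ln \<L>"
  shows "norm (F z) \<le> \<L> powr (46 / 100 * \<epsilon>)"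
proof -
  \<comment> \<open>Close to the optimal balance of \<theta> A^2 against 2 R / \<theta> when R = 10
    A^2 / \<epsilon>^2; the two become R \<epsilon> / 2 and 4 A^2 / \<epsilon>.\<close>
  define \<theta> where "\<theta> = real R * \<epsilon> / (2 * A\<^sup>2)"
  have A2: "A\<^sup>2 \<ge> 1" using A by simp
  have R0: "real R > 0" using R by simp
  have \<theta>: "\<theta> > 0" unfolding \<theta>_def using R0 \<epsilon> A2 by (intro divide_pos_pos mult_pos_pos) linarith+
  have lL: "ln \<L> > 0" using \<L> by simp
  define \<gamma> where "\<gamma> = \<epsilon>\<^sup>2 / (1000 * A\<^sup>2)"
  have \<gamma>0: "\<gamma> \<ge> 0" by (simp add: \<gamma>_def)
  have "2 * (\<Sum>k=1..R. ln (norm (F (s k)))) \<le> \<theta> * (A\<^sup>2 * ln (1 / (1 / \<L>)) + 4 * (A\<^sup>2 + A0)) +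
     (real R * ln (1 + 1 / (1 / \<L>)) + (real R)\<^sup>2 * ln (1 / \<L> powr (- (1 / real R)) + 2 * ln (2 * T + 4) + 4)) / \<theta>"
  proof (rule sum_ln_norm_F_le[OF _ _ _ _ \<theta> s sep T])
    show "\<L> powr (- (1 / real R)) \<le> 1" using \<L> R0 powr_mono[of "- (1 / real R)" 0 \<L>] by simp
  qed (use \<L> in auto)
  also have "1 / \<L> powr (- (1 / real R)) = \<L> powr (1 / real R)" by (simp add: powr_minus divide_inverse)
  also have "\<theta> * (A\<^sup>2 * ln (1 / (1 / \<L>)) + 4 * (A\<^sup>2 + A0)) +
     (real R * ln (1 + 1 / (1 / \<L>)) + (real R)\<^sup>2 * ln (\<L> powr (1 / real R) + 2 * ln (2 * T + 4) + 4)) / \<theta> \<le>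
     \<theta> * (A\<^sup>2 * ln \<L> + A\<^sup>2 / 1000 * ln \<L>) +
     (real R * ((1 + \<gamma>) * ln \<L>) + (real R)\<^sup>2 * ((1 / real R + \<gamma> / real R) * ln \<L>)) / \<theta>"
    using large \<theta> R0 unfolding \<gamma>_def
    by (intro add_mono mult_left_mono divide_right_mono) (auto simp: divide_divide_eq_left)
  also have "\<dots> = (\<theta> * A\<^sup>2 * (1001 / 1000) + 2 * real R * (1 + \<gamma>) / \<theta>) * ln \<L>"
    using \<theta> R0 by (simp add: field_simps power2_eq_square)
  also have "\<theta> * A\<^sup>2 = real R * \<epsilon> / 2" using A by (simp add: \<theta>_def)
  also have "2 * real R * (1 + \<gamma>) / \<theta> = 4 * A\<^sup>2 / \<epsilon> + \<epsilon> / 250"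
    using A \<epsilon> R0 by (simp add: \<theta>_def \<gamma>_def field_simps power2_eq_square)
  \<comment> \<open>As R >= 10 A^2 / \<epsilon>^2, the term 4 A^2 / \<epsilon> is at most 4/10 R
    \<epsilon>. The total 9/10 R \<epsilon>, halved and divided by R, is 45/100 \<epsilon>; one
    hundredth is left for the error terms.\<close>
  also have "(real R * \<epsilon> / 2 * (1001 / 1000) + (4 * A\<^sup>2 / \<epsilon> + \<epsilon> / 250)) * ln \<L> \<le> (2 * (46 / 100 * \<epsilon>) * real R) * ln \<L>"
  proof (intro mult_right_mono)
    define y q where "y = real R * \<epsilon>" and "q = A\<^sup>2 / \<epsilon>"
    have "10 * A\<^sup>2 / \<epsilon>\<^sup>2 * \<epsilon> \<le> y" unfolding y_def using R \<epsilon> by (intro mult_right_mono) auto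
    hence 1: "10 * q \<le> y" using \<epsilon> by (simp add: power2_eq_square q_def)
    have 2: "\<epsilon> \<le> y" using R \<epsilon> by (simp add: y_def)
    have "real R * \<epsilon> / 2 * (1001 / 1000) + (4 * A\<^sup>2 / \<epsilon> + \<epsilon> / 250) = y / 2 * (1001 / 1000) + (4 * q + \<epsilon> / 250)"
      by (simp add: y_def q_def)
    also have "\<dots> \<le> 92 / 100 * y" using 1 2 \<epsilon> by linarith
    also have "92 / 100 * y = 2 * (46 / 100 * \<epsilon>) * real R" by (simp add: y_def)
    finally show "real R * \<epsilon> / 2 * (1001 / 1000) + (4 * A\<^sup>2 / \<epsilon> + \<epsilon> / 250) \<le> 2 * (46 / 100 * \<epsilon>) * real R" .
  qed (use lL in auto)
  finally have "2 * (\<Sum>k=1..R. ln (norm (F (s k)))) \<le> (2 * (46 / 100 * \<epsilon>) * real R) * ln \<L>" .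
  moreover have "(2 * (46 / 100 * \<epsilon>) * real R) * ln \<L> = 2 * (real R * (46 / 100 * \<epsilon> * ln \<L>))" by (simp add: mult_ac)
  ultimately have ub: "(\<Sum>k=1..R. ln (norm (F (s k)))) \<le> real R * (46 / 100 * \<epsilon> * ln \<L>)" by linarith
  have nz: "norm (F z) > 0" using F_nonzero[OF z] by simp
  have "real R * ln (norm (F z)) = (\<Sum>k=1..R. ln (norm (F z)))" by simp
  also have "\<dots> \<le> (\<Sum>k=1..R. ln (norm (F (s k))))"
    by (intro sum_mono ln_le_mono nz max)
  also note ub
  finally have "ln (norm (F z)) \<le> 46 / 100 * \<epsilon> * ln \<L>" using R0 by (rule mult_left_le_imp_le)
  hence "exp (ln (norm (F z))) \<le> exp (46 / 100 * \<epsilon> * ln \<L>)" by (simp only: exp_le_cancel_iff)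
  moreover have "\<L> powr (46 / 100 * \<epsilon>) = exp (46 / 100 * \<epsilon> * ln \<L>)" using \<L> by (simp add: powr_def)
  ultimately show ?thesis unfolding exp_ln[OF nz] by (simp only:)
qed

lemma mollified_F_bound:
  fixes \<epsilon> w :: real and R L :: nat
  defines "C2 \<equiv> CF * (2 ^ (L * R) * 2 ^ (L - 1) * real (L * R))"
  assumes \<L>: "\<L> \<ge> 8" and T: "T \<ge> 1" and \<epsilon>: "0 < \<epsilon>" "\<epsilon> \<le> 1"
    and R: "R = nat \<lfloor>10 * A\<^sup>2 / \<epsilon>\<^sup>2\<rfloor> + 1" and L: "L = nat \<lfloor>10 * A * real R\<rfloor>"
    and w: "w > 0" "0 \<le> ln w" "ln w \<le> \<L> powr (1 / (3 * real R))"
    and large: "ln (1 + \<L>) \<le> (1 + \<epsilon>\<^sup>2 / (1000 * A\<^sup>2)) * ln \<L>"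
      "ln (\<L> powr (1 / real R) + 2 * ln (2 * T + 4) + 4) \<le> (1 / real R + \<epsilon>\<^sup>2 / (1000 * A\<^sup>2 * real R)) * ln \<L>"
      "4 * (A\<^sup>2 + A0) \<le> A\<^sup>2 / 1000 * ln \<L>"
  shows "\<exists>\<tau>. (\<forall>k\<in>{1..R}. \<bar>\<tau> k\<bar> \<le> T) \<and> (\<forall>s\<in>strip_box (1 / \<L>) T.
     norm (F s * (\<Sum>j\<in>osc_index R L. osc_coeff R L w \<tau> j * exp (- of_real (osc_shift R w j) * s))) \<le> C2 * \<L> powr (\<epsilon> / 2) \<and>
     norm (F s * (\<Sum>j\<in>osc_index R L. osc_coeff R L w \<tau> j * of_real (osc_shift R w j) * exp (- of_real (osc_shift R w j) * s))) \<le> C2 * \<L> powr (\<epsilon> / 2))"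
proof -
  have A2: "A\<^sup>2 \<ge> 1" using A by simp
  have R1: "R \<ge> 1" "real R \<ge> 1" using R by auto
  have RA: "10 * A\<^sup>2 / \<epsilon>\<^sup>2 \<le> real R" using R by linarith
  have AR1: "A * real R \<ge> 1" using mult_mono[of 1 A 1 "real R"] A R1 by simp
  have LA: "real L \<ge> 10 * A * real R - 1" using L by linarith
  have L2: "real L \<ge> 9" using LA AR1 by linarith
  hence L1: "L \<ge> 1" by simp
  have LR1: "real (L * R) \<ge> 1"
    using mult_mono[of 1 "real L" 1 "real R"] L2 R1 by simp
  have inv: "\<epsilon>\<^sup>2 / (10 * A\<^sup>2) \<ge> 1 / real R"
  proof -
    have pos: "10 * A\<^sup>2 > 0" "real R > 0" using A2 R1 by linarith+
    have "10 * A\<^sup>2 \<le> real R * \<epsilon>\<^sup>2" using RA \<epsilon> by (simp add: divide_le_eq)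
    thus ?thesis unfolding pos_le_divide_eq[OF pos(1)] using pos(2) by (simp add: pos_divide_le_eq mult.commute)
  qed
  have e2: "\<epsilon>\<^sup>2 \<le> \<epsilon>" using \<epsilon> by (simp add: power2_eq_square)
  have AR: "A / real R \<le> \<epsilon> / 10"
  proof -
    have "A / real R = A * (1 / real R)" by simp
    also have "\<dots> \<le> A * (\<epsilon>\<^sup>2 / (10 * A\<^sup>2))" using inv A by (intro mult_left_mono) auto
    also have "\<dots> = \<epsilon>\<^sup>2 / 10 / A" using A by (simp add: field_simps power2_eq_square)
    also have "\<dots> \<le> \<epsilon>\<^sup>2 / 10 / 1" using A by (intro divide_left_mono) auto
    finally show ?thesis using e2 by simp
  qed
  have R3: "1 / (3 * real R) \<le> \<epsilon> / 30"
  proof -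
    have "1 / real R \<le> A / real R" using A R1 by (intro divide_right_mono) auto
    hence "1 / real R \<le> \<epsilon> / 10" using AR by linarith
    thus ?thesis by simp
  qed
  define \<rho> where "\<rho> = \<L> powr (- (1 / real R))"
  have \<rho>0: "\<rho> > 0" using \<L> by (simp add: \<rho>_def)
  have \<kappa>: "0 < 1 / \<L>" "1 / \<L> \<le> 1" using \<L> by simp_all
  obtain s where s': "\<forall>k\<in>{1..R}. s k \<in> strip_box (1 / \<L>) T"
    and S': "\<forall>z\<in>strip_box (1 / \<L>) T. (\<forall>k\<in>{1..R}. \<bar>Im z - Im (s k)\<bar> \<ge> \<rho>) \<longrightarrow>
       (\<forall>k\<in>{1..R}. norm (F z) \<le> norm (F (s k))) \<and>
       (\<forall>k\<in>{1..R}. \<forall>l\<in>{1..R}. k \<noteq> l \<longrightarrow> \<bar>Im (s k) - Im (s l)\<bar> \<ge> \<rho>)"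
    using successive_maxima[OF \<kappa> order.trans[OF zero_le_one T], of R \<rho>] by (elim exE conjE) (rule that)
  have s: "s k \<in> strip_box (1 / \<L>) T" if "k \<in> {1..R}" for k using s' that by (rule bspec)
  define \<tau> where "\<tau> = (\<lambda>k. Im (s k))"
  \<comment> \<open>The derivative polynomial carries the additional factor L R ln w, of size
    \<L>^(\<epsilon>/30) at most; 46/100 + 1/30 is still below 1/2.\<close>
  have key: "norm (F z) * d ^ (L - 1) * max 1 (real (L * R) * ln w) \<le> 2 ^ (L - 1) * CF * real (L * R) * \<L> powr (\<epsilon> / 2)"
    if z: "z \<in> strip_box (1 / \<L>) T" and d: "norm (F z) * d ^ (L - 1) \<le> 2 ^ (L - 1) * CF * \<L> powr (46 / 100 * \<epsilon>)" for z d
  proof -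
    have "real (L * R) * ln w \<le> real (L * R) * \<L> powr (\<epsilon> / 30)"
    proof (intro mult_left_mono order.trans[OF w(3)] powr_mono R3)
    qed (use \<L> in auto)
    moreover have "1 * 1 \<le> real (L * R) * \<L> powr (\<epsilon> / 30)"
      using LR1 \<L> \<epsilon> by (intro mult_mono ge_one_powr_ge_zero) auto
    ultimately have m: "max 1 (real (L * R) * ln w) \<le> real (L * R) * \<L> powr (\<epsilon> / 30)" by simp
    have "norm (F z) * d ^ (L - 1) * max 1 (real (L * R) * ln w) \<le> (2 ^ (L - 1) * CF * \<L> powr (46 / 100 * \<epsilon>)) * (real (L * R) * \<L> powr (\<epsilon> / 30))"
      using CF_ge_1 by (intro mult_mono d m) auto
    also have "\<dots> = 2 ^ (L - 1) * CF * real (L * R) * (\<L> powr (46 / 100 * \<epsilon>) * \<L> powr (\<epsilon> / 30))" by (simp only: mult_ac)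
    also have "\<dots> \<le> 2 ^ (L - 1) * CF * real (L * R) * \<L> powr (\<epsilon> / 2)"
      unfolding powr_add [symmetric] using CF_ge_1 \<L> \<epsilon> by (intro mult_left_mono powr_mono) auto
    finally show ?thesis .
  qed
  have one: "norm (F z * (\<Sum>j\<in>osc_index R L. osc_coeff R L w \<tau> j * exp (- of_real (osc_shift R w j) * z))) \<le> C2 * \<L> powr (\<epsilon> / 2) \<and>
     norm (F z * (\<Sum>j\<in>osc_index R L. osc_coeff R L w \<tau> j * of_real (osc_shift R w j) * exp (- of_real (osc_shift R w j) * z))) \<le> C2 * \<L> powr (\<epsilon> / 2)"
    if z: "z \<in> strip_box (1 / \<L>) T" and k: "k0 \<in> {1..R}" and d: "norm (1 - osc_factor w (\<tau> k0) z) \<le> d" "d \<le> 2"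
      and Fd: "norm (F z) * d ^ (L - 1) \<le> 2 ^ (L - 1) * CF * \<L> powr (46 / 100 * \<epsilon>)" for z d k0
  proof -
    have "1 + 1 / \<L> \<le> Re z" using z by (simp add: strip_box_def)
    hence z1: "Re z \<ge> 1" using \<kappa> by linarith
    have d0: "d \<ge> 0" by (rule order.trans[OF norm_ge_zero d(1)])
    have *: "norm (F z) * (2 ^ (L * R) * d ^ (L - 1) * y) \<le> C2 * \<L> powr (\<epsilon> / 2)"
      if y: "y \<le> max 1 (real (L * R) * ln w)" "y \<ge> 0" for y
    proof -
      have "norm (F z) * (2 ^ (L * R) * d ^ (L - 1) * y) = 2 ^ (L * R) * (norm (F z) * d ^ (L - 1) * y)" by (simp only: mult_ac)
      also have "\<dots> \<le> 2 ^ (L * R) * (norm (F z) * d ^ (L - 1) * max 1 (real (L * R) * ln w))"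
        using d0 y by (intro mult_left_mono) auto
      also have "\<dots> \<le> 2 ^ (L * R) * (2 ^ (L - 1) * CF * real (L * R) * \<L> powr (\<epsilon> / 2))"
        by (intro mult_left_mono key z Fd) auto
      also have "\<dots> = C2 * \<L> powr (\<epsilon> / 2)" unfolding C2_def by (simp only: mult_ac)
      finally show ?thesis .
    qed
    note b = osc_polynomial_bounds[where \<tau> = \<tau>, OF w(1,2) L1 z1 k d]
    show ?thesis
    proof
      have "norm (F z * (\<Sum>j\<in>osc_index R L. osc_coeff R L w \<tau> j * exp (- of_real (osc_shift R w j) * z))) \<le>
        norm (F z) * (2 ^ (L * R) * d ^ (L - 1) * 1)"
        unfolding norm_mult mult_1_right by (intro mult_left_mono b norm_ge_zero)
      also have "\<dots> \<le> C2 * \<L> powr (\<epsilon> / 2)" by (rule *) auto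
      finally show "norm (F z * (\<Sum>j\<in>osc_index R L. osc_coeff R L w \<tau> j * exp (- of_real (osc_shift R w j) * z))) \<le> C2 * \<L> powr (\<epsilon> / 2)" .
      have "norm (F z * (\<Sum>j\<in>osc_index R L. osc_coeff R L w \<tau> j * of_real (osc_shift R w j) * exp (- of_real (osc_shift R w j) * z))) \<le>
        norm (F z) * (2 ^ (L * R) * d ^ (L - 1) * (real (L * R) * ln w))"
        unfolding norm_mult[of "F z"] by (intro mult_left_mono b norm_ge_zero)
      also have "\<dots> \<le> C2 * \<L> powr (\<epsilon> / 2)" using w(2) by (intro *) auto
      finally show "norm (F z * (\<Sum>j\<in>osc_index R L. osc_coeff R L w \<tau> j * of_real (osc_shift R w j) * exp (- of_real (osc_shift R w j) * z))) \<le> C2 * \<L> powr (\<epsilon> / 2)" .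
    qed
  qed
  have factor_le_2: "norm (1 - osc_factor w t z) \<le> 2" if "Re z \<ge> 1" for z t
  proof -
    have "norm (osc_factor w t z) \<le> 1" using that w by (simp add: osc_factor_def mult_nonneg_nonpos)
    thus ?thesis using norm_triangle_ineq4[of 1 "osc_factor w t z"] by simp
  qed
  have "norm (F z * (\<Sum>j\<in>osc_index R L. osc_coeff R L w \<tau> j * exp (- of_real (osc_shift R w j) * z))) \<le> C2 * \<L> powr (\<epsilon> / 2) \<and>
     norm (F z * (\<Sum>j\<in>osc_index R L. osc_coeff R L w \<tau> j * of_real (osc_shift R w j) * exp (- of_real (osc_shift R w j) * z))) \<le> C2 * \<L> powr (\<epsilon> / 2)"
    if z: "z \<in> strip_box (1 / \<L>) T" for z
  proof -
    have zr: "1 + 1 / \<L> \<le> Re z" "Re z \<le> 2" using z by (auto simp: strip_box_def)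
    have "1 / \<L> > 0" using \<L> by simp
    hence z1: "Re z > 1" "Re z \<ge> 1" using zr by linarith+
    have small: "norm (F z) \<le> CF * \<L> powr (46 / 100 * \<epsilon>) \<Longrightarrow> ?thesis"
    proof -
      assume "norm (F z) \<le> CF * \<L> powr (46 / 100 * \<epsilon>)"
      hence "norm (F z) * 2 ^ (L - 1) \<le> CF * \<L> powr (46 / 100 * \<epsilon>) * 2 ^ (L - 1)" by (intro mult_right_mono) auto
      hence "norm (F z) * 2 ^ (L - 1) \<le> 2 ^ (L - 1) * CF * \<L> powr (46 / 100 * \<epsilon>)" by (simp only: mult_ac)
      thus ?thesis using R1 by (intro one[OF z, of 1 2] factor_le_2 z1) auto
    qed
    show ?thesis
    proof (cases "\<forall>k\<in>{1..R}. \<bar>Im z - Im (s k)\<bar> \<ge> \<rho>")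
      case True
      note S = mp[OF bspec[OF S' z] True]
      have sep: "\<bar>Im (s k) - Im (s l)\<bar> \<ge> \<L> powr (- (1 / real R))" if "k \<in> {1..R}" "l \<in> {1..R}" "k \<noteq> l" for k l
        using S that unfolding \<rho>_def by blast
      have max: "norm (F z) \<le> norm (F (s k))" if "k \<in> {1..R}" for k using S that by blast
      have "norm (F z) \<le> \<L> powr (46 / 100 * \<epsilon>)"
        by (rule maximal_points_bound[OF \<L> T \<epsilon>(1) RA R1(1) s sep z1(1) max large])
      also have "\<dots> \<le> CF * \<L> powr (46 / 100 * \<epsilon>)" using mult_right_mono[OF CF_ge_1, of "\<L> powr (46 / 100 * \<epsilon>)"] by simp
      finally show ?thesis by (rule small)
    next
      case False
      then obtain k0 where k0: "k0 \<in> {1..R}" "\<bar>Im z - Im (s k0)\<bar> < \<rho>" unfolding not_le [symmetric] by blast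
      show ?thesis
      proof (cases "Re z - 1 \<ge> \<rho>")
        case True
        have "norm (F z) \<le> CF * (Re z - 1) powr (- A)" by (rule norm_F_le[OF z1(1) zr(2)])
        also have "\<dots> \<le> CF * \<rho> powr (- A)" using True \<rho>0 A CF_ge_1 by (intro mult_left_mono powr_mono2') auto
        also have "\<rho> powr (- A) = \<L> powr (A / real R)" by (simp add: \<rho>_def powr_powr)
        also have "CF * \<L> powr (A / real R) \<le> CF * \<L> powr (46 / 100 * \<epsilon>)"
        proof (intro mult_left_mono powr_mono)
          show "A / real R \<le> 46 / 100 * \<epsilon>" using AR \<epsilon> by linarith
        qed (use \<L> CF_ge_1 in auto)
        finally show ?thesis by (rule small)
      next
        case False
        \<comment> \<open>The distance to the zero 1 + i \<tau> of the factor is at most 2 \<rho>,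
          and ln w multiplies it by at most \<L>^(1/(3R)); the exponents add to - 2 / (3 R).\<close>
        define d where "d = 2 * \<L> powr (- (2 / (3 * real R)))"
        have "\<L> powr (- (2 / (3 * real R))) \<le> \<L> powr 0" using \<L> R1 by (intro powr_mono) auto
        hence d2: "d \<le> 2" using \<L> by (simp add: d_def)
        have "norm (1 - osc_factor w (\<tau> k0) z) \<le> norm (of_real (ln w) * (1 + \<i> * of_real (\<tau> k0) - z))"
          unfolding osc_factor_def by (rule norm_exp_minus_1_le) (use w z1 in \<open>auto intro!: mult_nonneg_nonpos\<close>)
        also have "\<dots> = ln w * norm (1 + \<i> * of_real (\<tau> k0) - z)" using w by (simp add: norm_mult)
        also have "\<dots> \<le> \<L> powr (1 / (3 * real R)) * (2 * \<rho>)"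
        proof (intro mult_mono w)
          have "norm (1 + \<i> * of_real (\<tau> k0) - z) \<le> \<bar>Re (1 + \<i> * of_real (\<tau> k0) - z)\<bar> + \<bar>Im (1 + \<i> * of_real (\<tau> k0) - z)\<bar>"
            by (rule cmod_le)
          moreover have "\<bar>Re (1 + \<i> * of_real (\<tau> k0) - z)\<bar> = Re z - 1" using z1 by simp
          moreover have "\<bar>Im (1 + \<i> * of_real (\<tau> k0) - z)\<bar> = \<bar>Im z - Im (s k0)\<bar>" by (simp add: \<tau>_def abs_minus_commute)
          ultimately show "norm (1 + \<i> * of_real (\<tau> k0) - z) \<le> 2 * \<rho>" using False k0(2) by linarith
        qed auto
        also have "\<dots> = d"
        proof -
          have "1 / (3 * real R) + - (1 / real R) = - (2 / (3 * real R))" using R1 by (simp add: field_simps)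
          thus ?thesis unfolding d_def \<rho>_def by (simp add: powr_add [symmetric])
        qed
        finally have d1: "norm (1 - osc_factor w (\<tau> k0) z) \<le> d" .
        have "norm (F z) \<le> CF * (Re z - 1) powr (- A)" by (rule norm_F_le[OF z1(1) zr(2)])
        also have "\<dots> \<le> CF * (1 / \<L>) powr (- A)" using zr \<L> A CF_ge_1 by (intro mult_left_mono powr_mono2') auto
        also have "(1 / \<L>) powr (- A) = \<L> powr A" using \<L> by (simp add: powr_def ln_div)
        finally have FA: "norm (F z) \<le> CF * \<L> powr A" .
        have dL: "d ^ (L - 1) = 2 ^ (L - 1) * \<L> powr (- (2 / (3 * real R)) * real (L - 1))"
          using \<L> by (simp add: d_def power_mult_distrib powr_power mult.commute)
        \<comment> \<open>L is about 10 A R, so 2 (L - 1) / (3 R) exceeds A with room to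
          spare.\<close>
        have ex: "A - 2 / (3 * real R) * real (L - 1) \<le> 46 / 100 * \<epsilon>"
        proof -
          have "real (L - 1) = real L - 1" using L1 by simp
          hence "A * (3 * real R) \<le> 2 * real (L - 1)" using LA AR1 by simp
          hence "A \<le> 2 * real (L - 1) / (3 * real R)" using R1 by (simp add: le_divide_eq)
          thus ?thesis using \<epsilon> by simp
        qed
        have "norm (F z) * d ^ (L - 1) \<le> (CF * \<L> powr A) * (2 ^ (L - 1) * \<L> powr (- (2 / (3 * real R)) * real (L - 1)))"
          unfolding dL by (intro mult_right_mono FA) auto
        also have "\<dots> = 2 ^ (L - 1) * CF * (\<L> powr A * \<L> powr (- (2 / (3 * real R)) * real (L - 1)))"
          by (simp only: mult_ac)
        also have "\<L> powr A * \<L> powr (- (2 / (3 * real R)) * real (L - 1)) = \<L> powr (A - 2 / (3 * real R) * real (L - 1))"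
          by (simp only: powr_add [symmetric] mult_minus_left add_uminus_conv_diff)
        also have "2 ^ (L - 1) * CF * \<L> powr (A - 2 / (3 * real R) * real (L - 1)) \<le> 2 ^ (L - 1) * CF * \<L> powr (46 / 100 * \<epsilon>)"
          using ex \<L> CF_ge_1 by (intro mult_left_mono powr_mono) auto
        finally show ?thesis by (rule one[OF z k0(1) d1 d2])
      qed
    qed
  qed
  moreover have "\<bar>\<tau> k\<bar> \<le> T" if "k \<in> {1..R}" for k
    using s[OF that] by (simp add: \<tau>_def strip_box_def)
  ultimately show ?thesis by blast
qed

end

section \<open>Choice of parameters\<close>

text \<open>All size conditions on x = \<L>, collected so that their eventual validity is settled
  once, with constants not involving f. T, h and \<delta> appear already expanded as exponentials of
  multiples of the square of ln x.\<close>

definition large_height :: "real \<Rightarrow> real \<Rightarrow> real \<Rightarrow> real \<Rightarrow> real \<Rightarrow> real \<Rightarrow> real \<Rightarrow> real \<Rightarrow> nat \<Rightarrow> nat \<Rightarrow> nat \<Rightarrow> real \<Rightarrow> bool" where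
  "large_height A A0 E G M K \<epsilon> \<eta> R L k x \<longleftrightarrow>
     x \<ge> 8 \<and> exp ((ln x)\<^sup>2 / 4) \<ge> 20 \<and> exp ((ln x)\<^sup>2 / 2) \<ge> 4 \<and> exp ((ln x)\<^sup>2) \<ge> 10 \<and>
     ln (1 + x) \<le> (1 + \<epsilon>\<^sup>2 / (1000 * A\<^sup>2)) * ln x \<and>
     ln (x powr (1 / real R) + 2 * ln (2 * exp ((ln x)\<^sup>2) + 4) + 4) \<le> (1 / real R + \<epsilon>\<^sup>2 / (1000 * A\<^sup>2 * real R)) * ln x \<and>
     4 * (A\<^sup>2 + A0) \<le> A\<^sup>2 / 1000 * ln x \<and>
     real (L * R) * x powr (1 / (3 * real R)) \<le> x powr \<eta> / 2 \<and>
     real k * (ln x)\<^sup>2 \<le> x powr \<eta> / 4 \<and> 8 \<le> x powr \<eta> \<and>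
     E * (1 + (ln x)\<^sup>2) / (x powr \<eta> / 4 - 1) \<le> x powr (- (\<eta> / 2)) \<and> x powr (- (\<eta> / 2)) \<le> 1 / 2 \<and>
     exp (- ((ln x)\<^sup>2 / 8)) * (E + 5 * (ln x)\<^sup>2) * (3 * G * (2 + x) powr A) \<le> 1 / (8 * x) / 2 \<and>
     6 * G * (2 + x) powr A * x powr (- (A + 2)) \<le> 1 / (8 * x) \<and>
     G * x powr A * (6 * exp (- exp ((ln x)\<^sup>2 / 4) / 2)) \<le> 1 / (4 * x) \<and>
     G * x powr A * (6 * exp (- exp ((ln x)\<^sup>2) / 4) * exp ((ln x)\<^sup>2 / 2)) \<le> 1 / (4 * x) \<and>
     M * (1 + E + 20 * E * G * 4 powr A) \<le> x powr \<epsilon> \<and>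
     (3 * (K * x powr (\<epsilon> / 2)) * (ln 3 + (ln x)\<^sup>2) + M + 3 * M * G * 2 powr A * x powr (\<epsilon> / 4)) * (2 + E * (1 + (ln x)\<^sup>2)) \<le> x powr \<epsilon> \<and>
     3 * (3 * (K * x powr (\<epsilon> / 2)) / 2 * (5400 * E * (ln x)\<^sup>2 + 4 * (E * (1 + (ln x)\<^sup>2) + 2)\<^sup>2 * (ln 3 + (ln x)\<^sup>2)) +
       24 * E * (1 + x) * (2 * E * (1 + x) * M * (G * x powr A)) * exp (- exp ((ln x)\<^sup>2) / 4) * exp ((ln x)\<^sup>2 / 2)) * ln (1 + x) \<le> x powr \<epsilon>"

lemma large_heightD:
  assumes "large_height A A0 E G M K \<epsilon> \<eta> R L k x"
  shows "x \<ge> 8"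
    "exp ((ln x)\<^sup>2 / 4) \<ge> 20"
    "exp ((ln x)\<^sup>2 / 2) \<ge> 4"
    "exp ((ln x)\<^sup>2) \<ge> 10"
    "ln (1 + x) \<le> (1 + \<epsilon>\<^sup>2 / (1000 * A\<^sup>2)) * ln x"
    "ln (x powr (1 / real R) + 2 * ln (2 * exp ((ln x)\<^sup>2) + 4) + 4) \<le> (1 / real R + \<epsilon>\<^sup>2 / (1000 * A\<^sup>2 * real R)) * ln x"
    "4 * (A\<^sup>2 + A0) \<le> A\<^sup>2 / 1000 * ln x"
    "real (L * R) * x powr (1 / (3 * real R)) \<le> x powr \<eta> / 2"
    "real k * (ln x)\<^sup>2 \<le> x powr \<eta> / 4"
    "8 \<le> x powr \<eta>"
    "E * (1 + (ln x)\<^sup>2) / (x powr \<eta> / 4 - 1) \<le> x powr (- (\<eta> / 2))"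
    "x powr (- (\<eta> / 2)) \<le> 1 / 2"
    "exp (- ((ln x)\<^sup>2 / 8)) * (E + 5 * (ln x)\<^sup>2) * (3 * G * (2 + x) powr A) \<le> 1 / (8 * x) / 2"
    "6 * G * (2 + x) powr A * x powr (- (A + 2)) \<le> 1 / (8 * x)"
    "G * x powr A * (6 * exp (- exp ((ln x)\<^sup>2 / 4) / 2)) \<le> 1 / (4 * x)"
    "G * x powr A * (6 * exp (- exp ((ln x)\<^sup>2) / 4) * exp ((ln x)\<^sup>2 / 2)) \<le> 1 / (4 * x)"
    "M * (1 + E + 20 * E * G * 4 powr A) \<le> x powr \<epsilon>"
    "(3 * (K * x powr (\<epsilon> / 2)) * (ln 3 + (ln x)\<^sup>2) + M + 3 * M * G * 2 powr A * x powr (\<epsilon> / 4)) * (2 + E * (1 + (ln x)\<^sup>2)) \<le> x powr \<epsilon>"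
    "3 * (3 * (K * x powr (\<epsilon> / 2)) / 2 * (5400 * E * (ln x)\<^sup>2 + 4 * (E * (1 + (ln x)\<^sup>2) + 2)\<^sup>2 * (ln 3 + (ln x)\<^sup>2)) + 24 * E * (1 + x) * (2 * E * (1 + x) * M * (G * x powr A)) * exp (- exp ((ln x)\<^sup>2) / 4) * exp ((ln x)\<^sup>2 / 2)) * ln (1 + x) \<le> x powr \<epsilon>"
  by (insert assms, unfold large_height_def, (elim conjE, assumption)+)

lemma eventually_large_height:
  fixes A A0 E G M K \<epsilon> \<eta> :: real and R L k :: nat
  assumes A: "A \<ge> 1" and pos: "A0 > 0" "E > 0" "G > 0" "M > 0" "K > 0" "\<epsilon> > 0" "\<eta> > 0" "R > 0" "k > 0"
    and \<eta>: "1 / (3 * real R) < \<eta>"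
  shows "eventually (large_height A A0 E G M K \<epsilon> \<eta> R L k) at_top"
proof -
  have R: "real R > 0" "1 / (3 * real R) > 0" "1 / real R > 0" and k: "real k > 0" using pos by auto
  have c: "\<epsilon>\<^sup>2 / (1000 * A\<^sup>2) > 0" "\<epsilon>\<^sup>2 / (1000 * A\<^sup>2 * real R) > 0" "A\<^sup>2 / 1000 > 0" "4 * (A\<^sup>2 + A0) > 0"
    using A pos R by (auto intro!: add_nonneg_pos)
  have 1: "M * (1 + E + 20 * E * G * 4 powr A) > 0" "3 * M * G * 2 powr A > 0" using pos by (auto intro!: mult_pos_pos add_pos_pos)
  have a: "eventually (\<lambda>x::real. x \<ge> 8) at_top" "eventually (\<lambda>x::real. exp ((ln x)\<^sup>2 / 4) \<ge> 20) at_top"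
    "eventually (\<lambda>x::real. exp ((ln x)\<^sup>2 / 2) \<ge> 4) at_top" "eventually (\<lambda>x::real. exp ((ln x)\<^sup>2) \<ge> 10) at_top"
    by real_asymp+
  have b: "eventually (\<lambda>x::real. ln (1 + x) \<le> (1 + a) * ln x) at_top" if "a > 0" for a using that by real_asymp
  have d: "eventually (\<lambda>x::real. ln (x powr a + 2 * ln (2 * exp ((ln x)\<^sup>2) + 4) + 4) \<le> (a + b) * ln x) at_top"
    if "a > 0" "b > 0" for a b using that by real_asymp
  have e: "eventually (\<lambda>x::real. a \<le> b * ln x) at_top" if "a > 0" "b > 0" for a b using that by real_asymp
  \<comment> \<open>The one comparison of two unspecified exponents; it rests on 1 / (3 R) < \<eta>,
    through the decay of x^(1/(3R) - \<eta>).\<close>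
  have g: "eventually (\<lambda>x::real. real (L * R) * x powr (1 / (3 * real R)) \<le> x powr \<eta> / 2) at_top"
  proof -
    have "((\<lambda>x. c * x powr (a - \<eta>)) \<longlongrightarrow> 0) at_top" if "0 < a" "a < \<eta>" for a c :: real using that by real_asymp
    from this[OF R(2) \<eta>, of "real (L * R)"]
    have "eventually (\<lambda>x. real (L * R) * x powr (1 / (3 * real R) - \<eta>) < 1 / 2) at_top" by (rule order_tendstoD) simp
    thus ?thesis using eventually_gt_at_top[of 0]
    proof eventually_elim
      case (elim x)
      have "real (L * R) * x powr (1 / (3 * real R)) = real (L * R) * x powr (1 / (3 * real R) - \<eta>) * x powr \<eta>"
        unfolding mult.assoc powr_add [symmetric] by simp
      also have "\<dots> \<le> 1 / 2 * x powr \<eta>" using elim by (intro mult_right_mono) auto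
      finally show ?case by simp
    qed
  qed
  have i: "eventually (\<lambda>x::real. r * (ln x)\<^sup>2 \<le> x powr \<eta> / 4) at_top" if "r > 0" for r
    using pos that by real_asymp
  have j: "eventually (\<lambda>x::real. 8 \<le> x powr \<eta>) at_top"
    "eventually (\<lambda>x::real. E * (1 + (ln x)\<^sup>2) / (x powr \<eta> / 4 - 1) \<le> x powr (- (\<eta> / 2))) at_top"
    "eventually (\<lambda>x::real. x powr (- (\<eta> / 2)) \<le> 1 / 2) at_top"
    "eventually (\<lambda>x::real. exp (- ((ln x)\<^sup>2 / 8)) * (E + 5 * (ln x)\<^sup>2) * (3 * G * (2 + x) powr A) \<le> 1 / (8 * x) / 2) at_top"
    "eventually (\<lambda>x::real. 6 * G * (2 + x) powr A * x powr (- (A + 2)) \<le> 1 / (8 * x)) at_top"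
    "eventually (\<lambda>x::real. G * x powr A * (6 * exp (- exp ((ln x)\<^sup>2 / 4) / 2)) \<le> 1 / (4 * x)) at_top"
    "eventually (\<lambda>x::real. G * x powr A * (6 * exp (- exp ((ln x)\<^sup>2) / 4) * exp ((ln x)\<^sup>2 / 2)) \<le> 1 / (4 * x)) at_top"
    using A pos by real_asymp+
  have m: "eventually (\<lambda>x::real. C1 \<le> x powr \<epsilon>) at_top"
    "eventually (\<lambda>x::real. (3 * (K * x powr (\<epsilon> / 2)) * (ln 3 + (ln x)\<^sup>2) + M + C1 * x powr (\<epsilon> / 4)) * (2 + E * (1 + (ln x)\<^sup>2)) \<le> x powr \<epsilon>) at_top"
    if "C1 > 0" for C1
    using A pos that by real_asymp+
  have n: "eventually (\<lambda>x::real. 3 * (3 * (K * x powr (\<epsilon> / 2)) / 2 * (5400 * E * (ln x)\<^sup>2 + 4 * (E * (1 + (ln x)\<^sup>2) + 2)\<^sup>2 * (ln 3 + (ln x)\<^sup>2)) +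
     24 * E * (1 + x) * (2 * E * (1 + x) * M * (G * x powr A)) * exp (- exp ((ln x)\<^sup>2) / 4) * exp ((ln x)\<^sup>2 / 2)) * ln (1 + x) \<le> x powr \<epsilon>) at_top"
    using A pos by real_asymp
  show ?thesis unfolding large_height_def
    by (intro eventually_conj a b[OF c(1)] d[OF R(3) c(2)] e[OF c(4,3)] g i[OF k] j m(1)[OF 1(1)] m(2)[OF 1(2)] n)
qed

context dirichlet_data
begin

text \<open>Used for small x and for bounded X. The weights exp (- \<mu>) from the shorter sums are
  exactly those under which the coefficients have total mass M.\<close>

lemma shifted_sum_trivial_bound:
  fixes c :: "'i \<Rightarrow> complex" and \<mu> :: "'i \<Rightarrow> real"
  assumes I: "\<And>i. i \<in> I \<Longrightarrow> \<mu> i \<ge> 0" and M: "(\<Sum>i\<in>I. norm (c i) * exp (- \<mu> i)) \<le> M"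
    and u: "u \<ge> 1" "ln u \<le> B"
  shows "norm (\<Sum>i\<in>I. c i * summatory f (u * exp (- \<mu> i))) \<le> M * (3 * CF * (1 + B) powr A) * u"
proof -
  let ?Q = "3 * CF * (1 + B) powr A"
  have Q0: "?Q \<ge> 0" using CF_ge_1 by simp
  have lu: "ln u \<ge> 0" using u by simp
  have S: "norm (summatory f v) \<le> v * ?Q" if v: "0 < v" "v \<le> u" for v
  proof (cases "v \<ge> 1")
    case True
    have "norm (summatory f v) \<le> (\<Sum>n | 1 \<le> n \<and> real n \<le> v. norm (f n))" unfolding summatory_def by (rule norm_sum)
    also have "\<dots> \<le> 3 * CF * v * (1 + ln v) powr A" by (rule sum_norm_f_le[OF True])
    also have "\<dots> \<le> 3 * CF * v * (1 + B) powr A"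
    proof (intro mult_left_mono powr_mono2)
      show "0 \<le> 1 + ln v" using True by simp
      have "ln v \<le> ln u" using v by (intro ln_le_mono) auto
      thus "1 + ln v \<le> 1 + B" using u by linarith
    qed (use A CF_ge_1 True in auto)
    finally show ?thesis by (simp only: mult_ac)
  next
    case False
    hence "{n. 1 \<le> n \<and> real n \<le> v} = {}" by auto
    hence "summatory f v = 0" unfolding summatory_def by (simp only: sum.empty)
    moreover have "v * ?Q \<ge> 0" by (rule mult_nonneg_nonneg[OF less_imp_le[OF v(1)] Q0])
    ultimately show ?thesis by (simp only: norm_zero)
  qed
  have "norm (\<Sum>i\<in>I. c i * summatory f (u * exp (- \<mu> i))) \<le> (\<Sum>i\<in>I. norm (c i) * exp (- \<mu> i) * (u * ?Q))"
  proof (rule sum_norm_le)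
    fix i assume i: "i \<in> I"
    have "norm (summatory f (u * exp (- \<mu> i))) \<le> u * exp (- \<mu> i) * ?Q"
      using I[OF i] u by (intro S) (auto intro: mult_left_le)
    hence "norm (c i) * norm (summatory f (u * exp (- \<mu> i))) \<le> norm (c i) * (u * exp (- \<mu> i) * ?Q)"
      by (rule mult_left_mono) simp
    thus "norm (c i * summatory f (u * exp (- \<mu> i))) \<le> norm (c i) * exp (- \<mu> i) * (u * ?Q)"
      unfolding norm_mult by (simp only: mult_ac)
  qed
  also have "\<dots> = (\<Sum>i\<in>I. norm (c i) * exp (- \<mu> i)) * (u * ?Q)" by (simp only: sum_distrib_right)
  also have "\<dots> \<le> M * (u * ?Q)" by (rule mult_right_mono[OF M mult_nonneg_nonneg[OF _ Q0]]) (use u in simp)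
  finally show ?thesis by (simp only: mult_ac)
qed

lemma oscillation_large_height:
  fixes \<epsilon> w \<eta> M K :: real and R L k :: nat
  defines "\<eta> \<equiv> \<epsilon> / (4 * A)" and "M \<equiv> 2 ^ (L * R)" and "K \<equiv> CF * (2 ^ (L * R) * 2 ^ (L - 1) * real (L * R))"
  assumes large: "large_height A A0 E CF M K \<epsilon> \<eta> R L k \<L>"
    and \<epsilon>: "0 < \<epsilon>" "\<epsilon> \<le> 1"
    and R: "R = nat \<lfloor>10 * A\<^sup>2 / \<epsilon>\<^sup>2\<rfloor> + 1" and L: "L = nat \<lfloor>10 * A * real R\<rfloor>"
    and w: "w > 0" "0 \<le> ln w" "ln w \<le> \<L> powr (1 / (3 * real R))"
    and k: "real k * (\<eta> / 2) \<ge> A + 2"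
  shows "\<exists>\<tau>. (\<forall>k\<in>{1..R}. \<bar>\<tau> k\<bar> \<le> exp ((ln \<L>)\<^sup>2)) \<and>
    (\<forall>x. 2 \<le> x \<and> ln x \<le> \<L> \<longrightarrow>
      norm (oscillation f R (\<lambda>_. L) x w \<tau>) \<le> (3 + M * (3 * CF * 2 powr A)) * (x / ln x * \<L> powr \<epsilon>))"
proof -
  define l where "l = (ln \<L>)\<^sup>2"
  note lg = large_heightD[OF large, folded l_def]
  define T where "T = exp l"
  \<comment> \<open>h = T^(-1/2) and \<delta> = T^(-1/4): then h T = T^(1/2) controls the truncation
    and \<delta> / h = T^(1/4) the leakage of the smoothing.\<close>
  define h where "h = exp (- (l / 2))"
  define \<delta> where "\<delta> = exp (- (l / 4))"
  \<comment> \<open>The sum of the Perron bound for large u and the trivial bound for small u, so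
    that one constant serves for every u up to x.\<close>
  define Kp where "Kp = 3 * (K * \<L> powr (\<epsilon> / 2)) * (ln 3 + l) + M + 3 * M * CF * 2 powr A * \<L> powr (\<epsilon> / 4)"
  note L8 = lg(1)
  have l0: "l \<ge> 0" by (simp add: l_def)
  note lg4 = lg(2-4)
  have "T \<ge> 10" unfolding T_def by (rule lg4)
  hence T: "T \<ge> 10" "T \<ge> 1" by simp_all
  have h: "0 < h" "h \<le> 1 / 4"
  proof -
    have "h = 1 / exp (l / 2)" by (simp add: h_def exp_minus inverse_eq_divide)
    also have "\<dots> \<le> 1 / 4" using lg4 by (intro divide_left_mono) auto
    finally show "h \<le> 1 / 4" .
  qed (simp add: h_def)
  have \<delta>: "0 < \<delta>" "\<delta> \<le> 1 / 20" "T * \<delta> \<ge> 1"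
  proof -
    have "\<delta> = 1 / exp (l / 4)" by (simp add: \<delta>_def exp_minus inverse_eq_divide)
    also have "\<dots> \<le> 1 / 20" using lg4 by (intro divide_left_mono) auto
    finally show "\<delta> \<le> 1 / 20" .
    show "T * \<delta> \<ge> 1" using l0 by (simp add: T_def \<delta>_def flip: exp_add)
  qed (simp add: \<delta>_def)
  have \<delta>4: "\<delta> \<le> 1 / 4" using \<delta> by simp
  have dh: "- \<delta> / (2 * h) = - exp (l / 4) / 2"
  proof -
    have "\<delta> = exp (l / 4) * h" by (simp add: \<delta>_def h_def flip: exp_add)
    thus ?thesis using h by simp
  qed
  have hT: "(h * T)\<^sup>2 = exp l"
    by (simp add: h_def T_def power2_eq_square flip: exp_add)
  have "h * exp (l / 2) = 1" by (simp add: h_def flip: exp_add)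
  hence dvh: "y / h = y * exp (l / 2)" for y by (simp only: divide_inverse inverse_unique)
  have lnT: "ln T = l" by (simp add: T_def)
  have ln3T: "ln (3 * T) = ln 3 + l" by (simp add: T_def ln_mult)
  have sq: "sqrt \<delta> = exp (- (l / 8))"
    by (rule real_sqrt_unique) (auto simp: \<delta>_def power2_eq_square simp flip: exp_add)
  have ln\<delta>: "20 * ln (1 / \<delta>) = 5 * l" by (simp add: \<delta>_def ln_div)
  have M0: "M > 0" by (simp add: M_def)
  have K0: "K \<ge> 0" using CF_ge_1 by (simp add: K_def)
  have E0: "E \<ge> 0" using E_ge by simp
  have e4: "\<eta> * A = \<epsilon> / 4" "\<eta> \<le> \<epsilon> / 4"
  proof -
    show "\<eta> * A = \<epsilon> / 4" using A by (simp add: \<eta>_def)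
    have "\<epsilon> / (4 * A) \<le> \<epsilon> / 4" using A \<epsilon> by (intro divide_left_mono) auto
    thus "\<eta> \<le> \<epsilon> / 4" by (simp add: \<eta>_def)
  qed
  have \<L>\<eta>: "\<L> powr \<eta> \<ge> 8" by (rule lg)
  obtain \<tau> where \<tau>: "\<forall>k\<in>{1..R}. \<bar>\<tau> k\<bar> \<le> T"
    and K': "\<forall>s\<in>strip_box (1 / \<L>) T.
     norm (F s * (\<Sum>j\<in>osc_index R L. osc_coeff R L w \<tau> j * exp (- of_real (osc_shift R w j) * s))) \<le> K * \<L> powr (\<epsilon> / 2) \<and>
     norm (F s * (\<Sum>j\<in>osc_index R L. osc_coeff R L w \<tau> j * of_real (osc_shift R w j) * exp (- of_real (osc_shift R w j) * s))) \<le> K * \<L> powr (\<epsilon> / 2)"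
    using mollified_F_bound[OF L8 T(2) \<epsilon> R L w lg(5) lg(6)[folded T_def] lg(7), folded K_def]
    by (elim exE conjE) (rule that)
  note KK = conjunct1[OF bspec[OF K']] conjunct2[OF bspec[OF K']]
  define c where "c = osc_coeff R L w \<tau>"
  define \<mu> where "\<mu> = osc_shift R w"
  define I where "I = osc_index R L"
  note KK = KK[folded c_def \<mu>_def I_def]
  have I: "finite I" by (simp add: I_def finite_osc_index)
  have \<mu>0: "\<mu> i \<ge> 0" for i using w by (simp add: \<mu>_def osc_shift_nonneg)
  have \<mu>h: "\<mu> i \<le> \<L> powr \<eta> / 2" if "i \<in> I" for i
  proof -
    have "\<mu> i \<le> real (L * R) * ln w" using that w unfolding \<mu>_def I_def by (intro osc_shift_le)
    also have "\<dots> \<le> real (L * R) * \<L> powr (1 / (3 * real R))" by (intro mult_left_mono w) simp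
    also have "\<dots> \<le> \<L> powr \<eta> / 2" by (rule lg)
    finally show ?thesis .
  qed
  have \<L>\<eta>1: "\<L> powr \<eta> \<le> \<L>"
    using powr_mono[of \<eta> 1 \<L>] e4 \<epsilon> L8 by simp
  have \<mu>L: "\<mu> i \<le> \<L>" if "i \<in> I" for i using \<mu>h[OF that] \<L>\<eta>1 \<L>\<eta> by linarith
  have M: "(\<Sum>i\<in>I. norm (c i) * exp (- \<mu> i)) \<le> M"
    unfolding c_def \<mu>_def I_def M_def using sum_norm_osc_coeff[OF w(1)] by (rule eq_refl)
  have M1: "(\<Sum>i\<in>I. norm (c i * of_real (\<mu> i)) * exp (- \<mu> i)) \<le> M * \<L>"
  proof -
    have "(\<Sum>i\<in>I. norm (c i * of_real (\<mu> i)) * exp (- \<mu> i)) \<le> (\<Sum>i\<in>I. (norm (c i) * exp (- \<mu> i)) * \<L>)"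
    proof (rule sum_mono)
      fix i assume i: "i \<in> I"
      have "norm (c i * of_real (\<mu> i)) * exp (- \<mu> i) = (norm (c i) * exp (- \<mu> i)) * \<mu> i"
        using \<mu>0[of i] by (simp add: norm_mult)
      also have "\<dots> \<le> (norm (c i) * exp (- \<mu> i)) * \<L>" using \<mu>L[OF i] by (intro mult_left_mono) auto
      finally show "norm (c i * of_real (\<mu> i)) * exp (- \<mu> i) \<le> (norm (c i) * exp (- \<mu> i)) * \<L>" .
    qed
    also have "\<dots> = (\<Sum>i\<in>I. norm (c i) * exp (- \<mu> i)) * \<L>" by (simp only: sum_distrib_right)
    also have "\<dots> \<le> M * \<L>" using M L8 by (intro mult_right_mono) auto
    finally show ?thesis .
  qed
  define b where "b = 1 / (4 * \<L>)"
  have short: "short_sum \<delta> (u * exp (- \<mu> i)) \<le> u * exp (- \<mu> i) * b"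
    if u: "\<L> powr \<eta> \<le> ln u" "ln u \<le> \<L>" "u > 0" and i: "i \<in> I" for u i
  proof -
    have lv: "ln (u * exp (- \<mu> i)) = ln u - \<mu> i" using u by (simp add: ln_mult)
    have "short_sum \<delta> (u * exp (- \<mu> i)) \<le> u * exp (- \<mu> i) * (6 * CF * (2 + \<L>) powr A * (\<L> powr (- (\<eta> / 2))) ^ k + 1 / (8 * \<L>))"
    \<comment> \<open>The lower bound \<L>^\<eta> for ln u is shared out: one half for the shift
      \<mu>, a quarter for k ln T, a quarter for Y. With a = \<L>^(-\<eta>/2) the k-th power is
      below \<L>^(-A-2), which beats the trivial factor (2 + \<L>)^A.\<close>
    proof (rule short_sum_bound[OF \<delta> T(2), of "\<L> powr \<eta> / 4"])
      show "2 \<le> \<L> powr \<eta> / 4" using \<L>\<eta> by simp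
      show "E * (1 + ln T) / (\<L> powr \<eta> / 4 - 1) \<le> \<L> powr (- (\<eta> / 2))" "\<L> powr (- (\<eta> / 2)) \<le> 1 / 2"
        unfolding lnT by (rule lg)+
      show "sqrt \<delta> * (E + 20 * ln (1 / \<delta>)) * (3 * CF * (2 + \<L>) powr A) \<le> 1 / (8 * \<L>) / 2"
        unfolding ln\<delta> sq by (rule lg)
      have "real k * l \<le> \<L> powr \<eta> / 4" by (rule lg)
      thus "\<L> powr \<eta> / 4 + real k * ln T \<le> ln (u * exp (- \<mu> i))"
        unfolding lv lnT using \<mu>h[OF i] u(1) by linarith
      show "ln (u * exp (- \<mu> i)) \<le> \<L>" unfolding lv using \<mu>0[of i] u by linarith
    qed (use u in simp)
    also have "\<dots> \<le> u * exp (- \<mu> i) * (1 / (8 * \<L>) + 1 / (8 * \<L>))"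
    proof (intro mult_left_mono add_mono order.refl)
      have "(\<L> powr (- (\<eta> / 2))) ^ k = \<L> powr (- (real k * (\<eta> / 2)))"
        using L8 by (simp add: powr_power mult.commute)
      also have "\<dots> \<le> \<L> powr (- (A + 2))" using k L8 by (intro powr_mono) auto
      finally have "6 * CF * (2 + \<L>) powr A * (\<L> powr (- (\<eta> / 2))) ^ k \<le> 6 * CF * (2 + \<L>) powr A * \<L> powr (- (A + 2))"
        using CF_ge_1 by (intro mult_left_mono) auto
      also have "\<dots> \<le> 1 / (8 * \<L>)" by (rule lg)
      finally show "6 * CF * (2 + \<L>) powr A * (\<L> powr (- (\<eta> / 2))) ^ k \<le> 1 / (8 * \<L>)" .
    qed (use u in simp)
    also have "1 / (8 * \<L>) + 1 / (8 * \<L>) = b" by (simp add: b_def)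
    finally show ?thesis .
  qed
  have b0: "b \<ge> 0" using L8 by (simp add: b_def)
  \<comment> \<open>A full factor \<L> is saved because the sums weighted by \<mu> have total mass M
    \<L> instead of M.\<close>
  have tail: "tail_const \<L> T h \<delta> b \<le> 1 / \<L>"
  proof -
    have "tail_const \<L> T h \<delta> b = 1 / (4 * \<L>) + CF * \<L> powr A * (6 * exp (- exp (l / 4) / 2)) +
      CF * \<L> powr A * (6 * exp (- exp l / 4) * exp (l / 2))"
      unfolding tail_const_def dh hT dvh b_def by (simp only: distrib_left add.assoc)
    also have "\<dots> \<le> 1 / (4 * \<L>) + 1 / (4 * \<L>) + 1 / (4 * \<L>)" by (intro add_mono order.refl lg)
    also have "\<dots> = 3 / 4 * (1 / \<L>)" by simp
    also have "\<dots> \<le> 1 * (1 / \<L>)" using L8 by (intro mult_right_mono) auto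
    finally show ?thesis by simp
  qed
  have tail0: "tail_const \<L> T h \<delta> b \<ge> 0"
    unfolding tail_const_def using b0 CF_ge_1 h by (intro add_nonneg_nonneg mult_nonneg_nonneg) auto
  let ?Kp1 = "3 * (K * \<L> powr (\<epsilon> / 2)) * (ln 3 + l) + M"
  let ?Kp2 = "3 * M * CF * 2 powr A * \<L> powr (\<epsilon> / 4)"
  have Kp1: "?Kp1 \<ge> 0" using K0 M0 l0 by (intro add_nonneg_nonneg mult_nonneg_nonneg) auto
  have Kp2: "?Kp2 \<ge> 0" using M0 CF_ge_1 by simp
  have Kp_ge: "?Kp1 \<le> Kp" "?Kp2 \<le> Kp" using Kp1 Kp2 unfolding Kp_def by linarith+
  have pw: "norm (\<Sum>i\<in>I. c i * summatory f (u * exp (- \<mu> i))) \<le> u * ?Kp1"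
    "norm (\<Sum>i\<in>I. c i * of_real (\<mu> i) * summatory f (u * exp (- \<mu> i))) \<le> u * ?Kp1"
    if u: "\<L> powr \<eta> \<le> ln u" "ln u \<le> \<L>" "u > 0" for u
  proof -
    have u1: "1 \<le> ln u" using u \<L>\<eta> by linarith
    have "norm (\<Sum>i\<in>I. c i * summatory f (u * exp (- \<mu> i))) \<le>
      u * (3 * (K * \<L> powr (\<epsilon> / 2)) * ln (3 * T) + M * tail_const \<L> T h \<delta> b)"
      by (rule pointwise_bound[OF I \<mu>0 M h \<delta>(1) \<delta>4 T(2) u1 u(2,3) KK(1) b0 short[OF u]])
    also have "\<dots> \<le> u * ?Kp1" unfolding ln3T
    proof (intro mult_left_mono add_left_mono)
      have "1 / \<L> \<le> 1" using L8 by simp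
      hence "M * tail_const \<L> T h \<delta> b \<le> M * 1" using tail M0 by (intro mult_left_mono) linarith+
      thus "M * tail_const \<L> T h \<delta> b \<le> M" by simp
    qed (use u in simp)
    finally show "norm (\<Sum>i\<in>I. c i * summatory f (u * exp (- \<mu> i))) \<le> u * ?Kp1" .
    have "norm (\<Sum>i\<in>I. c i * of_real (\<mu> i) * summatory f (u * exp (- \<mu> i))) \<le>
      u * (3 * (K * \<L> powr (\<epsilon> / 2)) * ln (3 * T) + M * \<L> * tail_const \<L> T h \<delta> b)"
      by (rule pointwise_bound[OF I \<mu>0 M1 h \<delta>(1) \<delta>4 T(2) u1 u(2,3) KK(2) b0 short[OF u]])
    also have "\<dots> \<le> u * ?Kp1" unfolding ln3T
    proof (intro mult_left_mono add_left_mono)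
      have "M * \<L> * tail_const \<L> T h \<delta> b \<le> M * \<L> * (1 / \<L>)" using tail M0 L8 by (intro mult_left_mono) auto
      thus "M * \<L> * tail_const \<L> T h \<delta> b \<le> M" using L8 by simp
    qed (use u in simp)
    finally show "norm (\<Sum>i\<in>I. c i * of_real (\<mu> i) * summatory f (u * exp (- \<mu> i))) \<le> u * ?Kp1" .
  qed
  have triv: "norm (\<Sum>i\<in>I. c i * summatory f (u * exp (- \<mu> i))) \<le> u * ?Kp2"
    if u: "u \<ge> 1" "ln u \<le> \<L> powr \<eta>" for u
  proof -
    have "norm (\<Sum>i\<in>I. c i * summatory f (u * exp (- \<mu> i))) \<le> M * (3 * CF * (1 + \<L> powr \<eta>) powr A) * u"
      by (rule shifted_sum_trivial_bound[OF \<mu>0 M u])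
    also have "\<dots> \<le> M * (3 * CF * (2 * \<L> powr \<eta>) powr A) * u"
      using M0 CF_ge_1 u \<L>\<eta> A by (intro mult_right_mono mult_left_mono powr_mono2) auto
    also have "(2 * \<L> powr \<eta>) powr A = 2 powr A * \<L> powr (\<epsilon> / 4)"
      by (simp add: powr_mult powr_powr e4)
    also have "M * (3 * CF * (2 powr A * \<L> powr (\<epsilon> / 4))) * u = u * ?Kp2" by (simp only: mult_ac)
    finally show ?thesis .
  qed
  have "norm (oscillation f R (\<lambda>_. L) x w \<tau>) \<le> (3 + M * (3 * CF * 2 powr A)) * (x / ln x * \<L> powr \<epsilon>)"
    if x: "2 \<le> x" "ln x \<le> \<L>" for x
  proof -
    let ?O = "norm (\<Sum>i\<in>I. c i * summatory f (x * exp (- \<mu> i)))"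
    have lx: "ln x > 0" using x by simp
    have D0: "M * (3 * CF * 2 powr A) \<ge> 0" using M0 CF_ge_1 by simp
    have "ln x * ?O \<le> (3 + M * (3 * CF * 2 powr A)) * (x * \<L> powr \<epsilon>)"
    \<comment> \<open>Below the threshold both the trivial loss and the factor ln x itself are at
      most \<L>^(\<epsilon>/4) up to constants, since \<eta> A = \<epsilon> / 4.\<close>
    proof (cases "ln x \<le> \<L> powr \<eta>")
      case True
      have "ln x * ?O \<le> \<L> powr (\<epsilon> / 4) * (x * ?Kp2)"
      proof (intro mult_mono triv True)
        have "ln x \<le> \<L> powr \<eta>" by (rule True)
        also have "\<dots> \<le> \<L> powr (\<epsilon> / 4)" using e4 L8 by (intro powr_mono) auto
        finally show "ln x \<le> \<L> powr (\<epsilon> / 4)" .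
      qed (use x in auto)
      also have "\<dots> = M * (3 * CF * 2 powr A) * (x * (\<L> powr (\<epsilon> / 4) * \<L> powr (\<epsilon> / 4)))" by (simp only: mult_ac)
      also have "\<dots> \<le> (3 + M * (3 * CF * 2 powr A)) * (x * \<L> powr \<epsilon>)"
        unfolding powr_add [symmetric] using D0 x L8 \<epsilon>
        by (intro mult_mono mult_left_mono powr_mono mult_nonneg_nonneg) auto
      finally show ?thesis .
    next
      case False
      hence lxe: "\<L> powr \<eta> \<le> ln x" by simp
      have x0: "x > 0" and x8: "8 \<le> ln x" using x lxe \<L>\<eta> by linarith+
      have "ln x * ?O \<le> x * (Kp * (2 + E * (1 + ln T)) +
         M * (sqrt \<delta> * (E + 20 * ln (1 / \<delta>)) * (3 * CF * (2 + \<L>) powr A) +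
              6 * exp (- \<delta> / (2 * h)) * (CF * \<L> powr A) * (E * (1 + \<L>)) + 20 * E * CF * 4 powr A) +
         quad_const \<L> T h (K * \<L> powr (\<epsilon> / 2)) M * ln (1 + \<L>))"
      proof (rule log_oscillation_bound[OF I \<mu>0 \<mu>L M h \<delta> T(1) x8 x(2) x0 KK])
        fix u assume u: "1 \<le> u" "u \<le> x"
        have "ln u \<le> ln x" using u by (intro ln_le_mono) auto
        hence ul: "ln u \<le> \<L>" using x by linarith
        have u0: "u > 0" using u by simp
        have "norm (\<Sum>i\<in>I. c i * summatory f (u * exp (- \<mu> i))) \<le> u * ?Kp1 \<or>
              norm (\<Sum>i\<in>I. c i * summatory f (u * exp (- \<mu> i))) \<le> u * ?Kp2"
          using pw(1)[OF _ ul u0] triv[OF u(1)] linear[of "ln u" "\<L> powr \<eta>"] by blast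
        moreover have "u * ?Kp1 \<le> u * Kp" "u * ?Kp2 \<le> u * Kp"
          by (rule mult_left_mono[OF _ less_imp_le[OF u0]], rule Kp_ge)+
        ultimately have "norm (\<Sum>i\<in>I. c i * summatory f (u * exp (- \<mu> i))) \<le> u * Kp" by linarith
        thus "norm (\<Sum>i\<in>I. c i * summatory f (u * exp (- \<mu> i))) \<le> Kp * u" by (simp only: mult.commute)
      next
        have "norm (\<Sum>i\<in>I. c i * of_real (\<mu> i) * summatory f (x * exp (- \<mu> i))) \<le> x * ?Kp1"
          by (rule pw(2)[OF lxe x(2) x0])
        also have "\<dots> \<le> x * Kp" by (rule mult_left_mono[OF Kp_ge(1) less_imp_le[OF x0]])
        finally show "norm (\<Sum>i\<in>I. c i * of_real (\<mu> i) * summatory f (x * exp (- \<mu> i))) \<le> Kp * x"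
          by (simp only: mult.commute)
      qed
      \<comment> \<open>One copy each for the pointwise, the error and the bilinear contribution;
        hence the 3 in the final constant.\<close>
      also have "\<dots> \<le> x * (\<L> powr \<epsilon> + \<L> powr \<epsilon> + \<L> powr \<epsilon>)"
      proof (intro mult_left_mono add_mono)
        show "Kp * (2 + E * (1 + ln T)) \<le> \<L> powr \<epsilon>" unfolding Kp_def lnT by (rule lg)
        show "quad_const \<L> T h (K * \<L> powr (\<epsilon> / 2)) M * ln (1 + \<L>) \<le> \<L> powr \<epsilon>"
          unfolding quad_const_def hT dvh lnT ln3T by (rule lg)
        have "M * (sqrt \<delta> * (E + 20 * ln (1 / \<delta>)) * (3 * CF * (2 + \<L>) powr A) +
              6 * exp (- \<delta> / (2 * h)) * (CF * \<L> powr A) * (E * (1 + \<L>)) + 20 * E * CF * 4 powr A) \<le>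
           M * (1 + E + 20 * E * CF * 4 powr A)"
        proof (intro mult_left_mono add_mono order.refl)
          have "sqrt \<delta> * (E + 20 * ln (1 / \<delta>)) * (3 * CF * (2 + \<L>) powr A) \<le> 1 / (8 * \<L>) / 2"
            unfolding sq ln\<delta> by (rule lg)
          also have "\<dots> \<le> 1" using L8 by simp
          finally show "sqrt \<delta> * (E + 20 * ln (1 / \<delta>)) * (3 * CF * (2 + \<L>) powr A) \<le> 1" .
          have "6 * exp (- \<delta> / (2 * h)) * (CF * \<L> powr A) = CF * \<L> powr A * (6 * exp (- exp (l / 4) / 2))"
            unfolding dh by (simp only: mult_ac)
          also have "\<dots> \<le> 1 / (4 * \<L>)" by (rule lg)
          finally have "6 * exp (- \<delta> / (2 * h)) * (CF * \<L> powr A) * (E * (1 + \<L>)) \<le> 1 / (4 * \<L>) * (E * (1 + \<L>))"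
            using E0 L8 by (intro mult_right_mono) auto
          also have "\<dots> = E * ((1 + \<L>) / (4 * \<L>))" by simp
          also have "\<dots> \<le> E * 1" using L8 E0 by (intro mult_left_mono) auto
          finally show "6 * exp (- \<delta> / (2 * h)) * (CF * \<L> powr A) * (E * (1 + \<L>)) \<le> E" by simp
        qed (use M0 E0 CF_ge_1 in auto)
        also have "\<dots> \<le> \<L> powr \<epsilon>" by (rule lg)
        finally show "M * (sqrt \<delta> * (E + 20 * ln (1 / \<delta>)) * (3 * CF * (2 + \<L>) powr A) +
              6 * exp (- \<delta> / (2 * h)) * (CF * \<L> powr A) * (E * (1 + \<L>)) + 20 * E * CF * 4 powr A) \<le> \<L> powr \<epsilon>" .
      qed (use x in simp)
      also have "\<dots> = 3 * (x * \<L> powr \<epsilon>)" by simp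
      also have "\<dots> \<le> (3 + M * (3 * CF * 2 powr A)) * (x * \<L> powr \<epsilon>)"
        using D0 x by (intro mult_right_mono) auto
      finally show ?thesis .
    qed
    hence "?O \<le> (3 + M * (3 * CF * 2 powr A)) * (x * \<L> powr \<epsilon>) / ln x"
      using lx by (simp add: le_divide_eq mult.commute)
    also have "\<dots> = (3 + M * (3 * CF * 2 powr A)) * (x / ln x * \<L> powr \<epsilon>)" by simp
    finally show ?thesis unfolding oscillation_eq[OF w(1)] c_def \<mu>_def I_def .
  qed
  thus ?thesis using \<tau> unfolding T_def l_def by blast
qed

end

theorem theorem2p1:
  fixes A A0 \<epsilon> :: real and R L :: nat
  assumes "A \<ge> 1" and "A0 \<ge> 1" and "0 < \<epsilon>" and "\<epsilon> \<le> 1"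
    and R: "R = nat \<lfloor>10 * A\<^sup>2 / \<epsilon>\<^sup>2\<rfloor> + 1"
    and L: "L = nat \<lfloor>10 * A * real R\<rfloor>"
  shows "\<exists>C::real. C > 0 \<and>
    (\<forall>(f :: nat \<Rightarrow> complex) (lam :: nat \<Rightarrow> complex) (X :: real) (w :: real).
       multiplicative f \<longrightarrow>
       (\<forall>s. Re s > 1 \<longrightarrow> (\<lambda>n. norm (f n / of_nat n powr s)) summable_on {1..}) \<longrightarrow>
       log_deriv_coeffs f lam \<longrightarrow>
       (\<forall>x::real. x \<ge> 1 \<longrightarrow>
          (\<Sum>n | x < real n \<and> real n \<le> exp 1 * x. (cmod (lam n))\<^sup>2 * mangoldt n / real n)
            \<le> A\<^sup>2 + A0 / ln (exp 1 * x)) \<longrightarrow>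
       X \<ge> 10 \<longrightarrow>
       w > 0 \<longrightarrow> 0 \<le> ln w \<longrightarrow> ln w \<le> (ln X) powr (1 / (3 * real R)) \<longrightarrow>
       (\<exists>\<tau> :: nat \<Rightarrow> real.
          (\<forall>k\<in>{1..R}. \<bar>\<tau> k\<bar> \<le> exp ((ln (ln X))\<^sup>2)) \<and>
          (\<forall>x::real. 2 \<le> x \<and> x \<le> X \<longrightarrow>
             cmod (oscillation f R (\<lambda>_. L) x w \<tau>) \<le> C * (x / ln x * (ln X) powr \<epsilon>))))"
proof -
  note A = assms(1) and A0 = assms(2) and \<epsilon> = assms(3,4)
  \<comment> \<open>These constants are fixed before f, \<open>lam\<close>, X and w, which makes the
    final constant depend on A, A0 and \<epsilon> only.\<close>
  define Ec G M K \<eta> where "Ec = A\<^sup>2 + A0 + 10" and "G = exp (3 * Ec)" and "M = (2 :: real) ^ (L * R)"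
    and "K = G * (2 ^ (L * R) * 2 ^ (L - 1) * real (L * R))" and "\<eta> = \<epsilon> / (4 * A)"
  have R1: "R > 0" and R1': "real R \<ge> 1" using R by simp_all
  have AR1: "A * real R \<ge> 1" using mult_mono[of 1 A 1 "real R"] A R1' by simp
  have "real L \<ge> 10 * A * real R - 1" using L by linarith
  hence "real L > 0" using AR1 by linarith
  hence L0: "L > 0" by simp
  have \<eta>0: "\<eta> > 0" using A \<epsilon> by (simp add: \<eta>_def)
  have Ec0: "Ec > 0" using A0 by (auto simp: Ec_def intro!: add_nonneg_pos)
  have pos: "A0 > 0" "Ec > 0" "G > 0" "M > 0" "K > 0" using A0 Ec0 R1 L0 by (auto simp: G_def M_def K_def)
  \<comment> \<open>The number of iterations of the short-sum recursion, enough for the gain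
    \<L>^(-k \<eta> / 2) to reach \<L>^(-A-2).\<close>
  define k where "k = nat \<lceil>2 * (A + 2) / \<eta>\<rceil>"
  have k: "real k * (\<eta> / 2) \<ge> A + 2" "k > 0"
  proof -
    have "real k \<ge> 2 * (A + 2) / \<eta>" unfolding k_def by linarith
    hence "real k * \<eta> \<ge> 2 * (A + 2)" using \<eta>0 by (simp add: divide_le_eq)
    thus "real k * (\<eta> / 2) \<ge> A + 2" by simp
    thus "k > 0" using A by (cases k) auto
  qed
  \<comment> \<open>This makes all shifts, at most L R ln w, negligible against the threshold
    \<L>^\<eta>.\<close>
  have "1 / (3 * real R) < \<eta>"
  proof -
    have "10 * A\<^sup>2 / \<epsilon>\<^sup>2 \<le> real R" using R by linarith
    hence "10 * A\<^sup>2 \<le> real R * \<epsilon>\<^sup>2" using \<epsilon> by (simp add: divide_le_eq)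
    also have "\<dots> \<le> real R * \<epsilon>" using \<epsilon> by (intro mult_left_mono) (auto simp: power2_eq_square)
    finally have "10 * A\<^sup>2 \<le> real R * \<epsilon>" .
    moreover have "A \<le> A\<^sup>2" using A by (simp add: power2_eq_square)
    ultimately have "4 * A < 3 * (real R * \<epsilon>)" using A by linarith
    thus ?thesis using A R1' by (simp add: \<eta>_def field_simps)
  qed
  from eventually_large_height[OF A pos \<epsilon>(1) \<eta>0 R1 k(2) this]
  obtain \<L>0 where \<L>0: "\<And>x. x \<ge> \<L>0 \<Longrightarrow> large_height A A0 Ec G M K \<epsilon> \<eta> R L k x"
    unfolding eventually_at_top_linorder by blast
  define B where "B = max 1 \<L>0"
  define C1 C2 where "C1 = 3 + M * (3 * G * 2 powr A)" and "C2 = B * (M * (3 * G * (1 + B) powr A))"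
  have C: "C1 \<ge> 3" "C2 \<ge> 0" using pos by (auto simp: C1_def C2_def B_def)
  show ?thesis
  proof (intro exI[of _ "C1 + C2"] conjI allI impI)
    show "C1 + C2 > 0" using C by simp
    fix f lam :: "nat \<Rightarrow> complex" and X w :: real
    assume mult: "multiplicative f"
      and conv: "\<forall>s. Re s > 1 \<longrightarrow> (\<lambda>n. norm (f n / of_nat n powr s)) summable_on {1..}"
      and ld: "log_deriv_coeffs f lam"
      and block: "\<forall>x::real. x \<ge> 1 \<longrightarrow>
          (\<Sum>n | x < real n \<and> real n \<le> exp 1 * x. (cmod (lam n))\<^sup>2 * mangoldt n / real n)
            \<le> A\<^sup>2 + A0 / ln (exp 1 * x)"
      and X: "X \<ge> 10" and w: "w > 0" "0 \<le> ln w" "ln w \<le> (ln X) powr (1 / (3 * real R))"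
    have f1: "f 1 = 1" using mult by (simp add: multiplicative_def)
    \<comment> \<open>The value of f at 0 is reset to 0 as the locale requires; neither the
      summatory function nor the oscillation sees it.\<close>
    interpret dirichlet_data lam A A0 "f(0 := 0)"
      by (rule dirichlet_data_fun_upd[OF A A0 f1 conv[rule_format] ld block[rule_format]])
    have Ec: "log_coeffs.E A A0 = Ec" by (simp add: Ec_def E_def)
    have CF: "CF = G" by (simp add: CF_def G_def Ec)
    have osc: "oscillation (f(0 := 0)) = oscillation f"
      by (intro ext) (simp only: oscillation_def summatory_fun_upd_0)
    have lX: "ln X \<ge> 1" using X exp_le by (subst ln_ge_iff) auto
    have lXe: "ln X powr \<epsilon> \<ge> 1" using lX \<epsilon> by (intro ge_one_powr_ge_zero) auto
    have lx: "ln x > 0" "ln x \<le> ln X" if "2 \<le> x" "x \<le> X" for x using that by auto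
    show "\<exists>\<tau>. (\<forall>k\<in>{1..R}. \<bar>\<tau> k\<bar> \<le> exp ((ln (ln X))\<^sup>2)) \<and>
          (\<forall>x::real. 2 \<le> x \<and> x \<le> X \<longrightarrow>
             cmod (oscillation f R (\<lambda>_. L) x w \<tau>) \<le> (C1 + C2) * (x / ln x * (ln X) powr \<epsilon>))"
    proof (cases "ln X \<ge> \<L>0")
      case True
      have "large_height A A0 (log_coeffs.E A A0) CF (2 ^ (L * R)) (CF * (2 ^ (L * R) * 2 ^ (L - 1) * real (L * R))) \<epsilon> (\<epsilon> / (4 * A)) R L k (ln X)"
        using \<L>0[OF True] unfolding Ec CF M_def K_def \<eta>_def .
      from oscillation_large_height[OF this \<epsilon> R L w k(1)[unfolded \<eta>_def]]
      obtain \<tau> where \<tau>: "\<forall>k\<in>{1..R}. \<bar>\<tau> k\<bar> \<le> exp ((ln (ln X))\<^sup>2)"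
        and b: "\<And>x. 2 \<le> x \<Longrightarrow> ln x \<le> ln X \<Longrightarrow> cmod (oscillation f R (\<lambda>_. L) x w \<tau>) \<le> C1 * (x / ln x * ln X powr \<epsilon>)"
        unfolding CF osc C1_def M_def by blast
      have "cmod (oscillation f R (\<lambda>_. L) x w \<tau>) \<le> (C1 + C2) * (x / ln x * (ln X) powr \<epsilon>)" if x: "2 \<le> x" "x \<le> X" for x
      proof -
        have "C1 * (x / ln x * ln X powr \<epsilon>) \<le> (C1 + C2) * (x / ln x * ln X powr \<epsilon>)"
          using C x lx[OF x] by (intro mult_right_mono mult_nonneg_nonneg divide_nonneg_nonneg) auto
        thus ?thesis using b[OF x(1) lx(2)[OF x]] by linarith
      qed
      thus ?thesis using \<tau> by blast
    \<comment> \<open>For ln X below the threshold any \<tau> will do. Then ln x is bounded, and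
      \<open>C2\<close> absorbs the trivial bound together with the factor ln x.\<close>
    next
      case False
      have "cmod (oscillation f R (\<lambda>_. L) x w (\<lambda>_. 0)) \<le> (C1 + C2) * (x / ln x * (ln X) powr \<epsilon>)" if x: "2 \<le> x" "x \<le> X" for x
      proof -
        let ?Q = "M * (3 * G * (1 + B) powr A)"
        have Q: "?Q \<ge> 0" using pos by simp
        have xB: "ln x \<le> B" using lx[OF x] False by (simp add: B_def)
        have "cmod (oscillation f R (\<lambda>_. L) x w (\<lambda>_. 0)) \<le> ?Q * x"
          unfolding osc [symmetric] oscillation_eq[OF w(1)] CF [symmetric]
          by (rule shifted_sum_trivial_bound) (use w x xB sum_norm_osc_coeff[OF w(1)] in \<open>auto simp: osc_shift_nonneg M_def\<close>)
        also have "?Q * x = (ln x * ?Q) * (x / ln x * 1)" using lx[OF x] by simp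
        also have "\<dots> \<le> C2 * (x / ln x * ln X powr \<epsilon>)"
          unfolding C2_def
        proof (rule mult_mono)
          have x0: "x / ln x \<ge> 0" using x lx[OF x] by (intro divide_nonneg_nonneg) linarith+
          show "ln x * ?Q \<le> B * ?Q" by (rule mult_right_mono[OF xB Q])
          show "x / ln x * 1 \<le> x / ln x * ln X powr \<epsilon>" by (rule mult_left_mono[OF lXe x0])
          show "0 \<le> B * ?Q" by (rule mult_nonneg_nonneg[OF _ Q]) (simp add: B_def)
          show "0 \<le> x / ln x * 1" using x0 by simp
        qed
        also have "\<dots> \<le> (C1 + C2) * (x / ln x * ln X powr \<epsilon>)"
          using C x lx[OF x] by (intro mult_right_mono mult_nonneg_nonneg divide_nonneg_nonneg) auto
        finally show ?thesis .
      qed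
      thus ?thesis by (intro exI[of _ "\<lambda>_. 0"]) auto
    qed
  qed
qed

end
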